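(* Let $n,m,q\ge1$, $L>0$, and consider the coupled linear PDE system $$\dot x(s,t)=A_0(s)x(s,t)+A_1(s)x_s(s,t)+A_2(s)x_{ss}(s,t)+B_1(s)w(t),$$ $$y(t)=C_1\begin{bmatrix} x(0,t) \\ x(L,t) \\ x_s(0,t) \\ x_s(L,t) \end{bmatrix}+\int_0^L\big(C_a(s)x(s,t)+C_b(s)x_s(s,t)\big)ds+D_1w(t),$$ $$B\begin{bmatrix} x(0,t) \\ x(L,t) \\ x_s(0,t) \\ x_s(L,t) \end{bmatrix}=0,\qquad x(s,0)=0,$$ with data as in the context. Suppose there exist $\epsilon>0$, $\gamma>0$ and matrix-valued polynomials $M:\mathbb{R}\to\mathbb{R}^{n\times n}$, $N_1,N_2:\mathbb{R}\times\mathbb{R}\to\mathbb{R}^{n\times n}$ such that $\{M-\epsilon I,N_1,N_2\}\in\Phi_2$. Then for all $x(\cdot,t)\in X$, $y\in L_2^q([0,\infty))$ and $w\in L_2^m([0,\infty))$ which satisfy the PDE system: (1) if $\{P,Q,R_1,R_2\}=\mathcal{L}_4(M,N_1,N_2)$ satisfies $\{-P,-Q,-R_1,-R_2\}\in\Phi_1$, then $\|y\|_{L_2}\le\gamma\|w\|_{L_2}$; (2) if $m=q$ and $\{P,Q,R_1,R_2\}=\mathcal{L}_5(M,N_1,N_2)$ satisfies $\{-P,-Q,-R_1,-R_2\}\in\Phi_1$, then $\langle y,w\rangle_{L_2}\ge0$. Here the sets $\Phi_1,\Phi_2$ and the maps $\mathcal{L}_4$ (which depends on $\gamma$) and $\mathcal{L}_5$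 are those defined in the context.
   Context: **Data.** $A_0,A_1,A_2:[0,L]\to\mathbb{R}^{n\times n}$, $B_1:[0,L]\to\mathbb{R}^{n\times m}$, $C_a,C_b:[0,L]\to\mathbb{R}^{q\times n}$ are continuous; $C_1\in\mathbb{R}^{q\times4n}$, $D_1\in\mathbb{R}^{q\times m}$; $B\in\mathbb{R}^{2n\times4n}$ has row rank $2n$ and $B_2:=B\begin{bmatrix} I & 0 \\ I & LI \\ 0 & I \\ 0 & I \end{bmatrix}$ is invertible. $X$ is the set of $x\in L_2^n([0,L])$ with weak derivatives $x_s,x_{ss}\in L_2^n([0,L])$ and $B\,[x(0);x(L);x_s(0);x_s(L)]=0$ (stacked column). **Solutions.** $x:[0,\infty)\to L_2^n([0,L])$ is locally absolutely continuous and differentiable a.e., $x(0)=0$, and for a.e. $t$, $x(t)\in X$ and the PDE and output equations hold. $\langle y,w\rangle_{L_2}=\int_0^\infty y(t)^Tw(t)dt$. **Set $\Phi_1$.** All $\{P,Q,R_1,R_2\}$ for which there are a bounded measurable $Z:[0,L]^2\to\mathbb{R}^{d_2\times n}$ (some $d_2$) and a symmetric positive semidefinite $T=(T_{ij})_{i,j=1}^3$ with $T_{11}\in\mathbb{R}^{m\times m}$, $T_{22},T_{33}\in\mathbb{R}^{d_2\times d_2}$ such that $P=T_{11}$, $Q(\theta)=\int_\theta^LT_{12}Z(s,\theta)ds+\int_0^\theta T_{13}Z(s,\theta)ds$, for $\theta\le s$: $R_1(s,\theta)=\int_s^LZ(\beta,s)^TT_{22}Z(\beta,\theta)d\beta+\int_\theta^sZ(\beta,s)^TT_{32}Z(\beta,\theta)d\beta+\int_0^\theta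 Z(\beta,s)^TT_{33}Z(\beta,\theta)d\beta$, and for $s\le\theta$: $R_2(s,\theta)=\int_\theta^LZ(\beta,s)^TT_{22}Z(\beta,\theta)d\beta+\int_s^\theta Z(\beta,s)^TT_{23}Z(\beta,\theta)d\beta+\int_0^sZ(\beta,s)^TT_{33}Z(\beta,\theta)d\beta$. **Set $\Phi_2$.** All $\{M,N_1,N_2\}$ for which there are bounded measurable $Z_1:[0,L]\to\mathbb{R}^{d_1\times n}$, $Z:[0,L]^2\to\mathbb{R}^{d_2\times n}$ and a symmetric positive semidefinite $T=(T_{ij})_{i,j=1}^3$ with $T_{11}\in\mathbb{R}^{d_1\times d_1}$, $T_{22},T_{33}\in\mathbb{R}^{d_2\times d_2}$ such that $M(s)=Z_1(s)^TT_{11}Z_1(s)$; for $\theta\le s$: $N_1(s,\theta)=Z_1(s)^TT_{12}Z(s,\theta)+Z(\theta,s)^TT_{31}Z_1(\theta)+\int_s^LZ(\beta,s)^TT_{22}Z(\beta,\theta)d\beta+\int_\theta^sZ(\beta,s)^TT_{32}Z(\beta,\theta)d\beta+\int_0^\theta Z(\beta,s)^TT_{33}Z(\beta,\theta)d\beta$; and $N_2(s,\theta)=N_1(\theta,s)^T$. **Map $\mathcal{L}_4$.** $\mathcal{L}_4(M,N_1,N_2)=\{P,Q,R_1,R_2\}$ with $P=\frac1L(D_1^TD_1-\gamma^2I)$, $Q(s)=D_1^TC_3(s)+\int_0^LV(s,\theta)^Td\theta$, $R_1(s,\theta)=H_1(s,\theta)+H_2(\theta,s)^T+C_3(s)^TC_3(\theta)$,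 $R_2(s,\theta)=R_1(\theta,s)^T$. **Map $\mathcal{L}_5$** (for $m=q$). $\mathcal{L}_5(M,N_1,N_2)=\{P,Q,R_1,R_2\}$ with $P=-\frac1L(D_1+D_1^T)$, $Q(s)=-C_3(s)+\int_0^LV(s,\theta)^Td\theta$, $R_1(s,\theta)=H_1(s,\theta)+H_2(\theta,s)^T$, $R_2(s,\theta)=R_1(\theta,s)^T$. **$G$, $C_3$, $V$.** $\mathcal{I}(r)=1$ if $r\ge0$, else $0$. $B_c(\eta)=-B_2^{-1}B\,[0;(L-\eta)I;0;I]$ (a $2n\times n$ matrix). $G(s,\eta)=[I\ \ sI]B_c(\eta)+\mathcal{I}(s-\eta)(s-\eta)I$, $G'(s,\eta)=[0\ \ I]B_c(\eta)+\mathcal{I}(s-\eta)I$. $$C_3(\theta)=C_1\Big(\begin{bmatrix} I & 0 \\ I & LI \\ 0 & I \\ 0 & I \end{bmatrix}B_c(\theta)+\begin{bmatrix} 0 \\ (L-\theta)I \\ 0 \\ I \end{bmatrix}\Big)+\int_0^L\big(C_a(s)G(s,\theta)+C_b(s)G'(s,\theta)\big)ds,$$ $$V(s,\eta)=\Big(G(\eta,s)^TM(\eta)+\int_\eta^LG(\beta,s)^TN_1(\beta,\eta)d\beta+\int_0^\eta G(\beta,s)^TN_2(\beta,\eta)d\beta\Big)B_1(\eta).$$ **$H_1,H_2$.** With $V_i(s)=M(s)A_i(s)$, $W_{ij}(s,\theta)=N_j(s,\theta)A_i(\theta)$ ($i=0,1,2$; $j=1,2$), $$(H_1,H_2)=\mathcal{L}_3(V_0,W_{01},W_{02})+\mathcal{L}_2(V_1,W_{11},W_{12})+\mathcal{L}_1(V_2,W_{21},W_{22}).$$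 **Maps $\mathcal{L}_1,\mathcal{L}_2,\mathcal{L}_3$.** For matrix functions $U(s),W_1(s,\theta),W_2(s,\theta)$ set $\mathcal{L}_1(U,W_1,W_2)=(E_1+E_3,E_2+E_3)$, $\mathcal{L}_2(U,W_1,W_2)=(F_1+F_3,F_2+F_3)$, $\mathcal{L}_3(U,W_1,W_2)=(J_1+J_3,J_2+J_3)$, where $E_1(s,\theta)=\int_s^L(\eta-s)W_1(\eta,\theta)d\eta$; $E_2(s,\theta)=(\theta-s)U(\theta)+\int_\theta^L(\eta-s)W_1(\eta,\theta)d\eta+\int_s^\theta(\eta-s)W_2(\eta,\theta)d\eta$; $E_3(s,\theta)=Y_1(s,\theta)$; $F_1(s,\theta)=\int_s^L\big((\eta-s)F_4(\theta,\eta)+F_5(s,\eta)\big)d\eta$; $F_2(s,\theta)=\int_\theta^L\big((\eta-s)F_4(\theta,\eta)+F_5(s,\eta)\big)d\eta$; $F_3(s,\theta)=\int_0^LB_a(\zeta,s)^TY_2(\zeta)B_b(\theta)d\zeta+\int_\theta^LY_1(s,\zeta)d\zeta+\int_s^L(\zeta-s)Y_2(\zeta)d\zeta\,B_b(\theta)$; $F_4(\theta,\eta)=U(\eta)+\int_\theta^\eta W_1(\eta,\zeta)d\zeta$; $F_5(s,\eta)=\int_s^\eta(\zeta-s)W_2(\zeta,\eta)d\zeta$; $J_1(s,\theta)=\int_s^L\big((\eta-s)J_4(\theta,\eta)+J_5(s,\theta,\eta)\big)d\eta$; $J_2(s,\theta)=\int_\theta^L\big((\eta-s)J_4(\theta,\eta)+J_5(s,\theta,\eta)\big)d\eta$;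 $J_3(s,\theta)=\int_0^LB_a(\eta,s)^TY_3(\eta,\theta)d\eta+\int_\theta^L(\eta-\theta)Y_1(s,\eta)d\eta+\int_s^L(\eta-s)Y_3(\eta,\theta)d\eta$; $J_4(\theta,\eta)=(\eta-\theta)U(\eta)+\int_\theta^\eta(\zeta-\theta)W_1(\eta,\zeta)d\zeta$; $J_5(s,\theta,\eta)=\int_s^\eta(\zeta-s)(\eta-\theta)W_2(\zeta,\eta)d\zeta$; $Y_1(s,\eta)=B_a(\eta,s)^TU(\eta)+\int_\eta^LB_a(\theta,s)^TW_1(\theta,\eta)d\theta+\int_0^\eta B_a(\theta,s)^TW_2(\theta,\eta)d\theta$; $Y_2(\zeta)=U(\zeta)+\int_0^\zeta W_1(\zeta,\theta)d\theta+\int_\zeta^LW_2(\zeta,\theta)d\theta$; $Y_3(\zeta,\eta)=U(\zeta)B_a(\zeta,\eta)+\int_0^\zeta W_1(\zeta,\theta)B_a(\theta,\eta)d\theta+\int_\zeta^LW_2(\zeta,\theta)B_a(\theta,\eta)d\theta$; $B_a(s,\eta)=B_4(s)(L-\eta)+B_5(s)$, $B_b(\eta)=B_6(L-\eta)+B_7$, $[B_4(s)\ B_5(s)]=[I\ \ sI]B_3$, $[B_6\ B_7]=[0\ \ I]B_3$, $B_3=-B_2^{-1}B\begin{bmatrix} 0 & 0 \\ I & 0 \\ 0 & 0 \\ 0 & I \end{bmatrix}$. *)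

theory Defs
  imports "HOL-Analysis.Analysis"
begin

abbreviation integ :: "real \<Rightarrow> real \<Rightarrow> (real \<Rightarrow> 'a::{banach, second_countable_topology}) \<Rightarrow> 'a"
  where "integ a b f \<equiv> integral\<^sup>L (lebesgue_on {a..b}) f"


subsection \<open>Block vectors and matrices\<close>

text \<open>An \<open>r \<times> c\<close> matrix is a vector of rows, so \<open>vstack\<close> stacks both column
  vectors and matrices; a \<open>k n\<close>-dimensional block object is indexed by \<open>'n + \<dots> + 'n\<close>.\<close>

definition vstack :: "'a^'r::finite \<Rightarrow> 'a^'s::finite \<Rightarrow> 'a^('r + 's)"
  where "vstack u v = (\<chi> i. case i of Inl k \<Rightarrow> u $ k | Inr k \<Rightarrow> v $ k)"

definition hstack :: "'a^'c::finite^'r \<Rightarrow> 'a^'d::finite^'r \<Rightarrow> 'a^('c + 'd)^'r"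
  where "hstack X Y = (\<chi> i. vstack (X $ i) (Y $ i))"

definition vstack4 :: "'a^'n::finite \<Rightarrow> 'a^'n \<Rightarrow> 'a^'n \<Rightarrow> 'a^'n \<Rightarrow> 'a^('n + 'n + 'n + 'n)"
  where "vstack4 u v w z = vstack u (vstack v (vstack w z))"

definition left_block :: "'a^('c::finite + 'd::finite)^'r \<Rightarrow> 'a^'c^'r"
  where "left_block X = (\<chi> i j. X $ i $ Inl j)"

definition right_block :: "'a^('c::finite + 'd::finite)^'r \<Rightarrow> 'a^'d^'r"
  where "right_block X = (\<chi> i j. X $ i $ Inr j)"

abbreviation scalar_mat :: "real \<Rightarrow> real^'n^'n"
  where "scalar_mat c \<equiv> c *\<^sub>R mat 1"


subsection \<open>Square-integrable functions, weak derivatives and boundary values\<close>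

text \<open>Elements of \<open>L\<^sub>2\<close> are represented by functions; all notions below are
  invariant under changes on null sets.\<close>

definition L2 :: "real set \<Rightarrow> (real \<Rightarrow> 'a::euclidean_space) set"
  where "L2 I = {f. f \<in> borel_measurable (lebesgue_on I)
                  \<and> integrable (lebesgue_on I) (\<lambda>s. (norm (f s))\<^sup>2)}"

definition L2_norm :: "real set \<Rightarrow> (real \<Rightarrow> 'a::euclidean_space) \<Rightarrow> real"
  where "L2_norm I f = sqrt (LINT s|lebesgue_on I. (norm (f s))\<^sup>2)"

definition L2_inner :: "real set \<Rightarrow> (real \<Rightarrow> 'a::euclidean_space) \<Rightarrow> (real \<Rightarrow> 'a) \<Rightarrow> real"
  where "L2_inner I f g = (LINT s|lebesgue_on I. f s \<bullet> g s)"

definition test_function :: "real \<Rightarrow> (real \<Rightarrow> real) \<Rightarrow> bool"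
  where "test_function L \<phi> \<longleftrightarrow>
    (\<forall>k s. (deriv ^^ k) \<phi> field_differentiable at s) \<and>
    (\<exists>a b. 0 < a \<and> b < L \<and> (\<forall>s. s \<notin> {a..b} \<longrightarrow> \<phi> s = 0))"

definition has_weak_deriv :: "real \<Rightarrow> (real \<Rightarrow> 'a::euclidean_space) \<Rightarrow> (real \<Rightarrow> 'a) \<Rightarrow> bool"
  where "has_weak_deriv L f g \<longleftrightarrow>
    (\<forall>\<phi>. test_function L \<phi> \<longrightarrow>
      integ 0 L (\<lambda>s. deriv \<phi> s *\<^sub>R f s) = - integ 0 L (\<lambda>s. \<phi> s *\<^sub>R g s))"

definition weakly_L2_differentiable :: "real \<Rightarrow> (real \<Rightarrow> 'a::euclidean_space) \<Rightarrow> bool"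
  where "weakly_L2_differentiable L f \<longleftrightarrow> (\<exists>g \<in> L2 {0..L}. has_weak_deriv L f g)"

text \<open>The weak derivative is unique only up to null sets; \<open>weak_deriv\<close> picks a representative.\<close>

definition weak_deriv :: "real \<Rightarrow> (real \<Rightarrow> 'a::euclidean_space) \<Rightarrow> real \<Rightarrow> 'a"
  where "weak_deriv L f = (SOME g. g \<in> L2 {0..L} \<and> has_weak_deriv L f g)"

text \<open>Point values of a function with an \<open>L\<^sub>2\<close> weak derivative are those of its
  continuous representative on \<open>[0,L]\<close>.\<close>

definition point_value :: "real \<Rightarrow> (real \<Rightarrow> 'a::euclidean_space) \<Rightarrow> real \<Rightarrow> 'a"
  where "point_value L f a = (THE c. \<exists>g. continuous_on {0..L} g
           \<and> (AE s in lebesgue_on {0..L}. g s = f s) \<and> g a = c)"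

definition boundary_values :: "real \<Rightarrow> (real \<Rightarrow> real^'n::finite) \<Rightarrow> real^('n + 'n + 'n + 'n)"
  where "boundary_values L f =
    vstack4 (point_value L f 0) (point_value L f L)
            (point_value L (weak_deriv L f) 0) (point_value L (weak_deriv L f) L)"


subsection \<open>Absolutely continuous and differentiable curves in \<open>L\<^sub>2([0,L])\<close>\<close>

definition locally_abs_continuous :: "real \<Rightarrow> (real \<Rightarrow> real \<Rightarrow> 'a::euclidean_space) \<Rightarrow> bool"
  where "locally_abs_continuous L x \<longleftrightarrow>
    (\<forall>T > 0. \<forall>e > 0. \<exists>d > 0. \<forall>(k::nat) a b.
       (\<forall>i<k. 0 \<le> a i \<and> a i \<le> b i \<and> b i \<le> T) \<and>
       disjoint_family_on (\<lambda>i. {a i<..<b i}) {..<k} \<and>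
       (\<Sum>i<k. b i - a i) < d
       \<longrightarrow> (\<Sum>i<k. L2_norm {0..L} (\<lambda>s. x (b i) s - x (a i) s)) < e)"

definition has_L2_deriv ::
    "real \<Rightarrow> (real \<Rightarrow> real \<Rightarrow> 'a::euclidean_space) \<Rightarrow> (real \<Rightarrow> 'a) \<Rightarrow> real \<Rightarrow> bool"
  where "has_L2_deriv L x v t \<longleftrightarrow> v \<in> L2 {0..L} \<and>
    ((\<lambda>h. L2_norm {0..L} (\<lambda>s. (x (t + h) s - x t s) /\<^sub>R h - v s)) \<longlongrightarrow> 0) (at 0)"


subsection \<open>The PDE system\<close>

text \<open>\<open>len\<close> is the length \<open>L\<close> of the spatial interval and \<open>Bbc\<close> the boundary condition matrix \<open>B\<close>.\<close>

record ('n::finite, 'm::finite, 'q::finite) pde_system =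
  len :: real
  A0 :: "real \<Rightarrow> real^'n^'n"
  A1 :: "real \<Rightarrow> real^'n^'n"
  A2 :: "real \<Rightarrow> real^'n^'n"
  B1 :: "real \<Rightarrow> real^'m^'n"
  C1 :: "real^('n + 'n + 'n + 'n)^'q"
  Ca :: "real \<Rightarrow> real^'n^'q"
  Cb :: "real \<Rightarrow> real^'n^'q"
  D1 :: "real^'m^'q"
  Bbc :: "real^('n + 'n + 'n + 'n)^('n + 'n)"

definition bnd_mat :: "real \<Rightarrow> real^('n::finite + 'n)^('n + 'n + 'n + 'n)"
  where "bnd_mat L =
    vstack4 (hstack (mat 1) 0) (hstack (mat 1) (scalar_mat L)) (hstack 0 (mat 1)) (hstack 0 (mat 1))"

definition B2 :: "('n::finite, 'm::finite, 'q::finite) pde_system \<Rightarrow> real^('n + 'n)^('n + 'n)"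
  where "B2 S = Bbc S ** bnd_mat (len S)"

definition admissible_data :: "('n::finite, 'm::finite, 'q::finite) pde_system \<Rightarrow> bool"
  where "admissible_data S \<longleftrightarrow> 0 < len S
    \<and> continuous_on {0..len S} (A0 S) \<and> continuous_on {0..len S} (A1 S)
    \<and> continuous_on {0..len S} (A2 S) \<and> continuous_on {0..len S} (B1 S)
    \<and> continuous_on {0..len S} (Ca S) \<and> continuous_on {0..len S} (Cb S)
    \<and> rank (Bbc S) = 2 * CARD('n) \<and> invertible (B2 S)"

definition X_space :: "('n::finite, 'm::finite, 'q::finite) pde_system \<Rightarrow> (real \<Rightarrow> real^'n) set"
  where "X_space S = {f \<in> L2 {0..len S}.
    weakly_L2_differentiable (len S) f
    \<and> weakly_L2_differentiable (len S) (weak_deriv (len S) f)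
    \<and> Bbc S *v boundary_values (len S) f = 0}"

text \<open>\<open>x t s\<close> is the state at time \<open>t\<close> and position \<open>s\<close>.\<close>

definition is_solution ::
    "('n::finite, 'm::finite, 'q::finite) pde_system \<Rightarrow> (real \<Rightarrow> real \<Rightarrow> real^'n) \<Rightarrow>
     (real \<Rightarrow> real^'q) \<Rightarrow> (real \<Rightarrow> real^'m) \<Rightarrow> bool"
  where "is_solution S x y w \<longleftrightarrow>
    (\<forall>t\<ge>0. x t \<in> L2 {0..len S})
    \<and> locally_abs_continuous (len S) x
    \<and> (AE s in lebesgue_on {0..len S}. x 0 s = 0)
    \<and> (AE t in lebesgue_on {0..}.
        x t \<in> X_space S
        \<and> (\<exists>xdot. has_L2_deriv (len S) x xdot t
            \<and> (AE s in lebesgue_on {0..len S}.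
                xdot s = A0 S s *v x t s + A1 S s *v weak_deriv (len S) (x t) s
                  + A2 S s *v weak_deriv (len S) (weak_deriv (len S) (x t)) s
                  + B1 S s *v w t))
        \<and> y t = C1 S *v boundary_values (len S) (x t)
            + integ 0 (len S) (\<lambda>s. Ca S s *v x t s + Cb S s *v weak_deriv (len S) (x t) s)
            + D1 S *v w t)"


subsection \<open>The sets \<open>\<Phi>\<^sub>1\<close> and \<open>\<Phi>\<^sub>2\<close>\<close>

text \<open>The inner dimensions \<open>d\<^sub>1\<close>, \<open>d\<^sub>2\<close> are existentially quantified, so the matrices
  involving them are indexed by natural numbers below these bounds: a \<open>d \<times> n\<close> matrix is given
  by its rows, of type \<^typ>\<open>nat \<Rightarrow> real^'n\<close>, and \<open>T\<close> by its entries. The three block rows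
  and columns of \<open>T\<close> are the three summands of its index type.\<close>

definition psd_on :: "'i set \<Rightarrow> ('i \<Rightarrow> 'i \<Rightarrow> real) \<Rightarrow> bool"
  where "psd_on I T \<longleftrightarrow> (\<forall>i\<in>I. \<forall>j\<in>I. T i j = T j i)
    \<and> (\<forall>v. 0 \<le> (\<Sum>i\<in>I. \<Sum>j\<in>I. v i * T i j * v j))"

abbreviation b1 :: "'a \<Rightarrow> 'a + nat + nat" where "b1 \<equiv> Inl"
abbreviation b2 :: "nat \<Rightarrow> 'a + nat + nat" where "b2 i \<equiv> Inr (Inl i)"
abbreviation b3 :: "nat \<Rightarrow> 'a + nat + nat" where "b3 i \<equiv> Inr (Inr i)"

text \<open>\<open>congr_prod k l X T Y\<close> is \<open>X\<^sup>T T Y\<close> for a \<open>k \<times> l\<close> matrix \<open>T\<close>, and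
  \<open>mat_rows_prod l T Y\<close> is \<open>T Y\<close> for a \<open>T\<close> with \<open>l\<close> columns.\<close>

definition congr_prod ::
    "nat \<Rightarrow> nat \<Rightarrow> (nat \<Rightarrow> real^'n) \<Rightarrow> (nat \<Rightarrow> nat \<Rightarrow> real) \<Rightarrow> (nat \<Rightarrow> real^'n) \<Rightarrow> real^'n^'n"
  where "congr_prod k l X T Y = (\<chi> a b. \<Sum>i<k. \<Sum>j<l. X i $ a * T i j * Y j $ b)"

definition mat_rows_prod :: "nat \<Rightarrow> ('m \<Rightarrow> nat \<Rightarrow> real) \<Rightarrow> (nat \<Rightarrow> real^'n) \<Rightarrow> real^'n^'m"
  where "mat_rows_prod l T Y = (\<chi> a. \<Sum>j<l. T a j *\<^sub>R Y j)"

definition bounded_measurable_on :: "'a::euclidean_space set \<Rightarrow> ('a \<Rightarrow> real^'n) \<Rightarrow> bool"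
  where "bounded_measurable_on \<Omega> f \<longleftrightarrow> f \<in> borel_measurable (lebesgue_on \<Omega>) \<and> bounded (f ` \<Omega>)"

text \<open>\<open>R\<^sub>1\<close> and \<open>N\<^sub>1\<close> are kernels on the triangle \<open>\<theta> \<le> s\<close>, \<open>R\<^sub>2\<close> and \<open>N\<^sub>2\<close> on
  \<open>s \<le> \<theta>\<close>; their values elsewhere are unconstrained.\<close>

definition Phi1 ::
    "real \<Rightarrow> ((real^'m^'m) \<times> (real \<Rightarrow> real^'n^'m) \<times>
              (real \<Rightarrow> real \<Rightarrow> real^'n^'n) \<times> (real \<Rightarrow> real \<Rightarrow> real^'n^'n)) set"
  where "Phi1 L = {(P, Q, R1, R2).
    \<exists>(d2::nat) (Z :: real \<Rightarrow> real \<Rightarrow> nat \<Rightarrow> real^'n) (T :: 'm + nat + nat \<Rightarrow> 'm + nat + nat \<Rightarrow> real).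
      (\<forall>i<d2. bounded_measurable_on ({0..L} \<times> {0..L}) (\<lambda>(s, \<theta>). Z s \<theta> i))
      \<and> psd_on (UNIV <+> ({..<d2} <+> {..<d2})) T
      \<and> P = (\<chi> i j. T (b1 i) (b1 j))
      \<and> (\<forall>\<theta>\<in>{0..L}. Q \<theta> =
            integ \<theta> L (\<lambda>s. mat_rows_prod d2 (\<lambda>i j. T (b1 i) (b2 j)) (Z s \<theta>))
          + integ 0 \<theta> (\<lambda>s. mat_rows_prod d2 (\<lambda>i j. T (b1 i) (b3 j)) (Z s \<theta>)))
      \<and> (\<forall>s\<in>{0..L}. \<forall>\<theta>\<in>{0..L}. \<theta> \<le> s \<longrightarrow> R1 s \<theta> =
            integ s L (\<lambda>\<beta>. congr_prod d2 d2 (Z \<beta> s) (\<lambda>i j. T (b2 i) (b2 j)) (Z \<beta> \<theta>))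
          + integ \<theta> s (\<lambda>\<beta>. congr_prod d2 d2 (Z \<beta> s) (\<lambda>i j. T (b3 i) (b2 j)) (Z \<beta> \<theta>))
          + integ 0 \<theta> (\<lambda>\<beta>. congr_prod d2 d2 (Z \<beta> s) (\<lambda>i j. T (b3 i) (b3 j)) (Z \<beta> \<theta>)))
      \<and> (\<forall>s\<in>{0..L}. \<forall>\<theta>\<in>{0..L}. s \<le> \<theta> \<longrightarrow> R2 s \<theta> =
            integ \<theta> L (\<lambda>\<beta>. congr_prod d2 d2 (Z \<beta> s) (\<lambda>i j. T (b2 i) (b2 j)) (Z \<beta> \<theta>))
          + integ s \<theta> (\<lambda>\<beta>. congr_prod d2 d2 (Z \<beta> s) (\<lambda>i j. T (b2 i) (b3 j)) (Z \<beta> \<theta>))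
          + integ 0 s (\<lambda>\<beta>. congr_prod d2 d2 (Z \<beta> s) (\<lambda>i j. T (b3 i) (b3 j)) (Z \<beta> \<theta>)))}"

definition Phi2 ::
    "real \<Rightarrow> ((real \<Rightarrow> real^'n^'n) \<times>
              (real \<Rightarrow> real \<Rightarrow> real^'n^'n) \<times> (real \<Rightarrow> real \<Rightarrow> real^'n^'n)) set"
  where "Phi2 L = {(M, N1, N2).
    \<exists>(d1::nat) (d2::nat) (Z1 :: real \<Rightarrow> nat \<Rightarrow> real^'n) (Z :: real \<Rightarrow> real \<Rightarrow> nat \<Rightarrow> real^'n)
     (T :: nat + nat + nat \<Rightarrow> nat + nat + nat \<Rightarrow> real).
      (\<forall>i<d1. bounded_measurable_on {0..L} (\<lambda>s. Z1 s i))
      \<and> (\<forall>i<d2. bounded_measurable_on ({0..L} \<times> {0..L}) (\<lambda>(s, \<theta>). Z s \<theta> i))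
      \<and> psd_on ({..<d1} <+> ({..<d2} <+> {..<d2})) T
      \<and> (\<forall>s\<in>{0..L}. M s = congr_prod d1 d1 (Z1 s) (\<lambda>i j. T (b1 i) (b1 j)) (Z1 s))
      \<and> (\<forall>s\<in>{0..L}. \<forall>\<theta>\<in>{0..L}. \<theta> \<le> s \<longrightarrow> N1 s \<theta> =
            congr_prod d1 d2 (Z1 s) (\<lambda>i j. T (b1 i) (b2 j)) (Z s \<theta>)
          + congr_prod d2 d1 (Z \<theta> s) (\<lambda>i j. T (b3 i) (b1 j)) (Z1 \<theta>)
          + integ s L (\<lambda>\<beta>. congr_prod d2 d2 (Z \<beta> s) (\<lambda>i j. T (b2 i) (b2 j)) (Z \<beta> \<theta>))
          + integ \<theta> s (\<lambda>\<beta>. congr_prod d2 d2 (Z \<beta> s) (\<lambda>i j. T (b3 i) (b2 j)) (Z \<beta> \<theta>))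
          + integ 0 \<theta> (\<lambda>\<beta>. congr_prod d2 d2 (Z \<beta> s) (\<lambda>i j. T (b3 i) (b3 j)) (Z \<beta> \<theta>)))
      \<and> (\<forall>s\<in>{0..L}. \<forall>\<theta>\<in>{0..L}. s \<le> \<theta> \<longrightarrow> N2 s \<theta> = transpose (N1 \<theta> s))}"


subsection \<open>The maps \<open>\<L>\<^sub>1\<close>, \<open>\<L>\<^sub>2\<close>, \<open>\<L>\<^sub>3\<close>\<close>

definition B3 :: "('n::finite, 'm::finite, 'q::finite) pde_system \<Rightarrow> real^('n + 'n)^('n + 'n)"
  where "B3 S = - (matrix_inv (B2 S) ** Bbc S **
    vstack4 (hstack 0 0) (hstack (mat 1) 0) (hstack 0 0) (hstack 0 (mat 1)))"

definition B4 :: "('n::finite, 'm::finite, 'q::finite) pde_system \<Rightarrow> real \<Rightarrow> real^'n^'n"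
  where "B4 S s = left_block (hstack (mat 1) (scalar_mat s) ** B3 S)"

definition B5 :: "('n::finite, 'm::finite, 'q::finite) pde_system \<Rightarrow> real \<Rightarrow> real^'n^'n"
  where "B5 S s = right_block (hstack (mat 1) (scalar_mat s) ** B3 S)"

definition B6 :: "('n::finite, 'm::finite, 'q::finite) pde_system \<Rightarrow> real^'n^'n"
  where "B6 S = left_block (hstack 0 (mat 1) ** B3 S)"

definition B7 :: "('n::finite, 'm::finite, 'q::finite) pde_system \<Rightarrow> real^'n^'n"
  where "B7 S = right_block (hstack 0 (mat 1) ** B3 S)"

definition Ba :: "('n::finite, 'm::finite, 'q::finite) pde_system \<Rightarrow> real \<Rightarrow> real \<Rightarrow> real^'n^'n"
  where "Ba S s \<eta> = (len S - \<eta>) *\<^sub>R B4 S s + B5 S s"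

definition Bb :: "('n::finite, 'm::finite, 'q::finite) pde_system \<Rightarrow> real \<Rightarrow> real^'n^'n"
  where "Bb S \<eta> = (len S - \<eta>) *\<^sub>R B6 S + B7 S"

type_synonym 'n mfun = "real \<Rightarrow> real^'n^'n"
type_synonym 'n mker = "real \<Rightarrow> real \<Rightarrow> real^'n^'n"

definition Y1 :: "('n::finite, 'm::finite, 'q::finite) pde_system \<Rightarrow>
    'n mfun \<Rightarrow> 'n mker \<Rightarrow> 'n mker \<Rightarrow> 'n mker"
  where "Y1 S U W1 W2 s \<eta> =
      transpose (Ba S \<eta> s) ** U \<eta>
    + integ \<eta> (len S) (\<lambda>\<theta>. transpose (Ba S \<theta> s) ** W1 \<theta> \<eta>)
    + integ 0 \<eta> (\<lambda>\<theta>. transpose (Ba S \<theta> s) ** W2 \<theta> \<eta>)"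

definition Y2 :: "('n::finite, 'm::finite, 'q::finite) pde_system \<Rightarrow>
    'n mfun \<Rightarrow> 'n mker \<Rightarrow> 'n mker \<Rightarrow> 'n mfun"
  where "Y2 S U W1 W2 \<zeta> =
    U \<zeta> + integ 0 \<zeta> (\<lambda>\<theta>. W1 \<zeta> \<theta>) + integ \<zeta> (len S) (\<lambda>\<theta>. W2 \<zeta> \<theta>)"

definition Y3 :: "('n::finite, 'm::finite, 'q::finite) pde_system \<Rightarrow>
    'n mfun \<Rightarrow> 'n mker \<Rightarrow> 'n mker \<Rightarrow> 'n mker"
  where "Y3 S U W1 W2 \<zeta> \<eta> =
      U \<zeta> ** Ba S \<zeta> \<eta>
    + integ 0 \<zeta> (\<lambda>\<theta>. W1 \<zeta> \<theta> ** Ba S \<theta> \<eta>)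
    + integ \<zeta> (len S) (\<lambda>\<theta>. W2 \<zeta> \<theta> ** Ba S \<theta> \<eta>)"

definition map_L1 :: "('n::finite, 'm::finite, 'q::finite) pde_system \<Rightarrow>
    'n mfun \<Rightarrow> 'n mker \<Rightarrow> 'n mker \<Rightarrow> 'n mker \<times> 'n mker"
  where "map_L1 S U W1 W2 =
    (let L = len S;
         E1 = (\<lambda>s \<theta>. integ s L (\<lambda>\<eta>. (\<eta> - s) *\<^sub>R W1 \<eta> \<theta>));
         E2 = (\<lambda>s \<theta>. (\<theta> - s) *\<^sub>R U \<theta> + integ \<theta> L (\<lambda>\<eta>. (\<eta> - s) *\<^sub>R W1 \<eta> \<theta>)
                 + integ s \<theta> (\<lambda>\<eta>. (\<eta> - s) *\<^sub>R W2 \<eta> \<theta>));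
         E3 = Y1 S U W1 W2
     in (\<lambda>s \<theta>. E1 s \<theta> + E3 s \<theta>, \<lambda>s \<theta>. E2 s \<theta> + E3 s \<theta>))"

definition map_L2 :: "('n::finite, 'm::finite, 'q::finite) pde_system \<Rightarrow>
    'n mfun \<Rightarrow> 'n mker \<Rightarrow> 'n mker \<Rightarrow> 'n mker \<times> 'n mker"
  where "map_L2 S U W1 W2 =
    (let L = len S;
         F4 = (\<lambda>\<theta> \<eta>. U \<eta> + integ \<theta> \<eta> (\<lambda>\<zeta>. W1 \<eta> \<zeta>));
         F5 = (\<lambda>s \<eta>. integ s \<eta> (\<lambda>\<zeta>. (\<zeta> - s) *\<^sub>R W2 \<zeta> \<eta>));
         F1 = (\<lambda>s \<theta>. integ s L (\<lambda>\<eta>. (\<eta> - s) *\<^sub>R F4 \<theta> \<eta> + F5 s \<eta>));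
         F2 = (\<lambda>s \<theta>. integ \<theta> L (\<lambda>\<eta>. (\<eta> - s) *\<^sub>R F4 \<theta> \<eta> + F5 s \<eta>));
         F3 = (\<lambda>s \<theta>. integ 0 L (\<lambda>\<zeta>. transpose (Ba S \<zeta> s) ** Y2 S U W1 W2 \<zeta> ** Bb S \<theta>)
                 + integ \<theta> L (\<lambda>\<zeta>. Y1 S U W1 W2 s \<zeta>)
                 + integ s L (\<lambda>\<zeta>. (\<zeta> - s) *\<^sub>R Y2 S U W1 W2 \<zeta>) ** Bb S \<theta>)
     in (\<lambda>s \<theta>. F1 s \<theta> + F3 s \<theta>, \<lambda>s \<theta>. F2 s \<theta> + F3 s \<theta>))"

definition map_L3 :: "('n::finite, 'm::finite, 'q::finite) pde_system \<Rightarrow>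
    'n mfun \<Rightarrow> 'n mker \<Rightarrow> 'n mker \<Rightarrow> 'n mker \<times> 'n mker"
  where "map_L3 S U W1 W2 =
    (let L = len S;
         J4 = (\<lambda>\<theta> \<eta>. (\<eta> - \<theta>) *\<^sub>R U \<eta> + integ \<theta> \<eta> (\<lambda>\<zeta>. (\<zeta> - \<theta>) *\<^sub>R W1 \<eta> \<zeta>));
         J5 = (\<lambda>s \<theta> \<eta>. integ s \<eta> (\<lambda>\<zeta>. ((\<zeta> - s) * (\<eta> - \<theta>)) *\<^sub>R W2 \<zeta> \<eta>));
         J1 = (\<lambda>s \<theta>. integ s L (\<lambda>\<eta>. (\<eta> - s) *\<^sub>R J4 \<theta> \<eta> + J5 s \<theta> \<eta>));
         J2 = (\<lambda>s \<theta>. integ \<theta> L (\<lambda>\<eta>. (\<eta> - s) *\<^sub>R J4 \<theta> \<eta> + J5 s \<theta> \<eta>));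
         J3 = (\<lambda>s \<theta>. integ 0 L (\<lambda>\<eta>. transpose (Ba S \<eta> s) ** Y3 S U W1 W2 \<eta> \<theta>)
                 + integ \<theta> L (\<lambda>\<eta>. (\<eta> - \<theta>) *\<^sub>R Y1 S U W1 W2 s \<eta>)
                 + integ s L (\<lambda>\<eta>. (\<eta> - s) *\<^sub>R Y3 S U W1 W2 \<eta> \<theta>))
     in (\<lambda>s \<theta>. J1 s \<theta> + J3 s \<theta>, \<lambda>s \<theta>. J2 s \<theta> + J3 s \<theta>))"


subsection \<open>The maps \<open>\<L>\<^sub>4\<close> and \<open>\<L>\<^sub>5\<close>\<close>

definition step :: "real \<Rightarrow> real"
  where "step r = (if 0 \<le> r then 1 else 0)"

definition Bc :: "('n::finite, 'm::finite, 'q::finite) pde_system \<Rightarrow> real \<Rightarrow> real^'n^('n + 'n)"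
  where "Bc S \<eta> = - (matrix_inv (B2 S) ** Bbc S **
    vstack4 0 (scalar_mat (len S - \<eta>)) 0 (mat 1))"

definition Gker :: "('n::finite, 'm::finite, 'q::finite) pde_system \<Rightarrow> 'n mker"
  where "Gker S s \<eta> =
    hstack (mat 1) (scalar_mat s) ** Bc S \<eta> + scalar_mat (step (s - \<eta>) * (s - \<eta>))"

definition Gker' :: "('n::finite, 'm::finite, 'q::finite) pde_system \<Rightarrow> 'n mker"
  where "Gker' S s \<eta> = hstack 0 (mat 1) ** Bc S \<eta> + scalar_mat (step (s - \<eta>))"

definition C3 :: "('n::finite, 'm::finite, 'q::finite) pde_system \<Rightarrow> real \<Rightarrow> real^'n^'q"
  where "C3 S \<theta> =
      C1 S ** (bnd_mat (len S) ** Bc S \<theta> + vstack4 0 (scalar_mat (len S - \<theta>)) 0 (mat 1))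
    + integ 0 (len S) (\<lambda>s. Ca S s ** Gker S s \<theta> + Cb S s ** Gker' S s \<theta>)"

definition Vker :: "('n::finite, 'm::finite, 'q::finite) pde_system \<Rightarrow>
    'n mfun \<Rightarrow> 'n mker \<Rightarrow> 'n mker \<Rightarrow> real \<Rightarrow> real \<Rightarrow> real^'m^'n"
  where "Vker S M N1 N2 s \<eta> =
    (transpose (Gker S \<eta> s) ** M \<eta>
     + integ \<eta> (len S) (\<lambda>\<beta>. transpose (Gker S \<beta> s) ** N1 \<beta> \<eta>)
     + integ 0 \<eta> (\<lambda>\<beta>. transpose (Gker S \<beta> s) ** N2 \<beta> \<eta>)) ** B1 S \<eta>"

definition H_pair :: "('n::finite, 'm::finite, 'q::finite) pde_system \<Rightarrow>
    'n mfun \<Rightarrow> 'n mker \<Rightarrow> 'n mker \<Rightarrow> 'n mker \<times> 'n mker"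
  where "H_pair S M N1 N2 =
    (let V = (\<lambda>A s. M s ** A s);
         W = (\<lambda>N A s \<theta>. N s \<theta> ** A \<theta>);
         (p1, p2) = map_L3 S (V (A0 S)) (W N1 (A0 S)) (W N2 (A0 S));
         (q1, q2) = map_L2 S (V (A1 S)) (W N1 (A1 S)) (W N2 (A1 S));
         (r1, r2) = map_L1 S (V (A2 S)) (W N1 (A2 S)) (W N2 (A2 S))
     in (\<lambda>s \<theta>. p1 s \<theta> + q1 s \<theta> + r1 s \<theta>, \<lambda>s \<theta>. p2 s \<theta> + q2 s \<theta> + r2 s \<theta>))"

definition map_L4 :: "real \<Rightarrow> ('n::finite, 'm::finite, 'q::finite) pde_system \<Rightarrow>
    'n mfun \<Rightarrow> 'n mker \<Rightarrow> 'n mker \<Rightarrow>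
    (real^'m^'m) \<times> (real \<Rightarrow> real^'n^'m) \<times> 'n mker \<times> 'n mker"
  where "map_L4 \<gamma> S M N1 N2 =
    (let (H1, H2) = H_pair S M N1 N2;
         P = (1 / len S) *\<^sub>R (transpose (D1 S) ** D1 S - scalar_mat (\<gamma>\<^sup>2));
         Q = (\<lambda>s. transpose (D1 S) ** C3 S s
                + integ 0 (len S) (\<lambda>\<theta>. transpose (Vker S M N1 N2 s \<theta>)));
         R1 = (\<lambda>s \<theta>. H1 s \<theta> + transpose (H2 \<theta> s) + transpose (C3 S s) ** C3 S \<theta>);
         R2 = (\<lambda>s \<theta>. transpose (R1 \<theta> s))
     in (P, Q, R1, R2))"

text \<open>Equality of the numbers of inputs and outputs is expressed by using one index type for both.\<close>

definition map_L5 :: "('n::finite, 'm::finite, 'm) pde_system \<Rightarrow>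
    'n mfun \<Rightarrow> 'n mker \<Rightarrow> 'n mker \<Rightarrow>
    (real^'m^'m) \<times> (real \<Rightarrow> real^'n^'m) \<times> 'n mker \<times> 'n mker"
  where "map_L5 S M N1 N2 =
    (let (H1, H2) = H_pair S M N1 N2;
         P = - (1 / len S) *\<^sub>R (D1 S + transpose (D1 S));
         Q = (\<lambda>s. - C3 S s + integ 0 (len S) (\<lambda>\<theta>. transpose (Vker S M N1 N2 s \<theta>)));
         R1 = (\<lambda>s \<theta>. H1 s \<theta> + transpose (H2 \<theta> s));
         R2 = (\<lambda>s \<theta>. transpose (R1 \<theta> s))
     in (P, Q, R1, R2))"

end

theory Submission
  imports Defs
begin

text \<open>
  The energy \<open>\<V>(t) = \<langle>x(t), \<P> x(t)\<rangle>\<close>, where \<open>\<P>\<close> is the integral operator with multiplier \<open>M\<close>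
  and kernel \<open>N\<^sub>1\<close>, \<open>N\<^sub>2\<close>, is nonnegative because \<open>{M - \<epsilon>I, N\<^sub>1, N\<^sub>2} \<in> \<Phi>\<^sub>2\<close> writes it as the
  integral of a positive semidefinite form. The boundary conditions express \<open>x\<close>, \<open>x\<^sub>s\<close> and \<open>y\<close> through
  \<open>u = x\<^sub>s\<^sub>s\<close> by the Green kernels \<open>G\<close>, \<open>G'\<close> and \<open>C\<^sub>3\<close>, so that \<open>\<V>' + |y|\<^sup>2 - \<gamma>\<^sup>2|w|\<^sup>2\<close>
  (respectively \<open>\<V>' - 2 y\<^sup>T w\<close>) becomes a quadratic form in \<open>w\<close> and \<open>u\<close>. By Fubini its kernels are
  those of \<open>\<L>\<^sub>4\<close> (respectively \<open>\<L>\<^sub>5\<close>), and membership of their negatives in \<open>\<Phi>\<^sub>1\<close> makes the form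
  nonpositive. As \<open>\<V>\<close> is absolutely continuous with \<open>\<V>(0) = 0\<close> and \<open>\<V> \<ge> 0\<close>, integrating over time
  gives both claims.
\<close>

text \<open>Passing to \<open>u\<close> absorbs the boundary conditions: \<open>f\<close>, its
  derivative and the boundary values are tied to each other through \<open>Bbc\<close>, whereas in
  the final form \<open>u\<close> and \<open>w\<close> are the only variables and the constraint
  sits in the kernels. Two obstacles shape the rest. The matrix functions \<open>Z\<close> behind
  \<open>Phi1\<close> and \<open>Phi2\<close> are only Lebesgue measurable on the square, and the
  Lebesgue sigma-algebra of the plane is larger than the product sigma-algebra on which Fubini
  works. So \<open>Z\<close> is replaced by a product measurable version, and kernels are compared
  almost everywhere or off the diagonal, which is all that their forms can see. Second, the
  evolution equation is known only for almost every time, so the energy has to be recovered from an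
  almost everywhere derivative. This calls for absolute continuity; the fundamental theorem is
  proved with gauges, where no integrability of the derivative has to be known beforehand. In space
  the same gap is closed by the du Bois-Reymond lemma: it turns the weak derivatives of the state
  into primitives, to which the point values in the boundary condition refer.\<close>

subsection \<open>Absolutely continuous functions\<close>

text \<open>Translates the indexed interval families of the absolute continuity hypothesis into the
  tagged divisions of gauge integration. The intervals of a division have disjoint interiors, so if
  all of them lie in a set of measure below \<open>d\<close>, their total length is below
  \<open>d\<close>.\<close>

lemma sum_increments_lt:
  fixes f :: "real \<Rightarrow> real"
  assumes AC: "\<And>(k::nat) l u. (\<forall>i<k. a \<le> l i \<and> l i \<le> u i \<and> u i \<le> b)
            \<Longrightarrow> disjoint_family_on (\<lambda>i. {l i<..<u i}) {..<k} \<Longrightarrow> (\<Sum>i<k. u i - l i) < d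
            \<Longrightarrow> (\<Sum>i<k. \<bar>f (u i) - f (l i)\<bar>) < e"
    and p: "p tagged_partial_division_of {a..b}"
    and U: "U \<in> lmeasurable" "measure lebesgue U < d" "\<And>x K. (x, K) \<in> p \<Longrightarrow> K \<subseteq> U"
  shows "(\<Sum>(x, K)\<in>p. \<bar>f (Sup K) - f (Inf K)\<bar>) < e"
proof -
  have fin: "finite p" using p by (simp add: tagged_partial_division_of_def)
  then obtain h where h: "bij_betw h {0..<card p} p"
    using ex_bij_betw_nat_finite by blast
  define k where "k = card p"
  have h: "bij_betw h {..<k} p"
    using h by (simp add: k_def atLeast0LessThan)
  define l where "l i = Inf (snd (h i))" for i
  define u where "u i = Sup (snd (h i))" for i
  have hp: "h i \<in> p" if "i < k" for i
    using h that by (auto simp: bij_betw_def)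
  have K: "l i \<le> u i \<and> snd (h i) = {l i..u i}" if i: "i < k" for i
  proof -
    obtain x K where xK: "h i = (x, K)" by fastforce
    with hp[OF i] have "(x, K) \<in> p" by simp
    then obtain c e where "K = cbox c e" "x \<in> K"
      using tagged_partial_division_ofD[OF p] by metis
    then show ?thesis using xK by (auto simp: l_def u_def)
  qed
  have Kab: "{l i..u i} \<subseteq> {a..b}" if "i < k" for i
  proof -
    have "(fst (h i), snd (h i)) \<in> p" using hp[OF that] by simp
    from tagged_partial_division_ofD(3)[OF p this] show ?thesis using K[OF that] by simp
  qed
  have disj: "disjoint_family_on (\<lambda>i. {l i<..<u i}) {..<k}"
    unfolding disjoint_family_on_def
  proof (intro ballI impI)
    fix i j assume ij: "i \<in> {..<k}" "j \<in> {..<k}" "i \<noteq> j"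
    then have "h i \<noteq> h j" using h by (auto simp: bij_betw_def inj_on_def)
    then have "interior (snd (h i)) \<inter> interior (snd (h j)) = {}"
      using tagged_partial_division_ofD(5)[OF p, of "fst (h i)" "snd (h i)" "fst (h j)" "snd (h j)"]
        hp ij by (simp add: prod_eq_iff)
    then show "{l i<..<u i} \<inter> {l j<..<u j} = {}"
      using K ij by (simp add: interior_atLeastAtMost_real)
  qed
  have "(\<Sum>i<k. u i - l i) = (\<Sum>i<k. measure lebesgue {l i<..<u i})"
    using K by (intro sum.cong) auto
  also have "\<dots> = measure lebesgue (\<Union>i<k. {l i<..<u i})"
    using disj K by (intro measure_finite_Union[symmetric]) auto
  also have "\<dots> \<le> measure lebesgue U"
  proof (rule measure_mono_fmeasurable[OF _ _ U(1)])
    show "(\<Union>i<k. {l i<..<u i}) \<subseteq> U"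
    proof (rule UN_least)
      fix i assume "i \<in> {..<k}"
      then have "{l i..u i} \<subseteq> U"
        using U(3)[of "fst (h i)" "snd (h i)"] hp[of i] K[of i] by (metis lessThan_iff prod.collapse)
      then show "{l i<..<u i} \<subseteq> U" by (rule subset_trans[rotated]) auto
    qed
  qed auto
  finally have "(\<Sum>i<k. u i - l i) < d" using U by simp
  then have "(\<Sum>i<k. \<bar>f (u i) - f (l i)\<bar>) < e"
    using Kab K by (intro AC disj) auto
  also have "(\<Sum>i<k. \<bar>f (u i) - f (l i)\<bar>) = (\<Sum>(x, K)\<in>p. \<bar>f (Sup K) - f (Inf K)\<bar>)"
    using sum.reindex_bij_betw[OF h, of "\<lambda>(x, K). \<bar>f (Sup K) - f (Inf K)\<bar>"]
    by (simp add: l_def u_def case_prod_unfold)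
  finally show ?thesis .
qed

text \<open>The subintervals tagged in \<open>N\<close> are kept inside an open set of small measure, so absolute
  continuity bounds their increments; the other ones are handled by the straddle inequality.\<close>

lemma abs_continuous_has_integral:
  fixes f h :: "real \<Rightarrow> real"
  assumes ab: "a \<le> b"
    and AC: "\<And>e. 0 < e \<Longrightarrow> \<exists>d>0. \<forall>(k::nat) l u. (\<forall>i<k. a \<le> l i \<and> l i \<le> u i \<and> u i \<le> b)
            \<and> disjoint_family_on (\<lambda>i. {l i<..<u i}) {..<k} \<and> (\<Sum>i<k. u i - l i) < d
            \<longrightarrow> (\<Sum>i<k. \<bar>f (u i) - f (l i)\<bar>) < e"
    and N: "negligible N"
    and der: "\<And>t. t \<in> {a..b} - N \<Longrightarrow> (f has_vector_derivative h t) (at t within {a..b})"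
    and h0: "\<And>t. t \<in> N \<Longrightarrow> h t = 0"
  shows "(h has_integral (f b - f a)) {a..b}"
  unfolding has_integral box_real[symmetric]
proof safe
  fix e :: real assume e: "e > 0"
  \<comment> \<open>Half of \<open>e\<close> pays for the straddle errors, which sum to
    \<open>e' * (b - a)\<close>; the \<open>+ 1\<close> keeps the denominator positive when
    \<open>a = b\<close>.\<close>
  define e' where "e' = e / 2 / (b - a + 1)"
  have e': "e' > 0" "e' * (b - a) < e / 2"
    using e ab by (auto simp: e'_def field_simps)
  obtain \<delta> where \<delta>: "\<delta> > 0" "\<And>(k::nat) l u. (\<forall>i<k. a \<le> l i \<and> l i \<le> u i \<and> u i \<le> b)
            \<Longrightarrow> disjoint_family_on (\<lambda>i. {l i<..<u i}) {..<k} \<Longrightarrow> (\<Sum>i<k. u i - l i) < \<delta>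
            \<Longrightarrow> (\<Sum>i<k. \<bar>f (u i) - f (l i)\<bar>) < e / 2"
    using AC[of "e / 2"] e by auto
  obtain U where U: "open U" "N \<subseteq> U" "U - N \<in> lmeasurable" "emeasure lebesgue (U - N) < ennreal \<delta>"
    using sets_lebesgue_outer_open[OF negligible_imp_sets[OF N] \<delta>(1)] by blast
  have Nm: "N \<in> lmeasurable" "measure lebesgue N = 0"
    using N by (auto simp: negligible_iff_measure)
  have U': "U \<in> lmeasurable"
    using fmeasurable.Un[OF U(3) Nm(1)] U(2) by (simp add: Un_absorb2)
  have "measure lebesgue U = measure lebesgue (U - N)"
    using N U' by (simp add: measure_Diff_null_set negligible_iff_null_sets fmeasurableD)
  also have "\<dots> < \<delta>" using U(3,4) \<delta>(1)
    by (simp add: emeasure_eq_measure2 ennreal_less_iff)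
  finally have mU: "measure lebesgue U < \<delta>" .
  have "\<exists>d>0. (t \<in> {a..b} - N \<longrightarrow>
         (\<forall>y\<in>{a..b}. norm (y - t) < d \<longrightarrow> norm (f y - f t - (y - t) *\<^sub>R h t) \<le> e' * norm (y - t)))
         \<and> (t \<in> N \<longrightarrow> ball t d \<subseteq> U)" for t
  proof (cases "t \<in> N")
    case True
    then obtain d where "d > 0" "ball t d \<subseteq> U"
      using openE[OF U(1)] U(2) by blast
    with True show ?thesis by (intro exI[of _ d]) simp
  next
    case False
    show ?thesis
    proof (cases "t \<in> {a..b}")
      case True
      with False have "t \<in> {a..b} - N" by simp
      from der[OF this, unfolded has_vector_derivative_def has_derivative_within_alt] e'(1)
      obtain d where "d > 0" "\<forall>y\<in>{a..b}. norm (y - t) < d \<longrightarrow> norm (f y - f t - (y - t) *\<^sub>R h t) \<le> e' * norm (y - t)"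
        by blast
      with False show ?thesis by (intro exI[of _ d]) simp
    qed (use False in \<open>auto intro: exI[of _ 1]\<close>)
  qed
  then obtain d where d: "\<And>t. 0 < d t"
     "\<And>t y. t \<in> {a..b} - N \<Longrightarrow> y \<in> {a..b} \<Longrightarrow> norm (y - t) < d t
         \<Longrightarrow> norm (f y - f t - (y - t) *\<^sub>R h t) \<le> e' * norm (y - t)"
     "\<And>t. t \<in> N \<Longrightarrow> ball t (d t) \<subseteq> U"
    by metis
  show "\<exists>\<gamma>. gauge \<gamma> \<and> (\<forall>\<D>. \<D> tagged_division_of cbox a b \<and> \<gamma> fine \<D> \<longrightarrow>
          norm ((\<Sum>(x, k)\<in>\<D>. measure lborel k *\<^sub>R h x) - (f b - f a)) < e)"
  proof (rule exI, safe)
    show "gauge (\<lambda>x. ball x (d x))" using d(1) gauge_ball_dependent by blast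
    fix p assume p: "p tagged_division_of cbox a b" and fine: "(\<lambda>x. ball x (d x)) fine p"
    have fin: "finite p" using p by (rule tagged_division_of_finite)
    have p': "p tagged_division_of {a..b}" using p by simp
    have ba: "b - a = (\<Sum>(x,K)\<in>p. Sup K - Inf K)" "f b - f a = (\<Sum>(x,K)\<in>p. f(Sup K) - f(Inf K))"
      using additive_tagged_division_1[OF ab p', of "\<lambda>x. x"] additive_tagged_division_1[OF ab p', of f] by auto
    define pN where "pN = {z \<in> p. fst z \<in> N}"
    have KD: "\<exists>u v. K = {u..v} \<and> u \<le> v \<and> x \<in> K \<and> K \<subseteq> {a..b} \<and> K \<subseteq> ball x (d x)" if xK: "(x, K) \<in> p" for x K
    proof -
      obtain u v where "K = cbox u v"
        using tagged_division_ofD(4)[OF p xK] by blast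
      moreover have "x \<in> K" "K \<subseteq> cbox a b"
        using tagged_division_ofD(2,3)[OF p xK] by blast+
      ultimately have "K = {u..v}" "u \<le> v" "x \<in> K" "K \<subseteq> {a..b}" by auto
      then show ?thesis using fineD[OF fine that] by (intro exI[of _ u] exI[of _ v]) auto
    qed
    define D where "D z = (case z of (x, K) \<Rightarrow> measure lborel K *\<^sub>R h x - (f (Sup K) - f (Inf K)))" for z
    have good: "\<bar>D z\<bar> \<le> e' * (Sup (snd z) - Inf (snd z))" if "z \<in> p - pN" for z
    proof -
      obtain x K where z: "z = (x, K)" by fastforce
      with that have xK: "(x, K) \<in> p" and xN: "x \<notin> N" by (auto simp: pN_def)
      then obtain u v where K: "K = {u..v}" "u \<le> v" "x \<in> K" "K \<subseteq> {a..b}" "K \<subseteq> ball x (d x)"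
        using KD by metis
      have uv: "u \<in> K" "v \<in> K" using K by auto
      have "x \<in> {a..b} - N" using K xN by blast
      note dd = d(2)[OF this]
      have u: "norm (f u - f x - (u - x) *\<^sub>R h x) \<le> e' * norm (u - x)"
        using dd[of u] uv(1) K(4,5) by (metis dist_norm dist_commute mem_ball subsetD)
      have v: "norm (f v - f x - (v - x) *\<^sub>R h x) \<le> e' * norm (v - x)"
        using dd[of v] uv(2) K(4,5) by (metis dist_norm dist_commute mem_ball subsetD)
      have eq: "D z = (f u - f x - (u - x) *\<^sub>R h x) - (f v - f x - (v - x) *\<^sub>R h x)"
        using K by (simp add: D_def z algebra_simps)
      have "norm (D z) \<le> e' * norm (u - x) + e' * norm (v - x)"
        unfolding eq by (rule order_trans[OF norm_triangle_ineq4 add_mono[OF u v]])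
      also have "\<dots> = e' * (v - u)" using K by (simp add: algebra_simps)
      finally show ?thesis using K by (simp add: z)
    qed
    \<comment> \<open>At a tag in \<open>N\<close> the Riemann term vanishes because
      \<open>h\<close> is 0 there, so only the increment of \<open>f\<close> is left.\<close>
    have bad: "(\<Sum>z\<in>pN. \<bar>D z\<bar>) < e / 2"
    proof -
      have "(\<Sum>z\<in>pN. \<bar>D z\<bar>) = (\<Sum>(x, K)\<in>pN. \<bar>f (Sup K) - f (Inf K)\<bar>)"
        by (intro sum.cong) (auto simp: pN_def D_def h0)
      also have "\<dots> < e / 2"
      proof (rule sum_increments_lt[OF \<delta>(2) _ U' mU])
        show "pN tagged_partial_division_of {a..b}"
          using p tagged_partial_division_subset[of p "{a..b}" pN]
          by (auto simp: tagged_division_of_def pN_def)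
        show "K \<subseteq> U" if "(x, K) \<in> pN" for x K
        proof -
          have "(x, K) \<in> p" "x \<in> N" using that by (auto simp: pN_def)
          then show ?thesis using KD[of x K] d(3)[of x] by blast
        qed
      qed auto
      finally show ?thesis .
    qed
    have "(\<Sum>(x, k)\<in>p. measure lborel k *\<^sub>R h x) - (f b - f a) = (\<Sum>z\<in>p. D z)"
      unfolding ba D_def by (simp add: sum_subtractf case_prod_unfold)
    also have "\<bar>\<dots>\<bar> \<le> (\<Sum>z\<in>p. \<bar>D z\<bar>)" by (rule sum_abs)
    also have "\<dots> = (\<Sum>z\<in>p - pN. \<bar>D z\<bar>) + (\<Sum>z\<in>pN. \<bar>D z\<bar>)"
      using fin by (intro sum.subset_diff) (auto simp: pN_def)
    also have "(\<Sum>z\<in>p - pN. \<bar>D z\<bar>) \<le> (\<Sum>z\<in>p - pN. e' * (Sup (snd z) - Inf (snd z)))"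
      by (intro sum_mono good)
    also have "\<dots> \<le> (\<Sum>z\<in>p. e' * (Sup (snd z) - Inf (snd z)))"
    proof (intro sum_mono2 fin)
      fix z assume z: "z \<in> p - (p - pN)"
      obtain x K where zz: "z = (x, K)" by fastforce
      show "0 \<le> e' * (Sup (snd z) - Inf (snd z))"
        using KD[of x K] z zz e'(1) by (auto simp: pN_def)
    qed auto
    also have "\<dots> = e' * (b - a)"
      unfolding ba by (simp add: sum_distrib_left case_prod_unfold)
    finally show "norm ((\<Sum>(x, k)\<in>p. measure lborel k *\<^sub>R h x) - (f b - f a)) < e"
      using bad e' by simp
  qed
qed

text \<open>Nothing is assumed about measurability or integrability of the derivative:
  \<open>abs_continuous_has_integral\<close> delivers the gauge integral of the derivative, and only
  then is it compared with the integral of \<open>g\<close>.\<close>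

lemma abs_continuous_le_integral:
  fixes f g :: "real \<Rightarrow> real"
  assumes ab: "a \<le> b"
    and AC: "\<And>e. 0 < e \<Longrightarrow> \<exists>d>0. \<forall>(k::nat) l u. (\<forall>i<k. a \<le> l i \<and> l i \<le> u i \<and> u i \<le> b)
            \<and> disjoint_family_on (\<lambda>i. {l i<..<u i}) {..<k} \<and> (\<Sum>i<k. u i - l i) < d
            \<longrightarrow> (\<Sum>i<k. \<bar>f (u i) - f (l i)\<bar>) < e"
    and der: "AE t in lebesgue_on {a..b}. \<exists>d. (f has_vector_derivative d) (at t) \<and> d \<le> g t"
    and g: "integrable (lebesgue_on {a..b}) g"
  shows "f b - f a \<le> (LINT t|lebesgue_on {a..b}. g t)"
proof -
  have "AE t in lebesgue. t \<in> {a..b} \<longrightarrow> (\<exists>d. (f has_vector_derivative d) (at t) \<and> d \<le> g t)"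
    using der by (simp add: AE_restrict_space_iff)
  then obtain N where "N \<in> null_sets lebesgue"
      "{t \<in> space lebesgue. \<not> (t \<in> {a..b} \<longrightarrow> (\<exists>d. (f has_vector_derivative d) (at t) \<and> d \<le> g t))} \<subseteq> N"
    unfolding eventually_ae_filter by blast
  then have N: "N \<in> null_sets lebesgue"
      "\<And>t. t \<in> {a..b} - N \<Longrightarrow> \<exists>d. (f has_vector_derivative d) (at t) \<and> d \<le> g t"
    by auto
  then obtain d where d: "\<And>t. t \<in> {a..b} - N \<Longrightarrow> (f has_vector_derivative d t) (at t) \<and> d t \<le> g t"
    by metis
  \<comment> \<open>The derivative is set to 0 on the exceptional set, as
    \<open>abs_continuous_has_integral\<close> demands; \<open>g\<close> is changed in the same way
    below, so that the comparison holds at every point.\<close>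
  define h where "h t = (if t \<in> N then 0 else d t)" for t
  have h: "(h has_integral (f b - f a)) {a..b}"
  proof (rule abs_continuous_has_integral[OF ab])
    show "negligible N" using N by (simp add: negligible_iff_null_sets)
    show "(f has_vector_derivative h t) (at t within {a..b})" if "t \<in> {a..b} - N" for t
      using d[OF that] that by (auto simp: h_def intro: has_vector_derivative_at_within)
  qed (use AC in \<open>auto simp: h_def\<close>)
  define g' where "g' t = (if t \<in> N then 0 else g t)" for t
  have "(g has_integral (LINT t|lebesgue_on {a..b}. g t)) {a..b}"
    using has_integral_integral_lebesgue_on[OF g] by simp
  then have "(g' has_integral (LINT t|lebesgue_on {a..b}. g t)) {a..b}"
    by (rule has_integral_spike[rotated 2, where S=N])
       (use N in \<open>auto simp: g'_def negligible_iff_null_sets\<close>)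
  with h show ?thesis
    by (rule has_integral_le) (use d in \<open>auto simp: h_def g'_def\<close>)
qed

subsection \<open>Weak derivatives\<close>

definition flat_exp :: "real \<Rightarrow> real poly \<Rightarrow> real \<Rightarrow> real"
  where "flat_exp c p x = (if 0 < x then poly p (1 / x) * exp (- c / x) else 0)"

text \<open>Read with \<open>y = 1 / x\<close>, this is the flatness of \<open>flat_exp\<close> at
  0.\<close>

lemma poly_mult_exp_tendsto_0:
  fixes p :: "real poly"
  assumes "0 < c"
  shows "((\<lambda>y. poly p y * exp (- c * y)) \<longlongrightarrow> 0) at_top"
proof -
  have "((\<lambda>y. y ^ i * exp (- c * y)) \<longlongrightarrow> 0) at_top" for i
  proof -
    have "((\<lambda>y::real. y ^ i / exp y) \<longlongrightarrow> 0) at_top" by (rule tendsto_power_div_exp_0)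
    moreover have "filterlim (\<lambda>y. c * y) at_top at_top"
      using assms by (intro filterlim_tendsto_pos_mult_at_top[OF tendsto_const]) (auto intro: filterlim_ident)
    ultimately have "((\<lambda>y. (c * y) ^ i / exp (c * y)) \<longlongrightarrow> 0) at_top"
      by (rule filterlim_compose)
    then have "((\<lambda>y. (1 / c ^ i) * ((c * y) ^ i / exp (c * y))) \<longlongrightarrow> (1 / c ^ i) * 0) at_top"
      by (intro tendsto_intros)
    then show ?thesis using assms by (simp add: power_mult_distrib exp_minus field_simps)
  qed
  then have "((\<lambda>y. \<Sum>i\<le>degree p. coeff p i * (y ^ i * exp (- c * y))) \<longlongrightarrow> (\<Sum>i\<le>degree p. coeff p i * 0)) at_top"
    by (intro tendsto_intros)
  then show ?thesis by (simp add: poly_altdef sum_distrib_right mult.assoc)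
qed

text \<open>With \<open>y = 1 / x\<close> one has dy/dx = -y^2, so the derivative of p(y) exp(-c y)
  is y^2 (c p(y) - p'(y)) exp(-c y); the factor \<open>[:0, 0, 1:]\<close> is y^2. The derivative is
  again a \<open>flat_exp\<close>, with another polynomial.\<close>

lemma flat_exp_deriv:
  assumes c: "0 < c"
  shows "(flat_exp c p has_real_derivative flat_exp c ([:0, 0, 1:] * (smult c p - pderiv p)) x) (at x)"
proof (cases "x = 0")
  case False
  consider "x < 0" | "0 < x" using False by linarith
  then show ?thesis
  proof cases
    case 1
    have "((\<lambda>_. 0) has_real_derivative 0) (at x)" by simp
    moreover have "eventually (\<lambda>y. flat_exp c p y = 0) (nhds x)"
      using eventually_nhds_in_open[of "{..<0}" x] 1
      by (auto simp: flat_exp_def elim!: eventually_mono)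
    ultimately show ?thesis
      using 1 by (subst DERIV_cong_ev[OF refl _ refl, where g="\<lambda>_. 0"]) (auto simp: flat_exp_def)
  next
    case 2
    have "((\<lambda>x. poly p (1 / x) * exp (- c / x)) has_real_derivative
       poly ([:0, 0, 1:] * (smult c p - pderiv p)) (1 / x) * exp (- c / x)) (at x)"
      using 2 by (auto intro!: derivative_eq_intros DERIV_chain2[OF poly_DERIV]
         simp: field_simps power2_eq_square)
    moreover have "eventually (\<lambda>y. flat_exp c p y = poly p (1 / y) * exp (- c / y)) (nhds x)"
      using eventually_nhds_in_open[of "{0<..}" x] 2
      by (auto simp: flat_exp_def elim!: eventually_mono)
    ultimately show ?thesis
      using 2 by (subst DERIV_cong_ev[OF refl _ refl]) (auto simp: flat_exp_def)
  qed
next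
  case True
  have "((\<lambda>h. flat_exp c p h / h) \<longlongrightarrow> 0) (at_right 0)"
  proof -
    \<comment> \<open>Dividing by \<open>h\<close> multiplies the polynomial in \<open>1 / h\<close>
      by its variable, hence \<open>pCons 0 p\<close>.\<close>
    have "((\<lambda>h. poly (pCons 0 p) (inverse h) * exp (- c * inverse h)) \<longlongrightarrow> 0) (at_right 0)"
      by (rule filterlim_compose[OF poly_mult_exp_tendsto_0[OF c] filterlim_inverse_at_top_right])
    moreover have "eventually (\<lambda>h. poly (pCons 0 p) (inverse h) * exp (- c * inverse h) = flat_exp c p h / h) (at_right 0)"
      using eventually_at_right_less[of 0] by eventually_elim (auto simp: flat_exp_def field_simps)
    ultimately show ?thesis by (rule Lim_transform_eventually)
  qed
  moreover have "((\<lambda>h. flat_exp c p h / h) \<longlongrightarrow> 0) (at_left 0)"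
  proof (rule Lim_transform_eventually[OF tendsto_const])
    show "eventually (\<lambda>h. 0 = flat_exp c p h / h) (at_left 0)"
      by (auto simp: eventually_at_filter flat_exp_def)
  qed
  ultimately have "((\<lambda>h. flat_exp c p h / h) \<longlongrightarrow> 0) (at 0)"
    by (simp add: filterlim_split_at)
  then show ?thesis
    using True by (simp add: DERIV_def flat_exp_def)
qed

text \<open>This class is closed under differentiation, hence all its members are smooth.\<close>

inductive bump_comb :: "(real \<Rightarrow> real) \<Rightarrow> bool" where
  bump: "0 < c \<Longrightarrow> bump_comb (\<lambda>x. flat_exp c p (x - a) * flat_exp c q (b - x))"
| add: "bump_comb f \<Longrightarrow> bump_comb g \<Longrightarrow> bump_comb (\<lambda>x. f x + g x)"
| scale: "bump_comb f \<Longrightarrow> bump_comb (\<lambda>x. r * f x)"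

lemma bump_comb_deriv:
  "bump_comb f \<Longrightarrow> \<exists>f'. bump_comb f' \<and> (\<forall>x. (f has_real_derivative f' x) (at x))"
proof (induction rule: bump_comb.induct)
  case (bump c p a q b)
  let ?D = "\<lambda>p. [:0, 0, 1:] * (smult c p - pderiv p)"
  have 1: "((\<lambda>x. flat_exp c p (x - a)) has_real_derivative flat_exp c (?D p) (x - a)) (at x)" for x
    using DERIV_chain2[OF flat_exp_deriv[OF bump], of "\<lambda>x. x - a" 1] by (force intro!: derivative_eq_intros)
  have 2: "((\<lambda>x. flat_exp c q (b - x)) has_real_derivative - flat_exp c (?D q) (b - x)) (at x)" for x
    using DERIV_chain2[OF flat_exp_deriv[OF bump], of "\<lambda>x. b - x" "-1"] by (force intro!: derivative_eq_intros)
  let ?f' = "\<lambda>x. flat_exp c (?D p) (x - a) * flat_exp c q (b - x)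
      + (- 1) * (flat_exp c p (x - a) * flat_exp c (?D q) (b - x))"
  have "bump_comb ?f'"
    using bump by (intro bump_comb.intros)
  moreover have "((\<lambda>x. flat_exp c p (x - a) * flat_exp c q (b - x)) has_real_derivative ?f' x) (at x)" for x
    by (rule DERIV_cong[OF DERIV_mult[OF 1 2]]) (simp add: algebra_simps)
  ultimately show ?case by blast
next
  case (add f g)
  then obtain f' g' where "bump_comb f'" "bump_comb g'"
    "\<And>x. (f has_real_derivative f' x) (at x)" "\<And>x. (g has_real_derivative g' x) (at x)" by blast
  then show ?case by (intro exI[of _ "\<lambda>x. f' x + g' x"]) (auto intro: bump_comb.add DERIV_add)
next
  case (scale f r)
  then obtain f' where "bump_comb f'" "\<And>x. (f has_real_derivative f' x) (at x)" by blast
  then show ?case by (intro exI[of _ "\<lambda>x. r * f' x"]) (auto intro: bump_comb.scale DERIV_cmult)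
qed

lemma bump_comb_deriv_funpow:
  assumes "bump_comb f" shows "bump_comb ((deriv ^^ k) f)"
proof (induction k)
  case (Suc k)
  then obtain f' where f': "bump_comb f'" "\<And>x. ((deriv ^^ k) f has_real_derivative f' x) (at x)"
    using bump_comb_deriv by blast
  then have "deriv ((deriv ^^ k) f) = f'" by (intro ext DERIV_imp_deriv)
  then show ?case using f' by simp
qed (use assms in simp)

lemma bump_comb_differentiable:
  "bump_comb f \<Longrightarrow> (deriv ^^ k) f field_differentiable at s"
  unfolding field_differentiable_def by (metis bump_comb_deriv bump_comb_deriv_funpow)

lemma bump_comb_continuous: "bump_comb f \<Longrightarrow> continuous_on S f"
  using bump_comb_differentiable[of f 0]
  by (auto intro!: continuous_at_imp_continuous_on field_differentiable_imp_continuous_at)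

text \<open>The primitive from 0 vanishes to the left of the support of \<open>f\<close>, is
  constant to its right, and this constant is the total integral, which is 0. So the primitive has
  compact support, and it inherits smoothness from \<open>f\<close>.\<close>

lemma test_function_antiderivative:
  assumes f: "bump_comb f" and ab: "0 < a" "a \<le> b" "b < L"
    and supp: "\<And>s. s \<notin> {a..b} \<Longrightarrow> f s = 0"
    and int0: "integral {0..L} f = 0"
  shows "\<exists>\<phi>. test_function L \<phi> \<and> deriv \<phi> = f"
proof -
  define \<phi> where "\<phi> x = integral {0..x} f" for x
  have int: "f integrable_on {u..v}" for u v
    using bump_comb_continuous[OF f] by (rule integrable_continuous_interval)
  have z1: "\<phi> x = 0" if "x < a" for x
    unfolding \<phi>_def using that supp by (intro integral_unique has_integral_is_0) auto
  have z2: "\<phi> x = 0" if x: "x > b" for x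
  proof -
    \<comment> \<open>The primitive has the same value at every point beyond \<open>b\<close>;
      comparison with the point \<open>L\<close>, where it is the total integral, shows that this
      value is 0.\<close>
    have b: "\<phi> y = integral {0..b} f" if y: "y > b" for y
    proof -
      have "\<phi> y = integral {0..b} f + integral {b..y} f"
        unfolding \<phi>_def using y ab int by (intro Henstock_Kurzweil_Integration.integral_combine[symmetric]) auto
      moreover have "integral {b..y} f = integral {b..y} (\<lambda>_. 0)"
        by (rule integral_spike[of "{b}"]) (use supp in auto)
      ultimately show ?thesis by simp
    qed
    show ?thesis using b[OF x] b[OF ab(3)] int0 by (simp add: \<phi>_def)
  qed
  have der: "(\<phi> has_real_derivative f x) (at x)" for x
  proof (cases "x < a")
    case True
    have "eventually (\<lambda>y. \<phi> y = 0) (nhds x)"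
      using eventually_nhds_in_open[of "{..<a}" x] True z1 by (auto elim!: eventually_mono)
    then show ?thesis using True supp[of x]
      by (subst DERIV_cong_ev[OF refl _ refl, where g="\<lambda>_. 0"]) auto
  next
    case False
    \<comment> \<open>The interval ends at \<open>x + 1\<close> only to have \<open>x\<close> in its
      interior; \<open>x > 0\<close> holds because \<open>a \<le> x\<close>.\<close>
    have "(\<phi> has_real_derivative f x) (at x within {0..x + 1})"
      unfolding \<phi>_def using bump_comb_continuous[OF f] False ab
      by (intro integral_has_real_derivative) auto
    then show ?thesis using False ab by (simp add: at_within_Icc_at)
  qed
  then have d: "deriv \<phi> = f" by (intro ext DERIV_imp_deriv)
  have "(deriv ^^ k) \<phi> field_differentiable at s" for k s
  proof (cases k)
    case 0
    then show ?thesis using der by (auto simp: field_differentiable_def)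
  next
    case (Suc j)
    then have "(deriv ^^ k) \<phi> = (deriv ^^ j) f" by (simp add: funpow_swap1 d)
    then show ?thesis using bump_comb_differentiable[OF f] by simp
  qed
  moreover have "\<forall>s. s \<notin> {a..b} \<longrightarrow> \<phi> s = 0"
    using z1 z2 by (meson atLeastAtMost_iff leI)
  ultimately show ?thesis
    using ab d unfolding test_function_def by (intro exI[of _ \<phi>]) auto
qed

text \<open>For \<open>x > 0\<close> the factor exp(-c/x) tends to 1 as c tends to 0, so the bumps
  with c = 1/(n+1) converge pointwise to the indicator of the open interval. They are bounded by 1,
  and \<open>norm (f x)\<close> dominates.\<close>

lemma bump_integral_tendsto:
  fixes f :: "real \<Rightarrow> 'a::euclidean_space"
  assumes f: "integrable (lebesgue_on {0..L}) f" and ab: "0 \<le> a" "b \<le> L"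
  shows "(\<lambda>n. integ 0 L (\<lambda>x. (flat_exp (1 / Suc n) 1 (x - a) * flat_exp (1 / Suc n) 1 (b - x)) *\<^sub>R f x))
           \<longlonglongrightarrow> integ 0 L (\<lambda>x. indicator {a<..<b} x *\<^sub>R f x)"
proof (rule integral_dominated_convergence[where w="\<lambda>x. norm (f x)"])
  have c: "(\<lambda>x. flat_exp (1 / Suc n) 1 (x - a) * flat_exp (1 / Suc n) 1 (b - x))
       \<in> borel_measurable (lebesgue_on {0..L})" for n
    by (intro continuous_imp_measurable_on_sets_lebesgue bump_comb_continuous bump_comb.bump) auto
  show "(\<lambda>x. (flat_exp (1 / Suc n) 1 (x - a) * flat_exp (1 / Suc n) 1 (b - x)) *\<^sub>R f x)
       \<in> borel_measurable (lebesgue_on {0..L})" for n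
    using c[of n] f by (intro borel_measurable_scaleR) auto
  have *: "(\<lambda>n. flat_exp (1 / Suc n) 1 x) \<longlonglongrightarrow> (if 0 < x then 1 else 0)" for x
  proof (cases "0 < x")
    case True
    have "(\<lambda>n. exp (- (1 / Suc n) / x)) \<longlonglongrightarrow> exp (- 0 / x)"
      using True by (intro tendsto_intros LIMSEQ_Suc lim_1_over_n) auto
    then show ?thesis using True by (simp add: flat_exp_def)
  qed (simp add: flat_exp_def)
  have "(\<lambda>n. flat_exp (1 / Suc n) 1 (x - a) * flat_exp (1 / Suc n) 1 (b - x)) \<longlonglongrightarrow> indicator {a<..<b} x" for x
    using tendsto_mult[OF *[of "x - a"] *[of "b - x"]] by (auto simp: indicator_def split: if_splits)
  then show "AE x in lebesgue_on {0..L}. (\<lambda>n. (flat_exp (1 / Suc n) 1 (x - a) * flat_exp (1 / Suc n) 1 (b - x)) *\<^sub>R f x)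
      \<longlonglongrightarrow> indicator {a<..<b} x *\<^sub>R f x"
    by (intro always_eventually allI tendsto_intros)
  have "\<bar>flat_exp c 1 x\<bar> \<le> 1" if "0 < c" for c x
    using that by (auto simp: flat_exp_def)
  then show "AE x in lebesgue_on {0..L}. norm ((flat_exp (1 / Suc n) 1 (x - a) * flat_exp (1 / Suc n) 1 (b - x)) *\<^sub>R f x) \<le> norm (f x)" for n
    by (intro always_eventually allI) (auto simp: abs_mult intro!: mult_left_le_one_le mult_le_one)
  show "integrable (lebesgue_on {0..L}) (\<lambda>x. norm (f x))" using f by simp
  show "(\<lambda>x. indicator {a<..<b} x *\<^sub>R f x) \<in> borel_measurable (lebesgue_on {0..L})"
    using f ab by (intro borel_measurable_scaleR borel_measurable_indicator) (auto simp: sets_restrict_space_iff)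
qed

text \<open>Lebesgue differentiation: at almost every \<open>x\<close> the value is the limit of the
  averages over \<open>{x..x + h}\<close>, and all these averages vanish once the interval lies
  inside the open interval from 0 to \<open>L\<close>.\<close>

lemma integrals_zero_imp_AE_zero:
  fixes f :: "real \<Rightarrow> 'a::euclidean_space"
  assumes f: "integrable (lebesgue_on {0..L}) f"
    and zero: "\<And>a b. 0 < a \<Longrightarrow> a \<le> b \<Longrightarrow> b < L \<Longrightarrow> integ 0 L (\<lambda>x. indicator {a<..<b} x *\<^sub>R f x) = 0"
  shows "AE x in lebesgue_on {0..L}. f x = 0"
proof -
  define g where "g x = (if x \<in> {0..L} then f x else 0)" for x
  have "integrable lebesgue (\<lambda>x. indicator {0..L} x *\<^sub>R f x)"
    using f by (subst (asm) integrable_restrict_space) auto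
  then have g: "integrable lebesgue g"
    by (rule Bochner_Integration.integrable_cong[THEN iffD1, rotated 2]) (auto simp: g_def)
  then have gu: "g integrable_on UNIV"
    using integrable_on_lebesgue by blast
  then have gi: "g integrable_on cbox a b" for a b
    by (rule integrable_on_subcbox) auto
  have zero': "integral {a..b} g = 0" if ab: "0 < a" "a \<le> b" "b < L" for a b
  proof -
    have "integral {a..b} g = integral {a<..<b} g"
      by (simp add: integral_open_interval_real)
    also have "\<dots> = integral UNIV (\<lambda>x. if x \<in> {a<..<b} then g x else 0)"
      by (simp only: integral_restrict_UNIV)
    also have "\<dots> = (LINT x|lebesgue. (if x \<in> {a<..<b} then g x else 0))"
    proof (rule integral_lebesgue)
      have "integrable lebesgue (\<lambda>x. indicator {a<..<b} x *\<^sub>R g x)"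
        using g by (intro integrable_mult_indicator) auto
      then show "integrable lebesgue (\<lambda>x. if x \<in> {a<..<b} then g x else 0)"
        by (rule Bochner_Integration.integrable_cong[THEN iffD1, rotated 2]) auto
    qed
    also have "\<dots> = (LINT x|lebesgue. indicator {0..L} x *\<^sub>R (indicator {a<..<b} x *\<^sub>R f x))"
      by (intro Bochner_Integration.integral_cong) (use ab in \<open>auto simp: g_def indicator_def\<close>)
    also have "\<dots> = integ 0 L (\<lambda>x. indicator {a<..<b} x *\<^sub>R f x)"
      by (simp add: integral_restrict_space)
    finally show ?thesis using zero[OF ab] by simp
  qed
  obtain N where N: "negligible N"
    "\<And>x e. \<lbrakk>x \<notin> N; 0 < e\<rbrakk> \<Longrightarrow> \<exists>d>0. \<forall>h. 0 < h \<and> h < d \<longrightarrow>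
        norm (integral (cbox x (x + h *\<^sub>R One)) g /\<^sub>R h ^ DIM(real) - g x) < e"
    by (rule integrable_ccontinuous_explicit[of g, OF gi]) blast
  have f0: "f x = 0" if x: "0 < x" "x < L" "x \<notin> N" for x
  proof (rule ccontr)
    assume "f x \<noteq> 0"
    then obtain d where d: "d > 0" "\<And>h. 0 < h \<Longrightarrow> h < d \<Longrightarrow>
        norm (integral (cbox x (x + h *\<^sub>R One)) g /\<^sub>R h ^ DIM(real) - g x) < norm (f x)"
      using N(2)[OF x(3), of "norm (f x)"] by auto
    \<comment> \<open>Small enough both for the differentiation estimate and for
      \<open>x + h\<close> to stay below \<open>L\<close>.\<close>
    define h where "h = min d (L - x) / 2"
    have h: "0 < h" "h < d" "x + h < L" using d(1) x by (auto simp: h_def min_def field_simps)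
    have "integral {x..x + h} g = 0" using x h by (intro zero') auto
    then show False using d(2)[OF h(1,2)] x by (simp add: g_def)
  qed
  have "N \<union> {0, L} \<in> null_sets lebesgue"
    using N(1) by (simp add: negligible_iff_null_sets[symmetric])
  then have "AE x in lebesgue. x \<notin> N \<union> {0, L}" by (rule AE_not_in)
  then have "AE x in lebesgue. x \<in> {0..L} \<longrightarrow> f x = 0"
    by eventually_elim (use f0 in force)
  then show ?thesis by (simp add: AE_restrict_space_iff)
qed

lemma integrable_continuous_scaleR:
  fixes f :: "real \<Rightarrow> 'a::euclidean_space"
  assumes "continuous_on {0..L} \<phi>" "integrable (lebesgue_on {0..L}) f"
  shows "integrable (lebesgue_on {0..L}) (\<lambda>x. \<phi> x *\<^sub>R f x)"
proof -
  obtain B where B: "\<And>x. x \<in> {0..L} \<Longrightarrow> norm (\<phi> x) \<le> B"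
    using compact_imp_bounded[OF compact_continuous_image[OF assms(1) compact_Icc]]
    unfolding bounded_iff by blast
  show ?thesis
  proof (rule Bochner_Integration.integrable_bound[where f="\<lambda>x. B *\<^sub>R norm (f x)"])
    show "(\<lambda>x. \<phi> x *\<^sub>R f x) \<in> borel_measurable (lebesgue_on {0..L})"
      using assms(2) continuous_imp_measurable_on_sets_lebesgue[OF assms(1)]
      by (intro borel_measurable_scaleR) auto
    show "AE x in lebesgue_on {0..L}. norm (\<phi> x *\<^sub>R f x) \<le> norm (B *\<^sub>R norm (f x))"
      using B by (intro AE_I2) (fastforce intro!: mult_right_mono simp: abs_mult intro: order_trans[OF _ abs_ge_self])
  qed (use assms in auto)
qed

text \<open>Not every bump is the derivative of a test function, only those of mean zero.
  Subtracting from a bump a suitable multiple of one fixed bump \<psi> makes the mean zero, and the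
  correction amounts to replacing \<open>f\<close> by \<open>f - c\<close>, where \<open>c\<close>
  is the \<psi>-weighted mean of \<open>f\<close>. Thus \<open>f - c\<close> is orthogonal to all
  bumps, and in the limit to all indicators of intervals.\<close>

proposition du_Bois_Reymond:
  fixes f :: "real \<Rightarrow> 'a::euclidean_space"
  assumes L: "0 < L" and f: "integrable (lebesgue_on {0..L}) f"
    and zero: "\<And>\<phi>. test_function L \<phi> \<Longrightarrow> integ 0 L (\<lambda>s. deriv \<phi> s *\<^sub>R f s) = 0"
  shows "\<exists>c. AE s in lebesgue_on {0..L}. f s = c"
proof -
  define bmp where "bmp n a b = (\<lambda>x. flat_exp (1 / Suc n) 1 (x - a) * flat_exp (1 / Suc n) 1 (b - x))" for n a b
  have one: "integrable (lebesgue_on {0..L}) (\<lambda>_. 1 :: real)"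
    by (simp add: finite_measure.integrable_const finite_measure_lebesgue_on)
  have bc: "bump_comb (bmp n a b)" for n a b
    unfolding bmp_def by (intro bump_comb.bump) auto
  have supp: "bmp n a b x = 0" if "x \<notin> {a..b}" for n a b x
    using that by (auto simp: bmp_def flat_exp_def)
  define a0 b0 where "a0 = L / 3" and "b0 = 2 * L / 3"
  have ab0: "0 < a0" "a0 < b0" "b0 < L" using L by (auto simp: a0_def b0_def)
  have "(\<lambda>n. integ 0 L (bmp n a0 b0)) \<longlonglongrightarrow> integ 0 L (\<lambda>x. indicat_real {a0<..<b0} x)"
    using bump_integral_tendsto[OF one, of a0 b0] ab0 by (simp add: bmp_def)
  moreover have "integ 0 L (\<lambda>x. indicat_real {a0<..<b0} x) = b0 - a0"
  proof -
    have "{a0<..<b0} \<inter> {0..L} = {a0<..<b0}" "{a0<..<b0} \<subseteq> {0..L}" using ab0 by auto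
    then show ?thesis using ab0 by (simp add: measure_restrict_space)
  qed
  \<comment> \<open>The integrals of the bumps tend to \<open>b0 - a0 > 0\<close>, so one of the
    bumps has a nonzero integral and can serve as the reference \<psi>.\<close>
  ultimately have "\<not> (\<forall>n. integ 0 L (bmp n a0 b0) = 0)"
    using ab0 LIMSEQ_unique[OF _ tendsto_const[of 0 sequentially]] by fastforce
  then obtain n0 where n0: "integ 0 L (bmp n0 a0 b0) \<noteq> 0" by blast
  define \<psi> where "\<psi> = bmp n0 a0 b0"
  define J where "J = integ 0 L \<psi>"
  have J: "J \<noteq> 0" using n0 by (simp add: J_def \<psi>_def)
  define c where "c = (1 / J) *\<^sub>R integ 0 L (\<lambda>x. \<psi> x *\<^sub>R f x)"
  have cont: "continuous_on {0..L} (bmp n a b)" for n a b using bc by (rule bump_comb_continuous)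
  have contp: "continuous_on {0..L} \<psi>" by (simp add: \<psi>_def cont)
  have iI: "integrable (lebesgue_on {0..L}) (\<lambda>x. bmp n a b x)" "integrable (lebesgue_on {0..L}) (\<lambda>x. \<psi> x)" for n a b
    using integrable_continuous_scaleR[OF _ one] cont contp by (simp_all)
  have key: "integ 0 L (\<lambda>x. bmp n a b x *\<^sub>R (f x - c)) = 0" if ab: "0 < a" "a \<le> b" "b < L" for n a b
  proof -
    \<comment> \<open>The multiple of \<psi> with the same integral as the bump, so that their
      difference \<xi> has mean zero.\<close>
    define r where "r = integ 0 L (bmp n a b) / J"
    define \<xi> where "\<xi> x = bmp n a b x + (- r) * \<psi> x" for x
    have "\<exists>\<phi>. test_function L \<phi> \<and> deriv \<phi> = \<xi>"
    proof (rule test_function_antiderivative)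
      show "bump_comb \<xi>" unfolding \<xi>_def \<psi>_def by (intro bump_comb.add bump_comb.scale bc)
      have "integrable (lebesgue_on {0..L}) \<xi>"
        unfolding \<xi>_def by (intro Bochner_Integration.integrable_add Bochner_Integration.integrable_mult_right iI)
      then have "integral {0..L} \<xi> = integ 0 L \<xi>"
        by (simp add: lebesgue_integral_eq_integral)
      also have "\<dots> = 0"
        unfolding \<xi>_def using iI J by (simp add: r_def J_def)
      finally show "integral {0..L} \<xi> = 0" .
      \<comment> \<open>The hull of the supports of the two bumps still lies strictly inside the
        interval.\<close>
      show "0 < min a a0" "min a a0 \<le> max b b0" "max b b0 < L" using ab ab0 by auto
      show "\<xi> s = 0" if "s \<notin> {min a a0..max b b0}" for s
              proof -
        have "s \<notin> {a..b}" "s \<notin> {a0..b0}" using that by auto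
        then show ?thesis by (simp add: \<xi>_def \<psi>_def supp)
      qed
    qed
    then have "integ 0 L (\<lambda>s. \<xi> s *\<^sub>R f s) = 0" using zero by force
    moreover have "integ 0 L (\<lambda>s. \<xi> s *\<^sub>R f s)
        = integ 0 L (\<lambda>s. bmp n a b s *\<^sub>R f s) - r *\<^sub>R integ 0 L (\<lambda>s. \<psi> s *\<^sub>R f s)"
      unfolding \<xi>_def scaleR_add_left
      using integrable_continuous_scaleR[OF cont f, of n a b] integrable_continuous_scaleR[OF contp f]
      by (simp add: scaleR_scaleR[symmetric] del: scaleR_scaleR)
    moreover have "integ 0 L (\<lambda>x. bmp n a b x *\<^sub>R (f x - c))
        = integ 0 L (\<lambda>s. bmp n a b s *\<^sub>R f s) - integ 0 L (bmp n a b) *\<^sub>R c"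
      unfolding scaleR_diff_right
      using integrable_continuous_scaleR[OF cont f, of n a b] iI(1)[of n a b] by simp
    ultimately show ?thesis by (simp add: c_def r_def)
  qed
  have fc: "integrable (lebesgue_on {0..L}) (\<lambda>x. f x - c)"
    using f by (intro Bochner_Integration.integrable_diff) (simp_all add: finite_measure.integrable_const finite_measure_lebesgue_on)
  have "AE x in lebesgue_on {0..L}. f x - c = 0"
  proof (rule integrals_zero_imp_AE_zero[OF fc])
    fix a b :: real assume ab: "0 < a" "a \<le> b" "b < L"
    have "(\<lambda>n. integ 0 L (\<lambda>x. bmp n a b x *\<^sub>R (f x - c))) \<longlonglongrightarrow> integ 0 L (\<lambda>x. indicator {a<..<b} x *\<^sub>R (f x - c))"
      using bump_integral_tendsto[OF fc, of a b] ab by (simp add: bmp_def)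
    then show "integ 0 L (\<lambda>x. indicator {a<..<b} x *\<^sub>R (f x - c)) = 0"
      using key[OF ab] by (simp add: LIMSEQ_const_iff)
  qed
  then show ?thesis by auto
qed

subsection \<open>Bounded measurable kernels\<close>

lemma bounded_bilinear_matrix_vector_mult:
  "bounded_bilinear ((*v) :: real^'n::finite^'m::finite \<Rightarrow> real^'n \<Rightarrow> real^'m)"
  by (intro bilinear_conv_bounded_bilinear[THEN iffD1])
     (simp add: bilinear_def linear_iff vec_eq_iff matrix_vector_mult_def sum_distrib_left
       sum.distrib algebra_simps)

lemma bounded_bilinear_matrix_matrix_mult:
  "bounded_bilinear ((**) :: real^'n::finite^'m::finite \<Rightarrow> real^'k::finite^'n \<Rightarrow> real^'k^'m)"
  by (intro bilinear_conv_bounded_bilinear[THEN iffD1])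
     (simp add: bilinear_def linear_iff vec_eq_iff matrix_matrix_mult_def sum_distrib_left
       sum.distrib algebra_simps)

lemma bounded_linear_transpose:
  "bounded_linear (transpose :: real^'n::finite^'m::finite \<Rightarrow> real^'m^'n)"
  by (intro linear_conv_bounded_linear[THEN iffD1]) (auto simp: linear_iff transpose_def vec_eq_iff)

definition outer :: "real^'m::finite \<Rightarrow> real^'n::finite \<Rightarrow> real^'n^'m"
  where "outer a b = (\<chi> i j. a $ i * b $ j)"

lemma outer_mult_vec: "outer a b *v v = (b \<bullet> v) *\<^sub>R a"
  by (simp add: outer_def vec_eq_iff matrix_vector_mult_def inner_vec_def sum_distrib_left mult_ac)

lemma bounded_bilinear_outer:
  "bounded_bilinear (outer :: real^'m::finite \<Rightarrow> real^'n::finite \<Rightarrow> real^'n^'m)"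
  by (intro bilinear_conv_bounded_bilinear[THEN iffD1])
     (auto simp: bilinear_def linear_iff outer_def vec_eq_iff algebra_simps)

lemma transpose_outer: "transpose (outer a b) = outer b a"
  by (simp add: outer_def transpose_def vec_eq_iff mult.commute)

lemma dot_matrix_vector_mult: "(x::real^'m::finite) \<bullet> (A *v y) = (transpose A *v x) \<bullet> (y::real^'n::finite)"
  by (metis dot_lmul_matrix vector_transpose_matrix transpose_transpose)

text \<open>The bound is required at every point, not almost everywhere, so that every section of a
  bounded kernel is again of this kind. The resulting class is closed under bilinear operations,
  case distinctions and integration of a variable, which makes all the kernels below tractable
  without separate estimates.\<close>

definition bdd_meas :: "'a measure \<Rightarrow> ('a \<Rightarrow> 'b::euclidean_space) \<Rightarrow> bool"
  where "bdd_meas M f \<longleftrightarrow> f \<in> borel_measurable M \<and> (\<exists>c. \<forall>x\<in>space M. norm (f x) \<le> c)"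

lemma bdd_meas_measurable: "bdd_meas M f \<Longrightarrow> f \<in> borel_measurable M"
  by (simp add: bdd_meas_def)

lemma bdd_measE:
  assumes "bdd_meas M f"
  obtains c where "0 \<le> c" "\<And>x. x \<in> space M \<Longrightarrow> norm (f x) \<le> c"
proof -
  obtain c where "\<And>x. x \<in> space M \<Longrightarrow> norm (f x) \<le> c" using assms by (auto simp: bdd_meas_def)
  then show ?thesis by (intro that[of "max c 0"]) (auto simp: le_max_iff_disj)
qed

lemma bdd_meas_const: "bdd_meas M (\<lambda>_. c)"
  by (auto simp: bdd_meas_def)

lemma bounded_bilinear_measurable:
  fixes f :: "'a \<Rightarrow> 'b::euclidean_space" and g :: "'a \<Rightarrow> 'c::euclidean_space"
  assumes "bounded_bilinear (op :: 'b \<Rightarrow> 'c \<Rightarrow> 'd::real_normed_vector)"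
    "f \<in> borel_measurable M" "g \<in> borel_measurable M"
  shows "(\<lambda>x. op (f x) (g x)) \<in> borel_measurable M"
  using assms(2,3)
proof (rule borel_measurable_continuous_Pair)
  show "continuous_on UNIV (\<lambda>x. op (fst x) (snd x))"
    by (rule bounded_bilinear.continuous_on[OF assms(1) continuous_on_fst[OF continuous_on_id]
          continuous_on_snd[OF continuous_on_id]])
qed

lemma bdd_meas_bilinear:
  assumes "bounded_bilinear op" "bdd_meas M f" "bdd_meas M g"
  shows "bdd_meas M (\<lambda>x. op (f x) (g x))"
proof -
  interpret bounded_bilinear op by fact
  have "(\<lambda>x. op (f x) (g x)) \<in> borel_measurable M"
    using assms(2,3) by (intro bounded_bilinear_measurable[OF assms(1)]) (auto simp: bdd_meas_def)
  moreover obtain c where c: "0 \<le> c" "\<And>x. x \<in> space M \<Longrightarrow> norm (f x) \<le> c" using bdd_measE[OF assms(2)] by blast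
  moreover obtain d where d: "0 \<le> d" "\<And>x. x \<in> space M \<Longrightarrow> norm (g x) \<le> d" using bdd_measE[OF assms(3)] by blast
  moreover obtain k where k: "0 \<le> k" "\<And>a b. norm (op a b) \<le> norm a * norm b * k"
    using nonneg_bounded by blast
  ultimately show ?thesis unfolding bdd_meas_def
    by (intro conjI exI[of _ "c * d * k"] ballI order_trans[OF k(2)] mult_right_mono mult_mono) auto
qed

lemma bdd_meas_linear:
  assumes "bounded_linear h" "bdd_meas M f"
  shows "bdd_meas M (\<lambda>x. h (f x))"
proof -
  have "(\<lambda>x. h (f x)) \<in> borel_measurable M"
    using bdd_meas_measurable[OF assms(2)]
    by (rule measurable_compose[OF _ borel_measurable_continuous_onI[OF linear_continuous_on[OF assms(1)]]])
  moreover obtain c where c: "0 \<le> c" "\<And>x. x \<in> space M \<Longrightarrow> norm (f x) \<le> c" using bdd_measE[OF assms(2)] by blast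
  moreover obtain k where k: "0 \<le> k" "\<And>a. norm (h a) \<le> norm a * k"
    using bounded_linear.nonneg_bounded[OF assms(1)] by blast
  ultimately show ?thesis unfolding bdd_meas_def
    by (intro conjI exI[of _ "c * k"] ballI order_trans[OF k(2)] mult_right_mono) auto
qed

lemma bdd_meas_add:
  assumes "bdd_meas M f" "bdd_meas M g" shows "bdd_meas M (\<lambda>x. f x + g x)"
proof -
  obtain c where c: "0 \<le> c" "\<And>x. x \<in> space M \<Longrightarrow> norm (f x) \<le> c" using bdd_measE[OF assms(1)] by blast
  moreover obtain d where d: "0 \<le> d" "\<And>x. x \<in> space M \<Longrightarrow> norm (g x) \<le> d" using bdd_measE[OF assms(2)] by blast
  ultimately show ?thesis using assms unfolding bdd_meas_def
    by (intro conjI exI[of _ "c + d"] ballI order_trans[OF norm_triangle_ineq] add_mono) auto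
qed

lemma bdd_meas_sum:
  "(\<And>i. i \<in> I \<Longrightarrow> bdd_meas M (f i)) \<Longrightarrow> bdd_meas M (\<lambda>x. \<Sum>i\<in>I. f i x)"
  by (induction I rule: infinite_finite_induct) (auto intro: bdd_meas_const bdd_meas_add)

lemma bdd_meas_If:
  assumes "bdd_meas M f" "bdd_meas M g" "Measurable.pred M P"
  shows "bdd_meas M (\<lambda>x. if P x then f x else g x)"
proof -
  obtain c where c: "0 \<le> c" "\<And>x. x \<in> space M \<Longrightarrow> norm (f x) \<le> c" using bdd_measE[OF assms(1)] by blast
  moreover obtain d where d: "0 \<le> d" "\<And>x. x \<in> space M \<Longrightarrow> norm (g x) \<le> d" using bdd_measE[OF assms(2)] by blast
  ultimately show ?thesis using assms unfolding bdd_meas_def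
    by (intro conjI exI[of _ "max c d"] ballI measurable_If) (auto simp: le_max_iff_disj)
qed

lemma bdd_meas_compose:
  assumes "bdd_meas N f" "g \<in> measurable M N"
  shows "bdd_meas M (\<lambda>x. f (g x))"
  using assms unfolding bdd_meas_def by (auto dest: measurable_space)

lemma bdd_meas_cong: "(\<And>x. x \<in> space M \<Longrightarrow> f x = g x) \<Longrightarrow> bdd_meas M f \<longleftrightarrow> bdd_meas M g"
  by (auto simp: bdd_meas_def cong: measurable_cong)

lemma bdd_meas_integrable_mult:
  fixes g :: "'a \<Rightarrow> 'b::euclidean_space"
  assumes "bounded_bilinear op" "bdd_meas M f" "integrable M g"
  shows "integrable M (\<lambda>x. op (f x) (g x) :: 'c::euclidean_space)"
proof -
  interpret bounded_bilinear op by fact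
  obtain c where c: "0 \<le> c" "\<And>x. x \<in> space M \<Longrightarrow> norm (f x) \<le> c" using bdd_measE[OF assms(2)] by blast
  obtain k where k: "0 \<le> k" "\<And>a b. norm (op a b) \<le> norm a * norm b * k"
    using nonneg_bounded by blast
  show ?thesis
  proof (rule Bochner_Integration.integrable_bound[where f="\<lambda>x. c * k * norm (g x)"])
    show "(\<lambda>x. op (f x) (g x)) \<in> borel_measurable M"
      using assms(2,3) by (intro bounded_bilinear_measurable[OF assms(1)]) (auto simp: bdd_meas_def)
    show "AE x in M. norm (op (f x) (g x)) \<le> norm (c * k * norm (g x))"
    proof (rule AE_I2)
      fix x assume x: "x \<in> space M"
      have "norm (op (f x) (g x)) \<le> norm (f x) * norm (g x) * k" by (rule k)
      also have "\<dots> \<le> c * norm (g x) * k" using c(2)[OF x] k by (intro mult_right_mono) auto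
      also have "\<dots> = norm (c * k * norm (g x))" using c k by (simp add: abs_mult)
      finally show "norm (op (f x) (g x)) \<le> norm (c * k * norm (g x))" .
    qed
  qed (use assms in auto)
qed

lemma bdd_meas_section1:
  "bdd_meas (M \<Otimes>\<^sub>M N) (\<lambda>p. f (fst p) (snd p)) \<Longrightarrow> x \<in> space M \<Longrightarrow> bdd_meas N (f x)"
  using bdd_meas_compose[of "M \<Otimes>\<^sub>M N" "\<lambda>p. f (fst p) (snd p)" "Pair x" N] by simp

lemma bdd_meas_section2:
  "bdd_meas (M \<Otimes>\<^sub>M N) (\<lambda>p. f (fst p) (snd p)) \<Longrightarrow> y \<in> space N \<Longrightarrow> bdd_meas M (\<lambda>x. f x y)"
  using bdd_meas_compose[of "M \<Otimes>\<^sub>M N" "\<lambda>p. f (fst p) (snd p)" "\<lambda>x. (x, y)" M] by simp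

lemma bdd_meas_swap:
  "bdd_meas (M \<Otimes>\<^sub>M N) (\<lambda>p. f (fst p) (snd p)) \<Longrightarrow> bdd_meas (N \<Otimes>\<^sub>M M) (\<lambda>p. f (snd p) (fst p))"
  using bdd_meas_compose[of "M \<Otimes>\<^sub>M N" "\<lambda>p. f (fst p) (snd p)" "\<lambda>p. (snd p, fst p)" "N \<Otimes>\<^sub>M M"] by simp

lemma norm_integral_le:
  fixes f :: "'a \<Rightarrow> 'b::euclidean_space"
  assumes "integrable M f" "integrable M g" "\<And>x. x \<in> space M \<Longrightarrow> norm (f x) \<le> g x"
  shows "norm (\<integral>x. f x \<partial>M) \<le> (\<integral>x. g x \<partial>M)"
  using assms by (intro order_trans[OF integral_norm_bound integral_mono]) auto

lemma integrable_pair_mult: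
  fixes f :: "'a \<Rightarrow> real" and g :: "'b \<Rightarrow> real"
  assumes "sigma_finite_measure M" "sigma_finite_measure N" "integrable M f" "integrable N g"
  shows "integrable (M \<Otimes>\<^sub>M N) (\<lambda>p. f (fst p) * g (snd p))"
proof -
  interpret pair_sigma_finite M N using assms by (simp add: pair_sigma_finite_def)
  have "(\<lambda>p. f (fst p) * g (snd p)) \<in> borel_measurable (M \<Otimes>\<^sub>M N)"
    using assms(3,4) by measurable
  moreover have "integrable M (\<lambda>x. \<integral>y. norm (f (fst (x, y)) * g (snd (x, y))) \<partial>N)"
    using assms(3) by (simp add: abs_mult)
  ultimately show ?thesis
    using assms(3,4) by (intro Fubini_integrable) auto
qed

section \<open>Fubini identities for bounded kernels on a finite measure space\<close>

context finite_measure begin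

lemma bdd_meas_integrable: "bdd_meas M f \<Longrightarrow> integrable M f"
  using integrable_const_bound[of f] by (auto simp: bdd_meas_def)

lemma bdd_meas_integral:
  assumes "bdd_meas (N \<Otimes>\<^sub>M M) (\<lambda>p. f (fst p) (snd p))"
  shows "bdd_meas N (\<lambda>x. \<integral>y. f x y \<partial>M)"
proof -
  obtain c where c: "0 \<le> c" "\<And>x. x \<in> space (N \<Otimes>\<^sub>M M) \<Longrightarrow> norm (f (fst x) (snd x)) \<le> c"
    using bdd_measE[OF assms] by blast
  have "norm (\<integral>y. f x y \<partial>M) \<le> c * measure M (space M)" if x: "x \<in> space N" for x
  proof -
    have "norm (\<integral>y. f x y \<partial>M) \<le> (\<integral>y. c \<partial>M)"
    proof (rule norm_integral_le)
      show "integrable M (f x)"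
        using bdd_meas_integrable[OF bdd_meas_section1[OF assms x]] .
    qed (use c(2)[of "(x, _)"] x in \<open>auto simp: space_pair_measure\<close>)
    then show ?thesis by (simp add: mult.commute)
  qed
  moreover have "(\<lambda>x. \<integral>y. f x y \<partial>M) \<in> borel_measurable N"
    using assms by (intro borel_measurable_lebesgue_integral) (simp add: bdd_meas_def case_prod_beta')
  ultimately show ?thesis unfolding bdd_meas_def by blast
qed

lemma bdd_meas_kernel_prod:
  assumes "bounded_bilinear op" "bdd_meas (M \<Otimes>\<^sub>M M) (\<lambda>p. A (fst p) (snd p))"
    "bdd_meas (M \<Otimes>\<^sub>M M) (\<lambda>p. B (fst p) (snd p))"
  shows "bdd_meas (M \<Otimes>\<^sub>M M) (\<lambda>p. \<integral>z. (op (A (fst p) z) (B z (snd p)) :: 'c::euclidean_space) \<partial>M)"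
proof (rule bdd_meas_integral)
  have "bdd_meas ((M \<Otimes>\<^sub>M M) \<Otimes>\<^sub>M M) (\<lambda>q. A (fst (fst q)) (snd q))"
    using bdd_meas_compose[OF assms(2), of "\<lambda>q. (fst (fst q), snd q)" "(M \<Otimes>\<^sub>M M) \<Otimes>\<^sub>M M"] by simp
  moreover have "bdd_meas ((M \<Otimes>\<^sub>M M) \<Otimes>\<^sub>M M) (\<lambda>q. B (snd q) (snd (fst q)))"
    using bdd_meas_compose[OF assms(3), of "\<lambda>q. (snd q, snd (fst q))" "(M \<Otimes>\<^sub>M M) \<Otimes>\<^sub>M M"] by simp
  ultimately show "bdd_meas ((M \<Otimes>\<^sub>M M) \<Otimes>\<^sub>M M)
      (\<lambda>p. op (A (fst (fst p)) (snd p)) (B (snd p) (snd (fst p))))"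
    by (rule bdd_meas_bilinear[OF assms(1)])
qed

lemma integrable_dominated_pair:
  fixes h :: "'a \<Rightarrow> 'a \<Rightarrow> 'c::euclidean_space"
    and f :: "'a \<Rightarrow> 'd::euclidean_space" and g :: "'a \<Rightarrow> 'e::euclidean_space"
  assumes f: "integrable M f" and g: "integrable M g"
    and meas: "(\<lambda>p. h (fst p) (snd p)) \<in> borel_measurable (M \<Otimes>\<^sub>M M)"
    and bound: "\<And>x y. x \<in> space M \<Longrightarrow> y \<in> space M \<Longrightarrow> norm (h x y) \<le> c * norm (f x) * norm (g y)"
  shows "integrable (M \<Otimes>\<^sub>M M) (\<lambda>p. h (fst p) (snd p))"
proof (rule Bochner_Integration.integrable_bound)
  show "integrable (M \<Otimes>\<^sub>M M) (\<lambda>p. (c * norm (f (fst p))) * norm (g (snd p)))"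
    using integrable_pair_mult[OF sigma_finite_measure_axioms sigma_finite_measure_axioms,
      of "\<lambda>x. c * norm (f x)" "\<lambda>x. norm (g x)"] f g by simp
  show "AE p in M \<Otimes>\<^sub>M M. norm (h (fst p) (snd p)) \<le> norm (c * norm (f (fst p)) * norm (g (snd p)))"
    using bound by (intro AE_I2) (fastforce simp: space_pair_measure intro: order_trans[OF _ abs_ge_self])
qed (use assms in auto)

lemma Fubini_pair:
  fixes h :: "'a \<Rightarrow> 'a \<Rightarrow> 'c::euclidean_space"
  assumes "integrable (M \<Otimes>\<^sub>M M) (\<lambda>p. h (fst p) (snd p))"
  shows "(\<integral>x. \<integral>y. h x y \<partial>M \<partial>M) = (\<integral>y. \<integral>x. h x y \<partial>M \<partial>M)"
proof -
  interpret pair_sigma_finite M M ..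
  show ?thesis
    using assms by (intro Fubini_integral[symmetric]) (simp add: case_prod_beta')
qed

lemma Fubini_bdd:
  assumes "bdd_meas (M \<Otimes>\<^sub>M M) (\<lambda>p. h (fst p) (snd p))"
  shows "(\<integral>x. \<integral>y. h x y \<partial>M \<partial>M) = (\<integral>y. \<integral>x. h x y \<partial>M \<partial>M)"
proof -
  interpret pair_sigma_finite M M ..
  interpret P: finite_measure "M \<Otimes>\<^sub>M M"
    by (rule finite_measure_pair_measure) unfold_locales
  show ?thesis by (rule Fubini_pair[OF P.bdd_meas_integrable[OF assms]])
qed

lemma kernel_apply_bdd:
  fixes g :: "'a \<Rightarrow> 'b::euclidean_space"
  assumes op: "bounded_bilinear op" and K: "bdd_meas (M \<Otimes>\<^sub>M M) (\<lambda>p. K (fst p) (snd p))"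
    and g: "integrable M g"
  shows "bdd_meas M (\<lambda>x. \<integral>y. (op (K x y) (g y) :: 'c::euclidean_space) \<partial>M)"
proof -
  interpret bounded_bilinear op by fact
  obtain c where c: "0 \<le> c" "\<And>x. x \<in> space (M \<Otimes>\<^sub>M M) \<Longrightarrow> norm (K (fst x) (snd x)) \<le> c"
    using bdd_measE[OF K] by blast
  obtain k where k: "0 \<le> k" "\<And>a b. norm (op a b) \<le> norm a * norm b * k"
    using nonneg_bounded by blast
  have "(\<lambda>p. op (K (fst p) (snd p)) (g (snd p))) \<in> borel_measurable (M \<Otimes>\<^sub>M M)"
    using bdd_meas_measurable[OF K] g
    by (intro bounded_bilinear_measurable[OF op]) auto
  then have "(\<lambda>x. \<integral>y. op (K x y) (g y) \<partial>M) \<in> borel_measurable M"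
    by (intro borel_measurable_lebesgue_integral) (simp add: case_prod_beta')
  moreover have "norm (\<integral>y. op (K x y) (g y) \<partial>M) \<le> (\<integral>y. c * k * norm (g y) \<partial>M)" if x: "x \<in> space M" for x
  proof (rule norm_integral_le)
    show "integrable M (\<lambda>y. op (K x y) (g y))"
      by (rule bdd_meas_integrable_mult[OF op bdd_meas_section1[OF K x] g])
    fix y assume "y \<in> space M"
    then have "norm (K x y) \<le> c" using c(2)[of "(x, y)"] x by (simp add: space_pair_measure)
    then have "norm (K x y) * norm (g y) * k \<le> c * norm (g y) * k"
      using k by (intro mult_right_mono) auto
    then show "norm (op (K x y) (g y)) \<le> c * k * norm (g y)"
      using k(2)[of "K x y" "g y"] by (simp add: mult_ac)
  qed (use g in auto)
  ultimately show ?thesis unfolding bdd_meas_def by blast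
qed

text \<open>Adjointness: transposing the kernel and swapping its variables gives the adjoint
  integral operator. The double integrand is dominated by a multiple of
  \<open>norm (f x) * norm (g y)\<close>, which is integrable on the product even when
  \<open>f\<close> and \<open>g\<close> are unbounded.\<close>

lemma kernel_dual:
  fixes f :: "'a \<Rightarrow> real^'m::finite" and g :: "'a \<Rightarrow> real^'n::finite"
  assumes K: "bdd_meas (M \<Otimes>\<^sub>M M) (\<lambda>p. K (fst p) (snd p))" and f: "integrable M f" and g: "integrable M g"
  shows "(\<integral>x. f x \<bullet> (\<integral>y. K x y *v g y \<partial>M) \<partial>M) = (\<integral>y. (\<integral>x. transpose (K x y) *v f x \<partial>M) \<bullet> g y \<partial>M)"
proof -
  interpret mv: bounded_bilinear "(*v) :: real^'n^'m \<Rightarrow> _ \<Rightarrow> _" by (rule bounded_bilinear_matrix_vector_mult)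
  obtain c where c: "0 \<le> c" "\<And>x. x \<in> space (M \<Otimes>\<^sub>M M) \<Longrightarrow> norm (K (fst x) (snd x)) \<le> c"
    using bdd_measE[OF K] by blast
  obtain k where k: "0 \<le> k" "\<And>a b. norm ((a :: real^'n^'m) *v b) \<le> norm a * norm b * k"
    using mv.nonneg_bounded by blast
  have KT: "bdd_meas (M \<Otimes>\<^sub>M M) (\<lambda>p. transpose (K (snd p) (fst p)))"
    by (rule bdd_meas_linear[OF bounded_linear_transpose bdd_meas_swap[OF K]])
  have "(\<integral>x. f x \<bullet> (\<integral>y. K x y *v g y \<partial>M) \<partial>M) = (\<integral>x. \<integral>y. f x \<bullet> (K x y *v g y) \<partial>M \<partial>M)"
    using bdd_meas_integrable_mult[OF bounded_bilinear_matrix_vector_mult bdd_meas_section1[OF K] g]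
    by (intro Bochner_Integration.integral_cong refl integral_inner_right[symmetric]) auto
  also have "\<dots> = (\<integral>y. \<integral>x. f x \<bullet> (K x y *v g y) \<partial>M \<partial>M)"
  proof (rule Fubini_pair, rule integrable_dominated_pair[OF f g])
    have "(\<lambda>p. K (fst p) (snd p) *v g (snd p)) \<in> borel_measurable (M \<Otimes>\<^sub>M M)"
      using bdd_meas_measurable[OF K] g
      by (intro bounded_bilinear_measurable[OF bounded_bilinear_matrix_vector_mult]) auto
    then show "(\<lambda>p. f (fst p) \<bullet> (K (fst p) (snd p) *v g (snd p))) \<in> borel_measurable (M \<Otimes>\<^sub>M M)"
      using f by (intro borel_measurable_inner) auto
    fix x y assume xy: "x \<in> space M" "y \<in> space M"
    have "norm (f x \<bullet> (K x y *v g y)) \<le> norm (f x) * norm (K x y *v g y)" by (simp add: Cauchy_Schwarz_ineq2)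
    also have "\<dots> \<le> norm (f x) * (norm (K x y) * norm (g y) * k)" by (intro mult_left_mono k) auto
    also have "\<dots> \<le> norm (f x) * (c * norm (g y) * k)"
      using c(2)[of "(x, y)"] xy k by (intro mult_left_mono mult_right_mono) (auto simp: space_pair_measure)
    finally show "norm (f x \<bullet> (K x y *v g y)) \<le> (c * k) * norm (f x) * norm (g y)" by (simp add: mult_ac)
  qed
  also have "\<dots> = (\<integral>y. \<integral>x. (transpose (K x y) *v f x) \<bullet> g y \<partial>M \<partial>M)"
    by (simp add: dot_matrix_vector_mult)
  also have "\<dots> = (\<integral>y. (\<integral>x. transpose (K x y) *v f x \<partial>M) \<bullet> g y \<partial>M)"
    using bdd_meas_integrable_mult[OF bounded_bilinear_matrix_vector_mult bdd_meas_section1[OF KT] f]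
    by (intro Bochner_Integration.integral_cong refl integral_inner_left) auto
  finally show ?thesis .
qed

text \<open>Composition of integral operators, in the form needed when the state is replaced by the
  integral of a Green kernel against \<open>u\<close> under an outer integral.\<close>

lemma kernel_mult:
  fixes g :: "'a \<Rightarrow> real^'n::finite" and A :: "'a \<Rightarrow> real^'m::finite^'k::finite"
  assumes A: "bdd_meas M A" and G: "bdd_meas (M \<Otimes>\<^sub>M M) (\<lambda>p. G (fst p) (snd p))" and g: "integrable M g"
  shows "(\<integral>z. A z *v (\<integral>y. G z y *v g y \<partial>M) \<partial>M) = (\<integral>y. (\<integral>z. A z ** G z y \<partial>M) *v g y \<partial>M)"
proof -
  have mv: "bounded_linear (\<lambda>B. B *v x)" "bounded_linear (\<lambda>x. B *v x)" for x :: "real^'i::finite" and B :: "real^'i^'j::finite"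
    using bounded_bilinear_matrix_vector_mult bounded_bilinear.bounded_linear_left bounded_bilinear.bounded_linear_right by blast+
  have AG: "bdd_meas (M \<Otimes>\<^sub>M M) (\<lambda>p. A (fst p) ** G (fst p) (snd p))"
    by (intro bdd_meas_bilinear[OF bounded_bilinear_matrix_matrix_mult] G
          bdd_meas_compose[OF A measurable_fst])
  obtain c where c: "0 \<le> c" "\<And>x. x \<in> space (M \<Otimes>\<^sub>M M) \<Longrightarrow> norm (A (fst x) ** G (fst x) (snd x)) \<le> c"
    using bdd_measE[OF AG] by blast
  interpret mv: bounded_bilinear "(*v) :: real^'n^'k \<Rightarrow> _ \<Rightarrow> _" by (rule bounded_bilinear_matrix_vector_mult)
  obtain k where k: "0 \<le> k" "\<And>a b. norm ((a :: real^'n^'k) *v b) \<le> norm a * norm b * k"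
    using mv.nonneg_bounded by blast
  have "(\<integral>z. A z *v (\<integral>y. G z y *v g y \<partial>M) \<partial>M) = (\<integral>z. \<integral>y. (A z ** G z y) *v g y \<partial>M \<partial>M)"
  proof (intro Bochner_Integration.integral_cong refl)
    fix z assume "z \<in> space M"
    then have "integrable M (\<lambda>y. G z y *v g y)"
      using bdd_meas_integrable_mult[OF bounded_bilinear_matrix_vector_mult bdd_meas_section1[OF G] g] by auto
    from integral_bounded_linear[OF mv(2)[of "A z"] this]
    show "A z *v (\<integral>y. G z y *v g y \<partial>M) = (\<integral>y. (A z ** G z y) *v g y \<partial>M)"
      by (simp add: matrix_vector_mul_assoc)
  qed
  also have "\<dots> = (\<integral>y. \<integral>z. (A z ** G z y) *v g y \<partial>M \<partial>M)"
  proof (rule Fubini_pair, rule integrable_dominated_pair[where f="\<lambda>_. 1::real", OF _ g])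
    show "(\<lambda>p. (A (fst p) ** G (fst p) (snd p)) *v g (snd p)) \<in> borel_measurable (M \<Otimes>\<^sub>M M)"
      using bdd_meas_measurable[OF AG] g
      by (intro bounded_bilinear_measurable[OF bounded_bilinear_matrix_vector_mult]) auto
    fix x y assume xy: "x \<in> space M" "y \<in> space M"
    have "norm ((A x ** G x y) *v g y) \<le> norm (A x ** G x y) * norm (g y) * k" by (rule k)
    also have "\<dots> \<le> c * norm (g y) * k"
      using c(2)[of "(x, y)"] xy k by (intro mult_right_mono) (auto simp: space_pair_measure)
    finally show "norm ((A x ** G x y) *v g y) \<le> (c * k) * norm (1::real) * norm (g y)" by (simp add: mult_ac)
  qed auto
  also have "\<dots> = (\<integral>y. (\<integral>z. A z ** G z y \<partial>M) *v g y \<partial>M)"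
    using bdd_meas_integrable[OF bdd_meas_section2[OF AG]]
    by (intro Bochner_Integration.integral_cong refl integral_bounded_linear[OF mv(1)]) auto
  finally show ?thesis .
qed

lemma kernel_outer:
  fixes u :: "'a \<Rightarrow> real^'m::finite" and v :: "'a \<Rightarrow> real^'n::finite"
  assumes a: "bdd_meas (M \<Otimes>\<^sub>M M) (\<lambda>p. a (fst p) (snd p))" and b: "bdd_meas (M \<Otimes>\<^sub>M M) (\<lambda>p. b (fst p) (snd p))"
    and u: "integrable M u" and v: "integrable M v"
  shows "(\<integral>z. (\<integral>x. a z x \<bullet> u x \<partial>M) * (\<integral>y. b z y \<bullet> v y \<partial>M) \<partial>M)
    = (\<integral>x. u x \<bullet> (\<integral>y. (\<integral>z. outer (a z x) (b z y) \<partial>M) *v v y \<partial>M) \<partial>M)"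
proof -
  \<comment> \<open>Rank-one factors through \<open>real^1\<close> reduce this scalar identity to \<open>kernel_mult\<close> and \<open>kernel_dual\<close>.\<close>
  define q where "q z = (\<integral>y. b z y \<bullet> v y \<partial>M)" for z
  have q: "bdd_meas M q"
    unfolding q_def by (rule kernel_apply_bdd[OF bounded_bilinear_inner b v])
  have inner: "(\<integral>y. (\<integral>z. outer (a z x) (b z y) \<partial>M) *v v y \<partial>M) = (\<integral>z. outer (a z x) (1 :: real^1) *v (q z *\<^sub>R 1) \<partial>M)"
    (is "?l = ?r") if x: "x \<in> space M" for x
  proof -
    have "?l = (\<integral>y. (\<integral>z. outer (a z x) (1 :: real^1) ** outer (1 :: real^1) (b z y) \<partial>M) *v v y \<partial>M)"
      by (simp add: outer_def matrix_matrix_mult_def)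
    also have "\<dots> = (\<integral>z. outer (a z x) (1 :: real^1) *v (\<integral>y. outer (1 :: real^1) (b z y) *v v y \<partial>M) \<partial>M)"
    proof (rule kernel_mult[symmetric, OF _ _ v])
      show "bdd_meas M (\<lambda>z. outer (a z x) (1 :: real^1))"
        by (intro bdd_meas_bilinear[OF bounded_bilinear_outer] bdd_meas_const bdd_meas_section2[OF a x])
      show "bdd_meas (M \<Otimes>\<^sub>M M) (\<lambda>p. outer (1 :: real^1) (b (fst p) (snd p)))"
        by (intro bdd_meas_bilinear[OF bounded_bilinear_outer] bdd_meas_const b)
    qed
    also have "\<dots> = ?r"
    proof (intro Bochner_Integration.integral_cong refl)
      fix z assume z: "z \<in> space M"
      have "integrable M (\<lambda>y. b z y \<bullet> v y)"
        by (rule bdd_meas_integrable_mult[OF bounded_bilinear_inner bdd_meas_section1[OF b z] v])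
      then have "(\<integral>y. outer (1 :: real^1) (b z y) *v v y \<partial>M) = q z *\<^sub>R 1"
        by (simp add: outer_mult_vec q_def)
      then show "outer (a z x) (1 :: real^1) *v (\<integral>y. outer (1 :: real^1) (b z y) *v v y \<partial>M)
         = outer (a z x) (1 :: real^1) *v (q z *\<^sub>R 1)" by simp
    qed
    finally show ?thesis .
  qed
  have "(\<integral>x. u x \<bullet> (\<integral>y. (\<integral>z. outer (a z x) (b z y) \<partial>M) *v v y \<partial>M) \<partial>M)
    = (\<integral>x. u x \<bullet> (\<integral>z. outer (a z x) 1 *v (q z *\<^sub>R (1 :: real^1)) \<partial>M) \<partial>M)"
    using inner by (intro Bochner_Integration.integral_cong refl) auto
  also have "\<dots> = (\<integral>z. (\<integral>x. transpose (outer (a z x) (1 :: real^1)) *v u x \<partial>M) \<bullet> (q z *\<^sub>R 1) \<partial>M)"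
  proof (rule kernel_dual[OF _ u])
    show "bdd_meas (M \<Otimes>\<^sub>M M) (\<lambda>p. outer (a (snd p) (fst p)) (1 :: real^1))"
      by (intro bdd_meas_bilinear[OF bounded_bilinear_outer] bdd_meas_const bdd_meas_swap[OF a])
    show "integrable M (\<lambda>z. q z *\<^sub>R (1 :: real^1))"
      using bdd_meas_integrable[OF q] by simp
  qed
  also have "\<dots> = (\<integral>z. (\<integral>x. a z x \<bullet> u x \<partial>M) * q z \<partial>M)"
  proof (intro Bochner_Integration.integral_cong refl)
    fix z assume z: "z \<in> space M"
    have "integrable M (\<lambda>x. a z x \<bullet> u x)"
      by (rule bdd_meas_integrable_mult[OF bounded_bilinear_inner bdd_meas_section1[OF a z] u])
    then show "(\<integral>x. transpose (outer (a z x) (1 :: real^1)) *v u x \<partial>M) \<bullet> (q z *\<^sub>R 1) = (\<integral>x. a z x \<bullet> u x \<partial>M) * q z"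
      by (simp add: transpose_outer outer_mult_vec inner_vec_def)
  qed
  finally show ?thesis by (simp add: q_def)
qed

end

lemma finite_measure_Icc: "finite_measure (lebesgue_on {a..b::real})"
  by (simp add: finite_measure_lebesgue_on)

lemma ident_measurable_lebesgue_on: "(\<lambda>x. x) \<in> borel_measurable (lebesgue_on (S :: real set))"
  by (simp add: measurable_restrict_space1 measurable_completion)

text \<open>Moves integrals with variable limits to the single measure space on
  \<open>{0..L}\<close>, where the kernel identities above apply.\<close>

lemma integ_eq_indicator:
  assumes "0 \<le> a" "b \<le> L"
  shows "integ a b f = (\<integral>x. indicator {a..b} x *\<^sub>R f x \<partial>lebesgue_on {0..L})"
proof -
  have "(\<lambda>x. indicat_real {0..L} x *\<^sub>R (indicat_real {a..b} x *\<^sub>R f x)) = (\<lambda>x. indicator {a..b} x *\<^sub>R f x)"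
    using assms by (auto simp: indicator_def fun_eq_iff)
  then show ?thesis by (simp add: integral_restrict_space)
qed

section \<open>Inner product and norm of square-integrable functions\<close>

lemma L2_measurable: "f \<in> L2 I \<Longrightarrow> f \<in> borel_measurable (lebesgue_on I)"
  by (simp add: L2_def)

lemma L2_integrable_inner:
  assumes "f \<in> L2 I" "g \<in> L2 I"
  shows "integrable (lebesgue_on I) (\<lambda>s. f s \<bullet> g s)"
proof (rule Bochner_Integration.integrable_bound[where f="\<lambda>s. (norm (f s))\<^sup>2 + (norm (g s))\<^sup>2"])
  show "integrable (lebesgue_on I) (\<lambda>s. (norm (f s))\<^sup>2 + (norm (g s))\<^sup>2)"
    using assms by (auto simp: L2_def)
  show "(\<lambda>s. f s \<bullet> g s) \<in> borel_measurable (lebesgue_on I)"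
    using assms by (auto simp: L2_def intro: borel_measurable_inner)
  have "\<bar>x \<bullet> y\<bar> \<le> (norm x)\<^sup>2 + (norm y)\<^sup>2" for x y :: 'a
  proof -
    have "\<bar>x \<bullet> y\<bar> \<le> norm x * norm y" by (rule Cauchy_Schwarz_ineq2)
    also have "\<dots> \<le> (norm x)\<^sup>2 + (norm y)\<^sup>2"
      using sum_squares_bound[of "norm x" "norm y"] mult_nonneg_nonneg[OF norm_ge_zero[of x] norm_ge_zero[of y]]
      by linarith
    finally show ?thesis .
  qed
  then show "AE s in lebesgue_on I. norm (f s \<bullet> g s) \<le> norm ((norm (f s))\<^sup>2 + (norm (g s))\<^sup>2)"
    by auto
qed

lemma L2_add:
  assumes "f \<in> L2 I" "g \<in> L2 I" shows "(\<lambda>s. f s + g s) \<in> L2 I"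
proof -
  have "integrable (lebesgue_on I) (\<lambda>s. (norm (f s))\<^sup>2 + 2 * (f s \<bullet> g s) + (norm (g s))\<^sup>2)"
    using assms L2_integrable_inner[OF assms] by (auto simp: L2_def)
  moreover have "(norm (x + y))\<^sup>2 = (norm x)\<^sup>2 + 2 * (x \<bullet> y) + (norm y)\<^sup>2" for x y :: 'a
    by (simp add: power2_norm_eq_inner algebra_simps inner_commute)
  ultimately show ?thesis using assms by (auto simp: L2_def)
qed

lemma L2_scaleR: "f \<in> L2 I \<Longrightarrow> (\<lambda>s. r *\<^sub>R f s) \<in> L2 I"
  by (auto simp: L2_def power_mult_distrib)

lemma L2_diff: "f \<in> L2 I \<Longrightarrow> g \<in> L2 I \<Longrightarrow> (\<lambda>s. f s - g s) \<in> L2 I"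
  using L2_add[of f I "\<lambda>s. (- 1) *\<^sub>R g s"] L2_scaleR[of g I "- 1"] by simp

lemma L2_norm_nonneg [simp]: "0 \<le> L2_norm I f"
  by (simp add: L2_norm_def)

lemma L2_norm_square: "(L2_norm I f)\<^sup>2 = (LINT s|lebesgue_on I. f s \<bullet> f s)"
  by (simp add: L2_norm_def power2_norm_eq_inner)

text \<open>The quadratic polynomial t -> |f + t g|^2 is nonnegative, so its discriminant is not
  positive. If its leading coefficient \<open>C\<close> is 0, the polynomial is affine and its slope
  must vanish.\<close>

lemma L2_Cauchy_Schwarz:
  assumes f: "f \<in> L2 I" and g: "g \<in> L2 I"
  shows "\<bar>LINT s|lebesgue_on I. f s \<bullet> g s\<bar> \<le> L2_norm I f * L2_norm I g"
proof -
  define A B C where "A = (L2_norm I f)\<^sup>2" and "B = (LINT s|lebesgue_on I. f s \<bullet> g s)" and "C = (L2_norm I g)\<^sup>2"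
  have quad: "0 \<le> A + 2 * t * B + t\<^sup>2 * C" for t
  proof -
    have "0 \<le> (LINT s|lebesgue_on I. (f s + t *\<^sub>R g s) \<bullet> (f s + t *\<^sub>R g s))"
      by (rule Bochner_Integration.integral_nonneg) simp
    also have "\<dots> = (LINT s|lebesgue_on I. f s \<bullet> f s + (2 * t) * (f s \<bullet> g s) + t\<^sup>2 * (g s \<bullet> g s))"
      by (intro Bochner_Integration.integral_cong refl)
         (simp add: algebra_simps inner_commute power2_eq_square)
    also have "\<dots> = A + 2 * t * B + t\<^sup>2 * C"
      using L2_integrable_inner[OF f g] L2_integrable_inner[OF f f] L2_integrable_inner[OF g g]
      by (simp add: A_def B_def C_def L2_norm_square)
    finally show ?thesis .
  qed
  have "B\<^sup>2 \<le> A * C"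
  proof (cases "C = 0")
    case True
    have "B = 0"
    proof (rule ccontr)
      assume "B \<noteq> 0"
      \<comment> \<open>At this \<open>t\<close> the affine function \<open>A + 2 * t * B\<close>
        takes the value -1.\<close>
      then show False using quad[of "- (A + 1) / (2 * B)"] True by (simp add: field_simps)
    qed
    then show ?thesis using True by simp
  next
    case False
    then have "C > 0" by (simp add: C_def order_less_le)
    \<comment> \<open>The value at the minimiser \<open>t = - B / C\<close>, cleared of its
      denominator.\<close>
    have "0 \<le> (A + 2 * (- B / C) * B + (- B / C)\<^sup>2 * C) * C"
      using quad[of "- B / C"] \<open>C > 0\<close> by (intro mult_nonneg_nonneg) auto
    also have "\<dots> = A * C - B\<^sup>2" using False by (simp add: field_simps power2_eq_square)
    finally show ?thesis by simp
  qed
  then have "B\<^sup>2 \<le> (L2_norm I f * L2_norm I g)\<^sup>2" by (simp add: A_def C_def power_mult_distrib)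
  then show ?thesis unfolding B_def[symmetric] by (rule abs_le_square_iff[THEN iffD2, THEN order_trans]) simp
qed

lemma L2_norm_triangle:
  assumes f: "f \<in> L2 I" and g: "g \<in> L2 I"
  shows "L2_norm I (\<lambda>s. f s + g s) \<le> L2_norm I f + L2_norm I g"
proof (rule power2_le_imp_le)
  have "(L2_norm I (\<lambda>s. f s + g s))\<^sup>2 = (LINT s|lebesgue_on I. f s \<bullet> f s + 2 * (f s \<bullet> g s) + g s \<bullet> g s)"
    unfolding L2_norm_square
    by (intro Bochner_Integration.integral_cong refl) (simp add: algebra_simps inner_commute)
  also have "\<dots> = (L2_norm I f)\<^sup>2 + 2 * (LINT s|lebesgue_on I. f s \<bullet> g s) + (L2_norm I g)\<^sup>2"
    using L2_integrable_inner[OF f g] L2_integrable_inner[OF f f] L2_integrable_inner[OF g g]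
    by (simp add: L2_norm_square)
  also have "\<dots> \<le> (L2_norm I f + L2_norm I g)\<^sup>2"
    using L2_Cauchy_Schwarz[OF f g] by (simp add: power2_sum)
  finally show "(L2_norm I (\<lambda>s. f s + g s))\<^sup>2 \<le> (L2_norm I f + L2_norm I g)\<^sup>2" .
qed simp

lemma L2_bdd_mult:
  fixes f :: "real \<Rightarrow> real^'n::finite" and A :: "real \<Rightarrow> real^'n^'m::finite"
  assumes A: "bdd_meas (lebesgue_on I) A" and f: "f \<in> L2 I"
  shows "(\<lambda>s. A s *v f s) \<in> L2 I"
proof -
  obtain c where c: "0 \<le> c" "\<And>x. x \<in> space (lebesgue_on I) \<Longrightarrow> norm (A x) \<le> c"
    using bdd_measE[OF A] by blast
  interpret mv: bounded_bilinear "(*v) :: real^'n^'m \<Rightarrow> _ \<Rightarrow> _" by (rule bounded_bilinear_matrix_vector_mult)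
  obtain k where k: "0 \<le> k" "\<And>a b. norm ((a :: real^'n^'m) *v b) \<le> norm a * norm b * k"
    using mv.nonneg_bounded by blast
  have meas: "(\<lambda>s. A s *v f s) \<in> borel_measurable (lebesgue_on I)"
    by (intro bounded_bilinear_measurable[OF bounded_bilinear_matrix_vector_mult]
        bdd_meas_measurable[OF A] L2_measurable[OF f])
  have "integrable (lebesgue_on I) (\<lambda>s. (norm (A s *v f s))\<^sup>2)"
  proof (rule Bochner_Integration.integrable_bound[where f="\<lambda>s. (c * k)\<^sup>2 * (norm (f s))\<^sup>2"])
    show "AE s in lebesgue_on I. norm ((norm (A s *v f s))\<^sup>2) \<le> norm ((c * k)\<^sup>2 * (norm (f s))\<^sup>2)"
    proof (rule AE_I2)
      fix s assume s: "s \<in> space (lebesgue_on I)"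
      have "norm (A s *v f s) \<le> norm (A s) * norm (f s) * k" by (rule k)
      also have "\<dots> \<le> c * norm (f s) * k" using c(2)[OF s] k by (intro mult_right_mono) auto
      finally have "(norm (A s *v f s))\<^sup>2 \<le> (c * norm (f s) * k)\<^sup>2" by (intro power_mono) auto
      then show "norm ((norm (A s *v f s))\<^sup>2) \<le> norm ((c * k)\<^sup>2 * (norm (f s))\<^sup>2)"
        by (simp add: power_mult_distrib mult_ac)
    qed
  qed (use f meas in \<open>auto simp: L2_def\<close>)
  with meas show ?thesis by (simp add: L2_def)
qed

lemma bdd_meas_L2:
  assumes "bdd_meas (lebesgue_on {a..b}) f" shows "f \<in> L2 {a..b}"
proof -
  interpret finite_measure "lebesgue_on {a..b}" by (rule finite_measure_Icc)
  have "bdd_meas (lebesgue_on {a..b}) (\<lambda>s. f s \<bullet> f s)"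
    by (rule bdd_meas_bilinear[OF bounded_bilinear_inner assms assms])
  then have "integrable (lebesgue_on {a..b}) (\<lambda>s. f s \<bullet> f s)" by (rule bdd_meas_integrable)
  then show ?thesis using assms by (simp add: L2_def bdd_meas_def power2_norm_eq_inner)
qed

lemma L2_integrable:
  assumes "f \<in> L2 {a..b}" shows "integrable (lebesgue_on {a..b}) f"
proof -
  interpret finite_measure "lebesgue_on {a..b}" by (rule finite_measure_Icc)
  have m: "f \<in> borel_measurable (lebesgue_on {a..b})" using assms by (rule L2_measurable)
  have "integrable (lebesgue_on {a..b}) (\<lambda>s. norm (f s))"
    by (rule square_integrable_imp_integrable) (use assms m in \<open>auto simp: L2_def\<close>)
  then show ?thesis using m integrable_norm_iff by blast
qed

lemma integral_norm_le_L2_norm: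
  assumes "a \<le> b" and f: "f \<in> L2 {a..b}"
  shows "(LINT s|lebesgue_on {a..b}. norm (f s)) \<le> sqrt (b - a) * L2_norm {a..b} f"
proof -
  have "(\<lambda>_. 1::real) \<in> L2 {a..b}" by (rule bdd_meas_L2[OF bdd_meas_const])
  moreover have "(\<lambda>s. norm (f s)) \<in> L2 {a..b}" using f by (auto simp: L2_def)
  ultimately have "\<bar>LINT s|lebesgue_on {a..b}. 1 \<bullet> norm (f s)\<bar> \<le> L2_norm {a..b} (\<lambda>_. 1::real) * L2_norm {a..b} (\<lambda>s. norm (f s))"
    by (rule L2_Cauchy_Schwarz)
  moreover have "L2_norm {a..b} (\<lambda>_. 1::real) = sqrt (b - a)"
    using assms(1) by (simp add: L2_norm_def measure_restrict_space)
  moreover have "L2_norm {a..b} (\<lambda>s. norm (f s)) = L2_norm {a..b} f" by (simp add: L2_norm_def)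
  ultimately show ?thesis by simp
qed

section \<open>Point values, primitives and weak derivatives\<close>

lemma AE_eq_continuous_imp_eq:
  fixes f g :: "real \<Rightarrow> 'a::real_normed_vector"
  assumes ab: "a < b" and c: "continuous_on {a..b} f" "continuous_on {a..b} g"
    and ae: "AE s in lebesgue_on {a..b}. f s = g s" and t: "t \<in> {a..b}"
  shows "f t = g t"
proof -
  have "AE s in lebesgue. s \<in> {a..b} \<longrightarrow> f s = g s"
    using ae by (simp add: AE_restrict_space_iff)
  then obtain N where "{s \<in> space lebesgue. \<not> (s \<in> {a..b} \<longrightarrow> f s = g s)} \<subseteq> N" and N0: "N \<in> null_sets lebesgue"
    unfolding eventually_ae_filter by blast
  then have N: "\<And>s. s \<in> {a..b} - N \<Longrightarrow> f s = g s" by auto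
  \<comment> \<open>The complement of a null set is dense in the interval, since no nondegenerate
    open interval is negligible; equality of continuous functions then passes to the
    closure.\<close>
  have "t \<in> closure ({a..b} - N)"
    unfolding closure_approachable
  proof (intro allI impI)
    fix e :: real assume e: "e > 0"
    define l u where "l = max a (t - e)" and "u = min b (t + e)"
    have lu: "l < u" using e t ab by (auto simp: l_def u_def)
    have "\<not> negligible {l<..<u}" using lu by (simp add: open_not_negligible)
    then have "\<not> {l<..<u} \<subseteq> N"
      using N0 negligible_subset negligible_iff_null_sets by blast
    then obtain y where "y \<in> {l<..<u}" "y \<notin> N" by blast
    then show "\<exists>y\<in>{a..b} - N. dist y t < e"
      by (intro bexI[of _ y]) (auto simp: l_def u_def dist_real_def)
  qed
  moreover have "closure ({a..b} - N) \<subseteq> {a..b}" by (intro closure_minimal) auto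
  ultimately show ?thesis
    using continuous_constant_on_closure[of "{a..b} - N" "\<lambda>x. f x - g x" 0 t] N
      continuous_on_subset[OF continuous_on_diff[OF c]] by auto
qed

text \<open>Two continuous representatives agree at every point of \<open>{0..L}\<close>, endpoints
  included, so the definite description in \<open>point_value\<close> picks a unique value.\<close>

lemma point_value_eq:
  assumes "0 < L" "continuous_on {0..L} h" "AE s in lebesgue_on {0..L}. h s = f s" "a \<in> {0..L}"
  shows "point_value L f a = h a"
  unfolding point_value_def
proof (rule the_equality)
  show "\<exists>g. continuous_on {0..L} g \<and> (AE s in lebesgue_on {0..L}. g s = f s) \<and> g a = h a"
    using assms by blast
  fix c assume "\<exists>g. continuous_on {0..L} g \<and> (AE s in lebesgue_on {0..L}. g s = f s) \<and> g a = c"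
  then obtain g where g: "continuous_on {0..L} g" "AE s in lebesgue_on {0..L}. g s = f s" "g a = c" by blast
  have "AE s in lebesgue_on {0..L}. g s = h s" using g(2) assms(3) by eventually_elim simp
  then show "c = h a" using AE_eq_continuous_imp_eq[OF assms(1) g(1) assms(2) _ assms(4)] g(3) by simp
qed

lemma continuous_on_primitive:
  fixes g :: "real \<Rightarrow> 'a::euclidean_space"
  assumes g: "integrable (lebesgue_on {0..L}) g"
  shows "continuous_on {0..L} (\<lambda>s. integ 0 s g)"
proof -
  have "integ 0 s g = integral {0..s} g" if s: "s \<in> {0..L}" for s
  proof -
    have "integrable (lebesgue_on {0..s}) g"
      by (rule integrable_subinterval[OF g]) (use s in auto)
    then show ?thesis by (simp add: lebesgue_integral_eq_integral)
  qed
  moreover have "continuous_on {0..L} (\<lambda>s. integral {0..s} g)"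
    using g by (intro indefinite_integral_continuous_1 integrable_on_lebesgue_on) auto
  ultimately show ?thesis by (metis (no_types, lifting) continuous_on_cong)
qed

lemma test_function_imp_deriv:
  assumes "test_function L \<phi>"
  shows "(\<phi> has_real_derivative deriv \<phi> s) (at s)" "continuous_on S (deriv \<phi>)" "\<phi> 0 = 0" "\<phi> L = 0"
proof -
  have d: "(deriv ^^ k) \<phi> field_differentiable at s" for k s using assms by (simp add: test_function_def)
  show "(\<phi> has_real_derivative deriv \<phi> s) (at s)"
    using d[of 0] by (simp add: field_differentiable_derivI)
  show "continuous_on S (deriv \<phi>)"
    using d[of 1] by (intro continuous_at_imp_continuous_on field_differentiable_imp_continuous_at ballI) simp
  show "\<phi> 0 = 0" "\<phi> L = 0" using assms by (auto simp: test_function_def)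
qed

text \<open>As \<open>g\<close> is merely integrable, the classical rule is replaced by Fubini on
  the triangle r \<le> s: the inner integral of the derivative of \<phi> over \<open>{r..L}\<close>
  is -\<phi>(r), because \<phi> vanishes at \<open>L\<close>.\<close>

lemma primitive_by_parts:
  fixes g :: "real \<Rightarrow> 'a::euclidean_space"
  assumes L: "0 < L" and g: "integrable (lebesgue_on {0..L}) g" and \<phi>: "test_function L \<phi>"
  shows "integ 0 L (\<lambda>s. deriv \<phi> s *\<^sub>R integ 0 s g) = - integ 0 L (\<lambda>s. \<phi> s *\<^sub>R g s)"
proof -
  interpret finite_measure "lebesgue_on {0..L}" by (rule finite_measure_Icc)
  let ?M = "lebesgue_on {0..L}"
  note idm [measurable] = ident_measurable_lebesgue_on[of "{0..L}"]
  have [measurable]: "(\<lambda>p. fst p) \<in> borel_measurable (?M \<Otimes>\<^sub>M ?M)" "(\<lambda>p. snd p) \<in> borel_measurable (?M \<Otimes>\<^sub>M ?M)"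
    by (rule measurable_compose[OF measurable_fst idm], rule measurable_compose[OF measurable_snd idm])
  have \<phi>m: "deriv \<phi> \<in> borel_measurable ?M"
    by (intro continuous_imp_measurable_on_sets_lebesgue test_function_imp_deriv[OF \<phi>]) auto
  obtain B where B: "\<And>x. x \<in> {0..L} \<Longrightarrow> norm (deriv \<phi> x) \<le> B"
    using compact_imp_bounded[OF compact_continuous_image[OF test_function_imp_deriv(2)[OF \<phi>] compact_Icc]]
    unfolding bounded_iff by blast
  have B0: "0 \<le> B" using B[of 0] L by (meson atLeastAtMost_iff less_imp_le norm_ge_zero order_refl order_trans)
  have gm: "g \<in> borel_measurable ?M" using g by simp
  have "integ 0 L (\<lambda>s. deriv \<phi> s *\<^sub>R integ 0 s g)
      = (\<integral>s. \<integral>r. (deriv \<phi> s * indicator {0..s} r) *\<^sub>R g r \<partial>?M \<partial>?M)"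
  proof (intro Bochner_Integration.integral_cong refl)
    fix s assume s: "s \<in> space ?M"
    have "deriv \<phi> s *\<^sub>R integ 0 s g = deriv \<phi> s *\<^sub>R (\<integral>r. indicator {0..s} r *\<^sub>R g r \<partial>?M)"
      using s by (subst integ_eq_indicator[of 0 s L]) auto
    also have "\<dots> = (\<integral>r. (deriv \<phi> s * indicator {0..s} r) *\<^sub>R g r \<partial>?M)"
      by (subst integral_scaleR_right[symmetric]) (simp_all)
    finally show "deriv \<phi> s *\<^sub>R integ 0 s g = (\<integral>r. (deriv \<phi> s * indicator {0..s} r) *\<^sub>R g r \<partial>?M)" .
  qed
  also have "\<dots> = (\<integral>r. \<integral>s. (deriv \<phi> s * indicator {0..s} r) *\<^sub>R g r \<partial>?M \<partial>?M)"
  proof (rule Fubini_pair, rule integrable_dominated_pair[where f="\<lambda>_. 1::real" and c=B, OF _ g])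
    have e: "(\<lambda>p :: real \<times> real. indicator {0..fst p} (snd p) :: real)
        = (\<lambda>p. if 0 \<le> snd p \<and> snd p \<le> fst p then 1 else 0)"
      by (auto simp: indicator_def fun_eq_iff)
    have im: "(\<lambda>p :: real \<times> real. indicator {0..fst p} (snd p) :: real) \<in> borel_measurable (?M \<Otimes>\<^sub>M ?M)"
      unfolding e by (intro measurable_If measurable_const) measurable
    show "(\<lambda>p. (deriv \<phi> (fst p) * indicator {0..fst p} (snd p)) *\<^sub>R g (snd p)) \<in> borel_measurable (?M \<Otimes>\<^sub>M ?M)"
      by (rule borel_measurable_scaleR[OF borel_measurable_times[OF
            measurable_compose[OF measurable_fst \<phi>m] im] measurable_compose[OF measurable_snd gm]])
    show "norm ((deriv \<phi> x * indicat_real {0..x} y) *\<^sub>R g y) \<le> B * norm (1::real) * norm (g y)"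
      if "x \<in> space ?M" "y \<in> space ?M" for x y
      using B[of x] B0 that by (auto simp: indicator_def intro!: mult_right_mono)
  qed auto
  also have "\<dots> = (\<integral>r. - (\<phi> r *\<^sub>R g r) \<partial>?M)"
  proof (intro Bochner_Integration.integral_cong refl)
    fix r assume r: "r \<in> space ?M"
    have i: "integrable (lebesgue_on {r..L}) (deriv \<phi>)"
      by (intro continuous_imp_integrable_real test_function_imp_deriv[OF \<phi>])
    have "(\<integral>s. deriv \<phi> s * indicator {0..s} r \<partial>?M) = (\<integral>s. indicator {r..L} s *\<^sub>R deriv \<phi> s \<partial>?M)"
      using r by (intro Bochner_Integration.integral_cong) (auto simp: indicator_def)
    also have "\<dots> = integ r L (deriv \<phi>)" using r by (subst integ_eq_indicator[of r L L]) auto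
    also have "\<dots> = integral {r..L} (deriv \<phi>)" using i by (simp add: lebesgue_integral_eq_integral)
    also have "\<dots> = \<phi> L - \<phi> r"
      using r test_function_imp_deriv(1)[OF \<phi>]
      by (intro integral_unique fundamental_theorem_of_calculus)
         (auto simp: has_real_derivative_iff_has_vector_derivative intro: has_vector_derivative_at_within)
    finally have e: "(\<integral>s. deriv \<phi> s * indicator {0..s} r \<partial>?M) = - \<phi> r"
      by (simp add: test_function_imp_deriv(4)[OF \<phi>])
    have "bdd_meas ?M (\<lambda>s. deriv \<phi> s * indicator {0..s} r)"
      unfolding bdd_meas_def
    proof (intro conjI exI[of _ B] ballI)
      have "(\<lambda>s. indicator {0..s} r :: real) = (\<lambda>s. if 0 \<le> r \<and> r \<le> s then 1 else 0)"
        by (auto simp: indicator_def fun_eq_iff)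
      moreover have "(\<lambda>s. if 0 \<le> r \<and> r \<le> s then 1 else (0::real)) \<in> borel_measurable ?M"
        by (intro measurable_If measurable_const) measurable
      ultimately show "(\<lambda>s. deriv \<phi> s * indicator {0..s} r) \<in> borel_measurable ?M"
        using \<phi>m by (intro borel_measurable_times) auto
    qed (use B B0 in \<open>auto simp: indicator_def\<close>)
    then have "integrable ?M (\<lambda>s. deriv \<phi> s * indicator {0..s} r)" by (rule bdd_meas_integrable)
    then show "(\<integral>s. (deriv \<phi> s * indicator {0..s} r) *\<^sub>R g r \<partial>?M) = - (\<phi> r *\<^sub>R g r)"
      using e by simp
  qed
  finally show ?thesis by simp
qed

text \<open>\<open>f\<close> minus the primitive of \<open>g\<close> has weak derivative 0, hence is
  almost everywhere a constant \<open>c\<close>. Then \<open>c\<close> plus the primitive is the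
  continuous representative of \<open>f\<close>, and \<open>point_value\<close> evaluates
  it.\<close>

proposition weak_deriv_primitive:
  fixes f g :: "real \<Rightarrow> 'a::euclidean_space"
  assumes L: "0 < L" and f: "integrable (lebesgue_on {0..L}) f" and g: "integrable (lebesgue_on {0..L}) g"
    and w: "has_weak_deriv L f g"
  obtains c where "AE s in lebesgue_on {0..L}. c + integ 0 s g = f s"
    "\<And>a. a \<in> {0..L} \<Longrightarrow> point_value L f a = c + integ 0 a g"
proof -
  have cont: "continuous_on {0..L} (\<lambda>s. integ 0 s g)" by (rule continuous_on_primitive[OF g])
  have Fi: "integrable (lebesgue_on {0..L}) (\<lambda>s. integ 0 s g)"
    by (rule continuous_imp_integrable_real[OF cont, simplified])
  have "\<exists>c. AE s in lebesgue_on {0..L}. f s - integ 0 s g = c"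
  proof (rule du_Bois_Reymond[OF L])
    show "integrable (lebesgue_on {0..L}) (\<lambda>s. f s - integ 0 s g)" using f Fi by simp
    fix \<phi> assume \<phi>: "test_function L \<phi>"
    note c = test_function_imp_deriv(2)[OF \<phi>]
    have "integ 0 L (\<lambda>s. deriv \<phi> s *\<^sub>R (f s - integ 0 s g))
       = integ 0 L (\<lambda>s. deriv \<phi> s *\<^sub>R f s) - integ 0 L (\<lambda>s. deriv \<phi> s *\<^sub>R integ 0 s g)"
      using integrable_continuous_scaleR[OF c f] integrable_continuous_scaleR[OF c Fi]
      by (simp add: scaleR_diff_right)
    also have "\<dots> = 0"
      using w \<phi> primitive_by_parts[OF L g \<phi>] by (simp add: has_weak_deriv_def)
    finally show "integ 0 L (\<lambda>s. deriv \<phi> s *\<^sub>R (f s - integ 0 s g)) = 0" .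
  qed
  then obtain c where "AE s in lebesgue_on {0..L}. f s - integ 0 s g = c" ..
  then have ae: "AE s in lebesgue_on {0..L}. c + integ 0 s g = f s"
    by eventually_elim (simp add: algebra_simps)
  show ?thesis
  proof (rule that[OF ae])
    show "point_value L f a = c + integ 0 a g" if "a \<in> {0..L}" for a
      by (rule point_value_eq[OF L _ ae that]) (intro continuous_intros cont)
  qed
qed

subsection \<open>Positivity of the forms of \<open>\<Phi>\<^sub>1\<close> and \<open>\<Phi>\<^sub>2\<close>\<close>

lemma complete_measure_lebesgue_on:
  assumes "S \<in> sets lebesgue" shows "complete_measure (lebesgue_on S)"
proof
  fix A B assume AB: "A \<subseteq> B" "B \<in> null_sets (lebesgue_on S)"
  then have "B \<subseteq> S" "B \<in> null_sets lebesgue" using assms by (auto simp: null_sets_restrict_space)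
  then have "A \<in> null_sets lebesgue" using AB(1) completion.complete2 by blast
  then have "A \<in> null_sets (lebesgue_on S)"
    using AB(1) \<open>B \<subseteq> S\<close> assms by (auto simp: null_sets_restrict_space)
  then show "A \<in> sets (lebesgue_on S)" by (rule null_setsD2)
qed

lemma (in complete_measure) AE_eq_imp_measurable:
  assumes "f \<in> measurable M N" "AE x in M. f x = g x" "\<And>x. x \<in> space M \<Longrightarrow> g x \<in> space N"
  shows "g \<in> measurable M N"
proof (rule measurableI)
  fix A assume A: "A \<in> sets N"
  show "g -` A \<inter> space M \<in> sets M"
  proof (rule in_sets_AE)
    show "f -` A \<inter> space M \<in> sets M" using assms(1) A by (rule measurable_sets)
    show "AE x in M. (x \<in> f -` A \<inter> space M) = (x \<in> g -` A \<inter> space M)"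
      using assms(2) by eventually_elim auto
  qed auto
qed (use assms(3) in auto)

text \<open>No measurability assumption is needed because Lebesgue measure is complete.\<close>

lemma integral_cong_AE_lebesgue_on:
  fixes f g :: "real \<Rightarrow> 'a::euclidean_space"
  assumes S: "S \<in> sets lebesgue" and ae: "AE x in lebesgue_on S. f x = g x"
  shows "integral\<^sup>L (lebesgue_on S) f = integral\<^sup>L (lebesgue_on S) g"
proof -
  interpret complete_measure "lebesgue_on S" by (rule complete_measure_lebesgue_on[OF S])
  have ae': "AE x in lebesgue_on S. g x = f x" using ae by eventually_elim simp
  show ?thesis
  proof (cases "f \<in> borel_measurable (lebesgue_on S)")
    case True
    then show ?thesis using AE_eq_imp_measurable[OF True ae] ae by (intro integral_cong_AE) auto
  next
    case False
    moreover have "g \<notin> borel_measurable (lebesgue_on S)"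
      using False AE_eq_imp_measurable[of g borel f, OF _ ae'] by auto
    ultimately have "\<not> integrable (lebesgue_on S) f" "\<not> integrable (lebesgue_on S) g" by auto
    then show ?thesis by (simp add: not_integrable_integral_eq)
  qed
qed

lemma lebesgue_measurable_ex_borel_vec:
  fixes f :: "'a::euclidean_space \<Rightarrow> real^'n::finite"
  assumes "f \<in> borel_measurable lebesgue"
  shows "\<exists>g\<in>borel_measurable borel. AE x in lborel. f x = g x"
proof -
  have "(\<lambda>x. f x $ k) \<in> borel_measurable lebesgue" for k
    using borel_measurable_inner[OF assms borel_measurable_const[of "axis k 1"]] by (simp add: inner_axis)
  then have "\<exists>g\<in>borel_measurable lborel. AE x in lborel. f x $ k = g x" for k
    by (rule completion_ex_borel_measurable_real)
  then have "\<forall>k. \<exists>g. g \<in> borel_measurable borel \<and> (AE x in lborel. f x $ k = g x)" by auto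
  from choice[OF this] obtain g where g: "\<And>k. g k \<in> borel_measurable borel" "\<And>k. AE x in lborel. f x $ k = g k x"
    by blast
  have "(\<lambda>x. \<chi> k. g k x) \<in> borel_measurable borel"
  proof (subst borel_measurable_euclidean_space, rule ballI)
    fix b :: "real^'n" assume "b \<in> Basis"
    then obtain k where "b = axis k 1" by (auto simp: Basis_vec_def)
    then show "(\<lambda>x. (\<chi> k. g k x) \<bullet> b) \<in> borel_measurable borel"
      using g(1)[of k] by (simp add: inner_axis)
  qed
  moreover have "AE x in lborel. \<forall>k. f x $ k = g k x"
    using g(2) by (simp add: AE_all_countable)
  then have "AE x in lborel. f x = (\<chi> k. g k x)"
    by eventually_elim (simp add: vec_eq_iff)
  ultimately show ?thesis by (intro bexI[of _ "\<lambda>x. \<chi> k. g k x"])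
qed

lemma AE_lborel_imp_lebesgue_on:
  assumes "AE x in lborel. P x" "S \<in> sets lebesgue"
  shows "AE x in lebesgue_on S. P x"
proof -
  have "AE x in lebesgue. x \<in> S \<longrightarrow> P x" using AE_completion[OF assms(1)] by eventually_elim simp
  then show ?thesis using assms(2) by (simp add: AE_restrict_space_iff)
qed

text \<open>A Borel version of the function on the plane is measurable for the product of the two
  one-dimensional measure spaces, which a Lebesgue measurable function need not be. The equality
  almost everywhere in the plane becomes equality on almost every slice, and both orders are
  recorded because the formulas of \<open>Phi1\<close> and \<open>Phi2\<close> fix sometimes the
  first and sometimes the second argument of \<open>Z\<close>.\<close>

lemma square_representative:
  fixes Z :: "real \<Rightarrow> real \<Rightarrow> real^'n::finite"
  assumes "bounded_measurable_on ({0..L} \<times> {0..L}) (\<lambda>(s, \<theta>). Z s \<theta>)"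
  obtains Z' where "bdd_meas (lebesgue_on {0..L} \<Otimes>\<^sub>M lebesgue_on {0..L}) (\<lambda>p. Z' (fst p) (snd p))"
    "AE s in lebesgue_on {0..L}. AE \<theta> in lebesgue_on {0..L}. Z s \<theta> = Z' s \<theta>"
    "AE \<theta> in lebesgue_on {0..L}. AE s in lebesgue_on {0..L}. Z s \<theta> = Z' s \<theta>"
proof -
  let ?\<Omega> = "{0..L} \<times> {0..L}" and ?M = "lebesgue_on {0..L}"
  have Om: "?\<Omega> \<in> sets lebesgue"
    by (simp add: sets_completionI_sets borel_closed closed_Times)
  obtain c where c: "\<And>p. p \<in> ?\<Omega> \<Longrightarrow> norm (case p of (s, \<theta>) \<Rightarrow> Z s \<theta>) \<le> c"
    using assms unfolding bounded_measurable_on_def bounded_iff by blast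
  define f where "f p = (if p \<in> ?\<Omega> then (case p of (s, \<theta>) \<Rightarrow> Z s \<theta>) else 0)" for p
  have "f \<in> borel_measurable lebesgue"
    using assms Om unfolding f_def bounded_measurable_on_def
    by (subst borel_measurable_if) auto
  then obtain g where g: "g \<in> borel_measurable borel" "AE x in lborel. f x = g x"
    using lebesgue_measurable_ex_borel_vec by blast
  \<comment> \<open>The Borel version satisfies the bound only almost everywhere; cutting it off at
    \<open>c\<close> restores the bound at every point without changing it where it equals
    \<open>Z\<close>.\<close>
  define h where "h p = (if norm (g p) \<le> c then g p else 0)" for p
  have hm: "h \<in> borel_measurable borel"
    unfolding h_def using g(1) by measurable
  have c0: "0 \<le> c" if "p \<in> ?\<Omega>" for p using c[OF that] by (meson norm_ge_zero order_trans)
  have ae: "AE p in lborel \<Otimes>\<^sub>M lborel. p \<in> ?\<Omega> \<longrightarrow> Z (fst p) (snd p) = h p"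
    unfolding lborel_prod using g(2)
  proof eventually_elim
    case (elim p)
    show ?case
    proof
      assume p: "p \<in> ?\<Omega>"
      then have "g p = Z (fst p) (snd p)" using elim by (simp add: f_def case_prod_beta)
      then show "Z (fst p) (snd p) = h p" using c[OF p] by (simp add: h_def case_prod_beta)
    qed
  qed
  have idm: "(\<lambda>x. x) \<in> measurable ?M borel" by (rule ident_measurable_lebesgue_on)
  have "(\<lambda>p. (fst p, snd p)) \<in> measurable (?M \<Otimes>\<^sub>M ?M) (borel \<Otimes>\<^sub>M borel)"
    by (intro measurable_Pair measurable_compose[OF measurable_fst idm] measurable_compose[OF measurable_snd idm])
  then have "(\<lambda>p. (fst p, snd p)) \<in> borel_measurable (?M \<Otimes>\<^sub>M ?M)" by (simp add: borel_prod)
  from measurable_compose[OF this hm]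
  have "bdd_meas (?M \<Otimes>\<^sub>M ?M) (\<lambda>p. h (fst p, snd p))"
    unfolding bdd_meas_def by (intro conjI exI[of _ "max c 0"]) (auto simp: h_def le_max_iff_disj)
  moreover have "AE s in ?M. AE \<theta> in ?M. Z s \<theta> = h (s, \<theta>)"
  proof -
    have "AE s in lborel. AE \<theta> in lborel. (s, \<theta>) \<in> ?\<Omega> \<longrightarrow> Z s \<theta> = h (s, \<theta>)"
      using lborel_pair.AE_pair[OF ae] by simp
    then have "AE s in ?M. AE \<theta> in lborel. (s, \<theta>) \<in> ?\<Omega> \<longrightarrow> Z s \<theta> = h (s, \<theta>)"
      by (rule AE_lborel_imp_lebesgue_on) simp
    then have "AE s in ?M. s \<in> {0..L} \<longrightarrow> (AE \<theta> in ?M. \<theta> \<in> {0..L} \<longrightarrow> Z s \<theta> = h (s, \<theta>))"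
    proof eventually_elim
      case (elim s)
      from AE_lborel_imp_lebesgue_on[OF this, of "{0..L}"] show ?case by auto
    qed
    then show ?thesis by (auto simp: AE_restrict_space_iff)
  qed
  moreover have "AE \<theta> in ?M. AE s in ?M. Z s \<theta> = h (s, \<theta>)"
  proof -
    \<comment> \<open>The other order of slicing: the planar null set is transported by the
      coordinate swap, which preserves the product measure.\<close>
    have "AE p in distr (lborel \<Otimes>\<^sub>M lborel) (lborel \<Otimes>\<^sub>M lborel) (\<lambda>(x::real, y::real). (y, x)).
          p \<in> ?\<Omega> \<longrightarrow> Z (fst p) (snd p) = h p"
      unfolding lborel_pair.distr_pair_swap[symmetric] by (rule ae)
    then have "AE q in lborel \<Otimes>\<^sub>M lborel.
        (case q of (x, y) \<Rightarrow> (y, x)) \<in> ?\<Omega> \<longrightarrow>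
        Z (fst (case q of (x, y) \<Rightarrow> (y, x))) (snd (case q of (x, y) \<Rightarrow> (y, x))) = h (case q of (x, y) \<Rightarrow> (y, x))"
      by (rule AE_distrD[OF measurable_pair_swap'])
    from lborel_pair.AE_pair[OF this]
    have "AE \<theta> in lborel. AE s in lborel. (s, \<theta>) \<in> ?\<Omega> \<longrightarrow> Z s \<theta> = h (s, \<theta>)" by simp
    then have "AE \<theta> in ?M. AE s in lborel. (s, \<theta>) \<in> ?\<Omega> \<longrightarrow> Z s \<theta> = h (s, \<theta>)"
      by (rule AE_lborel_imp_lebesgue_on) simp
    then have "AE \<theta> in ?M. \<theta> \<in> {0..L} \<longrightarrow> (AE s in ?M. s \<in> {0..L} \<longrightarrow> Z s \<theta> = h (s, \<theta>))"
    proof eventually_elim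
      case (elim s)
      from AE_lborel_imp_lebesgue_on[OF this, of "{0..L}"] show ?case by auto
    qed
    then show ?thesis by (auto simp: AE_restrict_space_iff)
  qed
  ultimately show ?thesis by (rule that[of "\<lambda>s \<theta>. h (s, \<theta>)"])
qed

section \<open>Bilinear forms given by kernels\<close>

definition kform :: "real \<Rightarrow> (real \<Rightarrow> real \<Rightarrow> real^'n::finite^'m::finite) \<Rightarrow>
    (real \<Rightarrow> real^'m) \<Rightarrow> (real \<Rightarrow> real^'n) \<Rightarrow> real"
  where "kform L K f g = integ 0 L (\<lambda>s. f s \<bullet> integ 0 L (\<lambda>\<theta>. K s \<theta> *v g \<theta>))"

abbreviation bdd_kernel :: "real \<Rightarrow> (real \<Rightarrow> real \<Rightarrow> 'a::euclidean_space) \<Rightarrow> bool"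
  where "bdd_kernel L K \<equiv> bdd_meas (lebesgue_on {0..L} \<Otimes>\<^sub>M lebesgue_on {0..L}) (\<lambda>p. K (fst p) (snd p))"

text \<open>The hypothesis is the iterated one, which is what \<open>square_representative\<close>
  yields and what an argument off the diagonal yields section by section.\<close>

lemma kform_cong_AE:
  assumes "AE s in lebesgue_on {0..L}. AE \<theta> in lebesgue_on {0..L}. K s \<theta> = K' s \<theta>"
  shows "kform L K f g = kform L K' f g"
  unfolding kform_def
proof (rule integral_cong_AE_lebesgue_on)
  show "AE s in lebesgue_on {0..L}. f s \<bullet> integ 0 L (\<lambda>\<theta>. K s \<theta> *v g \<theta>) = f s \<bullet> integ 0 L (\<lambda>\<theta>. K' s \<theta> *v g \<theta>)"
    using assms
  proof eventually_elim
    case (elim s)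
    have "integ 0 L (\<lambda>\<theta>. K s \<theta> *v g \<theta>) = integ 0 L (\<lambda>\<theta>. K' s \<theta> *v g \<theta>)"
      by (rule integral_cong_AE_lebesgue_on) (use elim in \<open>auto elim: AE_mp\<close>)
    then show ?case by simp
  qed
qed simp

lemma kform_transpose:
  assumes "bdd_kernel L K" "integrable (lebesgue_on {0..L}) f" "integrable (lebesgue_on {0..L}) g"
  shows "kform L (\<lambda>s \<theta>. transpose (K \<theta> s)) g f = kform L K f g"
  unfolding kform_def finite_measure.kernel_dual[OF finite_measure_Icc assms]
  by (simp add: inner_commute)

lemma kernel_row_integrable:
  fixes g :: "real \<Rightarrow> real^'n::finite" and K :: "real \<Rightarrow> real \<Rightarrow> real^'n^'m::finite"
  assumes "bdd_kernel L K" "integrable (lebesgue_on {0..L}) g" "s \<in> {0..L}"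
  shows "integrable (lebesgue_on {0..L}) (\<lambda>\<theta>. K s \<theta> *v g \<theta>)"
  using bdd_meas_integrable_mult[OF bounded_bilinear_matrix_vector_mult bdd_meas_section1[OF assms(1)] assms(2)] assms(3)
  by simp

lemma kform_integrable:
  fixes f :: "real \<Rightarrow> real^'m::finite" and g :: "real \<Rightarrow> real^'n::finite"
  assumes "bdd_kernel L K" "integrable (lebesgue_on {0..L}) f" "integrable (lebesgue_on {0..L}) g"
  shows "integrable (lebesgue_on {0..L}) (\<lambda>s. f s \<bullet> integ 0 L (\<lambda>\<theta>. K s \<theta> *v g \<theta>))"
  using bdd_meas_integrable_mult[OF bounded_bilinear_inner finite_measure.kernel_apply_bdd[OF finite_measure_Icc
     bounded_bilinear_matrix_vector_mult assms(1,3)] assms(2)]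
  by (simp add: inner_commute)

lemma kform_add:
  fixes f :: "real \<Rightarrow> real^'m::finite" and g :: "real \<Rightarrow> real^'n::finite"
  assumes K: "bdd_kernel L K" and K': "bdd_kernel L K'"
    and f: "integrable (lebesgue_on {0..L}) f" and g: "integrable (lebesgue_on {0..L}) g"
  shows "kform L (\<lambda>s \<theta>. K s \<theta> + K' s \<theta>) f g = kform L K f g + kform L K' f g"
proof -
  have "kform L (\<lambda>s \<theta>. K s \<theta> + K' s \<theta>) f g
      = integ 0 L (\<lambda>s. f s \<bullet> integ 0 L (\<lambda>\<theta>. K s \<theta> *v g \<theta>) + f s \<bullet> integ 0 L (\<lambda>\<theta>. K' s \<theta> *v g \<theta>))"
    unfolding kform_def
    using kernel_row_integrable[OF K g] kernel_row_integrable[OF K' g]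
    by (intro Bochner_Integration.integral_cong refl) (simp add: matrix_vector_mult_add_rdistrib inner_add_right)
  then show ?thesis
    using kform_integrable[OF K f g] kform_integrable[OF K' f g] by (simp add: kform_def)
qed

lemma kform_scaleR:
  fixes f :: "real \<Rightarrow> real^'m::finite" and g :: "real \<Rightarrow> real^'n::finite"
  shows "kform L (\<lambda>s \<theta>. c *\<^sub>R K s \<theta>) f g = c * kform L K f g"
  by (simp add: kform_def scaleR_matrix_vector_assoc[symmetric])

lemma bdd_kernel_scaleR: "bdd_kernel L K \<Longrightarrow> bdd_kernel L (\<lambda>s \<theta>. c *\<^sub>R K s \<theta>)"
  using bdd_meas_linear[OF bounded_linear_scaleR_right] .

lemma kform_sum:
  fixes f :: "real \<Rightarrow> real^'m::finite" and g :: "real \<Rightarrow> real^'n::finite"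
  assumes K: "\<And>i. i \<in> I \<Longrightarrow> bdd_kernel L (K i)"
    and f: "integrable (lebesgue_on {0..L}) f" and g: "integrable (lebesgue_on {0..L}) g"
  shows "kform L (\<lambda>s \<theta>. \<Sum>i\<in>I. c i *\<^sub>R K i s \<theta>) f g = (\<Sum>i\<in>I. c i * kform L (K i) f g)"
  using K
proof (induction I rule: infinite_finite_induct)
  case (insert i I)
  have "bdd_kernel L (\<lambda>s \<theta>. c i *\<^sub>R K i s \<theta>)" "bdd_kernel L (\<lambda>s \<theta>. \<Sum>i\<in>I. c i *\<^sub>R K i s \<theta>)"
    using insert by (auto intro!: bdd_meas_sum bdd_kernel_scaleR)
  then show ?case using insert by (simp add: kform_add[OF _ _ f g] kform_scaleR)
qed (simp_all add: kform_def)

text \<open>Fubini for a pairing, read off from \<open>kernel_dual\<close>: the vector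
  \<open>b z y\<close> is viewed as the matrix with the single row \<open>b z y\<close>, applied to
  \<open>v\<close> and paired with the constant \<open>1 :: real^1\<close>.\<close>

lemma kernel_functional:
  fixes b :: "real \<Rightarrow> real \<Rightarrow> real^'n::finite"
  assumes b: "bdd_kernel L b" and v: "integrable (lebesgue_on {0..L}) v"
  shows "integ 0 L (\<lambda>z. integ 0 L (\<lambda>y. b z y \<bullet> v y)) = integ 0 L (\<lambda>y. integ 0 L (\<lambda>z. b z y) \<bullet> v y)"
proof -
  interpret finite_measure "lebesgue_on {0..L}" by (rule finite_measure_Icc)
  have K: "bdd_kernel L (\<lambda>z y. outer (1 :: real^1) (b z y))"
    by (intro bdd_meas_bilinear[OF bounded_bilinear_outer] bdd_meas_const b)
  have one: "(1 :: real^1) \<bullet> 1 = 1" by (simp add: inner_vec_def)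
  have "integ 0 L (\<lambda>x. (1 :: real^1) \<bullet> integ 0 L (\<lambda>y. outer 1 (b x y) *v v y))
      = integ 0 L (\<lambda>y. integ 0 L (\<lambda>x. transpose (outer (1 :: real^1) (b x y)) *v 1) \<bullet> v y)"
    by (rule kernel_dual[OF K _ v]) simp
  moreover have "integ 0 L (\<lambda>x. (1 :: real^1) \<bullet> integ 0 L (\<lambda>y. outer 1 (b x y) *v v y))
      = integ 0 L (\<lambda>z. integ 0 L (\<lambda>y. b z y \<bullet> v y))"
  proof (intro Bochner_Integration.integral_cong refl)
    fix x assume x: "x \<in> space (lebesgue_on {0..L})"
    show "(1 :: real^1) \<bullet> integ 0 L (\<lambda>y. outer 1 (b x y) *v v y) = integ 0 L (\<lambda>y. b x y \<bullet> v y)"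
      using bdd_meas_integrable_mult[OF bounded_bilinear_inner bdd_meas_section1[OF b x] v]
      by (simp add: outer_mult_vec one)
  qed
  ultimately show ?thesis by (simp add: transpose_outer outer_mult_vec one)
qed

text \<open>The entries of \<open>\<integral>\<^sub>0\<^sup>\<beta> Z(\<beta>,\<theta>) u(\<theta>) d\<theta>\<close> (\<open>Inl\<close>) and \<open>\<integral>\<^sub>\<beta>\<^sup>L Z(\<beta>,\<theta>) u(\<theta>) d\<theta>\<close> (\<open>Inr\<close>)
  are the integrals of \<open>half Z k \<beta> \<theta> \<bullet> u \<theta>\<close>; they are the vectors on which the second and third
  block of \<open>T\<close> act.\<close>

definition half :: "(real \<Rightarrow> real \<Rightarrow> nat \<Rightarrow> real^'n) \<Rightarrow> nat + nat \<Rightarrow> real \<Rightarrow> real \<Rightarrow> real^'n"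
  where "half Z k \<beta> \<theta> = (case k of Inl i \<Rightarrow> if \<theta> \<le> \<beta> then Z \<beta> \<theta> i else 0
                                | Inr i \<Rightarrow> if \<beta> \<le> \<theta> then Z \<beta> \<theta> i else 0)"

abbreviation double :: "nat \<Rightarrow> (nat + nat) set"
  where "double d \<equiv> {..<d} <+> {..<d}"

text \<open>The kernel of the form that integrates V(\<beta>)^T T V(\<beta>) over \<beta>, where
  V(\<beta>) collects the integrals of \<open>half Z k \<beta>\<close> against \<open>u\<close>.
  Here \<open>T\<close> stands for the lower right two by two blocks, with \<open>Inl\<close> for
  the second and \<open>Inr\<close> for the third block of the matrix in \<open>Phi1\<close> and
  \<open>Phi2\<close>.\<close>

definition dkern :: "real \<Rightarrow> nat \<Rightarrow> (nat + nat \<Rightarrow> nat + nat \<Rightarrow> real) \<Rightarrow>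
    (real \<Rightarrow> real \<Rightarrow> nat \<Rightarrow> real^'n::finite) \<Rightarrow> real \<Rightarrow> real \<Rightarrow> real^'n^'n"
  where "dkern L d T Z s \<theta> =
    integ 0 L (\<lambda>\<beta>. \<Sum>k\<in>double d. \<Sum>l\<in>double d. T k l *\<^sub>R outer (half Z k \<beta> s) (half Z l \<beta> \<theta>))"

lemma congr_prod_outer:
  "congr_prod k l X T Y = (\<Sum>i<k. \<Sum>j<l. T i j *\<^sub>R outer (X i) (Y j))"
  by (simp add: congr_prod_def outer_def vec_eq_iff mult_ac)

lemma transpose_congr_prod:
  "transpose (congr_prod k l X T Y) = congr_prod l k Y (\<lambda>i j. T j i) X"
  unfolding congr_prod_def transpose_def vec_eq_iff
  by (simp add: mult_ac) (subst sum.swap, simp)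

lemma dot_congr_prod:
  "u \<bullet> (congr_prod k l X T Y *v v) = (\<Sum>i<k. \<Sum>j<l. T i j * ((X i \<bullet> u) * (Y j \<bullet> v)))"
proof -
  interpret bounded_linear "\<lambda>A. u \<bullet> (A *v v)"
    by (rule bounded_linear_compose[OF bounded_linear_inner_right
          bounded_bilinear.bounded_linear_left[OF bounded_bilinear_matrix_vector_mult]])
  show ?thesis
    by (simp add: congr_prod_outer sum scaleR outer_mult_vec inner_commute mult_ac)
qed

lemma dkern_integrand:
  "(\<Sum>k\<in>double d. \<Sum>l\<in>double d. T k l *\<^sub>R outer (half Z k \<beta> s) (half Z l \<beta> \<theta>)) =
     (if s \<le> \<beta> \<and> \<theta> \<le> \<beta> then congr_prod d d (Z \<beta> s) (\<lambda>i j. T (Inl i) (Inl j)) (Z \<beta> \<theta>) else 0)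
   + (if s \<le> \<beta> \<and> \<beta> \<le> \<theta> then congr_prod d d (Z \<beta> s) (\<lambda>i j. T (Inl i) (Inr j)) (Z \<beta> \<theta>) else 0)
   + (if \<beta> \<le> s \<and> \<theta> \<le> \<beta> then congr_prod d d (Z \<beta> s) (\<lambda>i j. T (Inr i) (Inl j)) (Z \<beta> \<theta>) else 0)
   + (if \<beta> \<le> s \<and> \<beta> \<le> \<theta> then congr_prod d d (Z \<beta> s) (\<lambda>i j. T (Inr i) (Inr j)) (Z \<beta> \<theta>) else 0)"
proof -
  have o: "outer a 0 = 0" "outer 0 a = 0" for a :: "real^'n"
    by (simp_all add: outer_def vec_eq_iff)
  show ?thesis
    by (cases "s \<le> \<beta>"; cases "\<theta> \<le> \<beta>"; cases "\<beta> \<le> s"; cases "\<beta> \<le> \<theta>")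
       (simp_all add: sum.Plus half_def o congr_prod_outer sum.distrib)
qed

lemma pred_le_lebesgue_on:
  "Measurable.pred (lebesgue_on {0..L::real} \<Otimes>\<^sub>M lebesgue_on {0..L}) (\<lambda>p. snd p \<le> fst p)"
  "Measurable.pred (lebesgue_on {0..L::real} \<Otimes>\<^sub>M lebesgue_on {0..L}) (\<lambda>p. fst p \<le> snd p)"
proof -
  note idm = ident_measurable_lebesgue_on[of "{0..L}"]
  have [measurable]: "(\<lambda>p. fst p) \<in> borel_measurable (lebesgue_on {0..L} \<Otimes>\<^sub>M lebesgue_on {0..L})"
      "(\<lambda>p. snd p) \<in> borel_measurable (lebesgue_on {0..L} \<Otimes>\<^sub>M lebesgue_on {0..L})"
    by (rule measurable_compose[OF measurable_fst idm], rule measurable_compose[OF measurable_snd idm])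
  show "Measurable.pred (lebesgue_on {0..L::real} \<Otimes>\<^sub>M lebesgue_on {0..L}) (\<lambda>p. snd p \<le> fst p)"
    "Measurable.pred (lebesgue_on {0..L::real} \<Otimes>\<^sub>M lebesgue_on {0..L}) (\<lambda>p. fst p \<le> snd p)"
    by measurable
qed

lemma half_bdd:
  assumes "\<forall>i<d. bdd_kernel L (\<lambda>\<beta> \<theta>. Z \<beta> \<theta> i)" "k \<in> double d"
  shows "bdd_kernel L (half Z k)"
proof (cases k)
  case (Inl i)
  then show ?thesis using assms by (auto simp: half_def intro!: bdd_meas_If bdd_meas_const pred_le_lebesgue_on)
next
  case (Inr i)
  then show ?thesis using assms by (auto simp: half_def intro!: bdd_meas_If bdd_meas_const pred_le_lebesgue_on)
qed

lemma bdd_meas_indicator: "bdd_meas (lebesgue_on {0..L::real}) (indicat_real {a..b})"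
proof -
  note [measurable] = ident_measurable_lebesgue_on[of "{0..L}"]
  have "indicat_real {a..b} = (\<lambda>x. if a \<le> x \<and> x \<le> b then 1 else 0)"
    by (auto simp: indicator_def fun_eq_iff)
  moreover have "Measurable.pred (lebesgue_on {0..L}) (\<lambda>x. a \<le> x \<and> x \<le> b)" by measurable
  ultimately show ?thesis by (simp add: bdd_meas_If bdd_meas_const)
qed

lemma bdd_meas_scaleR_const: "bdd_meas M f \<Longrightarrow> bdd_meas M (\<lambda>x. c *\<^sub>R f x)"
  by (rule bdd_meas_linear[OF bounded_linear_scaleR_right])

lemma integ_congr_prod:
  fixes Z Z' :: "real \<Rightarrow> real \<Rightarrow> nat \<Rightarrow> real^'n::finite"
  assumes Z': "\<forall>i<d. bdd_kernel L (\<lambda>\<beta> \<theta>. Z' \<beta> \<theta> i)"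
    and st: "s \<in> {0..L}" "\<theta> \<in> {0..L}"
    and ae: "AE \<beta> in lebesgue_on {0..L}. \<forall>i<d. Z \<beta> s i = Z' \<beta> s i"
      "AE \<beta> in lebesgue_on {0..L}. \<forall>i<d. Z \<beta> \<theta> i = Z' \<beta> \<theta> i"
    and ab: "0 \<le> a" "b \<le> L"
  shows "integ a b (\<lambda>\<beta>. congr_prod d d (Z \<beta> s) T (Z \<beta> \<theta>))
      = integ 0 L (\<lambda>\<beta>. indicator {a..b} \<beta> *\<^sub>R congr_prod d d (Z' \<beta> s) T (Z' \<beta> \<theta>))"
    and "integrable (lebesgue_on {0..L}) (\<lambda>\<beta>. indicator {a..b} \<beta> *\<^sub>R congr_prod d d (Z' \<beta> s) T (Z' \<beta> \<theta>))"
proof -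
  show "integ a b (\<lambda>\<beta>. congr_prod d d (Z \<beta> s) T (Z \<beta> \<theta>))
      = integ 0 L (\<lambda>\<beta>. indicator {a..b} \<beta> *\<^sub>R congr_prod d d (Z' \<beta> s) T (Z' \<beta> \<theta>))"
    unfolding integ_eq_indicator[OF ab]
  proof (rule integral_cong_AE_lebesgue_on)
    show "AE \<beta> in lebesgue_on {0..L}. indicat_real {a..b} \<beta> *\<^sub>R congr_prod d d (Z \<beta> s) T (Z \<beta> \<theta>)
        = indicat_real {a..b} \<beta> *\<^sub>R congr_prod d d (Z' \<beta> s) T (Z' \<beta> \<theta>)"
      using ae by eventually_elim (simp add: congr_prod_outer)
  qed simp
  have "bdd_meas (lebesgue_on {0..L}) (\<lambda>\<beta>. indicator {a..b} \<beta> *\<^sub>R congr_prod d d (Z' \<beta> s) T (Z' \<beta> \<theta>))"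
    unfolding congr_prod_outer using st
    by (intro bdd_meas_bilinear[OF bounded_bilinear_scaleR] bdd_meas_indicator bdd_meas_sum bdd_meas_scaleR_const
        bdd_meas_bilinear[OF bounded_bilinear_outer] bdd_meas_section2[OF Z'[rule_format]]) auto
  then show "integrable (lebesgue_on {0..L}) (\<lambda>\<beta>. indicator {a..b} \<beta> *\<^sub>R congr_prod d d (Z' \<beta> s) T (Z' \<beta> \<theta>))"
    by (rule finite_measure.bdd_meas_integrable[OF finite_measure_Icc])
qed

lemma AE_neq_lebesgue_on: "AE x in lebesgue_on {0..L}. x \<noteq> (c::real)"
  by (rule AE_lborel_imp_lebesgue_on[OF AE_lborel_singleton]) simp

text \<open>When \<beta> differs from \<open>s\<close> and \<theta>, exactly one of the four terms
  of \<open>dkern_integrand\<close> survives, according to the side of \<beta> on which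
  \<open>s\<close> and \<theta> lie. For \<theta> < s no \<beta> lies above \<open>s\<close> and
  below \<theta> at once, so three intervals with the blocks 22, 32, 33 remain; for s < \<theta> the
  middle block is 23.\<close>

lemma dkern_eq:
  fixes Z Z' :: "real \<Rightarrow> real \<Rightarrow> nat \<Rightarrow> real^'n::finite"
  assumes Z': "\<forall>i<d. bdd_kernel L (\<lambda>\<beta> \<theta>. Z' \<beta> \<theta> i)"
    and st: "s \<in> {0..L}" "\<theta> \<in> {0..L}"
    and ae: "AE \<beta> in lebesgue_on {0..L}. \<forall>i<d. Z \<beta> s i = Z' \<beta> s i"
      "AE \<beta> in lebesgue_on {0..L}. \<forall>i<d. Z \<beta> \<theta> i = Z' \<beta> \<theta> i"
  shows "\<theta> < s \<Longrightarrow> dkern L d T Z' s \<theta> =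
      integ s L (\<lambda>\<beta>. congr_prod d d (Z \<beta> s) (\<lambda>i j. T (Inl i) (Inl j)) (Z \<beta> \<theta>))
    + integ \<theta> s (\<lambda>\<beta>. congr_prod d d (Z \<beta> s) (\<lambda>i j. T (Inr i) (Inl j)) (Z \<beta> \<theta>))
    + integ 0 \<theta> (\<lambda>\<beta>. congr_prod d d (Z \<beta> s) (\<lambda>i j. T (Inr i) (Inr j)) (Z \<beta> \<theta>))"
    and "s < \<theta> \<Longrightarrow> dkern L d T Z' s \<theta> =
      integ \<theta> L (\<lambda>\<beta>. congr_prod d d (Z \<beta> s) (\<lambda>i j. T (Inl i) (Inl j)) (Z \<beta> \<theta>))
    + integ s \<theta> (\<lambda>\<beta>. congr_prod d d (Z \<beta> s) (\<lambda>i j. T (Inl i) (Inr j)) (Z \<beta> \<theta>))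
    + integ 0 s (\<lambda>\<beta>. congr_prod d d (Z \<beta> s) (\<lambda>i j. T (Inr i) (Inr j)) (Z \<beta> \<theta>))"
proof -
  let ?c = "\<lambda>T \<beta>. congr_prod d d (Z' \<beta> s) T (Z' \<beta> \<theta>)"
  let ?i = "\<lambda>a b T \<beta>. indicat_real {a..b} \<beta> *\<^sub>R ?c T \<beta>"
  note I = integ_congr_prod[where Z=Z and Z'=Z', OF Z' st ae]
  have split: "integ 0 L (\<lambda>\<beta>. ?i a b T1 \<beta> + ?i a' b' T2 \<beta> + ?i a'' b'' T3 \<beta>)
      = integ a b (\<lambda>\<beta>. congr_prod d d (Z \<beta> s) T1 (Z \<beta> \<theta>)) + integ a' b' (\<lambda>\<beta>. congr_prod d d (Z \<beta> s) T2 (Z \<beta> \<theta>))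
      + integ a'' b'' (\<lambda>\<beta>. congr_prod d d (Z \<beta> s) T3 (Z \<beta> \<theta>))"
    if "0 \<le> a" "b \<le> L" "0 \<le> a'" "b' \<le> L" "0 \<le> a''" "b'' \<le> L" for a b a' b' a'' b'' T1 T2 T3
    using that by (simp add: I)
  have ne: "AE \<beta> in lebesgue_on {0..L}. \<beta> \<in> {0..L} \<and> \<beta> \<noteq> s \<and> \<beta> \<noteq> \<theta>"
    using AE_neq_lebesgue_on[of s L] AE_neq_lebesgue_on[of \<theta> L] AE_space[of "lebesgue_on {0..L}"] by eventually_elim simp
  show "dkern L d T Z' s \<theta> =
      integ s L (\<lambda>\<beta>. congr_prod d d (Z \<beta> s) (\<lambda>i j. T (Inl i) (Inl j)) (Z \<beta> \<theta>))
    + integ \<theta> s (\<lambda>\<beta>. congr_prod d d (Z \<beta> s) (\<lambda>i j. T (Inr i) (Inl j)) (Z \<beta> \<theta>))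
    + integ 0 \<theta> (\<lambda>\<beta>. congr_prod d d (Z \<beta> s) (\<lambda>i j. T (Inr i) (Inr j)) (Z \<beta> \<theta>))" if lt: "\<theta> < s"
  proof (subst split[symmetric])
    show "dkern L d T Z' s \<theta> = integ 0 L (\<lambda>\<beta>. ?i s L (\<lambda>i j. T (Inl i) (Inl j)) \<beta>
       + ?i \<theta> s (\<lambda>i j. T (Inr i) (Inl j)) \<beta> + ?i 0 \<theta> (\<lambda>i j. T (Inr i) (Inr j)) \<beta>)"
      unfolding dkern_def dkern_integrand
    proof (rule integral_cong_AE_lebesgue_on)
      show "AE \<beta> in lebesgue_on {0..L}.
         (if s \<le> \<beta> \<and> \<theta> \<le> \<beta> then ?c (\<lambda>i j. T (Inl i) (Inl j)) \<beta> else 0)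
       + (if s \<le> \<beta> \<and> \<beta> \<le> \<theta> then ?c (\<lambda>i j. T (Inl i) (Inr j)) \<beta> else 0)
       + (if \<beta> \<le> s \<and> \<theta> \<le> \<beta> then ?c (\<lambda>i j. T (Inr i) (Inl j)) \<beta> else 0)
       + (if \<beta> \<le> s \<and> \<beta> \<le> \<theta> then ?c (\<lambda>i j. T (Inr i) (Inr j)) \<beta> else 0)
       = ?i s L (\<lambda>i j. T (Inl i) (Inl j)) \<beta>
       + ?i \<theta> s (\<lambda>i j. T (Inr i) (Inl j)) \<beta> + ?i 0 \<theta> (\<lambda>i j. T (Inr i) (Inr j)) \<beta>"
        using ne by eventually_elim (use lt st in \<open>auto simp: indicator_def\<close>)
    qed simp
  qed (use st in auto)
  show "dkern L d T Z' s \<theta> =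
      integ \<theta> L (\<lambda>\<beta>. congr_prod d d (Z \<beta> s) (\<lambda>i j. T (Inl i) (Inl j)) (Z \<beta> \<theta>))
    + integ s \<theta> (\<lambda>\<beta>. congr_prod d d (Z \<beta> s) (\<lambda>i j. T (Inl i) (Inr j)) (Z \<beta> \<theta>))
    + integ 0 s (\<lambda>\<beta>. congr_prod d d (Z \<beta> s) (\<lambda>i j. T (Inr i) (Inr j)) (Z \<beta> \<theta>))" if lt: "s < \<theta>"
  proof (subst split[symmetric])
    show "dkern L d T Z' s \<theta> = integ 0 L (\<lambda>\<beta>. ?i \<theta> L (\<lambda>i j. T (Inl i) (Inl j)) \<beta>
       + ?i s \<theta> (\<lambda>i j. T (Inl i) (Inr j)) \<beta> + ?i 0 s (\<lambda>i j. T (Inr i) (Inr j)) \<beta>)"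
      unfolding dkern_def dkern_integrand
    proof (rule integral_cong_AE_lebesgue_on)
      show "AE \<beta> in lebesgue_on {0..L}.
         (if s \<le> \<beta> \<and> \<theta> \<le> \<beta> then ?c (\<lambda>i j. T (Inl i) (Inl j)) \<beta> else 0)
       + (if s \<le> \<beta> \<and> \<beta> \<le> \<theta> then ?c (\<lambda>i j. T (Inl i) (Inr j)) \<beta> else 0)
       + (if \<beta> \<le> s \<and> \<theta> \<le> \<beta> then ?c (\<lambda>i j. T (Inr i) (Inl j)) \<beta> else 0)
       + (if \<beta> \<le> s \<and> \<beta> \<le> \<theta> then ?c (\<lambda>i j. T (Inr i) (Inr j)) \<beta> else 0)
       = ?i \<theta> L (\<lambda>i j. T (Inl i) (Inl j)) \<beta>
       + ?i s \<theta> (\<lambda>i j. T (Inl i) (Inr j)) \<beta> + ?i 0 s (\<lambda>i j. T (Inr i) (Inr j)) \<beta>"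
        using ne by eventually_elim (use lt st in \<open>auto simp: indicator_def\<close>)
    qed simp
  qed (use st in auto)
qed

lemma dkern_transpose:
  fixes Z :: "real \<Rightarrow> real \<Rightarrow> nat \<Rightarrow> real^'n::finite"
  assumes "\<And>k l. k \<in> double d \<Longrightarrow> l \<in> double d \<Longrightarrow> T k l = T l k"
    and Z: "\<forall>i<d. bdd_kernel L (\<lambda>\<beta> \<theta>. Z \<beta> \<theta> i)" and st: "s \<in> {0..L}" "\<theta> \<in> {0..L}"
  shows "transpose (dkern L d T Z s \<theta>) = dkern L d T Z \<theta> s"
proof -
  have "bdd_meas (lebesgue_on {0..L}) (\<lambda>\<beta>. \<Sum>k\<in>double d. \<Sum>l\<in>double d. T k l *\<^sub>R outer (half Z k \<beta> s) (half Z l \<beta> \<theta>))"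
    using st by (intro bdd_meas_sum bdd_meas_scaleR_const bdd_meas_bilinear[OF bounded_bilinear_outer]
        bdd_meas_section2[OF half_bdd[OF Z]]) auto
  from finite_measure.bdd_meas_integrable[OF finite_measure_Icc this]
  have "transpose (dkern L d T Z s \<theta>)
      = integ 0 L (\<lambda>\<beta>. transpose (\<Sum>k\<in>double d. \<Sum>l\<in>double d. T k l *\<^sub>R outer (half Z k \<beta> s) (half Z l \<beta> \<theta>)))"
    unfolding dkern_def by (rule integral_bounded_linear[OF bounded_linear_transpose, symmetric])
  also have "\<dots> = dkern L d T Z \<theta> s"
    unfolding dkern_def
  proof (intro Bochner_Integration.integral_cong refl)
    fix \<beta>
    interpret bounded_linear "transpose :: real^'n^'n \<Rightarrow> _" by (rule bounded_linear_transpose)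
    show "transpose (\<Sum>k\<in>double d. \<Sum>l\<in>double d. T k l *\<^sub>R outer (half Z k \<beta> s) (half Z l \<beta> \<theta>))
      = (\<Sum>k\<in>double d. \<Sum>l\<in>double d. T k l *\<^sub>R outer (half Z k \<beta> \<theta>) (half Z l \<beta> s))"
      unfolding sum scaleR transpose_outer by (subst sum.swap) (intro sum.cong refl, simp add: assms(1))
  qed
  finally show ?thesis .
qed

lemma dkern_bdd:
  assumes Z: "\<forall>i<d. bdd_kernel L (\<lambda>\<beta> \<theta>. Z \<beta> \<theta> i)"
  shows "bdd_kernel L (dkern L d T Z)"
  unfolding dkern_def
proof (rule finite_measure.bdd_meas_integral[OF finite_measure_Icc], intro bdd_meas_sum bdd_meas_scaleR_const
    bdd_meas_bilinear[OF bounded_bilinear_outer])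
  let ?M = "lebesgue_on {0..L}"
  fix k assume "k \<in> double d"
  then have h: "bdd_kernel L (half Z k)" by (rule half_bdd[OF Z])
  have "(\<lambda>p. (snd p, fst (fst p))) \<in> measurable ((?M \<Otimes>\<^sub>M ?M) \<Otimes>\<^sub>M ?M) (?M \<Otimes>\<^sub>M ?M)"
    "(\<lambda>p. (snd p, snd (fst p))) \<in> measurable ((?M \<Otimes>\<^sub>M ?M) \<Otimes>\<^sub>M ?M) (?M \<Otimes>\<^sub>M ?M)"
    by measurable
  from this[THEN bdd_meas_compose[OF h]]
  show "bdd_meas ((?M \<Otimes>\<^sub>M ?M) \<Otimes>\<^sub>M ?M) (\<lambda>p. half Z k (snd p) (fst (fst p)))"
    "bdd_meas ((?M \<Otimes>\<^sub>M ?M) \<Otimes>\<^sub>M ?M) (\<lambda>p. half Z k (snd p) (snd (fst p)))" by simp_all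
qed

text \<open>\<open>kernel_outer\<close> is applied to each pair of indices. The double sum is
  reindexed by pairs so that \<open>kform_sum\<close> can collect the kernels.\<close>

lemma kform_dkern:
  fixes Z :: "real \<Rightarrow> real \<Rightarrow> nat \<Rightarrow> real^'n::finite"
  assumes Z: "\<forall>i<d. bdd_kernel L (\<lambda>\<beta> \<theta>. Z \<beta> \<theta> i)" and u: "integrable (lebesgue_on {0..L}) u"
  shows "(\<Sum>k\<in>double d. \<Sum>l\<in>double d. T k l * integ 0 L (\<lambda>\<beta>.
      integ 0 L (\<lambda>\<theta>. half Z k \<beta> \<theta> \<bullet> u \<theta>) * integ 0 L (\<lambda>\<theta>. half Z l \<beta> \<theta> \<bullet> u \<theta>))) = kform L (dkern L d T Z) u u"
proof -
  interpret finite_measure "lebesgue_on {0..L}" by (rule finite_measure_Icc)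
  define K where "K z s \<theta> = integ 0 L (\<lambda>\<beta>. outer (half Z (fst z) \<beta> s) (half Z (snd z) \<beta> \<theta>))" for z s \<theta>
  have K: "bdd_kernel L (K z)" if "z \<in> double d \<times> double d" for z
  proof -
    have "fst z \<in> double d" "snd z \<in> double d" using that by auto
    note h = this[THEN half_bdd[OF Z]]
    show ?thesis unfolding K_def
      by (rule bdd_meas_kernel_prod[OF bounded_bilinear_outer bdd_meas_swap[OF h(1)] h(2), simplified])
  qed
  have "(\<Sum>k\<in>double d. \<Sum>l\<in>double d. T k l * integ 0 L (\<lambda>\<beta>.
      integ 0 L (\<lambda>\<theta>. half Z k \<beta> \<theta> \<bullet> u \<theta>) * integ 0 L (\<lambda>\<theta>. half Z l \<beta> \<theta> \<bullet> u \<theta>)))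
    = (\<Sum>z\<in>double d \<times> double d. T (fst z) (snd z) * kform L (K z) u u)"
    unfolding sum.cartesian_product case_prod_beta' kform_def K_def
    by (intro sum.cong refl arg_cong2[where f="(*)"] kernel_outer half_bdd[OF Z] u) auto
  also have "\<dots> = kform L (\<lambda>s \<theta>. \<Sum>z\<in>double d \<times> double d. T (fst z) (snd z) *\<^sub>R K z s \<theta>) u u"
    by (rule kform_sum[symmetric, OF K u u])
  also have "\<dots> = kform L (dkern L d T Z) u u"
  proof (rule kform_cong_AE, intro AE_I2)
    fix s \<theta> assume st: "s \<in> space (lebesgue_on {0..L})" "\<theta> \<in> space (lebesgue_on {0..L})"
    have i: "integrable (lebesgue_on {0..L}) (\<lambda>\<beta>. outer (half Z k \<beta> s) (half Z l \<beta> \<theta>))"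
      if "k \<in> double d" "l \<in> double d" for k l
      using that st by (intro bdd_meas_integrable bdd_meas_bilinear[OF bounded_bilinear_outer]
        bdd_meas_section2[OF half_bdd[OF Z]]) auto
    have "dkern L d T Z s \<theta> = (\<Sum>k\<in>double d. \<Sum>l\<in>double d. integ 0 L (\<lambda>\<beta>. T k l *\<^sub>R outer (half Z k \<beta> s) (half Z l \<beta> \<theta>)))"
      unfolding dkern_def by (subst Bochner_Integration.integral_sum; (intro sum.cong refl Bochner_Integration.integral_sum)?)
         (auto intro!: Bochner_Integration.integrable_sum i)
    also have "\<dots> = (\<Sum>k\<in>double d. \<Sum>l\<in>double d. T k l *\<^sub>R K (k, l) s \<theta>)"
      by (intro sum.cong refl) (simp add: K_def i)
    finally show "(\<Sum>z\<in>double d \<times> double d. T (fst z) (snd z) *\<^sub>R K z s \<theta>) = dkern L d T Z s \<theta>"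
      by (simp add: sum.cartesian_product case_prod_beta')
  qed
  finally show ?thesis .
qed

lemma kernel_representative:
  fixes Z :: "real \<Rightarrow> real \<Rightarrow> nat \<Rightarrow> real^'n::finite"
  assumes "\<forall>i<d. bounded_measurable_on ({0..L} \<times> {0..L}) (\<lambda>(s, \<theta>). Z s \<theta> i)"
  obtains Z' where "\<forall>i<d. bdd_kernel L (\<lambda>s \<theta>. Z' s \<theta> i)"
    "AE s in lebesgue_on {0..L}. AE \<theta> in lebesgue_on {0..L}. \<forall>i<d. Z s \<theta> i = Z' s \<theta> i"
    "AE \<theta> in lebesgue_on {0..L}. AE s in lebesgue_on {0..L}. \<forall>i<d. Z s \<theta> i = Z' s \<theta> i"
proof -
  have "\<forall>i. \<exists>Z'. i < d \<longrightarrow> bdd_kernel L Z'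
    \<and> (AE s in lebesgue_on {0..L}. AE \<theta> in lebesgue_on {0..L}. Z s \<theta> i = Z' s \<theta>)
    \<and> (AE \<theta> in lebesgue_on {0..L}. AE s in lebesgue_on {0..L}. Z s \<theta> i = Z' s \<theta>)"
  proof
    fix i
    show "\<exists>Z'. i < d \<longrightarrow> bdd_kernel L Z'
    \<and> (AE s in lebesgue_on {0..L}. AE \<theta> in lebesgue_on {0..L}. Z s \<theta> i = Z' s \<theta>)
    \<and> (AE \<theta> in lebesgue_on {0..L}. AE s in lebesgue_on {0..L}. Z s \<theta> i = Z' s \<theta>)"
    proof (cases "i < d")
      case True
      with assms have "bounded_measurable_on ({0..L} \<times> {0..L}) (\<lambda>(s, \<theta>). Z s \<theta> i)" by blast
      then show ?thesis by (rule square_representative[where Z="\<lambda>s \<theta>. Z s \<theta> i"]) blast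
    qed simp
  qed
  from choice[OF this] obtain Z' where Z': "\<And>i. i < d \<Longrightarrow> bdd_kernel L (Z' i)"
    "\<And>i. i < d \<Longrightarrow> AE s in lebesgue_on {0..L}. AE \<theta> in lebesgue_on {0..L}. Z s \<theta> i = Z' i s \<theta>"
    "\<And>i. i < d \<Longrightarrow> AE \<theta> in lebesgue_on {0..L}. AE s in lebesgue_on {0..L}. Z s \<theta> i = Z' i s \<theta>"
    by blast
  have all: "(AE x in lebesgue_on {0..L}. \<forall>i<d. Q x i) \<longleftrightarrow> (\<forall>i<d. AE x in lebesgue_on {0..L}. Q x i)" for Q
    using AE_ball_countable[of "{..<d}" Q "lebesgue_on {0..L}"] by (simp add: Ball_def)
  show ?thesis
    by (rule that[of "\<lambda>s \<theta> i. Z' i s \<theta>"]) (simp_all add: all Z')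
qed

lemma mat_rows_prod_outer: "mat_rows_prod l T Y = (\<Sum>j<l. outer (\<chi> a. T a j) (Y j))"
  by (simp add: mat_rows_prod_def outer_def vec_eq_iff)

text \<open>The integration ranges of the two terms of \<open>Q\<close> are exactly the sets where
  the corresponding half kernels do not vanish by definition, so both become integrals over all of
  \<open>{0..L}\<close>.\<close>

lemma integ_mat_rows_prod:
  fixes Z Z' :: "real \<Rightarrow> real \<Rightarrow> nat \<Rightarrow> real^'n::finite" and T :: "'m::finite \<Rightarrow> nat + nat \<Rightarrow> real"
  assumes Z': "\<forall>i<d. bdd_kernel L (\<lambda>\<beta> \<theta>. Z' \<beta> \<theta> i)" and t: "\<theta> \<in> {0..L}"
    and ae: "AE \<beta> in lebesgue_on {0..L}. \<forall>i<d. Z \<beta> \<theta> i = Z' \<beta> \<theta> i"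
  shows "integ \<theta> L (\<lambda>s. mat_rows_prod d (\<lambda>i j. T i (Inl j)) (Z s \<theta>))
       + integ 0 \<theta> (\<lambda>s. mat_rows_prod d (\<lambda>i j. T i (Inr j)) (Z s \<theta>))
     = (\<Sum>k\<in>double d. outer (\<chi> a. T a k) (integ 0 L (\<lambda>\<beta>. half Z' k \<beta> \<theta>)))"
proof -
  interpret finite_measure "lebesgue_on {0..L}" by (rule finite_measure_Icc)
  have int: "integrable (lebesgue_on {0..L}) (\<lambda>\<beta>. half Z' k \<beta> \<theta>)" if "k \<in> double d" for k
    using bdd_meas_integrable[OF bdd_meas_section2[OF half_bdd[OF Z' that]]] t by simp
  have bl: "bounded_linear (outer c)" for c :: "real^'m"
    by (rule bounded_bilinear.bounded_linear_right[OF bounded_bilinear_outer])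
  have *: "integ 0 L f = (\<Sum>j<d. outer (\<chi> a. T a (k j)) (integ 0 L (\<lambda>\<beta>. half Z' (k j) \<beta> \<theta>)))"
    if k: "\<And>j. j < d \<Longrightarrow> k j \<in> double d"
      and f: "AE s in lebesgue_on {0..L}. f s = (\<Sum>j<d. outer (\<chi> a. T a (k j)) (half Z' (k j) s \<theta>))" for f k
  proof -
    have "integ 0 L f = integ 0 L (\<lambda>s. \<Sum>j<d. outer (\<chi> a. T a (k j)) (half Z' (k j) s \<theta>))"
      by (rule integral_cong_AE_lebesgue_on[OF _ f]) simp
    also have "\<dots> = (\<Sum>j<d. integ 0 L (\<lambda>s. outer (\<chi> a. T a (k j)) (half Z' (k j) s \<theta>)))"
      using k by (intro Bochner_Integration.integral_sum integrable_bounded_linear[OF bl] int) auto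
    also have "\<dots> = (\<Sum>j<d. outer (\<chi> a. T a (k j)) (integ 0 L (\<lambda>\<beta>. half Z' (k j) \<beta> \<theta>)))"
      using k by (intro sum.cong refl integral_bounded_linear[OF bl] int) auto
    finally show ?thesis .
  qed
  have sp: "AE s in lebesgue_on {0..L}. s \<in> {0..L}" using AE_space[of "lebesgue_on {0..L}"] by simp
  have o0: "outer c 0 = 0" for c :: "real^'m" by (simp add: outer_def vec_eq_iff)
  have 1: "integ \<theta> L (\<lambda>s. mat_rows_prod d (\<lambda>i j. T i (Inl j)) (Z s \<theta>))
      = (\<Sum>j<d. outer (\<chi> a. T a (Inl j)) (integ 0 L (\<lambda>\<beta>. half Z' (Inl j) \<beta> \<theta>)))"
  proof (subst integ_eq_indicator[of \<theta> L L], use t in simp, simp, rule *)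
    show "AE s in lebesgue_on {0..L}. indicat_real {\<theta>..L} s *\<^sub>R mat_rows_prod d (\<lambda>i j. T i (Inl j)) (Z s \<theta>)
       = (\<Sum>j<d. outer (\<chi> a. T a (Inl j)) (half Z' (Inl j) s \<theta>))"
      using ae sp by eventually_elim (auto simp: mat_rows_prod_outer half_def indicator_def o0)
  qed auto
  have 2: "integ 0 \<theta> (\<lambda>s. mat_rows_prod d (\<lambda>i j. T i (Inr j)) (Z s \<theta>))
      = (\<Sum>j<d. outer (\<chi> a. T a (Inr j)) (integ 0 L (\<lambda>\<beta>. half Z' (Inr j) \<beta> \<theta>)))"
  proof (subst integ_eq_indicator[of 0 \<theta> L], simp, use t in simp, rule *)
    show "AE s in lebesgue_on {0..L}. indicat_real {0..\<theta>} s *\<^sub>R mat_rows_prod d (\<lambda>i j. T i (Inr j)) (Z s \<theta>)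
       = (\<Sum>j<d. outer (\<chi> a. T a (Inr j)) (half Z' (Inr j) s \<theta>))"
      using ae sp by eventually_elim (auto simp: mat_rows_prod_outer half_def indicator_def o0)
  qed auto
  show ?thesis unfolding 1 2 by (simp add: sum.Plus)
qed

lemma psd_on_Plus:
  assumes "psd_on (I <+> J) T" "finite I" "finite J"
  shows "0 \<le> (\<Sum>i\<in>I. \<Sum>j\<in>I. T (Inl i) (Inl j) * (a i * a j))
     + 2 * (\<Sum>i\<in>I. \<Sum>k\<in>J. T (Inl i) (Inr k) * (a i * b k))
     + (\<Sum>k\<in>J. \<Sum>l\<in>J. T (Inr k) (Inr l) * (b k * b l))"
proof -
  let ?v = "case_sum a b"
  have sym: "T (Inr k) (Inl i) = T (Inl i) (Inr k)" if "k \<in> J" "i \<in> I" for k i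
    using assms(1) that by (auto simp: psd_on_def)
  have "(\<Sum>k\<in>J. \<Sum>i\<in>I. b k * T (Inr k) (Inl i) * a i) = (\<Sum>i\<in>I. \<Sum>k\<in>J. T (Inl i) (Inr k) * (a i * b k))"
    by (subst sum.swap) (intro sum.cong refl, simp add: sym mult_ac)
  moreover have "0 \<le> (\<Sum>i\<in>I <+> J. \<Sum>j\<in>I <+> J. ?v i * T i j * ?v j)"
    using assms(1) by (simp add: psd_on_def)
  ultimately show ?thesis
    using assms(2,3) by (simp add: sum.Plus sum.distrib mult_ac)
qed

lemma integral_double_sum:
  fixes g :: "'i \<Rightarrow> 'j \<Rightarrow> 'a \<Rightarrow> real"
  assumes "\<And>i j. i \<in> I \<Longrightarrow> j \<in> J \<Longrightarrow> integrable M (g i j)"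
  shows "integrable M (\<lambda>x. \<Sum>i\<in>I. \<Sum>j\<in>J. c i j * g i j x)"
    and "(\<integral>x. (\<Sum>i\<in>I. \<Sum>j\<in>J. c i j * g i j x) \<partial>M) = (\<Sum>i\<in>I. \<Sum>j\<in>J. c i j * (\<integral>x. g i j x \<partial>M))"
proof -
  have 1: "integrable M (\<lambda>x. \<Sum>j\<in>J. c i j * g i j x)" if "i \<in> I" for i
    by (intro Bochner_Integration.integrable_sum Bochner_Integration.integrable_mult_right assms that)
  then show "integrable M (\<lambda>x. \<Sum>i\<in>I. \<Sum>j\<in>J. c i j * g i j x)"
    by (rule Bochner_Integration.integrable_sum)
  have "(\<integral>x. (\<Sum>i\<in>I. \<Sum>j\<in>J. c i j * g i j x) \<partial>M) = (\<Sum>i\<in>I. \<integral>x. (\<Sum>j\<in>J. c i j * g i j x) \<partial>M)"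
    by (intro Bochner_Integration.integral_sum 1)
  also have "\<dots> = (\<Sum>i\<in>I. \<Sum>j\<in>J. \<integral>x. c i j * g i j x \<partial>M)"
    by (intro sum.cong refl Bochner_Integration.integral_sum Bochner_Integration.integrable_mult_right assms)
  finally show "(\<integral>x. (\<Sum>i\<in>I. \<Sum>j\<in>J. c i j * g i j x) \<partial>M) = (\<Sum>i\<in>I. \<Sum>j\<in>J. c i j * (\<integral>x. g i j x \<partial>M))"
    by simp
qed

text \<open>For each \<beta> the matrix \<open>T\<close> is tested on the vector consisting of
  \<open>w\<close> and the half integrals \<open>V k \<beta>\<close>, and the result is integrated
  over \<beta>. The block of \<open>w\<close> does not depend on \<beta> and so acquires the factor
  \<open>L\<close>, which is the origin of the factor 1/L in the \<open>P\<close> of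
  \<open>map_L4\<close> and \<open>map_L5\<close>.\<close>

proposition Phi1_nonneg:
  fixes P :: "real^'m::finite^'m" and Q :: "real \<Rightarrow> real^'n::finite^'m"
  assumes Phi1: "(P, Q, R1, R2) \<in> Phi1 L" and L: "0 < L" and u: "integrable (lebesgue_on {0..L}) u"
  shows "0 \<le> L * (w \<bullet> (P *v w)) + 2 * (w \<bullet> integ 0 L (\<lambda>\<theta>. Q \<theta> *v u \<theta>))
     + kform L (\<lambda>s \<theta>. if \<theta> \<le> s then R1 s \<theta> else R2 s \<theta>) u u"
proof -
  interpret finite_measure "lebesgue_on {0..L}" by (rule finite_measure_Icc)
  obtain d and Z :: "real \<Rightarrow> real \<Rightarrow> nat \<Rightarrow> real^'n" and T :: "'m + nat + nat \<Rightarrow> 'm + nat + nat \<Rightarrow> real" where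
    Z: "\<forall>i<d. bounded_measurable_on ({0..L} \<times> {0..L}) (\<lambda>(s, \<theta>). Z s \<theta> i)"
    and T: "psd_on (UNIV <+> double d) T"
    and P: "P = (\<chi> i j. T (b1 i) (b1 j))"
    and Q: "\<forall>\<theta>\<in>{0..L}. Q \<theta> =
            integ \<theta> L (\<lambda>s. mat_rows_prod d (\<lambda>i j. T (b1 i) (b2 j)) (Z s \<theta>))
          + integ 0 \<theta> (\<lambda>s. mat_rows_prod d (\<lambda>i j. T (b1 i) (b3 j)) (Z s \<theta>))"
    and R1: "\<forall>s\<in>{0..L}. \<forall>\<theta>\<in>{0..L}. \<theta> \<le> s \<longrightarrow> R1 s \<theta> =
            integ s L (\<lambda>\<beta>. congr_prod d d (Z \<beta> s) (\<lambda>i j. T (b2 i) (b2 j)) (Z \<beta> \<theta>))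
          + integ \<theta> s (\<lambda>\<beta>. congr_prod d d (Z \<beta> s) (\<lambda>i j. T (b3 i) (b2 j)) (Z \<beta> \<theta>))
          + integ 0 \<theta> (\<lambda>\<beta>. congr_prod d d (Z \<beta> s) (\<lambda>i j. T (b3 i) (b3 j)) (Z \<beta> \<theta>))"
    and R2: "\<forall>s\<in>{0..L}. \<forall>\<theta>\<in>{0..L}. s \<le> \<theta> \<longrightarrow> R2 s \<theta> =
            integ \<theta> L (\<lambda>\<beta>. congr_prod d d (Z \<beta> s) (\<lambda>i j. T (b2 i) (b2 j)) (Z \<beta> \<theta>))
          + integ s \<theta> (\<lambda>\<beta>. congr_prod d d (Z \<beta> s) (\<lambda>i j. T (b2 i) (b3 j)) (Z \<beta> \<theta>))
          + integ 0 s (\<lambda>\<beta>. congr_prod d d (Z \<beta> s) (\<lambda>i j. T (b3 i) (b3 j)) (Z \<beta> \<theta>))"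
    using Phi1 unfolding Phi1_def mem_Collect_eq prod.case by (elim exE conjE) (rule that; assumption)
  obtain Z' where Z': "\<forall>i<d. bdd_kernel L (\<lambda>s \<theta>. Z' s \<theta> i)"
    and ae: "AE \<theta> in lebesgue_on {0..L}. AE s in lebesgue_on {0..L}. \<forall>i<d. Z s \<theta> i = Z' s \<theta> i"
    using kernel_representative[OF Z] by blast
  define V where "V k \<beta> = integ 0 L (\<lambda>\<theta>. half Z' k \<beta> \<theta> \<bullet> u \<theta>)" for k \<beta>
  have V: "bdd_meas (lebesgue_on {0..L}) (V k)" if "k \<in> double d" for k
    unfolding V_def by (rule kernel_apply_bdd[OF bounded_bilinear_inner half_bdd[OF Z' that] u])
  have Vi: "integrable (lebesgue_on {0..L}) (V k)" if "k \<in> double d" for k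
    by (rule bdd_meas_integrable[OF V[OF that]])
  have VVi: "integrable (lebesgue_on {0..L}) (\<lambda>\<beta>. V k \<beta> * V l \<beta>)" if "k \<in> double d" "l \<in> double d" for k l
    by (rule bdd_meas_integrable[OF bdd_meas_bilinear[OF bounded_bilinear_mult V[OF that(1)] V[OF that(2)]]])
  have "0 \<le> integ 0 L (\<lambda>\<beta>. (\<Sum>i\<in>UNIV. \<Sum>j\<in>UNIV. T (Inl i) (Inl j) * (w $ i * w $ j))
     + 2 * (\<Sum>i\<in>UNIV. \<Sum>k\<in>double d. T (Inl i) (Inr k) * (w $ i * V k \<beta>))
     + (\<Sum>k\<in>double d. \<Sum>l\<in>double d. T (Inr k) (Inr l) * (V k \<beta> * V l \<beta>)))"
    by (intro Bochner_Integration.integral_nonneg psd_on_Plus[OF T]) auto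
  also have "\<dots> = L * (\<Sum>i\<in>UNIV. \<Sum>j\<in>UNIV. T (Inl i) (Inl j) * (w $ i * w $ j))
     + 2 * (\<Sum>i\<in>UNIV. \<Sum>k\<in>double d. T (Inl i) (Inr k) * (w $ i * integ 0 L (V k)))
     + (\<Sum>k\<in>double d. \<Sum>l\<in>double d. T (Inr k) (Inr l) * integ 0 L (\<lambda>\<beta>. V k \<beta> * V l \<beta>))"
  proof -
    show ?thesis using L Vi VVi
      by (simp add: integral_double_sum[of UNIV "double d" _ "\<lambda>i k \<beta>. w $ i * V k \<beta>"]
          integral_double_sum[of "double d" "double d" _ "\<lambda>k l \<beta>. V k \<beta> * V l \<beta>"] measure_restrict_space)
  qed
  also have "(\<Sum>i\<in>UNIV. \<Sum>j\<in>UNIV. T (Inl i) (Inl j) * (w $ i * w $ j)) = w \<bullet> (P *v w)"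
    by (simp add: P inner_vec_def matrix_vector_mult_def sum_distrib_left mult_ac)
  also have "(\<Sum>i\<in>UNIV. \<Sum>k\<in>double d. T (Inl i) (Inr k) * (w $ i * integ 0 L (V k)))
      = w \<bullet> integ 0 L (\<lambda>\<theta>. Q \<theta> *v u \<theta>)"
  proof -
    define h where "h k \<theta> = integ 0 L (\<lambda>\<beta>. half Z' k \<beta> \<theta>)" for k \<theta>
    have hb: "bdd_meas (lebesgue_on {0..L}) (h k)" if "k \<in> double d" for k
      unfolding h_def by (rule bdd_meas_integral[OF bdd_meas_swap[OF half_bdd[OF Z' that]]])
    have hu: "integrable (lebesgue_on {0..L}) (\<lambda>\<theta>. h k \<theta> \<bullet> u \<theta>)" if "k \<in> double d" for k
      by (rule bdd_meas_integrable_mult[OF bounded_bilinear_inner hb[OF that] u])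
    have sp: "AE s in lebesgue_on {0..L}. s \<in> {0..L}" using AE_space[of "lebesgue_on {0..L}"] by simp
    have "integ 0 L (\<lambda>\<theta>. Q \<theta> *v u \<theta>) = integ 0 L (\<lambda>\<theta>. \<Sum>k\<in>double d. (h k \<theta> \<bullet> u \<theta>) *\<^sub>R (\<chi> i. T (Inl i) (Inr k)))"
    proof (rule integral_cong_AE_lebesgue_on)
      show "AE \<theta> in lebesgue_on {0..L}. Q \<theta> *v u \<theta> = (\<Sum>k\<in>double d. (h k \<theta> \<bullet> u \<theta>) *\<^sub>R (\<chi> i. T (Inl i) (Inr k)))"
        using ae sp
      proof eventually_elim
        case (elim \<theta>)
        have Qeq: "Q \<theta> = (\<Sum>k\<in>double d. outer (\<chi> a. T (Inl a) (Inr k)) (h k \<theta>))"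
          using Q integ_mat_rows_prod[where Z=Z and T="\<lambda>a k. T (Inl a) (Inr k)", OF Z' elim(2,1)] elim(2) by (simp add: h_def)
        interpret bounded_linear "\<lambda>A :: real^'n^'m. A *v u \<theta>"
          by (rule bounded_bilinear.bounded_linear_left[OF bounded_bilinear_matrix_vector_mult])
        show ?case by (simp add: Qeq sum outer_mult_vec)
      qed
    qed simp
    also have "\<dots> = (\<Sum>k\<in>double d. integ 0 L (\<lambda>\<theta>. h k \<theta> \<bullet> u \<theta>) *\<^sub>R (\<chi> i. T (Inl i) (Inr k)))"
      using hu by (subst Bochner_Integration.integral_sum) auto
    also have "\<dots> = (\<Sum>k\<in>double d. integ 0 L (V k) *\<^sub>R (\<chi> i. T (Inl i) (Inr k)))"
      \<comment> \<open>\<open>Q\<close> integrates \<open>Z\<close> over its first argument, while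
        \<open>V\<close> integrates it against \<open>u\<close> over the second;
        \<open>kernel_functional\<close> exchanges the two.\<close>
      unfolding V_def h_def by (intro sum.cong refl arg_cong2[where f="(*\<^sub>R)"]
          kernel_functional[symmetric] half_bdd[OF Z'] u)
    finally show ?thesis
      by (simp add: inner_sum_right inner_vec_def sum_distrib_left mult_ac)
  qed
  also have "(\<Sum>k\<in>double d. \<Sum>l\<in>double d. T (Inr k) (Inr l) * integ 0 L (\<lambda>\<beta>. V k \<beta> * V l \<beta>))
      = kform L (dkern L d (\<lambda>k l. T (Inr k) (Inr l)) Z') u u"
    unfolding V_def by (rule kform_dkern[OF Z' u])
  also have "\<dots> = kform L (\<lambda>s \<theta>. if \<theta> \<le> s then R1 s \<theta> else R2 s \<theta>) u u"
  proof (rule kform_cong_AE)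
    have sp: "AE s in lebesgue_on {0..L}. s \<in> {0..L}" using AE_space[of "lebesgue_on {0..L}"] by simp
    show "AE s in lebesgue_on {0..L}. AE \<theta> in lebesgue_on {0..L}.
      dkern L d (\<lambda>k l. T (Inr k) (Inr l)) Z' s \<theta> = (if \<theta> \<le> s then R1 s \<theta> else R2 s \<theta>)"
      using ae sp
    proof eventually_elim
      case (elim s)
      note s = elim
      show ?case using ae sp AE_neq_lebesgue_on[of s]
      proof eventually_elim
        case (elim \<theta>)
        note D = dkern_eq[where Z=Z and T="\<lambda>k l. T (Inr k) (Inr l)", OF Z' s(2) elim(2) s(1) elim(1)]
        show ?case
        proof (cases "\<theta> < s")
          case True
          then show ?thesis using D(1)[OF True] R1 s(2) elim(2) by simp
        next
          case False
          then have lt: "s < \<theta>" using elim(3) by simp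
          then show ?thesis using D(2)[OF lt] R2 s(2) elim(2) by simp
        qed
      qed
    qed
  qed
  finally show ?thesis .
qed

text \<open>As in \<open>Phi1_nonneg\<close>, but the first block now acts on Z1(\<beta>)
  f(\<beta>), which varies with \<beta>. Its own square gives the multiplier \<open>M\<close>, and
  its products with the half integrals give the two terms of \<open>N1\<close> that carry no
  integral.\<close>

proposition Phi2_nonneg:
  fixes M :: "real \<Rightarrow> real^'n::finite^'n"
  assumes Phi2: "(M, N1, N2) \<in> Phi2 L" and f: "f \<in> L2 {0..L}"
  shows "0 \<le> integ 0 L (\<lambda>s. f s \<bullet> (M s *v f s)) + kform L (\<lambda>s \<theta>. if \<theta> \<le> s then N1 s \<theta> else N2 s \<theta>) f f"
proof -
  interpret finite_measure "lebesgue_on {0..L}" by (rule finite_measure_Icc)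
  obtain d1 d and Z1 :: "real \<Rightarrow> nat \<Rightarrow> real^'n" and Z :: "real \<Rightarrow> real \<Rightarrow> nat \<Rightarrow> real^'n"
      and T :: "nat + nat + nat \<Rightarrow> nat + nat + nat \<Rightarrow> real" where
    Z1: "\<forall>i<d1. bounded_measurable_on {0..L} (\<lambda>s. Z1 s i)"
    and Z: "\<forall>i<d. bounded_measurable_on ({0..L} \<times> {0..L}) (\<lambda>(s, \<theta>). Z s \<theta> i)"
    and T: "psd_on ({..<d1} <+> double d) T"
    and M: "\<forall>s\<in>{0..L}. M s = congr_prod d1 d1 (Z1 s) (\<lambda>i j. T (b1 i) (b1 j)) (Z1 s)"
    and N1: "\<forall>s\<in>{0..L}. \<forall>\<theta>\<in>{0..L}. \<theta> \<le> s \<longrightarrow> N1 s \<theta> =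
            congr_prod d1 d (Z1 s) (\<lambda>i j. T (b1 i) (b2 j)) (Z s \<theta>)
          + congr_prod d d1 (Z \<theta> s) (\<lambda>i j. T (b3 i) (b1 j)) (Z1 \<theta>)
          + integ s L (\<lambda>\<beta>. congr_prod d d (Z \<beta> s) (\<lambda>i j. T (b2 i) (b2 j)) (Z \<beta> \<theta>))
          + integ \<theta> s (\<lambda>\<beta>. congr_prod d d (Z \<beta> s) (\<lambda>i j. T (b3 i) (b2 j)) (Z \<beta> \<theta>))
          + integ 0 \<theta> (\<lambda>\<beta>. congr_prod d d (Z \<beta> s) (\<lambda>i j. T (b3 i) (b3 j)) (Z \<beta> \<theta>))"
    and N2: "\<forall>s\<in>{0..L}. \<forall>\<theta>\<in>{0..L}. s \<le> \<theta> \<longrightarrow> N2 s \<theta> = transpose (N1 \<theta> s)"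
    using Phi2 unfolding Phi2_def mem_Collect_eq prod.case by (elim exE conjE) (rule that; assumption)
  obtain Z' where Z': "\<forall>i<d. bdd_kernel L (\<lambda>s \<theta>. Z' s \<theta> i)"
    and ae1: "AE s in lebesgue_on {0..L}. AE \<theta> in lebesgue_on {0..L}. \<forall>i<d. Z s \<theta> i = Z' s \<theta> i"
    and ae: "AE \<theta> in lebesgue_on {0..L}. AE s in lebesgue_on {0..L}. \<forall>i<d. Z s \<theta> i = Z' s \<theta> i"
    using kernel_representative[OF Z] by blast
  have sp: "AE s in lebesgue_on {0..L}. s \<in> {0..L}" using AE_space[of "lebesgue_on {0..L}"] by simp
  have fi: "integrable (lebesgue_on {0..L}) f" using f by (rule L2_integrable)
  have Z1b: "bdd_meas (lebesgue_on {0..L}) (\<lambda>s. Z1 s i)" if "i < d1" for i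
    using Z1 that by (auto simp: bounded_measurable_on_def bdd_meas_def bounded_iff)
  define T1 where "T1 z = T (Inl (fst z)) (Inr (snd z))" for z
  define T2 where "T2 k l = T (Inr k) (Inr l)" for k l
  have symT: "T x y = T y x" if "x \<in> {..<d1} <+> double d" "y \<in> {..<d1} <+> double d" for x y
    using T that by (simp add: psd_on_def)
  define A where "A i \<beta> = Z1 \<beta> i \<bullet> f \<beta>" for i \<beta>
  define V where "V k \<beta> = integ 0 L (\<lambda>\<theta>. half Z' k \<beta> \<theta> \<bullet> f \<theta>)" for k \<beta>
  have V: "bdd_meas (lebesgue_on {0..L}) (V k)" if "k \<in> double d" for k
    unfolding V_def by (rule kernel_apply_bdd[OF bounded_bilinear_inner half_bdd[OF Z' that] fi])
  have Ai: "integrable (lebesgue_on {0..L}) (A i)" if "i < d1" for i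
    unfolding A_def by (rule bdd_meas_integrable_mult[OF bounded_bilinear_inner Z1b[OF that] fi])
  \<comment> \<open>The one product that is quadratic in pointwise values of \<open>f\<close>, hence
    the place where square integrability enters; in the other products at least one factor is
    bounded. Writing \<open>A i\<close> as a matrix with one row times \<open>f\<close> makes
    \<open>L2_bdd_mult\<close> applicable.\<close>
  have AAi: "integrable (lebesgue_on {0..L}) (\<lambda>\<beta>. A i \<beta> * A j \<beta>)" if ij: "i < d1" "j < d1" for i j
  proof -
    have "(\<lambda>s. outer (1 :: real^1) (Z1 s i) *v f s) \<in> L2 {0..L}" if "i < d1" for i
      by (rule L2_bdd_mult[OF bdd_meas_bilinear[OF bounded_bilinear_outer bdd_meas_const Z1b[OF that]] f])
    from L2_integrable_inner[OF this[OF ij(1)] this[OF ij(2)]]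
    show ?thesis by (simp add: outer_mult_vec A_def inner_vec_def)
  qed
  have AVi: "integrable (lebesgue_on {0..L}) (\<lambda>\<beta>. A i \<beta> * V k \<beta>)" if "i < d1" "k \<in> double d" for i k
    using bdd_meas_integrable_mult[OF bounded_bilinear_mult V[OF that(2)] Ai[OF that(1)]] by (simp add: mult.commute)
  have VVi: "integrable (lebesgue_on {0..L}) (\<lambda>\<beta>. V k \<beta> * V l \<beta>)" if "k \<in> double d" "l \<in> double d" for k l
    by (rule bdd_meas_integrable[OF bdd_meas_bilinear[OF bounded_bilinear_mult V[OF that(1)] V[OF that(2)]]])
  have "0 \<le> integ 0 L (\<lambda>\<beta>. (\<Sum>i<d1. \<Sum>j<d1. T (Inl i) (Inl j) * (A i \<beta> * A j \<beta>))
     + 2 * (\<Sum>i<d1. \<Sum>k\<in>double d. T (Inl i) (Inr k) * (A i \<beta> * V k \<beta>))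
     + (\<Sum>k\<in>double d. \<Sum>l\<in>double d. T (Inr k) (Inr l) * (V k \<beta> * V l \<beta>)))"
    by (intro Bochner_Integration.integral_nonneg psd_on_Plus[OF T]) auto
  also have "\<dots> = (\<Sum>i<d1. \<Sum>j<d1. T (Inl i) (Inl j) * integ 0 L (\<lambda>\<beta>. A i \<beta> * A j \<beta>))
     + 2 * (\<Sum>i<d1. \<Sum>k\<in>double d. T (Inl i) (Inr k) * integ 0 L (\<lambda>\<beta>. A i \<beta> * V k \<beta>))
     + (\<Sum>k\<in>double d. \<Sum>l\<in>double d. T (Inr k) (Inr l) * integ 0 L (\<lambda>\<beta>. V k \<beta> * V l \<beta>))"
  proof -
    have I1: "integrable (lebesgue_on {0..L}) (\<lambda>\<beta>. \<Sum>i\<in>{..<d1}. \<Sum>j\<in>{..<d1}. c i j * (A i \<beta> * A j \<beta>))"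
      "integ 0 L (\<lambda>\<beta>. \<Sum>i\<in>{..<d1}. \<Sum>j\<in>{..<d1}. c i j * (A i \<beta> * A j \<beta>)) = (\<Sum>i\<in>{..<d1}. \<Sum>j\<in>{..<d1}. c i j * integ 0 L (\<lambda>\<beta>. A i \<beta> * A j \<beta>))" for c
      using AAi by (intro integral_double_sum; simp)+
    have I2: "integrable (lebesgue_on {0..L}) (\<lambda>\<beta>. \<Sum>i\<in>{..<d1}. \<Sum>j\<in>double d. c i j * (A i \<beta> * V j \<beta>))"
      "integ 0 L (\<lambda>\<beta>. \<Sum>i\<in>{..<d1}. \<Sum>j\<in>double d. c i j * (A i \<beta> * V j \<beta>)) = (\<Sum>i\<in>{..<d1}. \<Sum>j\<in>double d. c i j * integ 0 L (\<lambda>\<beta>. A i \<beta> * V j \<beta>))" for c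
      using AVi by (intro integral_double_sum; simp)+
    have I3: "integrable (lebesgue_on {0..L}) (\<lambda>\<beta>. \<Sum>i\<in>double d. \<Sum>j\<in>double d. c i j * (V i \<beta> * V j \<beta>))"
      "integ 0 L (\<lambda>\<beta>. \<Sum>i\<in>double d. \<Sum>j\<in>double d. c i j * (V i \<beta> * V j \<beta>)) = (\<Sum>i\<in>double d. \<Sum>j\<in>double d. c i j * integ 0 L (\<lambda>\<beta>. V i \<beta> * V j \<beta>))" for c
      using VVi by (intro integral_double_sum; simp)+
    show ?thesis by (simp add: I1 I2 I3)
  qed
  also have "(\<Sum>i<d1. \<Sum>j<d1. T (Inl i) (Inl j) * integ 0 L (\<lambda>\<beta>. A i \<beta> * A j \<beta>)) = integ 0 L (\<lambda>s. f s \<bullet> (M s *v f s))"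
  proof -
    have "integ 0 L (\<lambda>s. f s \<bullet> (M s *v f s)) = integ 0 L (\<lambda>\<beta>. \<Sum>i<d1. \<Sum>j<d1. T (Inl i) (Inl j) * (A i \<beta> * A j \<beta>))"
      using M by (intro Bochner_Integration.integral_cong refl) (simp add: dot_congr_prod A_def)
    also have "\<dots> = (\<Sum>i<d1. \<Sum>j<d1. T (Inl i) (Inl j) * integ 0 L (\<lambda>\<beta>. A i \<beta> * A j \<beta>))"
      using AAi by (intro integral_double_sum(2)) auto
    finally show ?thesis by simp
  qed
  also have "(\<Sum>k\<in>double d. \<Sum>l\<in>double d. T (Inr k) (Inr l) * integ 0 L (\<lambda>\<beta>. V k \<beta> * V l \<beta>))
      = kform L (dkern L d T2 Z') f f"
    unfolding V_def T2_def by (rule kform_dkern[OF Z' fi])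
  finally have "0 \<le> integ 0 L (\<lambda>s. f s \<bullet> (M s *v f s))
      + 2 * (\<Sum>i<d1. \<Sum>k\<in>double d. T (Inl i) (Inr k) * integ 0 L (\<lambda>\<beta>. A i \<beta> * V k \<beta>))
      + kform L (dkern L d T2 Z') f f" .
  moreover have "2 * (\<Sum>i<d1. \<Sum>k\<in>double d. T (Inl i) (Inr k) * integ 0 L (\<lambda>\<beta>. A i \<beta> * V k \<beta>))
      + kform L (dkern L d T2 Z') f f = kform L (\<lambda>s \<theta>. if \<theta> \<le> s then N1 s \<theta> else N2 s \<theta>) f f"
  proof -
    \<comment> \<open>The kernel of the integral of \<open>A i * V k\<close>. The cross terms occur
      twice in the form, so their kernel \<open>C\<close> may be replaced by \<open>C\<close> plus
      its transpose \<open>CT\<close>, which yields a symmetric kernel to compare with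
      \<open>N1\<close> and \<open>N2\<close>.\<close>
    define K where "K z s \<theta> = outer (Z1 s (fst z)) (half Z' (snd z) s \<theta>)" for z s \<theta>
    define C where "C s \<theta> = (\<Sum>z\<in>{..<d1} \<times> double d. T1 z *\<^sub>R K z s \<theta>)" for s \<theta>
    define CT where "CT s \<theta> = transpose (C \<theta> s)" for s \<theta>
    have Kb: "bdd_kernel L (K z)" if "z \<in> {..<d1} \<times> double d" for z
    proof -
      have z: "fst z < d1" "snd z \<in> double d" using that by auto
      show ?thesis unfolding K_def
        by (intro bdd_meas_bilinear[OF bounded_bilinear_outer] half_bdd[OF Z' z(2)]
            bdd_meas_compose[OF Z1b[OF z(1)] measurable_fst])
    qed
    have Cb: "bdd_kernel L C"
      unfolding C_def by (intro bdd_meas_sum bdd_meas_scaleR_const Kb)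
    have CTb: "bdd_kernel L CT"
      unfolding CT_def by (rule bdd_meas_linear[OF bounded_linear_transpose bdd_meas_swap[OF Cb]])
    have kf: "kform L (K (i, k)) f f = integ 0 L (\<lambda>\<beta>. A i \<beta> * V k \<beta>)" if ik: "i < d1" "k \<in> double d" for i k
      unfolding kform_def
    proof (intro Bochner_Integration.integral_cong refl)
      fix s assume s: "s \<in> space (lebesgue_on {0..L})"
      have "integrable (lebesgue_on {0..L}) (\<lambda>\<theta>. half Z' k s \<theta> \<bullet> f \<theta>)"
        by (rule bdd_meas_integrable_mult[OF bounded_bilinear_inner bdd_meas_section1[OF half_bdd[OF Z' ik(2)] s] fi])
      then show "f s \<bullet> integ 0 L (\<lambda>\<theta>. K (i, k) s \<theta> *v f \<theta>) = A i s * V k s"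
        by (simp add: K_def outer_mult_vec A_def V_def inner_commute mult.commute)
    qed
    have "(\<Sum>i<d1. \<Sum>k\<in>double d. T (Inl i) (Inr k) * integ 0 L (\<lambda>\<beta>. A i \<beta> * V k \<beta>))
        = (\<Sum>z\<in>{..<d1} \<times> double d. T1 z * kform L (K z) f f)"
      unfolding sum.cartesian_product by (intro sum.cong refl, erule SigmaE) (simp add: T1_def kf)
    also have "\<dots> = kform L C f f"
      unfolding C_def by (rule kform_sum[symmetric, OF Kb fi fi])
    finally have C: "(\<Sum>i<d1. \<Sum>k\<in>double d. T (Inl i) (Inr k) * integ 0 L (\<lambda>\<beta>. A i \<beta> * V k \<beta>)) = kform L C f f" .
    have T2sym: "T2 k l = T2 l k" if "k \<in> double d" "l \<in> double d" for k l
      unfolding T2_def by (intro symT InrI that)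
    define K0 where "K0 s \<theta> = C s \<theta> + CT s \<theta> + dkern L d T2 Z' s \<theta>" for s \<theta>
    have K0T: "transpose (K0 s \<theta>) = K0 \<theta> s" if "s \<in> {0..L}" "\<theta> \<in> {0..L}" for s \<theta>
      using that dkern_transpose[OF T2sym Z' that]
      by (simp add: K0_def CT_def linear_add[OF bounded_linear.linear[OF bounded_linear_transpose]])
    \<comment> \<open>Below the diagonal C(s,\<theta>) meets only the second block, since the other
      half kernel vanishes there, while C(\<theta>,s) meets only the third. They are the terms with
      T12 and, after transposition, T31.\<close>
    have lower: "K0 s \<theta> = N1 s \<theta>"
      if st: "s \<in> {0..L}" "\<theta> \<in> {0..L}" "\<theta> < s"
        and good: "AE \<beta> in lebesgue_on {0..L}. \<forall>i<d. Z \<beta> s i = Z' \<beta> s i"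
          "AE \<beta> in lebesgue_on {0..L}. \<forall>i<d. Z \<beta> \<theta> i = Z' \<beta> \<theta> i"
          "\<forall>i<d. Z s \<theta> i = Z' s \<theta> i" "\<forall>i<d. Z \<theta> s i = Z' \<theta> s i" for s \<theta>
    proof -
      have o0: "outer a (0 :: real^'n) = (0 :: real^'n^'n)" for a by (simp add: outer_def vec_eq_iff)
      have Ceq: "C a b = (\<Sum>i<d1. \<Sum>k\<in>double d. T (Inl i) (Inr k) *\<^sub>R outer (Z1 a i) (half Z' k a b))" for a b
        by (simp add: C_def K_def T1_def sum.cartesian_product case_prod_beta')
      have c1: "C s \<theta> = congr_prod d1 d (Z1 s) (\<lambda>i j. T (b1 i) (b2 j)) (Z s \<theta>)"
        using st good(3) by (simp add: Ceq congr_prod_outer sum.Plus half_def o0)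
      have c2: "C \<theta> s = congr_prod d1 d (Z1 \<theta>) (\<lambda>i j. T (b1 i) (b3 j)) (Z \<theta> s)"
        using st good(4) by (simp add: Ceq congr_prod_outer sum.Plus half_def o0)
      have "CT s \<theta> = congr_prod d d1 (Z \<theta> s) (\<lambda>i j. T (b1 j) (b3 i)) (Z1 \<theta>)"
        unfolding CT_def c2 transpose_congr_prod ..
      also have "\<dots> = congr_prod d d1 (Z \<theta> s) (\<lambda>i j. T (b3 i) (b1 j)) (Z1 \<theta>)"
        unfolding congr_prod_outer
        by (intro sum.cong refl arg_cong2[where f="(*\<^sub>R)"] symT InrI InlI)
      finally show ?thesis
        using N1 st dkern_eq(1)[where Z=Z and T=T2, OF Z' st(1,2) good(1,2) st(3)] by (simp add: K0_def c1 T2_def)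
    qed
    have "kform L (\<lambda>s \<theta>. if \<theta> \<le> s then N1 s \<theta> else N2 s \<theta>) f f = kform L K0 f f"
    proof (rule kform_cong_AE)
      show "AE s in lebesgue_on {0..L}. AE \<theta> in lebesgue_on {0..L}.
        (if \<theta> \<le> s then N1 s \<theta> else N2 s \<theta>) = K0 s \<theta>"
        using ae ae1 sp
      proof eventually_elim
        case (elim s)
        note s = elim
        show ?case using s(1,2) ae sp AE_neq_lebesgue_on[of s]
        proof eventually_elim
          case (elim \<theta>)
          show ?case
          proof (cases "\<theta> < s")
            case True
            then show ?thesis using lower[of s \<theta>] s elim by simp
          next
            case False
            then have lt: "s < \<theta>" using elim by simp
            \<comment> \<open>Above the diagonal nothing is computed anew: \<open>K0\<close> is
              symmetric and \<open>N2\<close> is by definition the transposed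
              \<open>N1\<close>.\<close>
            have "K0 s \<theta> = transpose (K0 \<theta> s)" using K0T s elim by simp
            also have "K0 \<theta> s = N1 \<theta> s" using lower[of \<theta> s] s elim lt by simp
            finally show ?thesis using lt N2 s elim by simp
          qed
        qed
      qed
    qed
    also have "\<dots> = kform L (\<lambda>s \<theta>. C s \<theta> + CT s \<theta>) f f + kform L (dkern L d T2 Z') f f"
      unfolding K0_def by (rule kform_add[OF bdd_meas_add[OF Cb CTb] dkern_bdd[OF Z'] fi fi])
    also have "kform L (\<lambda>s \<theta>. C s \<theta> + CT s \<theta>) f f = 2 * kform L C f f"
      using kform_add[OF Cb CTb fi fi] kform_transpose[OF Cb fi fi] by (simp add: CT_def)
    finally show ?thesis using C by simp
  qed
  ultimately show ?thesis by linarith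
qed

subsection \<open>The state as a function of its second derivative\<close>

lemma sum_UNIV_Plus:
  "(\<Sum>i\<in>(UNIV :: ('a::finite + 'b::finite) set). g i) = (\<Sum>i\<in>UNIV. g (Inl i)) + (\<Sum>i\<in>UNIV. g (Inr i))"
  by (simp add: UNIV_Plus_UNIV[symmetric] sum.Plus del: UNIV_Plus_UNIV)

lemma vstack_mult: "vstack A B ** C = vstack (A ** C) (B ** C)"
  by (auto simp: vstack_def matrix_matrix_mult_def vec_eq_iff split: sum.splits)

lemma vstack_mult_vec: "vstack A B *v x = vstack (A *v x) (B *v x)"
  by (auto simp: vstack_def matrix_vector_mult_def vec_eq_iff split: sum.splits)

lemma hstack_mult: "hstack A B ** vstack X Y = A ** X + B ** Y"
  by (simp add: vstack_def hstack_def matrix_matrix_mult_def vec_eq_iff sum_UNIV_Plus)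

lemma hstack_mult_vec: "hstack A B *v vstack x y = A *v x + B *v y"
  by (simp add: vstack_def hstack_def matrix_vector_mult_def vec_eq_iff sum_UNIV_Plus)

lemma mult_vstack: "A ** vstack X Y = left_block A ** X + right_block A ** Y"
  by (simp add: vstack_def left_block_def right_block_def matrix_matrix_mult_def vec_eq_iff sum_UNIV_Plus)

lemma scalar_mat_mult_vec: "scalar_mat c *v x = c *\<^sub>R (x :: real^'n::finite)"
  by (simp add: scaleR_matrix_vector_assoc[symmetric])

lemma scalar_mat_mult: "scalar_mat c ** A = c *\<^sub>R (A :: real^'k::finite^'n::finite)"
  by (simp add: scalar_matrix_assoc[symmetric])

lemma mult_scalar_mat: "A ** scalar_mat c = c *\<^sub>R (A :: real^'n::finite^'k::finite)"
  by (simp add: matrix_scalar_ac scalar_matrix_assoc[symmetric])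

lemma matrix_mult_uminus_left: "(- A) ** B = - (A ** (B :: real^'k::finite^'n::finite))"
  by (simp add: matrix_matrix_mult_def vec_eq_iff sum_negf)

lemma left_block_add: "left_block (A + B) = left_block A + left_block B"
  and right_block_add: "right_block (A + B) = right_block A + right_block B"
  and left_block_scaleR: "left_block (c *\<^sub>R C) = c *\<^sub>R left_block C"
  and right_block_scaleR: "right_block (c *\<^sub>R C) = c *\<^sub>R right_block C"
  by (simp_all add: left_block_def right_block_def vec_eq_iff)

text \<open>Connects the two notations of the definitions: the matrix \<open>Bc\<close> in the Green
  kernels is \<open>B3\<close> applied to the column with blocks (L - \<eta>) I and I, so
  multiplying it by the rows [I, s I] and [0, I] produces the \<open>Ba\<close> and
  \<open>Bb\<close> of the maps \<open>map_L1\<close> to \<open>map_L3\<close>.\<close>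

lemma Bc_eq: "Bc S \<eta> = B3 S ** vstack (scalar_mat (len S - \<eta>)) (mat 1)"
  unfolding Bc_def B3_def matrix_mult_uminus_left vstack4_def
  by (simp add: matrix_mul_assoc[symmetric] vstack_mult hstack_mult scalar_matrix_assoc[symmetric])

lemma Ba_eq: "hstack (mat 1) (scalar_mat s) ** Bc S \<eta> = Ba S s \<eta>"
  unfolding Bc_eq matrix_mul_assoc unfolding mult_vstack by (simp add: Ba_def B4_def B5_def mult_scalar_mat)

lemma Bb_eq: "hstack 0 (mat 1) ** Bc S \<eta> = Bb S \<eta>"
  unfolding Bc_eq matrix_mul_assoc unfolding mult_vstack by (simp add: Bb_def B6_def B7_def mult_scalar_mat)

lemma Gker_eq: "Gker S s \<eta> = Ba S s \<eta> + scalar_mat (step (s - \<eta>) * (s - \<eta>))"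
  by (simp add: Gker_def Ba_eq)

lemma Gker'_eq: "Gker' S s \<eta> = Bb S \<eta> + scalar_mat (step (s - \<eta>))"
  by (simp add: Gker'_def Bb_eq)

lemma hstack_affine: "hstack (mat 1) (scalar_mat s) = hstack (mat 1) 0 + s *\<^sub>R hstack 0 (mat 1 :: real^'n::finite^'n)"
  by (auto simp: hstack_def vstack_def vec_eq_iff split: sum.splits)

text \<open>Makes the dependence on \<open>s\<close>, hidden in the blocks \<open>B4\<close> and
  \<open>B5\<close>, explicit, so that boundedness and measurability follow from those of the
  coordinates.\<close>

lemma Ba_affine: "Ba S s \<eta> = (len S - \<eta>) *\<^sub>R (B4 S 0 + s *\<^sub>R B6 S) + (B5 S 0 + s *\<^sub>R B7 S)"
  unfolding Ba_def B4_def B5_def B6_def B7_def hstack_affine[of s] hstack_affine[of 0]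
  by (simp add: scalar_matrix_assoc[symmetric] left_block_add right_block_add
      left_block_scaleR right_block_scaleR bounded_bilinear.add_left[OF bounded_bilinear_matrix_matrix_mult])

section \<open>The Green kernels are bounded and measurable\<close>

lemma bdd_kernel_coord:
  "bdd_kernel L (\<lambda>s \<theta>. s)" "bdd_kernel L (\<lambda>s \<theta>. \<theta>)" if "0 < L"
proof -
  note idm = ident_measurable_lebesgue_on[of "{0..L}"]
  have "bdd_meas (lebesgue_on {0..L}) (\<lambda>x. x)"
    unfolding bdd_meas_def using idm by (intro conjI exI[of _ L]) auto
  then show "bdd_kernel L (\<lambda>s \<theta>. s)" "bdd_kernel L (\<lambda>s \<theta>. \<theta>)"
    by (auto intro: bdd_meas_compose)
qed

lemma bdd_kernel_diff: "bdd_kernel L f \<Longrightarrow> bdd_kernel L g \<Longrightarrow> bdd_kernel L (\<lambda>s \<theta>. f s \<theta> - g s \<theta> :: 'a::euclidean_space)"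
  using bdd_meas_add[OF _ bdd_meas_scaleR_const[of _ "\<lambda>p. g (fst p) (snd p)" "-1"]] by fastforce

lemma bdd_kernel_step: "0 < L \<Longrightarrow> bdd_kernel L (\<lambda>s \<theta>. step (s - \<theta>))"
  unfolding step_def using pred_le_lebesgue_on[of L]
  by (intro bdd_meas_If bdd_meas_const) simp_all

lemma bdd_kernel_Ba: "0 < L \<Longrightarrow> bdd_kernel L (Ba S)"
  unfolding Ba_affine
  by (intro bdd_meas_add bdd_meas_bilinear[OF bounded_bilinear_scaleR] bdd_kernel_diff[unfolded fst_conv]
      bdd_kernel_coord bdd_meas_const)

lemma bdd_kernel_Bb: "0 < L \<Longrightarrow> bdd_kernel L (\<lambda>s. Bb S)"
  unfolding Bb_def
  by (intro bdd_meas_add bdd_meas_bilinear[OF bounded_bilinear_scaleR] bdd_kernel_diff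
      bdd_kernel_coord bdd_meas_const)

lemma bdd_kernel_scalar_mat:
  "bdd_kernel L f \<Longrightarrow> bdd_kernel L (\<lambda>s \<theta>. scalar_mat (f s \<theta>) :: real^'n::finite^'n)"
  by (intro bdd_meas_bilinear[OF bounded_bilinear_scaleR] bdd_meas_const)

lemma bdd_kernel_Gker: "0 < L \<Longrightarrow> bdd_kernel L (Gker S)"
  unfolding Gker_eq
  by (intro bdd_meas_add bdd_kernel_Ba bdd_kernel_scalar_mat bdd_meas_bilinear[OF bounded_bilinear_mult]
      bdd_kernel_step bdd_kernel_diff bdd_kernel_coord)

lemma bdd_kernel_Gker': "0 < L \<Longrightarrow> bdd_kernel L (Gker' S)"
  unfolding Gker'_eq
  by (intro bdd_meas_add bdd_kernel_Bb bdd_kernel_scalar_mat bdd_kernel_step)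

lemma bdd_meas_continuous_on:
  fixes f :: "real \<Rightarrow> 'a::euclidean_space"
  assumes "continuous_on {a..b} f" shows "bdd_meas (lebesgue_on {a..b}) f"
proof -
  have "f \<in> borel_measurable (lebesgue_on {a..b})"
    using assms by (rule continuous_imp_measurable_on_sets_lebesgue) simp
  moreover have "bounded (f ` {a..b})"
    by (intro compact_imp_bounded compact_continuous_image assms compact_Icc)
  ultimately show ?thesis by (auto simp: bdd_meas_def bounded_iff)
qed

lemma bdd_meas_vstack4:
  "bdd_meas (lebesgue_on {a..b::real}) (\<lambda>\<eta>. vstack4 0 (scalar_mat (L - \<eta>)) 0 (mat 1 :: real^'n::finite^'n))"
proof (rule bdd_meas_continuous_on)
  have "vstack4 0 (scalar_mat (L - \<eta>)) 0 (mat 1 :: real^'n^'n)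
      = vstack4 0 0 0 (mat 1) + (L - \<eta>) *\<^sub>R vstack4 0 (mat 1) 0 0" for \<eta>
    by (auto simp: vstack4_def vstack_def vec_eq_iff split: sum.splits)
  then show "continuous_on {a..b} (\<lambda>\<eta>. vstack4 0 (scalar_mat (L - \<eta>)) 0 (mat 1 :: real^'n^'n))"
    by (simp add: continuous_intros)
qed

text \<open>Cauchy's formula for the repeated integral: exchanging the integrations over \<eta>
  \<le> r \<le> s leaves the length s - \<eta> of the range of \<open>r\<close> as the
  kernel.\<close>

lemma primitive_primitive:
  fixes u :: "real \<Rightarrow> real^'n::finite"
  assumes L: "0 < L" and u: "integrable (lebesgue_on {0..L}) u" and s: "s \<in> {0..L}"
  shows "integ 0 s (\<lambda>r. integ 0 r u) = integ 0 L (\<lambda>\<eta>. (step (s - \<eta>) * (s - \<eta>)) *\<^sub>R u \<eta>)"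
proof -
  interpret finite_measure "lebesgue_on {0..L}" by (rule finite_measure_Icc)
  let ?M = "lebesgue_on {0..L}"
  have "integ 0 s (\<lambda>r. integ 0 r u) = integ 0 L (\<lambda>r. indicator {0..s} r *\<^sub>R integ 0 r u)"
    using s by (intro integ_eq_indicator) auto
  \<comment> \<open>Scalars are written as scalar matrices so that \<open>kernel_mult\<close>
    performs the exchange.\<close>
  also have "\<dots> = integ 0 L (\<lambda>r. scalar_mat (indicator {0..s} r) *v integ 0 L (\<lambda>\<eta>. scalar_mat (step (r - \<eta>)) *v u \<eta>))"
  proof (intro Bochner_Integration.integral_cong refl)
    fix r assume "r \<in> space ?M"
    then have "integ 0 r u = integ 0 L (\<lambda>\<eta>. indicator {0..r} \<eta> *\<^sub>R u \<eta>)" by (intro integ_eq_indicator) auto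
    also have "\<dots> = integ 0 L (\<lambda>\<eta>. scalar_mat (step (r - \<eta>)) *v u \<eta>)"
      by (intro Bochner_Integration.integral_cong refl) (auto simp: step_def indicator_def scalar_mat_mult_vec)
    finally show "indicator {0..s} r *\<^sub>R integ 0 r u
      = scalar_mat (indicator {0..s} r) *v integ 0 L (\<lambda>\<eta>. scalar_mat (step (r - \<eta>)) *v u \<eta>)"
      by (simp add: scalar_mat_mult_vec)
  qed
  also have "\<dots> = integ 0 L (\<lambda>\<eta>. integ 0 L (\<lambda>r. scalar_mat (indicator {0..s} r) ** (scalar_mat (step (r - \<eta>)) :: real^'n^'n)) *v u \<eta>)"
    by (rule kernel_mult[OF bdd_meas_bilinear[OF bounded_bilinear_scaleR bdd_meas_indicator bdd_meas_const]
       bdd_kernel_scalar_mat[OF bdd_kernel_step[OF L]] u])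
  also have "\<dots> = integ 0 L (\<lambda>\<eta>. (step (s - \<eta>) * (s - \<eta>)) *\<^sub>R u \<eta>)"
  proof (intro Bochner_Integration.integral_cong refl)
    fix \<eta> assume e: "\<eta> \<in> space ?M"
    have "integ 0 L (\<lambda>r. scalar_mat (indicator {0..s} r) ** (scalar_mat (step (r - \<eta>)) :: real^'n^'n))
        = integ 0 L (\<lambda>r. indicator {\<eta>..s} r *\<^sub>R mat 1)"
      using e by (intro Bochner_Integration.integral_cong refl)
         (auto simp: scalar_mat_mult step_def indicator_def)
    also have "\<dots> = integ \<eta> s (\<lambda>_. mat 1)"
      using e s by (intro integ_eq_indicator[symmetric]) auto
    also have "\<dots> = scalar_mat (step (s - \<eta>) * (s - \<eta>))"
      by (auto simp: step_def measure_restrict_space)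
    finally show "integ 0 L (\<lambda>r. scalar_mat (indicator {0..s} r) ** (scalar_mat (step (r - \<eta>)) :: real^'n^'n)) *v u \<eta>
        = (step (s - \<eta>) * (s - \<eta>)) *\<^sub>R u \<eta>" by (simp add: scalar_mat_mult_vec)
  qed
  finally show ?thesis .
qed

text \<open>Two integrations give f(s) = c0 + s c1 plus the second primitive of \<open>u\<close>,
  with c0 and c1 the values of \<open>f\<close> and its derivative at 0. The boundary condition
  becomes a linear equation for (c0, c1) with matrix \<open>B2\<close> and a right-hand side linear
  in \<open>u\<close>; solving it expresses everything as an integral against \<open>u\<close>, and
  the step parts of \<open>Gker\<close> and \<open>Gker'\<close> come from the primitives.\<close>

proposition X_space_representation:
  fixes S :: "('n::finite, 'm::finite, 'q::finite) pde_system"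
  assumes adm: "admissible_data S" and f: "f \<in> X_space S"
  defines "f1 \<equiv> weak_deriv (len S) f"
  defines "u \<equiv> weak_deriv (len S) f1"
  shows "f1 \<in> L2 {0..len S}" "u \<in> L2 {0..len S}"
    and "AE s in lebesgue_on {0..len S}. f s = integ 0 (len S) (\<lambda>\<eta>. Gker S s \<eta> *v u \<eta>)"
    and "AE s in lebesgue_on {0..len S}. f1 s = integ 0 (len S) (\<lambda>\<eta>. Gker' S s \<eta> *v u \<eta>)"
    and "boundary_values (len S) f = integ 0 (len S)
        (\<lambda>\<eta>. (bnd_mat (len S) ** Bc S \<eta> + vstack4 0 (scalar_mat (len S - \<eta>)) 0 (mat 1)) *v u \<eta>)"
proof -
  define L where "L = len S"
  let ?M = "lebesgue_on {0..L}"
  interpret finite_measure ?M by (rule finite_measure_Icc)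
  have L: "0 < L" and inv: "invertible (B2 S)" using adm by (auto simp: admissible_data_def L_def)
  have "\<exists>g. g \<in> L2 {0..L} \<and> has_weak_deriv L f g"
    using f by (auto simp: X_space_def weakly_L2_differentiable_def L_def)
  from someI_ex[OF this] have f1: "f1 \<in> L2 {0..L}" "has_weak_deriv L f f1"
    by (auto simp: f1_def weak_deriv_def L_def)
  have "\<exists>g. g \<in> L2 {0..L} \<and> has_weak_deriv L f1 g"
    using f by (auto simp: X_space_def weakly_L2_differentiable_def L_def f1_def)
  from someI_ex[OF this] have u: "u \<in> L2 {0..L}" "has_weak_deriv L f1 u"
    by (auto simp: u_def weak_deriv_def L_def)
  have fL2: "f \<in> L2 {0..L}" and bc: "Bbc S *v boundary_values L f = 0"
    using f by (auto simp: X_space_def L_def)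
  have fi: "integrable ?M f" "integrable ?M f1" and ui: "integrable ?M u" using fL2 f1(1) u(1) by (auto intro: L2_integrable)
  obtain c0 where c0: "AE s in ?M. c0 + integ 0 s f1 = f s"
      "\<And>a. a \<in> {0..L} \<Longrightarrow> point_value L f a = c0 + integ 0 a f1"
    by (rule weak_deriv_primitive[OF L fi(1,2) f1(2)]) blast
  obtain c1 where c1: "AE s in ?M. c1 + integ 0 s u = f1 s"
      "\<And>a. a \<in> {0..L} \<Longrightarrow> point_value L f1 a = c1 + integ 0 a u"
    by (rule weak_deriv_primitive[OF L fi(2) ui u(2)]) blast
  have pu: "integrable (lebesgue_on {0..s}) (\<lambda>r. integ 0 r u)" if "s \<in> {0..L}" for s
    using continuous_on_subset[OF continuous_on_primitive[OF ui]] that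
    by (intro continuous_imp_integrable_real) auto
  have if1: "integ 0 s f1 = s *\<^sub>R c1 + integ 0 L (\<lambda>\<eta>. (step (s - \<eta>) * (s - \<eta>)) *\<^sub>R u \<eta>)" if s: "s \<in> {0..L}" for s
  proof -
    have "AE r in lebesgue_on {0..s}. f1 r = c1 + integ 0 r u"
      using c1(1) s by (auto simp: AE_restrict_space_iff elim!: eventually_mono)
    then have "integ 0 s f1 = integ 0 s (\<lambda>r. c1 + integ 0 r u)"
      by (intro integral_cong_AE_lebesgue_on) auto
    also have "\<dots> = s *\<^sub>R c1 + integ 0 s (\<lambda>r. integ 0 r u)"
      using pu[OF s] s by (subst Bochner_Integration.integral_add)
        (auto simp: measure_restrict_space finite_measure.integrable_const finite_measure_Icc)
    finally show ?thesis using primitive_primitive[OF L ui s] by simp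
  qed
  have iu: "integ 0 s u = integ 0 L (\<lambda>\<eta>. step (s - \<eta>) *\<^sub>R u \<eta>)" if "s \<in> {0..L}" for s
    using that by (subst integ_eq_indicator[of 0 s L])
      (auto simp: step_def indicator_def intro!: Bochner_Integration.integral_cong)
  define V where "V \<eta> = vstack4 0 (scalar_mat (L - \<eta>)) 0 (mat 1 :: real^'n^'n)" for \<eta>
  \<comment> \<open>The point values at 0 involve integrals over the single point
    \<open>{0}\<close>.\<close>
  have bnd0: "integral\<^sup>L (lebesgue_on {0}) g = 0" for g :: "real \<Rightarrow> real^'n"
    by (rule integral_eq_zero_null_sets) (simp add: space_restrict_space null_sets_restrict_space)
  have i1: "integrable ?M (\<lambda>\<eta>. (L - \<eta>) *\<^sub>R u \<eta>)"
    by (intro integrable_continuous_scaleR ui continuous_intros)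
  have Vm: "bdd_meas ?M V"
    unfolding V_def by (rule bdd_meas_vstack4)
  have Vi: "integrable ?M (\<lambda>\<eta>. V \<eta> *v u \<eta>)"
    by (rule bdd_meas_integrable_mult[OF bounded_bilinear_matrix_vector_mult Vm ui])
  \<comment> \<open>The boundary vector splits into the part of the affine function with
    coefficients c0, c1 and the part of the primitives, which vanishes in the two slots at 0 and
    gives the weights L - \<eta> and 1 at \<open>L\<close>.\<close>
  have bv: "boundary_values L f = bnd_mat L *v vstack c0 c1 + integ 0 L (\<lambda>\<eta>. V \<eta> *v u \<eta>)"
  proof -
    have "integ 0 L (\<lambda>\<eta>. V \<eta> *v u \<eta>) = vstack4 0 (integ 0 L (\<lambda>\<eta>. (L - \<eta>) *\<^sub>R u \<eta>)) 0 (integ 0 L u)"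
    proof (rule vec_eq_iff[THEN iffD2], rule allI)
      fix i
      have Vu: "V \<eta> *v u \<eta> = vstack4 0 ((L - \<eta>) *\<^sub>R u \<eta>) 0 (u \<eta>)" for \<eta>
        by (simp add: V_def vstack4_def vstack_mult_vec scalar_mat_mult_vec)
      have "integ 0 L (\<lambda>\<eta>. V \<eta> *v u \<eta>) $ i = integ 0 L (\<lambda>\<eta>. (V \<eta> *v u \<eta>) $ i)"
        using integral_bounded_linear[OF bounded_linear_vec_nth Vi] by simp
      also have "\<dots> = vstack4 0 (integ 0 L (\<lambda>\<eta>. (L - \<eta>) *\<^sub>R u \<eta>)) 0 (integ 0 L u) $ i"
        using integral_bounded_linear[OF bounded_linear_vec_nth i1] integral_bounded_linear[OF bounded_linear_vec_nth ui]
        by (auto simp: Vu vstack4_def vstack_def split: sum.splits)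
      finally show "integ 0 L (\<lambda>\<eta>. V \<eta> *v u \<eta>) $ i = vstack4 0 (integ 0 L (\<lambda>\<eta>. (L - \<eta>) *\<^sub>R u \<eta>)) 0 (integ 0 L u) $ i" .
    qed
    moreover have "integ 0 L (\<lambda>\<eta>. (step (L - \<eta>) * (L - \<eta>)) *\<^sub>R u \<eta>) = integ 0 L (\<lambda>\<eta>. (L - \<eta>) *\<^sub>R u \<eta>)"
      by (intro Bochner_Integration.integral_cong refl) (auto simp: step_def)
    moreover have "bnd_mat L *v vstack c0 c1 = vstack4 c0 (c0 + L *\<^sub>R c1) c1 c1"
      by (simp add: bnd_mat_def vstack4_def vstack_mult_vec hstack_mult_vec scalar_mat_mult_vec)
    moreover have "vstack4 a b c d + vstack4 a' b' c' d' = vstack4 (a + a') (b + b') (c + c') (d + d')"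
      for a b c d a' b' c' d' :: "real^'n"
      by (auto simp: vstack4_def vstack_def vec_eq_iff split: sum.splits)
    ultimately show ?thesis
      using c0(2)[of 0] c0(2)[of L] c1(2)[of 0] c1(2)[of L] if1[of L] L
      by (simp add: boundary_values_def f1_def[folded L_def, symmetric] bnd0 add.assoc)
  qed
  have Bc: "Bc S \<eta> = - (matrix_inv (B2 S) ** Bbc S) ** V \<eta>" for \<eta>
    by (simp add: Bc_def V_def L_def matrix_mult_uminus_left)
  \<comment> \<open>The only use of the boundary condition: it determines c0 and c1 because
    \<open>B2\<close> is invertible.\<close>
  have c01: "vstack c0 c1 = integ 0 L (\<lambda>\<eta>. Bc S \<eta> *v u \<eta>)"
  proof -
    have "B2 S *v vstack c0 c1 + Bbc S *v integ 0 L (\<lambda>\<eta>. V \<eta> *v u \<eta>) = 0"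
      using bc unfolding bv B2_def L_def[symmetric]
      by (simp add: bounded_bilinear.add_right[OF bounded_bilinear_matrix_vector_mult] matrix_vector_mul_assoc)
    then have "B2 S *v vstack c0 c1 = - (Bbc S *v integ 0 L (\<lambda>\<eta>. V \<eta> *v u \<eta>))" by (simp add: eq_neg_iff_add_eq_0)
    then have "matrix_inv (B2 S) *v (B2 S *v vstack c0 c1) = matrix_inv (B2 S) *v (- (Bbc S *v integ 0 L (\<lambda>\<eta>. V \<eta> *v u \<eta>)))"
      by simp
    moreover have "matrix_inv (B2 S) *v (B2 S *v vstack c0 c1) = vstack c0 c1"
    proof -
      have "matrix_inv (B2 S) ** B2 S = mat 1"
        using someI_ex[OF inv[unfolded invertible_def]] by (simp add: matrix_inv_def)
      then show ?thesis by (simp add: matrix_vector_mul_assoc)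
    qed
    ultimately have "vstack c0 c1 = - (matrix_inv (B2 S) ** Bbc S) *v integ 0 L (\<lambda>\<eta>. V \<eta> *v u \<eta>)"
      by (simp add: matrix_vector_mul_assoc bounded_bilinear.minus_left[OF bounded_bilinear_matrix_vector_mult]
          bounded_bilinear.minus_right[OF bounded_bilinear_matrix_vector_mult])
    also have "\<dots> = integ 0 L (\<lambda>\<eta>. (- (matrix_inv (B2 S) ** Bbc S)) *v (V \<eta> *v u \<eta>))"
      by (rule integral_bounded_linear[OF matrix_vector_mul_bounded_linear Vi, symmetric])
    finally show ?thesis by (simp add: Bc matrix_vector_mul_assoc)
  qed
  have Bci: "integrable ?M (\<lambda>\<eta>. Bc S \<eta> *v u \<eta>)"
    unfolding Bc by (intro bdd_meas_integrable_mult[OF bounded_bilinear_matrix_vector_mult _ ui]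
        bdd_meas_bilinear[OF bounded_bilinear_matrix_matrix_mult] bdd_meas_const Vm)
  have row: "H *v vstack c0 c1 = integ 0 L (\<lambda>\<eta>. (H ** Bc S \<eta>) *v u \<eta>)" for H :: "real^('n + 'n)^'k::finite"
    unfolding c01 using integral_bounded_linear[OF matrix_vector_mul_bounded_linear[of H] Bci, symmetric]
    by (simp add: matrix_vector_mul_assoc)
  have rowi: "integrable ?M (\<lambda>\<eta>. (H ** Bc S \<eta>) *v u \<eta>)" for H :: "real^('n + 'n)^'k::finite"
    using integrable_bounded_linear[OF matrix_vector_mul_bounded_linear[of H] Bci]
    by (simp add: matrix_vector_mul_assoc)
  have "\<And>s. s \<in> {0..L} \<Longrightarrow> integrable ?M (\<lambda>\<eta>. scalar_mat (step (s - \<eta>)) *v u \<eta>)"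
    by (rule kernel_row_integrable[OF bdd_kernel_scalar_mat[OF bdd_kernel_step[OF L]] ui])
  then have si: "integrable ?M (\<lambda>\<eta>. step (s - \<eta>) *\<^sub>R u \<eta>)" if "s \<in> {0..L}" for s
    using that by (simp add: scalar_mat_mult_vec)
  have "\<And>s. s \<in> {0..L} \<Longrightarrow> integrable ?M (\<lambda>\<eta>. scalar_mat (step (s - \<eta>) * (s - \<eta>)) *v u \<eta>)"
    by (rule kernel_row_integrable[OF bdd_kernel_scalar_mat[OF bdd_meas_bilinear[OF bounded_bilinear_mult
          bdd_kernel_step[OF L] bdd_kernel_diff[OF bdd_kernel_coord[OF L]]]] ui])
  then have ssi: "integrable ?M (\<lambda>\<eta>. (step (s - \<eta>) * (s - \<eta>)) *\<^sub>R u \<eta>)" if "s \<in> {0..L}" for s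
    using that by (simp add: scalar_mat_mult_vec)
  have sp: "AE s in ?M. s \<in> {0..L}" using AE_space[of ?M] by simp
  have r1: "AE s in ?M. f s = integ 0 L (\<lambda>\<eta>. Gker S s \<eta> *v u \<eta>)"
    using c0(1) sp
  proof eventually_elim
    case (elim s)
    have "f s = hstack (mat 1) (scalar_mat s) *v vstack c0 c1 + integ 0 L (\<lambda>\<eta>. (step (s - \<eta>) * (s - \<eta>)) *\<^sub>R u \<eta>)"
      using elim if1[of s] by (simp add: hstack_mult_vec scalar_mat_mult_vec add.assoc)
    also have "\<dots> = integ 0 L (\<lambda>\<eta>. Gker S s \<eta> *v u \<eta>)"
      unfolding row Gker_def using rowi[of "hstack (mat 1) (scalar_mat s)"] ssi[OF elim(2)]
      by (simp add: matrix_vector_mult_add_rdistrib scalar_mat_mult_vec)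
    finally show ?case .
  qed
  have r2: "AE s in ?M. f1 s = integ 0 L (\<lambda>\<eta>. Gker' S s \<eta> *v u \<eta>)"
    using c1(1) sp
  proof eventually_elim
    case (elim s)
    have "f1 s = hstack 0 (mat 1) *v vstack c0 c1 + integ 0 L (\<lambda>\<eta>. step (s - \<eta>) *\<^sub>R u \<eta>)"
      using elim iu[of s] by (simp add: hstack_mult_vec)
    also have "\<dots> = integ 0 L (\<lambda>\<eta>. Gker' S s \<eta> *v u \<eta>)"
      unfolding row Gker'_def using rowi[of "hstack 0 (mat 1)"] si[OF elim(2)]
      by (simp add: matrix_vector_mult_add_rdistrib scalar_mat_mult_vec)
    finally show ?case .
  qed
  have r3: "boundary_values L f = integ 0 L (\<lambda>\<eta>. (bnd_mat L ** Bc S \<eta> + V \<eta>) *v u \<eta>)"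
    unfolding bv row using rowi[of "bnd_mat L"] Vi by (simp add: matrix_vector_mult_add_rdistrib)
  show "f1 \<in> L2 {0..len S}" "u \<in> L2 {0..len S}" using f1 u by (simp_all add: L_def)
  show "AE s in lebesgue_on {0..len S}. f s = integ 0 (len S) (\<lambda>\<eta>. Gker S s \<eta> *v u \<eta>)"
    "AE s in lebesgue_on {0..len S}. f1 s = integ 0 (len S) (\<lambda>\<eta>. Gker' S s \<eta> *v u \<eta>)"
    "boundary_values (len S) f = integ 0 (len S)
        (\<lambda>\<eta>. (bnd_mat (len S) ** Bc S \<eta> + vstack4 0 (scalar_mat (len S - \<eta>)) 0 (mat 1)) *v u \<eta>)"
    using r1 r2 r3 unfolding V_def L_def .
qed

subsection \<open>The kernels \<open>\<L>\<^sub>1\<close>, \<open>\<L>\<^sub>2\<close>, \<open>\<L>\<^sub>3\<close>\<close>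

lemmas bounded_linear_mult_right = bounded_bilinear.bounded_linear_right[OF bounded_bilinear_matrix_matrix_mult]
lemmas bounded_linear_mult_left = bounded_bilinear.bounded_linear_left[OF bounded_bilinear_matrix_matrix_mult]
lemmas bdd_meas_mult = bdd_meas_bilinear[OF bounded_bilinear_matrix_matrix_mult]
lemmas bdd_meas_scaleR = bdd_meas_bilinear[OF bounded_bilinear_scaleR]
lemmas bdd_meas_times = bdd_meas_bilinear[OF bounded_bilinear_mult]

lemma bdd_meas_integrable_Icc: "bdd_meas (lebesgue_on {a..b::real}) f \<Longrightarrow> integrable (lebesgue_on {a..b}) f"
  by (rule finite_measure.bdd_meas_integrable[OF finite_measure_Icc])

lemma integ_split:
  fixes p q :: "real \<Rightarrow> 'a::euclidean_space"
  assumes p: "bdd_meas (lebesgue_on {0..L}) p" and q: "bdd_meas (lebesgue_on {0..L}) q" and c: "c \<in> {0..L}"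
  shows "integ 0 L (\<lambda>x. if x \<le> c then p x else q x) = integ 0 c p + integ c L q"
    and "integ 0 L (\<lambda>x. if c \<le> x then q x else p x) = integ 0 c p + integ c L q"
proof -
  have ip: "integrable (lebesgue_on {0..L}) (\<lambda>x. indicator {0..c} x *\<^sub>R p x)"
    "integrable (lebesgue_on {0..L}) (\<lambda>x. indicator {c..L} x *\<^sub>R q x)"
    by (intro bdd_meas_integrable_Icc bdd_meas_scaleR bdd_meas_indicator p q)+
  have eq: "integ 0 c p + integ c L q = integ 0 L (\<lambda>x. indicator {0..c} x *\<^sub>R p x + indicator {c..L} x *\<^sub>R q x)"
    using c ip by (simp add: integ_eq_indicator[of 0 c L] integ_eq_indicator[of c L L])
  have ne: "AE x in lebesgue_on {0..L}. x \<noteq> c \<and> x \<in> {0..L}"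
    using AE_neq_lebesgue_on[of c L] AE_space[of "lebesgue_on {0..L}"] by eventually_elim simp
  show "integ 0 L (\<lambda>x. if x \<le> c then p x else q x) = integ 0 c p + integ c L q"
    unfolding eq
  proof (rule integral_cong_AE_lebesgue_on)
    show "AE x in lebesgue_on {0..L}. (if x \<le> c then p x else q x) = indicator {0..c} x *\<^sub>R p x + indicator {c..L} x *\<^sub>R q x"
      using ne by eventually_elim (auto simp: indicator_def)
  qed simp
  show "integ 0 L (\<lambda>x. if c \<le> x then q x else p x) = integ 0 c p + integ c L q"
    unfolding eq
  proof (rule integral_cong_AE_lebesgue_on)
    show "AE x in lebesgue_on {0..L}. (if c \<le> x then q x else p x) = indicator {0..c} x *\<^sub>R p x + indicator {c..L} x *\<^sub>R q x"
      using ne by eventually_elim (auto simp: indicator_def)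
  qed simp
qed

text \<open>Substitutes the representation of \<open>f\<close> and shifts its kernel to the other
  factor, so that \<open>u\<close> appears where \<open>f\<close> stood.\<close>

lemma kform_eq_swap:
  fixes G :: "real \<Rightarrow> real \<Rightarrow> real^'n::finite^'m::finite"
  assumes "bdd_kernel L G" "integrable (lebesgue_on {0..L}) u" "integrable (lebesgue_on {0..L}) g"
    and f: "AE s in lebesgue_on {0..L}. f s = integ 0 L (\<lambda>\<eta>. G s \<eta> *v u \<eta>)"
  shows "integ 0 L (\<lambda>s. f s \<bullet> g s) = integ 0 L (\<lambda>s. u s \<bullet> integ 0 L (\<lambda>\<eta>. transpose (G \<eta> s) *v g \<eta>))"
proof -
  have "integ 0 L (\<lambda>s. f s \<bullet> g s) = kform L G g u"
    unfolding kform_def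
    by (rule integral_cong_AE_lebesgue_on) (use f in \<open>auto simp: inner_commute elim!: eventually_mono\<close>)
  also have "\<dots> = kform L (\<lambda>s \<eta>. transpose (G \<eta> s)) u g"
    using kform_transpose[OF assms(1,3,2)] by simp
  finally show ?thesis by (simp add: kform_def)
qed

lemma integ_right_mult:
  "integrable M f \<Longrightarrow> (\<integral>x. A ** f x \<partial>M) = A ** (\<integral>x. f x \<partial>M)" for A :: "real^'n::finite^'m::finite" and f :: "'a \<Rightarrow> real^'k::finite^'n"
  by (rule integral_bounded_linear[OF bounded_linear_mult_right])

lemma integ_left_mult:
  "integrable M f \<Longrightarrow> (\<integral>x. f x ** A \<partial>M) = (\<integral>x. f x \<partial>M) ** A" for A :: "real^'k::finite^'n::finite" and f :: "'a \<Rightarrow> real^'n^'m::finite"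
  by (rule integral_bounded_linear[OF bounded_linear_mult_left])

text \<open>The partial integral operator with multiplier \<open>U\<close> and kernel \<open>W\<close>. Its composition with state
  kernels on both sides is \<open>Phi\<close>, which is bilinear; splitting each state kernel into its boundary part
  \<open>Ba\<close>, \<open>Bb\<close> and its step part yields the summands of \<open>\<L>\<^sub>1\<close>, \<open>\<L>\<^sub>2\<close>, \<open>\<L>\<^sub>3\<close>.\<close>

locale pi_operator =
  fixes L :: real and U :: "real \<Rightarrow> real^'n::finite^'n" and W1 W2 :: "real \<Rightarrow> real \<Rightarrow> real^'n^'n"
  assumes L: "0 < L" and U: "bdd_meas (lebesgue_on {0..L}) U"
    and W1: "bdd_kernel L W1" and W2: "bdd_kernel L W2"
begin

sublocale finite_measure "lebesgue_on {0..L}" by (rule finite_measure_Icc)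

definition W :: "real \<Rightarrow> real \<Rightarrow> real^'n^'n"
  where "W s \<theta> = (if \<theta> \<le> s then W1 s \<theta> else W2 s \<theta>)"

lemma W: "bdd_kernel L W"
  unfolding W_def by (intro bdd_meas_If W1 W2 pred_le_lebesgue_on)

definition Phi :: "(real \<Rightarrow> real^'n^'n) \<Rightarrow> (real \<Rightarrow> real^'n^'n) \<Rightarrow> real^'n^'n"
  where "Phi g d = integ 0 L (\<lambda>\<eta>. g \<eta> ** (U \<eta> ** d \<eta> + integ 0 L (\<lambda>\<zeta>. W \<eta> \<zeta> ** d \<zeta>)))"

lemma W_row:
  assumes "bdd_meas (lebesgue_on {0..L}) d" "\<eta> \<in> {0..L}"
  shows "integ 0 L (\<lambda>\<zeta>. W \<eta> \<zeta> ** d \<zeta>) = integ 0 \<eta> (\<lambda>\<zeta>. W1 \<eta> \<zeta> ** d \<zeta>) + integ \<eta> L (\<lambda>\<zeta>. W2 \<eta> \<zeta> ** d \<zeta>)"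
proof -
  have "integ 0 L (\<lambda>\<zeta>. W \<eta> \<zeta> ** d \<zeta>) = integ 0 L (\<lambda>\<zeta>. if \<zeta> \<le> \<eta> then W1 \<eta> \<zeta> ** d \<zeta> else W2 \<eta> \<zeta> ** d \<zeta>)"
    by (intro Bochner_Integration.integral_cong refl) (simp add: W_def)
  then show ?thesis
    using assms by (simp add: integ_split bdd_meas_mult bdd_meas_section1[OF W1] bdd_meas_section1[OF W2])
qed

lemma W_col:
  assumes "bdd_meas (lebesgue_on {0..L}) g" "\<zeta> \<in> {0..L}"
  shows "integ 0 L (\<lambda>\<eta>. g \<eta> ** W \<eta> \<zeta>) = integ \<zeta> L (\<lambda>\<eta>. g \<eta> ** W1 \<eta> \<zeta>) + integ 0 \<zeta> (\<lambda>\<eta>. g \<eta> ** W2 \<eta> \<zeta>)"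
proof -
  have "integ 0 L (\<lambda>\<eta>. g \<eta> ** W \<eta> \<zeta>) = integ 0 L (\<lambda>\<eta>. if \<zeta> \<le> \<eta> then g \<eta> ** W1 \<eta> \<zeta> else g \<eta> ** W2 \<eta> \<zeta>)"
    by (intro Bochner_Integration.integral_cong refl) (simp add: W_def)
  then show ?thesis
    using assms by (simp add: integ_split bdd_meas_mult bdd_meas_section2[OF W1] bdd_meas_section2[OF W2])
qed

lemma row_bdd:
  assumes "bdd_meas (lebesgue_on {0..L}) d"
  shows "bdd_meas (lebesgue_on {0..L}) (\<lambda>\<eta>. integ 0 L (\<lambda>\<zeta>. W \<eta> \<zeta> ** d \<zeta>))"
  by (rule kernel_apply_bdd[OF bounded_bilinear_matrix_matrix_mult W bdd_meas_integrable[OF assms]])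

lemma col_bdd:
  assumes "bdd_meas (lebesgue_on {0..L}) g"
  shows "bdd_meas (lebesgue_on {0..L}) (\<lambda>\<zeta>. integ 0 L (\<lambda>\<eta>. g \<eta> ** W \<eta> \<zeta>))"
  by (rule bdd_meas_integral, rule bdd_meas_mult)
     (intro bdd_meas_compose[OF assms measurable_snd] bdd_meas_swap[OF W])+

text \<open>The definition of \<open>Phi\<close> integrates along the rows of \<open>W\<close>,
  which suits \<open>Y2\<close> and \<open>Y3\<close>; this form integrates along its columns, which
  suits \<open>Y1\<close>. It also gives linearity in the right factor, and it exhibits
  \<open>Phi\<close> as a composition of two bounded kernels.\<close>

lemma Phi_alt:
  assumes g: "bdd_meas (lebesgue_on {0..L}) g" and d: "bdd_meas (lebesgue_on {0..L}) d"
  shows "Phi g d = integ 0 L (\<lambda>\<zeta>. (g \<zeta> ** U \<zeta> + integ 0 L (\<lambda>\<eta>. g \<eta> ** W \<eta> \<zeta>)) ** d \<zeta>)"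
proof -
  have i: "integrable (lebesgue_on {0..L}) (\<lambda>\<eta>. g \<eta> ** (U \<eta> ** d \<eta>))"
    "integrable (lebesgue_on {0..L}) (\<lambda>\<eta>. g \<eta> ** integ 0 L (\<lambda>\<zeta>. W \<eta> \<zeta> ** d \<zeta>))"
    "integrable (lebesgue_on {0..L}) (\<lambda>\<zeta>. integ 0 L (\<lambda>\<eta>. g \<eta> ** W \<eta> \<zeta>) ** d \<zeta>)"
    by (intro bdd_meas_integrable bdd_meas_mult g d U row_bdd col_bdd)+
  have "integ 0 L (\<lambda>\<eta>. g \<eta> ** integ 0 L (\<lambda>\<zeta>. W \<eta> \<zeta> ** d \<zeta>))
      = integ 0 L (\<lambda>\<eta>. integ 0 L (\<lambda>\<zeta>. g \<eta> ** (W \<eta> \<zeta> ** d \<zeta>)))"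
    by (intro Bochner_Integration.integral_cong refl integ_right_mult[symmetric] bdd_meas_integrable
        bdd_meas_mult bdd_meas_section1[OF W] d)
  also have "\<dots> = integ 0 L (\<lambda>\<zeta>. integ 0 L (\<lambda>\<eta>. g \<eta> ** (W \<eta> \<zeta> ** d \<zeta>)))"
    by (rule Fubini_bdd) (intro bdd_meas_mult W bdd_meas_compose[OF g measurable_fst] bdd_meas_compose[OF d measurable_snd])
  also have "\<dots> = integ 0 L (\<lambda>\<zeta>. integ 0 L (\<lambda>\<eta>. g \<eta> ** W \<eta> \<zeta>) ** d \<zeta>)"
    unfolding matrix_mul_assoc
    by (intro Bochner_Integration.integral_cong refl integ_left_mult bdd_meas_integrable
        bdd_meas_mult bdd_meas_section2[OF W] g)
  finally show ?thesis
    using i unfolding Phi_def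
    by (simp add: bounded_bilinear.add_left[OF bounded_bilinear_matrix_matrix_mult]
        bounded_bilinear.add_right[OF bounded_bilinear_matrix_matrix_mult] matrix_mul_assoc)
qed

lemma Phi_add_left:
  assumes "bdd_meas (lebesgue_on {0..L}) g" "bdd_meas (lebesgue_on {0..L}) g'" "bdd_meas (lebesgue_on {0..L}) d"
  shows "Phi (\<lambda>\<eta>. g \<eta> + g' \<eta>) d = Phi g d + Phi g' d"
proof -
  have "integrable (lebesgue_on {0..L}) (\<lambda>\<eta>. h \<eta> ** (U \<eta> ** d \<eta> + integ 0 L (\<lambda>\<zeta>. W \<eta> \<zeta> ** d \<zeta>)))"
    if "bdd_meas (lebesgue_on {0..L}) h" for h :: "real \<Rightarrow> real^'n^'n"
    by (intro bdd_meas_integrable bdd_meas_mult bdd_meas_add that assms(3) U row_bdd)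
  then show ?thesis
    unfolding Phi_def using assms(1,2) by (simp add: bounded_bilinear.add_left[OF bounded_bilinear_matrix_matrix_mult])
qed

lemma Phi_add_right:
  assumes "bdd_meas (lebesgue_on {0..L}) g" "bdd_meas (lebesgue_on {0..L}) d" "bdd_meas (lebesgue_on {0..L}) d'"
  shows "Phi g (\<lambda>\<eta>. d \<eta> + d' \<eta>) = Phi g d + Phi g d'"
proof -
  have "integrable (lebesgue_on {0..L}) (\<lambda>\<zeta>. (g \<zeta> ** U \<zeta> + integ 0 L (\<lambda>\<eta>. g \<eta> ** W \<eta> \<zeta>)) ** h \<zeta>)"
    if "bdd_meas (lebesgue_on {0..L}) h" for h :: "real \<Rightarrow> real^'n^'n"
    by (intro bdd_meas_integrable bdd_meas_mult bdd_meas_add that assms(1) U col_bdd)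
  then show ?thesis
    using assms by (simp add: Phi_alt bdd_meas_add bounded_bilinear.add_right[OF bounded_bilinear_matrix_matrix_mult])
qed

text \<open>For arguments \<open>z\<close> that enter as they are: \<open>u\<close> itself, in the
  term with \<open>A2\<close>, and the input term. Here only the left state is replaced by its
  kernel.\<close>

lemma form_state:
  fixes f u z :: "real \<Rightarrow> real^'n"
  assumes G: "bdd_kernel L G" and u: "integrable (lebesgue_on {0..L}) u" and z: "integrable (lebesgue_on {0..L}) z"
    and f: "AE s in lebesgue_on {0..L}. f s = integ 0 L (\<lambda>\<eta>. G s \<eta> *v u \<eta>)"
  shows "integ 0 L (\<lambda>s. f s \<bullet> (U s *v z s + integ 0 L (\<lambda>\<theta>. W s \<theta> *v z \<theta>)))
    = kform L (\<lambda>s \<theta>. transpose (G \<theta> s) ** U \<theta> + integ 0 L (\<lambda>\<eta>. transpose (G \<eta> s) ** W \<eta> \<theta>)) u z"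
proof -
  have Uz: "integrable (lebesgue_on {0..L}) (\<lambda>s. U s *v z s)"
    by (rule bdd_meas_integrable_mult[OF bounded_bilinear_matrix_vector_mult U z])
  have Wz: "integrable (lebesgue_on {0..L}) (\<lambda>s. integ 0 L (\<lambda>\<theta>. W s \<theta> *v z \<theta>))"
    by (rule bdd_meas_integrable[OF kernel_apply_bdd[OF bounded_bilinear_matrix_vector_mult W z]])
  have GT: "bdd_kernel L (\<lambda>s \<theta>. transpose (G \<theta> s))"
    by (rule bdd_meas_linear[OF bounded_linear_transpose bdd_meas_swap[OF G]])
  have K2: "bdd_kernel L (\<lambda>s \<theta>. integ 0 L (\<lambda>\<eta>. transpose (G \<eta> s) ** W \<eta> \<theta>))"
    by (rule bdd_meas_kernel_prod[OF bounded_bilinear_matrix_matrix_mult GT W])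
  have K1: "bdd_kernel L (\<lambda>s \<theta>. transpose (G \<theta> s) ** U \<theta>)"
    by (intro bdd_meas_mult GT bdd_meas_compose[OF U measurable_snd])
  have "integ 0 L (\<lambda>s. f s \<bullet> (U s *v z s + integ 0 L (\<lambda>\<theta>. W s \<theta> *v z \<theta>)))
    = integ 0 L (\<lambda>s. u s \<bullet> integ 0 L (\<lambda>\<eta>. transpose (G \<eta> s) *v (U \<eta> *v z \<eta> + integ 0 L (\<lambda>\<theta>. W \<eta> \<theta> *v z \<theta>))))"
    by (rule kform_eq_swap[OF G u Bochner_Integration.integrable_add[OF Uz Wz] f])
  also have "\<dots> = kform L (\<lambda>s \<theta>. transpose (G \<theta> s) ** U \<theta> + integ 0 L (\<lambda>\<eta>. transpose (G \<eta> s) ** W \<eta> \<theta>)) u z"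
    unfolding kform_def
  proof (rule Bochner_Integration.integral_cong[OF refl], rule arg_cong2[where f=inner, OF refl])
    fix s assume s: "s \<in> space (lebesgue_on {0..L})"
    note g = bdd_meas_section1[OF GT s]
    have "integ 0 L (\<lambda>\<eta>. transpose (G \<eta> s) *v (U \<eta> *v z \<eta> + integ 0 L (\<lambda>\<theta>. W \<eta> \<theta> *v z \<theta>)))
      = integ 0 L (\<lambda>\<eta>. transpose (G \<eta> s) *v (U \<eta> *v z \<eta>)) + integ 0 L (\<lambda>\<eta>. transpose (G \<eta> s) *v integ 0 L (\<lambda>\<theta>. W \<eta> \<theta> *v z \<theta>))"
      using bdd_meas_integrable_mult[OF bounded_bilinear_matrix_vector_mult g Uz]
        bdd_meas_integrable_mult[OF bounded_bilinear_matrix_vector_mult g Wz]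
      by (simp add: bounded_bilinear.add_right[OF bounded_bilinear_matrix_vector_mult])
    also have "\<dots> = integ 0 L (\<lambda>\<theta>. (transpose (G \<theta> s) ** U \<theta>) *v z \<theta>)
        + integ 0 L (\<lambda>\<theta>. integ 0 L (\<lambda>\<eta>. transpose (G \<eta> s) ** W \<eta> \<theta>) *v z \<theta>)"
      unfolding kernel_mult[OF g W z] by (simp add: matrix_vector_mul_assoc)
    also have "\<dots> = integ 0 L (\<lambda>\<theta>. (transpose (G \<theta> s) ** U \<theta> + integ 0 L (\<lambda>\<eta>. transpose (G \<eta> s) ** W \<eta> \<theta>)) *v z \<theta>)"
      using kernel_row_integrable[OF K1 z, of s] kernel_row_integrable[OF K2 z, of s] s
      by (simp add: matrix_vector_mult_add_rdistrib)
    finally show "integ 0 L (\<lambda>\<eta>. transpose (G \<eta> s) *v (U \<eta> *v z \<eta> + integ 0 L (\<lambda>\<theta>. W \<eta> \<theta> *v z \<theta>)))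
       = integ 0 L (\<lambda>\<theta>. (transpose (G \<theta> s) ** U \<theta> + integ 0 L (\<lambda>\<eta>. transpose (G \<eta> s) ** W \<eta> \<theta>)) *v z \<theta>)" .
  qed
  finally show ?thesis .
qed

text \<open>For the state and its first derivative in the right factor, so that both factors are
  replaced by integrals against \<open>u\<close>.\<close>

lemma form_state_state:
  fixes f u z :: "real \<Rightarrow> real^'n"
  assumes G: "bdd_kernel L G" and D: "bdd_kernel L D"
    and u: "integrable (lebesgue_on {0..L}) u" and z: "integrable (lebesgue_on {0..L}) z"
    and f: "AE s in lebesgue_on {0..L}. f s = integ 0 L (\<lambda>\<eta>. G s \<eta> *v u \<eta>)"
    and zD: "AE s in lebesgue_on {0..L}. z s = integ 0 L (\<lambda>\<eta>. D s \<eta> *v u \<eta>)"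
  shows "integ 0 L (\<lambda>s. f s \<bullet> (U s *v z s + integ 0 L (\<lambda>\<theta>. W s \<theta> *v z \<theta>)))
    = kform L (\<lambda>s \<theta>. Phi (\<lambda>\<eta>. transpose (G \<eta> s)) (\<lambda>\<zeta>. D \<zeta> \<theta>)) u u"
proof -
  have GT: "bdd_kernel L (\<lambda>s \<theta>. transpose (G \<theta> s))"
    by (rule bdd_meas_linear[OF bounded_linear_transpose bdd_meas_swap[OF G]])
  define K where "K s \<theta> = transpose (G \<theta> s) ** U \<theta> + integ 0 L (\<lambda>\<eta>. transpose (G \<eta> s) ** W \<eta> \<theta>)" for s \<theta>
  have K: "bdd_kernel L K"
    unfolding K_def
    by (intro bdd_meas_add bdd_meas_mult GT bdd_meas_compose[OF U measurable_snd]
         bdd_meas_kernel_prod[OF bounded_bilinear_matrix_matrix_mult GT W])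
  have "integ 0 L (\<lambda>s. f s \<bullet> (U s *v z s + integ 0 L (\<lambda>\<theta>. W s \<theta> *v z \<theta>))) = kform L K u z"
    unfolding K_def by (rule form_state[OF G u z f])
  also have "\<dots> = kform L (\<lambda>s \<theta>. Phi (\<lambda>\<eta>. transpose (G \<eta> s)) (\<lambda>\<zeta>. D \<zeta> \<theta>)) u u"
    unfolding kform_def
  proof (rule Bochner_Integration.integral_cong[OF refl], rule arg_cong2[where f=inner, OF refl])
    fix s assume s: "s \<in> space (lebesgue_on {0..L})"
    have "integ 0 L (\<lambda>\<theta>. K s \<theta> *v z \<theta>) = integ 0 L (\<lambda>\<theta>. K s \<theta> *v integ 0 L (\<lambda>\<eta>. D \<theta> \<eta> *v u \<eta>))"
      by (rule integral_cong_AE_lebesgue_on) (use zD in \<open>auto elim!: eventually_mono\<close>)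
    also have "\<dots> = integ 0 L (\<lambda>\<theta>. integ 0 L (\<lambda>\<zeta>. K s \<zeta> ** D \<zeta> \<theta>) *v u \<theta>)"
      by (rule kernel_mult[OF bdd_meas_section1[OF K s] D u])
    also have "\<dots> = integ 0 L (\<lambda>\<theta>. Phi (\<lambda>\<eta>. transpose (G \<eta> s)) (\<lambda>\<zeta>. D \<zeta> \<theta>) *v u \<theta>)"
      using Phi_alt[OF bdd_meas_section1[OF GT s] bdd_meas_section2[OF D]]
      by (intro Bochner_Integration.integral_cong refl) (simp add: K_def)
    finally show "integ 0 L (\<lambda>\<theta>. K s \<theta> *v z \<theta>)
        = integ 0 L (\<lambda>\<theta>. Phi (\<lambda>\<eta>. transpose (G \<eta> s)) (\<lambda>\<zeta>. D \<zeta> \<theta>) *v u \<theta>)" .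
  qed
  finally show ?thesis .
qed

end

section \<open>Comparison with the formulas of \<open>map_L1\<close>, \<open>map_L2\<close> and
  \<open>map_L3\<close>\<close>

lemma transpose_scalar_mat: "transpose (scalar_mat c) = scalar_mat c"
  by (auto simp: transpose_def mat_def vec_eq_iff)

lemma transpose_add: "transpose (A + B) = transpose A + transpose (B :: real^'n::finite^'m::finite)"
  by (simp add: transpose_def vec_eq_iff)

lemma transpose_Gker:
  "transpose (Gker S \<eta> s) = transpose (Ba S \<eta> s) + scalar_mat (step (\<eta> - s) * (\<eta> - s))"
  by (simp add: Gker_eq transpose_add transpose_scalar_mat)

lemma integ_step:
  fixes f :: "real \<Rightarrow> 'a::euclidean_space"
  assumes "0 \<le> a" "b \<le> L" "0 \<le> s"
  shows "integ a b (\<lambda>\<eta>. (step (\<eta> - s) * c \<eta>) *\<^sub>R f \<eta>) = integ (max a s) b (\<lambda>\<eta>. c \<eta> *\<^sub>R f \<eta>)"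
  using assms by (simp add: integ_eq_indicator[of _ b L])
    (intro Bochner_Integration.integral_cong refl, auto simp: step_def indicator_def)

lemma integ_empty: "b < a \<Longrightarrow> integ a b f = 0"
  by (simp add: integral_eq_zero_null_sets space_restrict_space)

lemma bdd_meas_step_mult:
  assumes "0 < L" "bdd_kernel L (\<lambda>s \<theta>. p (s - \<theta>))" "\<theta> \<in> {0..L}"
  shows "bdd_meas (lebesgue_on {0..L}) (\<lambda>s. step (s - \<theta>) * p (s - \<theta>))"
  using bdd_meas_section2[OF bdd_meas_times[OF bdd_kernel_step[OF assms(1)] assms(2)]] assms(3) by simp

context pi_operator begin

lemma bdd_scalar_step:
  assumes "bdd_kernel L (\<lambda>s \<theta>. p (s - \<theta>))" "\<theta> \<in> {0..L}"
  shows "bdd_meas (lebesgue_on {0..L}) (\<lambda>s. scalar_mat (step (s - \<theta>) * p (s - \<theta>)) :: real^'n^'n)"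
  by (intro bdd_meas_scaleR bdd_meas_const bdd_meas_step_mult[OF L assms])

lemma coord_diff: "bdd_kernel L (\<lambda>s \<theta>. s - \<theta>)"
  by (intro bdd_kernel_diff bdd_kernel_coord L)

lemma Ba_col: "len S = L \<Longrightarrow> s \<in> {0..L} \<Longrightarrow> bdd_meas (lebesgue_on {0..L}) (\<lambda>\<eta>. Ba S \<eta> s)"
  using bdd_meas_section2[OF bdd_kernel_Ba[OF L]] by simp

lemma Ba_colT: "len S = L \<Longrightarrow> s \<in> {0..L} \<Longrightarrow> bdd_meas (lebesgue_on {0..L}) (\<lambda>\<eta>. transpose (Ba S \<eta> s))"
  by (rule bdd_meas_linear[OF bounded_linear_transpose Ba_col])

lemma Y1_eq:
  assumes "len S = L" "s \<in> {0..L}" "\<theta> \<in> {0..L}"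
  shows "transpose (Ba S \<theta> s) ** U \<theta> + integ 0 L (\<lambda>\<eta>. transpose (Ba S \<eta> s) ** W \<eta> \<theta>) = Y1 S U W1 W2 s \<theta>"
  using W_col[OF Ba_colT[OF assms(1,2)] assms(3)] assms(1) by (simp add: Y1_def add.assoc)

lemma Y3_eq:
  assumes "len S = L" "\<eta> \<in> {0..L}" "\<theta> \<in> {0..L}"
  shows "U \<eta> ** Ba S \<eta> \<theta> + integ 0 L (\<lambda>\<zeta>. W \<eta> \<zeta> ** Ba S \<zeta> \<theta>) = Y3 S U W1 W2 \<eta> \<theta>"
  using W_row[OF Ba_col[OF assms(1,3)] assms(2)] assms(1) by (simp add: Y3_def add.assoc)

lemma Y2_eq:
  assumes "len S = L" "\<eta> \<in> {0..L}"
  shows "U \<eta> + integ 0 L (\<lambda>\<zeta>. W \<eta> \<zeta>) = Y2 S U W1 W2 \<eta>"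
  using W_row[OF bdd_meas_const[of _ "mat 1"] assms(2)] assms(1) by (simp add: Y2_def add.assoc)

lemma Y2_mult_eq:
  assumes "len S = L" "\<eta> \<in> {0..L}"
  shows "U \<eta> ** A + integ 0 L (\<lambda>\<zeta>. W \<eta> \<zeta> ** A) = Y2 S U W1 W2 \<eta> ** A"
  using bdd_meas_integrable[OF bdd_meas_section1[OF W]] assms
  by (simp add: Y2_eq[symmetric] integ_left_mult bounded_bilinear.add_left[OF bounded_bilinear_matrix_matrix_mult])

text \<open>The boundary part of the Green kernel gives \<open>Y1\<close>. The step part confines
  the integrals to \<eta> \<ge> s: for \<theta> < s the term with \<open>U\<close> and the integral
  of \<open>W2\<close> disappear and \<open>E1\<close> is left, and for s < \<theta> all three terms
  of \<open>E2\<close> remain.\<close>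

lemma map_L1_eq:
  assumes S: "len S = L" and st: "s \<in> {0..L}" "\<theta> \<in> {0..L}" "s \<noteq> \<theta>"
  shows "transpose (Gker S \<theta> s) ** U \<theta> + integ 0 L (\<lambda>\<eta>. transpose (Gker S \<eta> s) ** W \<eta> \<theta>)
    = (if \<theta> \<le> s then fst (map_L1 S U W1 W2) s \<theta> else snd (map_L1 S U W1 W2) s \<theta>)"
proof -
  define c where "c \<eta> = step (\<eta> - s) * (\<eta> - s)" for \<eta>
  have cb: "bdd_meas (lebesgue_on {0..L}) (\<lambda>\<eta>. scalar_mat (c \<eta>) :: real^'n^'n)"
    unfolding c_def using bdd_scalar_step[of "\<lambda>x. x", OF coord_diff st(1)] .
  have i: "integrable (lebesgue_on {0..L}) (\<lambda>\<eta>. transpose (Ba S \<eta> s) ** W \<eta> \<theta>)"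
    "integrable (lebesgue_on {0..L}) (\<lambda>\<eta>. scalar_mat (c \<eta>) ** W \<eta> \<theta>)"
    using st by (intro bdd_meas_integrable bdd_meas_mult Ba_colT[OF S] cb bdd_meas_section2[OF W]; simp)+
  have "transpose (Gker S \<theta> s) ** U \<theta> + integ 0 L (\<lambda>\<eta>. transpose (Gker S \<eta> s) ** W \<eta> \<theta>)
    = (transpose (Ba S \<theta> s) ** U \<theta> + integ 0 L (\<lambda>\<eta>. transpose (Ba S \<eta> s) ** W \<eta> \<theta>))
      + (scalar_mat (c \<theta>) ** U \<theta> + integ 0 L (\<lambda>\<eta>. scalar_mat (c \<eta>) ** W \<eta> \<theta>))"
    using i by (simp add: transpose_Gker c_def bounded_bilinear.add_left[OF bounded_bilinear_matrix_matrix_mult])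
  also have "integ 0 L (\<lambda>\<eta>. scalar_mat (c \<eta>) ** W \<eta> \<theta>)
    = integ (max \<theta> s) L (\<lambda>\<eta>. (\<eta> - s) *\<^sub>R W1 \<eta> \<theta>) + integ s \<theta> (\<lambda>\<eta>. (\<eta> - s) *\<^sub>R W2 \<eta> \<theta>)"
    unfolding W_col[OF cb st(2)] unfolding scalar_mat_mult c_def
    using integ_step[of \<theta> L L s "\<lambda>\<eta>. \<eta> - s" "\<lambda>\<eta>. W1 \<eta> \<theta>"] integ_step[of 0 \<theta> L s "\<lambda>\<eta>. \<eta> - s" "\<lambda>\<eta>. W2 \<eta> \<theta>"] st
    by simp
  finally show ?thesis
    unfolding Y1_eq[OF S st(1,2)] map_L1_def Let_def S using st
    by (auto simp: c_def step_def scalar_mat_mult max_def integ_empty)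
qed

text \<open>The shape shared by \<open>F\<^sub>1\<close>, \<open>F\<^sub>2\<close> (where \<open>p = 1\<close>) and \<open>J\<^sub>1\<close>, \<open>J\<^sub>2\<close> (where \<open>p\<close> is the identity).\<close>

definition Jker :: "(real \<Rightarrow> real) \<Rightarrow> real \<Rightarrow> real \<Rightarrow> real \<Rightarrow> real^'n^'n"
  where "Jker p a s \<theta> = integ a L (\<lambda>\<eta>. (\<eta> - s) *\<^sub>R (p (\<eta> - \<theta>) *\<^sub>R U \<eta> + integ \<theta> \<eta> (\<lambda>\<zeta>. p (\<zeta> - \<theta>) *\<^sub>R W1 \<eta> \<zeta>))
     + integ s \<eta> (\<lambda>\<zeta>. ((\<zeta> - s) * p (\<eta> - \<theta>)) *\<^sub>R W2 \<zeta> \<eta>))"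

text \<open>\<open>W1\<close> is used for \<zeta> \<le> \<eta> and \<open>W2\<close> for \<eta>
  \<le> \<zeta>. In both parts the larger of the two variables runs over
  \<open>{max s \<theta>..L}\<close>, so Fubini is applied to the \<open>W2\<close> part alone, to
  make the larger variable the outer one there as well. This explains the transposed arguments of
  \<open>W2\<close> in \<open>F5\<close> and \<open>J5\<close>.\<close>

lemma Phi_step_step:
  assumes st: "s \<in> {0..L}" "\<theta> \<in> {0..L}" and p: "bdd_kernel L (\<lambda>s \<theta>. p (s - \<theta>))"
  shows "Phi (\<lambda>\<eta>. scalar_mat (step (\<eta> - s) * (\<eta> - s))) (\<lambda>\<zeta>. scalar_mat (step (\<zeta> - \<theta>) * p (\<zeta> - \<theta>)))
    = Jker p (max s \<theta>) s \<theta>"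
proof -
  let ?M = "lebesgue_on {0..L}"
  define c where "c \<eta> = step (\<eta> - s) * (\<eta> - s)" for \<eta>
  define q where "q \<zeta> = step (\<zeta> - \<theta>) * p (\<zeta> - \<theta>)" for \<zeta>
  have c: "bdd_meas ?M c" unfolding c_def using bdd_meas_step_mult[of L "\<lambda>x. x", OF L coord_diff st(1)] .
  have q: "bdd_meas ?M q" unfolding q_def by (rule bdd_meas_step_mult[OF L p st(2)])
  have qm: "bdd_meas ?M (\<lambda>\<zeta>. scalar_mat (q \<zeta>) :: real^'n^'n)" by (intro bdd_meas_scaleR q bdd_meas_const)
  define A where "A \<eta> = c \<eta> *\<^sub>R (q \<eta> *\<^sub>R U \<eta> + integ 0 \<eta> (\<lambda>\<zeta>. q \<zeta> *\<^sub>R W1 \<eta> \<zeta>))" for \<eta>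
  \<comment> \<open>The \<open>W2\<close> part as a kernel on the whole square, with
    \<open>step (\<zeta> - \<eta>)\<close> cutting out the triangle, so that the order of
    integration can be exchanged.\<close>
  define h where "h \<eta> \<zeta> = (c \<eta> * (step (\<zeta> - \<eta>) * q \<zeta>)) *\<^sub>R W2 \<eta> \<zeta>" for \<eta> \<zeta>
  have hb: "bdd_kernel L h"
    unfolding h_def
    using bdd_meas_swap[OF bdd_kernel_step[OF L]]
    by (intro bdd_meas_scaleR bdd_meas_times W2 bdd_meas_compose[OF c measurable_fst] bdd_meas_compose[OF q measurable_snd])
  have hi: "integrable ?M (\<lambda>\<eta>. integ 0 L (h \<eta>))" by (rule bdd_meas_integrable[OF bdd_meas_integral[OF hb]])
  have hi': "integrable ?M (\<lambda>\<zeta>. integ 0 L (\<lambda>\<eta>. h \<eta> \<zeta>))"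
    by (rule bdd_meas_integrable[OF bdd_meas_integral[OF bdd_meas_swap[OF hb]]])
  have row: "c \<eta> *\<^sub>R (U \<eta> ** scalar_mat (q \<eta>) + integ 0 L (\<lambda>\<zeta>. W \<eta> \<zeta> ** scalar_mat (q \<zeta>))) = A \<eta> + integ 0 L (h \<eta>)"
    if e: "\<eta> \<in> {0..L}" for \<eta>
  proof -
    have "integ \<eta> L (\<lambda>\<zeta>. q \<zeta> *\<^sub>R W2 \<eta> \<zeta>) = integ 0 L (\<lambda>\<zeta>. (step (\<zeta> - \<eta>) * q \<zeta>) *\<^sub>R W2 \<eta> \<zeta>)"
      using e integ_step[of 0 L L \<eta> q "W2 \<eta>"] by simp
    moreover have "h \<eta> = (\<lambda>\<zeta>. c \<eta> *\<^sub>R ((step (\<zeta> - \<eta>) * q \<zeta>) *\<^sub>R W2 \<eta> \<zeta>))"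
      by (simp add: h_def fun_eq_iff)
    ultimately have "c \<eta> *\<^sub>R integ \<eta> L (\<lambda>\<zeta>. q \<zeta> *\<^sub>R W2 \<eta> \<zeta>) = integ 0 L (h \<eta>)"
      by (simp only: integral_scaleR_right)
    then show ?thesis
      unfolding W_row[OF qm e] unfolding mult_scalar_mat A_def by (simp add: scaleR_add_right)
  qed
  have Phi: "Phi (\<lambda>\<eta>. scalar_mat (c \<eta>)) (\<lambda>\<zeta>. scalar_mat (q \<zeta>)) = integ 0 L (\<lambda>\<eta>. A \<eta> + integ 0 L (h \<eta>))"
    unfolding Phi_def scalar_mat_mult by (intro Bochner_Integration.integral_cong refl row) auto
  \<comment> \<open>Integrability is obtained by subtraction: the whole row is bounded and
    measurable by \<open>row_bdd\<close>, and the \<open>W2\<close> part is integrable, so no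
    separate argument is required for the variable limits in \<open>A\<close>.\<close>
  have Ai: "integrable ?M A"
  proof -
    have "integrable ?M (\<lambda>\<eta>. c \<eta> *\<^sub>R (U \<eta> ** scalar_mat (q \<eta>) + integ 0 L (\<lambda>\<zeta>. W \<eta> \<zeta> ** scalar_mat (q \<zeta>))) - integ 0 L (h \<eta>))"
      by (intro Bochner_Integration.integrable_diff hi bdd_meas_integrable bdd_meas_scaleR c bdd_meas_add
          bdd_meas_mult U qm row_bdd)
    then show ?thesis
      by (rule Bochner_Integration.integrable_cong[THEN iffD1, rotated 2]) (auto simp: row)
  qed
  define a where "a = max s \<theta>"
  have A: "A \<eta> = indicator {a..L} \<eta> *\<^sub>R ((\<eta> - s) *\<^sub>R (p (\<eta> - \<theta>) *\<^sub>R U \<eta> + integ \<theta> \<eta> (\<lambda>\<zeta>. p (\<zeta> - \<theta>) *\<^sub>R W1 \<eta> \<zeta>)))"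
    if e: "\<eta> \<in> {0..L}" for \<eta>
  proof -
    have "integ 0 \<eta> (\<lambda>\<zeta>. q \<zeta> *\<^sub>R W1 \<eta> \<zeta>) = integ \<theta> \<eta> (\<lambda>\<zeta>. p (\<zeta> - \<theta>) *\<^sub>R W1 \<eta> \<zeta>)"
      unfolding q_def using e st integ_step[of 0 \<eta> L \<theta> "\<lambda>\<zeta>. p (\<zeta> - \<theta>)" "W1 \<eta>"] by simp
    then show ?thesis
      using e st by (auto simp: A_def c_def q_def step_def indicator_def a_def integ_empty)
  qed
  have H: "integ 0 L (\<lambda>\<eta>. h \<eta> \<zeta>) = indicator {a..L} \<zeta> *\<^sub>R integ s \<zeta> (\<lambda>\<eta>. ((\<eta> - s) * p (\<zeta> - \<theta>)) *\<^sub>R W2 \<eta> \<zeta>)"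
    if z: "\<zeta> \<in> {0..L}" for \<zeta>
  proof (cases "\<theta> \<le> \<zeta>")
    case True
    have "integ 0 L (\<lambda>\<eta>. h \<eta> \<zeta>) = integ 0 L (\<lambda>\<eta>. indicator {s..\<zeta>} \<eta> *\<^sub>R (((\<eta> - s) * p (\<zeta> - \<theta>)) *\<^sub>R W2 \<eta> \<zeta>))"
      using True by (intro Bochner_Integration.integral_cong refl)
        (auto simp: h_def c_def q_def step_def indicator_def)
    also have "\<dots> = integ s \<zeta> (\<lambda>\<eta>. ((\<eta> - s) * p (\<zeta> - \<theta>)) *\<^sub>R W2 \<eta> \<zeta>)"
      using z st by (intro integ_eq_indicator[symmetric]) auto
    finally show ?thesis using z True by (auto simp: indicator_def a_def integ_empty)
  next
    case False
    then show ?thesis by (simp add: h_def q_def step_def indicator_def a_def)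
  qed
  have "Phi (\<lambda>\<eta>. scalar_mat (c \<eta>)) (\<lambda>\<zeta>. scalar_mat (q \<zeta>)) = integ 0 L A + integ 0 L (\<lambda>\<zeta>. integ 0 L (\<lambda>\<eta>. h \<eta> \<zeta>))"
    unfolding Phi using Ai hi Fubini_bdd[OF hb] by simp
  also have "\<dots> = integ 0 L (\<lambda>\<eta>. A \<eta> + integ 0 L (\<lambda>\<zeta>. h \<zeta> \<eta>))"
    using Ai hi' by simp
  also have "\<dots> = integ 0 L (\<lambda>\<eta>. indicator {a..L} \<eta> *\<^sub>R
     ((\<eta> - s) *\<^sub>R (p (\<eta> - \<theta>) *\<^sub>R U \<eta> + integ \<theta> \<eta> (\<lambda>\<zeta>. p (\<zeta> - \<theta>) *\<^sub>R W1 \<eta> \<zeta>))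
     + integ s \<eta> (\<lambda>\<zeta>. ((\<zeta> - s) * p (\<eta> - \<theta>)) *\<^sub>R W2 \<zeta> \<eta>)))"
    by (rule Bochner_Integration.integral_cong[OF refl]) (simp add: A H scaleR_add_right)
  also have "\<dots> = Jker p a s \<theta>"
    unfolding Jker_def using st by (intro integ_eq_indicator[symmetric]) (auto simp: a_def)
  finally show ?thesis by (simp add: c_def q_def a_def)
qed

lemma Phi_Ba_step:
  assumes S: "len S = L" and st: "s \<in> {0..L}" "\<theta> \<in> {0..L}" and p: "bdd_kernel L (\<lambda>s \<theta>. p (s - \<theta>))"
  shows "Phi (\<lambda>\<eta>. transpose (Ba S \<eta> s)) (\<lambda>\<zeta>. scalar_mat (step (\<zeta> - \<theta>) * p (\<zeta> - \<theta>)))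
    = integ \<theta> L (\<lambda>\<zeta>. p (\<zeta> - \<theta>) *\<^sub>R Y1 S U W1 W2 s \<zeta>)"
proof -
  have "Phi (\<lambda>\<eta>. transpose (Ba S \<eta> s)) (\<lambda>\<zeta>. scalar_mat (step (\<zeta> - \<theta>) * p (\<zeta> - \<theta>)))
    = integ 0 L (\<lambda>\<zeta>. (step (\<zeta> - \<theta>) * p (\<zeta> - \<theta>)) *\<^sub>R Y1 S U W1 W2 s \<zeta>)"
    unfolding Phi_alt[OF Ba_colT[OF S st(1)] bdd_scalar_step[OF p st(2)]] mult_scalar_mat
    by (intro Bochner_Integration.integral_cong refl) (simp add: Y1_eq[OF S st(1)])
  then show ?thesis using integ_step[of 0 L L \<theta> "\<lambda>\<zeta>. p (\<zeta> - \<theta>)"] st by simp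
qed

text \<open>Of the four products of boundary and step parts, the three that contain a boundary part
  are the three terms of \<open>J3\<close>. The product of the step parts is \<open>J1\<close> or
  \<open>J2\<close>, which differ only in the lower limit: it is \<open>s\<close> or \<theta>,
  whichever is larger.\<close>

lemma map_L3_eq:
  assumes S: "len S = L" and st: "s \<in> {0..L}" "\<theta> \<in> {0..L}" "s \<noteq> \<theta>"
  shows "Phi (\<lambda>\<eta>. transpose (Gker S \<eta> s)) (\<lambda>\<zeta>. Gker S \<zeta> \<theta>)
    = (if \<theta> \<le> s then fst (map_L3 S U W1 W2) s \<theta> else snd (map_L3 S U W1 W2) s \<theta>)"
proof -
  note b = Ba_colT[OF S st(1)] bdd_scalar_step[of "\<lambda>x. x", OF coord_diff st(1)]
    Ba_col[OF S st(2)] bdd_scalar_step[of "\<lambda>x. x", OF coord_diff st(2)]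
  have "Phi (\<lambda>\<eta>. transpose (Gker S \<eta> s)) (\<lambda>\<zeta>. Gker S \<zeta> \<theta>)
    = Phi (\<lambda>\<eta>. transpose (Ba S \<eta> s)) (\<lambda>\<zeta>. Ba S \<zeta> \<theta>)
    + Phi (\<lambda>\<eta>. transpose (Ba S \<eta> s)) (\<lambda>\<zeta>. scalar_mat (step (\<zeta> - \<theta>) * (\<zeta> - \<theta>)))
    + (Phi (\<lambda>\<eta>. scalar_mat (step (\<eta> - s) * (\<eta> - s))) (\<lambda>\<zeta>. Ba S \<zeta> \<theta>)
    + Phi (\<lambda>\<eta>. scalar_mat (step (\<eta> - s) * (\<eta> - s))) (\<lambda>\<zeta>. scalar_mat (step (\<zeta> - \<theta>) * (\<zeta> - \<theta>))))"
    unfolding transpose_Gker unfolding Gker_eq by (simp only: Phi_add_left Phi_add_right bdd_meas_add b)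
  also have "Phi (\<lambda>\<eta>. transpose (Ba S \<eta> s)) (\<lambda>\<zeta>. Ba S \<zeta> \<theta>)
      = integ 0 L (\<lambda>\<eta>. transpose (Ba S \<eta> s) ** Y3 S U W1 W2 \<eta> \<theta>)"
    unfolding Phi_def by (intro Bochner_Integration.integral_cong refl) (simp add: Y3_eq[OF S _ st(2)])
  also have "Phi (\<lambda>\<eta>. scalar_mat (step (\<eta> - s) * (\<eta> - s))) (\<lambda>\<zeta>. Ba S \<zeta> \<theta>)
      = integ 0 L (\<lambda>\<eta>. (step (\<eta> - s) * (\<eta> - s)) *\<^sub>R Y3 S U W1 W2 \<eta> \<theta>)"
    unfolding Phi_def scalar_mat_mult by (intro Bochner_Integration.integral_cong refl) (simp add: Y3_eq[OF S _ st(2)])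
  also have "\<dots> = integ s L (\<lambda>\<eta>. (\<eta> - s) *\<^sub>R Y3 S U W1 W2 \<eta> \<theta>)"
    using integ_step[of 0 L L s "\<lambda>\<eta>. \<eta> - s"] st by simp
  also note Phi_Ba_step[of S s \<theta> "\<lambda>x. x", OF S st(1,2) coord_diff]
  also note Phi_step_step[of s \<theta> "\<lambda>x. x", OF st(1,2) coord_diff]
  finally show ?thesis
    unfolding map_L3_def Let_def S Jker_def using st by (auto simp: max_def algebra_simps)
qed

text \<open>The same splitting with the derivative kernel on the right: its boundary part
  \<open>Bb S \<theta>\<close> does not depend on the integration variable and can be pulled out,
  and its step part has weight 1.\<close>

lemma map_L2_eq:
  assumes S: "len S = L" and st: "s \<in> {0..L}" "\<theta> \<in> {0..L}" "s \<noteq> \<theta>"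
  shows "Phi (\<lambda>\<eta>. transpose (Gker S \<eta> s)) (\<lambda>\<zeta>. Gker' S \<zeta> \<theta>)
    = (if \<theta> \<le> s then fst (map_L2 S U W1 W2) s \<theta> else snd (map_L2 S U W1 W2) s \<theta>)"
proof -
  have one: "bdd_kernel L (\<lambda>s \<theta>. (\<lambda>_. 1 :: real) (s - \<theta>))" by (rule bdd_meas_const)
  note b = Ba_colT[OF S st(1)] bdd_scalar_step[of "\<lambda>x. x", OF coord_diff st(1)]
    bdd_meas_const bdd_scalar_step[of "\<lambda>_. 1", OF one st(2), unfolded mult_1_right]
  have "Phi (\<lambda>\<eta>. transpose (Gker S \<eta> s)) (\<lambda>\<zeta>. Gker' S \<zeta> \<theta>)
    = Phi (\<lambda>\<eta>. transpose (Ba S \<eta> s)) (\<lambda>\<zeta>. Bb S \<theta>)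
    + Phi (\<lambda>\<eta>. transpose (Ba S \<eta> s)) (\<lambda>\<zeta>. scalar_mat (step (\<zeta> - \<theta>)))
    + (Phi (\<lambda>\<eta>. scalar_mat (step (\<eta> - s) * (\<eta> - s))) (\<lambda>\<zeta>. Bb S \<theta>)
    + Phi (\<lambda>\<eta>. scalar_mat (step (\<eta> - s) * (\<eta> - s))) (\<lambda>\<zeta>. scalar_mat (step (\<zeta> - \<theta>))))"
    unfolding transpose_Gker Gker'_eq by (simp only: Phi_add_left Phi_add_right bdd_meas_add b)
  also have "Phi (\<lambda>\<eta>. transpose (Ba S \<eta> s)) (\<lambda>\<zeta>. Bb S \<theta>)
      = integ 0 L (\<lambda>\<eta>. transpose (Ba S \<eta> s) ** Y2 S U W1 W2 \<eta> ** Bb S \<theta>)"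
    unfolding Phi_def by (intro Bochner_Integration.integral_cong refl) (simp add: Y2_mult_eq[OF S] matrix_mul_assoc)
  also have "Phi (\<lambda>\<eta>. scalar_mat (step (\<eta> - s) * (\<eta> - s))) (\<lambda>\<zeta>. Bb S \<theta>)
      = integ 0 L (\<lambda>\<eta>. ((step (\<eta> - s) * (\<eta> - s)) *\<^sub>R (U \<eta> + integ 0 L (\<lambda>\<zeta>. W \<eta> \<zeta>))) ** Bb S \<theta>)"
    unfolding Phi_def scalar_mat_mult
    by (intro Bochner_Integration.integral_cong refl) (simp add: Y2_mult_eq[OF S] Y2_eq[OF S] scalar_matrix_assoc)
  also have "\<dots> = integ 0 L (\<lambda>\<eta>. (step (\<eta> - s) * (\<eta> - s)) *\<^sub>R (U \<eta> + integ 0 L (\<lambda>\<zeta>. W \<eta> \<zeta>))) ** Bb S \<theta>"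
    using bdd_meas_step_mult[of L "\<lambda>x. x", OF L coord_diff st(1)]
    by (intro integ_left_mult bdd_meas_integrable bdd_meas_scaleR bdd_meas_add U bdd_meas_integral W)
  also have "integ 0 L (\<lambda>\<eta>. (step (\<eta> - s) * (\<eta> - s)) *\<^sub>R (U \<eta> + integ 0 L (\<lambda>\<zeta>. W \<eta> \<zeta>)))
      = integ 0 L (\<lambda>\<eta>. (step (\<eta> - s) * (\<eta> - s)) *\<^sub>R Y2 S U W1 W2 \<eta>)"
    by (intro Bochner_Integration.integral_cong refl) (simp add: Y2_eq[OF S])
  also have "\<dots> = integ s L (\<lambda>\<eta>. (\<eta> - s) *\<^sub>R Y2 S U W1 W2 \<eta>)"
    using integ_step[of 0 L L s "\<lambda>\<eta>. \<eta> - s"] st by simp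
  also note Phi_Ba_step[of S s \<theta> "\<lambda>_. 1", OF S st(1,2) one, unfolded mult_1_right]
  also note Phi_step_step[of s \<theta> "\<lambda>_. 1", OF st(1,2) one, unfolded mult_1_right]
  finally show ?thesis
    unfolding map_L2_def Let_def S Jker_def using st by (auto simp: max_def algebra_simps)
qed

end

subsection \<open>The energy balance\<close>

text \<open>Symmetry of the kernel is asked almost everywhere only, because
  \<open>glue N1 N2\<close> takes the value of \<open>N1\<close> on the diagonal, where membership
  in \<open>Phi2\<close> does not force a symmetric matrix.\<close>

locale quadratic_form =
  fixes L :: real and M :: "real \<Rightarrow> real^'n::finite^'n" and N :: "real \<Rightarrow> real \<Rightarrow> real^'n^'n"
  assumes L: "0 < L" and M: "bdd_meas (lebesgue_on {0..L}) M" and N: "bdd_kernel L N"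
    and M_sym: "\<And>s. s \<in> {0..L} \<Longrightarrow> transpose (M s) = M s"
    and N_sym: "AE s in lebesgue_on {0..L}. AE \<theta> in lebesgue_on {0..L}. transpose (N \<theta> s) = N s \<theta>"
begin

definition B :: "(real \<Rightarrow> real^'n) \<Rightarrow> (real \<Rightarrow> real^'n) \<Rightarrow> real"
  where "B f g = integ 0 L (\<lambda>s. f s \<bullet> (M s *v g s)) + kform L N f g"

lemma Mf_integrable: "f \<in> L2 {0..L} \<Longrightarrow> g \<in> L2 {0..L} \<Longrightarrow> integrable (lebesgue_on {0..L}) (\<lambda>s. f s \<bullet> (M s *v g s))"
  by (rule L2_integrable_inner[OF _ L2_bdd_mult[OF M]])

lemma Nf_integrable:
  "f \<in> L2 {0..L} \<Longrightarrow> g \<in> L2 {0..L} \<Longrightarrow> integrable (lebesgue_on {0..L}) (\<lambda>s. f s \<bullet> integ 0 L (\<lambda>\<theta>. N s \<theta> *v g \<theta>))"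
  by (rule kform_integrable[OF N L2_integrable L2_integrable])

lemma B_sym:
  assumes f: "f \<in> L2 {0..L}" and g: "g \<in> L2 {0..L}"
  shows "B f g = B g f"
proof -
  have "integ 0 L (\<lambda>s. f s \<bullet> (M s *v g s)) = integ 0 L (\<lambda>s. g s \<bullet> (M s *v f s))"
    by (intro Bochner_Integration.integral_cong refl)
      (simp add: M_sym dot_matrix_vector_mult[of "g _"] inner_commute)
  moreover have "kform L N f g = kform L (\<lambda>s \<theta>. transpose (N \<theta> s)) f g"
    by (rule kform_cong_AE) (use N_sym in \<open>auto elim!: eventually_mono\<close>)
  ultimately show ?thesis
    using kform_transpose[OF N L2_integrable[OF g] L2_integrable[OF f]] by (simp add: B_def)
qed

lemma B_add_left:
  assumes "f \<in> L2 {0..L}" "f' \<in> L2 {0..L}" "g \<in> L2 {0..L}"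
  shows "B (\<lambda>s. f s + f' s) g = B f g + B f' g"
  using assms by (simp add: B_def kform_def inner_add_left Mf_integrable Nf_integrable)

lemma B_scaleR_left: "B (\<lambda>s. c *\<^sub>R f s) g = c * B f g"
  by (simp add: B_def kform_def algebra_simps)

lemma B_diff_left:
  assumes "f \<in> L2 {0..L}" "f' \<in> L2 {0..L}" "g \<in> L2 {0..L}"
  shows "B (\<lambda>s. f s - f' s) g = B f g - B f' g"
  using assms by (simp add: B_def kform_def inner_diff_left Mf_integrable Nf_integrable)

lemma B_add_right:
  assumes "f \<in> L2 {0..L}" "g \<in> L2 {0..L}" "g' \<in> L2 {0..L}"
  shows "B f (\<lambda>s. g s + g' s) = B f g + B f g'"
  using assms by (simp add: B_sym[of f] L2_add B_add_left)

lemma B_scaleR_right: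
  assumes "f \<in> L2 {0..L}" "g \<in> L2 {0..L}"
  shows "B f (\<lambda>s. c *\<^sub>R g s) = c * B f g"
  using assms by (simp add: B_sym[of f] L2_scaleR B_scaleR_left)

lemma B_bounded:
  obtains C where "0 \<le> C" "\<And>f g. f \<in> L2 {0..L} \<Longrightarrow> g \<in> L2 {0..L} \<Longrightarrow> \<bar>B f g\<bar> \<le> C * L2_norm {0..L} f * L2_norm {0..L} g"
proof -
  let ?M = "lebesgue_on {0..L}"
  obtain c where c: "0 \<le> c" "\<And>x. x \<in> space ?M \<Longrightarrow> norm (M x) \<le> c" using bdd_measE[OF M] by blast
  obtain d where d: "0 \<le> d" "\<And>x. x \<in> space (?M \<Otimes>\<^sub>M ?M) \<Longrightarrow> norm (N (fst x) (snd x)) \<le> d" using bdd_measE[OF N] by blast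
  obtain k where k: "0 \<le> k" "\<And>a b. norm ((a :: real^'n^'n) *v b) \<le> norm a * norm b * k"
    using bounded_bilinear.nonneg_bounded[OF bounded_bilinear_matrix_vector_mult] by blast
  have "\<bar>B f g\<bar> \<le> (c * k + d * k * L) * L2_norm {0..L} f * L2_norm {0..L} g"
    if f: "f \<in> L2 {0..L}" and g: "g \<in> L2 {0..L}" for f g
  proof -
    define F G where "F = L2_norm {0..L} f" and "G = L2_norm {0..L} g"
    have nf: "(\<lambda>s. norm (f s)) \<in> L2 {0..L}" and ng: "(\<lambda>s. norm (g s)) \<in> L2 {0..L}" using f g by (auto simp: L2_def)
    have N1: "integ 0 L (\<lambda>s. norm (f s)) \<le> sqrt L * F" "integ 0 L (\<lambda>s. norm (g s)) \<le> sqrt L * G"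
      using integral_norm_le_L2_norm[of 0 L f] integral_norm_le_L2_norm[of 0 L g] L f g by (simp_all add: F_def G_def)
    have "\<bar>integ 0 L (\<lambda>s. f s \<bullet> (M s *v g s))\<bar> \<le> integ 0 L (\<lambda>s. c * k * (norm (f s) \<bullet> norm (g s)))"
      unfolding real_norm_def[symmetric]
    proof (rule norm_integral_le[OF Mf_integrable[OF f g]])
      show "integrable ?M (\<lambda>s. c * k * (norm (f s) \<bullet> norm (g s)))" using L2_integrable_inner[OF nf ng] by simp
      fix s assume s: "s \<in> space ?M"
      have "norm (f s \<bullet> (M s *v g s)) \<le> norm (f s) * norm (M s *v g s)" by (simp add: Cauchy_Schwarz_ineq2)
      also have "\<dots> \<le> norm (f s) * (norm (M s) * norm (g s) * k)" by (intro mult_left_mono k) auto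
      also have "\<dots> \<le> norm (f s) * (c * norm (g s) * k)"
        using c(2)[OF s] k by (intro mult_left_mono mult_right_mono) auto
      finally show "norm (f s \<bullet> (M s *v g s)) \<le> c * k * (norm (f s) \<bullet> norm (g s))" by (simp add: mult_ac)
    qed
    also have "\<dots> \<le> c * k * (F * G)"
      using L2_Cauchy_Schwarz[OF nf ng] c k by (simp add: F_def G_def L2_norm_def mult_left_mono)
    finally have 1: "\<bar>integ 0 L (\<lambda>s. f s \<bullet> (M s *v g s))\<bar> \<le> c * k * (F * G)" .
    have inner: "norm (integ 0 L (\<lambda>\<theta>. N s \<theta> *v g \<theta>)) \<le> d * k * (sqrt L * G)" if s: "s \<in> space ?M" for s
    proof -
      have "norm (integ 0 L (\<lambda>\<theta>. N s \<theta> *v g \<theta>)) \<le> integ 0 L (\<lambda>\<theta>. d * k * norm (g \<theta>))"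
      proof (rule norm_integral_le)
        show "integrable ?M (\<lambda>\<theta>. N s \<theta> *v g \<theta>)"
          using kernel_row_integrable[OF N L2_integrable[OF g]] s by simp
        show "integrable ?M (\<lambda>\<theta>. d * k * norm (g \<theta>))" using L2_integrable[OF g] by simp
        fix \<theta> assume "\<theta> \<in> space ?M"
        then have "norm (N s \<theta>) \<le> d" using d(2)[of "(s, \<theta>)"] s by (simp add: space_pair_measure)
        then have "norm (N s \<theta>) * norm (g \<theta>) * k \<le> d * norm (g \<theta>) * k" using k by (intro mult_right_mono) auto
        then show "norm (N s \<theta> *v g \<theta>) \<le> d * k * norm (g \<theta>)" using k(2)[of "N s \<theta>" "g \<theta>"] by (simp add: mult_ac)
      qed
      also have "\<dots> \<le> d * k * (sqrt L * G)" using N1 d k by (simp add: mult_left_mono)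
      finally show ?thesis .
    qed
    have "\<bar>kform L N f g\<bar> \<le> integ 0 L (\<lambda>s. norm (f s) * (d * k * (sqrt L * G)))"
      unfolding kform_def real_norm_def[symmetric]
    proof (rule norm_integral_le[OF Nf_integrable[OF f g]])
      show "integrable ?M (\<lambda>s. norm (f s) * (d * k * (sqrt L * G)))" using L2_integrable[OF f] by simp
      fix s assume s: "s \<in> space ?M"
      have "norm (f s \<bullet> integ 0 L (\<lambda>\<theta>. N s \<theta> *v g \<theta>)) \<le> norm (f s) * norm (integ 0 L (\<lambda>\<theta>. N s \<theta> *v g \<theta>))"
        by (simp add: Cauchy_Schwarz_ineq2)
      also have "\<dots> \<le> norm (f s) * (d * k * (sqrt L * G))" by (intro mult_left_mono inner s) auto
      finally show "norm (f s \<bullet> integ 0 L (\<lambda>\<theta>. N s \<theta> *v g \<theta>)) \<le> norm (f s) * (d * k * (sqrt L * G))" .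
    qed
    also have "\<dots> = integ 0 L (\<lambda>s. norm (f s)) * (d * k * (sqrt L * G))" by simp
    also have "\<dots> \<le> (sqrt L * F) * (d * k * (sqrt L * G))"
      using N1 d k L by (intro mult_right_mono mult_nonneg_nonneg) (auto simp: G_def)
    also have "\<dots> = d * k * L * (F * G)" using L real_sqrt_mult_self[of L] by (simp add: mult_ac)
    finally have "\<bar>kform L N f g\<bar> \<le> d * k * L * (F * G)" .
    then have "\<bar>B f g\<bar> \<le> c * k * (F * G) + d * k * L * (F * G)" using 1 unfolding B_def by linarith
    then show ?thesis by (simp add: F_def G_def algebra_simps)
  qed
  then show ?thesis using c d k L by (intro that[of "c * k + d * k * L"]) auto
qed

text \<open>Write x(t+h) = x(t) + h \<delta> with \<delta> = v + r(h), where r(h) tends to 0 in L2.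
  By symmetry the increment of the energy is 2 h B(\<delta>, x(t)) + h^2 B(\<delta>, \<delta>), and
  boundedness of \<open>B\<close> controls what remains after division by \<open>h\<close>.\<close>

lemma B_has_derivative:
  assumes x: "\<And>\<tau>. 0 \<le> \<tau> \<Longrightarrow> x \<tau> \<in> L2 {0..L}" and t: "0 < t" and d: "has_L2_deriv L x v t"
  shows "((\<lambda>\<tau>. B (x \<tau>) (x \<tau>)) has_vector_derivative 2 * B v (x t)) (at t)"
proof -
  obtain C where C: "0 \<le> C" "\<And>f g. f \<in> L2 {0..L} \<Longrightarrow> g \<in> L2 {0..L} \<Longrightarrow> \<bar>B f g\<bar> \<le> C * L2_norm {0..L} f * L2_norm {0..L} g"
    by (rule B_bounded) blast
  have v: "v \<in> L2 {0..L}" using d by (simp add: has_L2_deriv_def)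
  define r where "r h s = (x (t + h) s - x t s) /\<^sub>R h - v s" for h s
  define e where "e h = L2_norm {0..L} (r h)" for h
  have e0: "(e \<longlongrightarrow> 0) (at 0)"
    using d by (simp add: has_L2_deriv_def e_def[abs_def] r_def[abs_def])
  define A where "A = L2_norm {0..L} (x t)"
  define D where "D = L2_norm {0..L} v"
  have xt: "x t \<in> L2 {0..L}" using x t by simp
  have bound: "\<bar>(B (x (t + h)) (x (t + h)) - B (x t) (x t)) / h - 2 * B v (x t)\<bar> \<le> 2 * (C * e h * A) + \<bar>h\<bar> * (C * (e h + D) * (e h + D))"
    if h: "h \<noteq> 0" "t + h > 0" for h
  proof -
    have xh: "x (t + h) \<in> L2 {0..L}" using x h by simp
    have rL: "r h \<in> L2 {0..L}" unfolding r_def by (intro L2_diff L2_scaleR xh xt v)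
    define \<delta> where "\<delta> s = r h s + v s" for s
    have dL: "\<delta> \<in> L2 {0..L}" unfolding \<delta>_def by (intro L2_add rL v)
    have xe: "x (t + h) = (\<lambda>s. x t s + h *\<^sub>R \<delta> s)" using h by (simp add: \<delta>_def r_def)
    have hd: "(\<lambda>s. h *\<^sub>R \<delta> s) \<in> L2 {0..L}" by (rule L2_scaleR[OF dL])
    have "B (x (t + h)) (x (t + h)) = B (x t) (x t) + 2 * h * B \<delta> (x t) + h * h * B \<delta> \<delta>"
      unfolding xe using xt hd dL L2_add[OF xt hd] B_sym[OF xt dL]
      by (simp add: B_add_left B_add_right B_scaleR_left B_scaleR_right algebra_simps)
    then have "(B (x (t + h)) (x (t + h)) - B (x t) (x t)) / h - 2 * B v (x t) = 2 * (B \<delta> (x t) - B v (x t)) + h * B \<delta> \<delta>"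
      using h by (simp add: field_simps)
    also have "B \<delta> (x t) = B (r h) (x t) + B v (x t)" unfolding \<delta>_def by (rule B_add_left[OF rL v xt])
    finally have eq: "(B (x (t + h)) (x (t + h)) - B (x t) (x t)) / h - 2 * B v (x t) = 2 * B (r h) (x t) + h * B \<delta> \<delta>" by simp
    have b1: "\<bar>B (r h) (x t)\<bar> \<le> C * e h * A" using C(2)[OF rL xt] by (simp add: e_def A_def)
    have n: "L2_norm {0..L} \<delta> \<le> e h + D" unfolding \<delta>_def e_def D_def by (rule L2_norm_triangle[OF rL v])
    have "\<bar>B \<delta> \<delta>\<bar> \<le> C * L2_norm {0..L} \<delta> * L2_norm {0..L} \<delta>" by (rule C(2)[OF dL dL])
    also have "\<dots> \<le> C * (e h + D) * (e h + D)"
      using n C(1) order_trans[OF L2_norm_nonneg n] by (intro mult_mono mult_nonneg_nonneg) auto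
    finally have b2: "\<bar>h * B \<delta> \<delta>\<bar> \<le> \<bar>h\<bar> * (C * (e h + D) * (e h + D))"
      by (simp add: abs_mult mult_left_mono)
    show ?thesis unfolding eq using b1 b2 by (simp add: abs_le_iff)
  qed
  have lim: "((\<lambda>h. 2 * (C * e h * A) + \<bar>h\<bar> * (C * (e h + D) * (e h + D))) \<longlongrightarrow> 2 * (C * 0 * A) + \<bar>0\<bar> * (C * (0 + D) * (0 + D))) (at 0)"
    by (intro tendsto_intros e0)
  have "((\<lambda>h. (B (x (t + h)) (x (t + h)) - B (x t) (x t)) / h - 2 * B v (x t)) \<longlongrightarrow> 0) (at 0)"
  proof (rule Lim_null_comparison[OF _ lim[simplified]])
    \<comment> \<open>The state is known to be square-integrable at nonnegative times only, so
      \<open>h\<close> has to be small when it is negative.\<close>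
    have "eventually (\<lambda>h. t + h > 0) (at 0)"
      using order_tendstoD(1)[OF tendsto_add[OF tendsto_const[of t] tendsto_ident_at[of 0 UNIV]], of 0] t by simp
    moreover have "eventually (\<lambda>h::real. h \<noteq> 0) (at 0)" by (simp add: eventually_at_filter)
    ultimately show "eventually (\<lambda>h. norm ((B (x (t + h)) (x (t + h)) - B (x t) (x t)) / h - 2 * B v (x t))
        \<le> 2 * (C * e h * A) + \<bar>h\<bar> * (C * (e h + D) * (e h + D))) (at 0)"
      by eventually_elim (use bound in auto)
  qed
  then have "((\<lambda>h. (B (x (t + h)) (x (t + h)) - B (x t) (x t)) / h) \<longlongrightarrow> 2 * B v (x t)) (at 0)"
    using Lim_null by blast
  then show ?thesis
    by (simp add: has_real_derivative_iff_has_vector_derivative[symmetric] DERIV_def)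
qed

text \<open>With d = x(b) - x(a), the increment of the energy equals B(d, x(b)) + B(d, x(a)). Since
  the norm of the state is bounded on \<open>{0..T}\<close>, the energy inherits absolute continuity
  from the state with a constant factor.\<close>

lemma B_abs_continuous:
  assumes x: "\<And>\<tau>. 0 \<le> \<tau> \<Longrightarrow> x \<tau> \<in> L2 {0..L}" and ac: "locally_abs_continuous L x" and T: "0 < T" and e: "0 < e"
  shows "\<exists>d>0. \<forall>(k::nat) l u. (\<forall>i<k. 0 \<le> l i \<and> l i \<le> u i \<and> u i \<le> T)
            \<and> disjoint_family_on (\<lambda>i. {l i<..<u i}) {..<k} \<and> (\<Sum>i<k. u i - l i) < d
            \<longrightarrow> (\<Sum>i<k. \<bar>B (x (u i)) (x (u i)) - B (x (l i)) (x (l i))\<bar>) < e"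
proof -
  obtain C where C: "0 \<le> C" "\<And>f g. f \<in> L2 {0..L} \<Longrightarrow> g \<in> L2 {0..L} \<Longrightarrow> \<bar>B f g\<bar> \<le> C * L2_norm {0..L} f * L2_norm {0..L} g"
    by (rule B_bounded) blast
  have ac': "\<exists>d>0. \<forall>(k::nat) a b. (\<forall>i<k. 0 \<le> a i \<and> a i \<le> b i \<and> b i \<le> T) \<and>
       disjoint_family_on (\<lambda>i. {a i<..<b i}) {..<k} \<and> (\<Sum>i<k. b i - a i) < d
       \<longrightarrow> (\<Sum>i<k. L2_norm {0..L} (\<lambda>s. x (b i) s - x (a i) s)) < e" if "e > 0" for e
    using ac T that unfolding locally_abs_continuous_def by blast
  define n where "n t = L2_norm {0..L} (x t)" for t
  have ndiff: "\<bar>n b - n a\<bar> \<le> L2_norm {0..L} (\<lambda>s. x b s - x a s)" if "0 \<le> a" "0 \<le> b" for a b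
  proof -
    have xa: "x a \<in> L2 {0..L}" and xb: "x b \<in> L2 {0..L}" using x that by auto
    have "n b \<le> L2_norm {0..L} (\<lambda>s. x b s - x a s) + n a"
      using L2_norm_triangle[OF L2_diff[OF xb xa] xa] by (simp add: n_def)
    moreover have "n a \<le> L2_norm {0..L} (\<lambda>s. x a s - x b s) + n b"
      using L2_norm_triangle[OF L2_diff[OF xa xb] xb] by (simp add: n_def)
    moreover have "L2_norm {0..L} (\<lambda>s. x a s - x b s) = L2_norm {0..L} (\<lambda>s. x b s - x a s)"
      by (simp add: L2_norm_def norm_minus_commute)
    ultimately show ?thesis by linarith
  qed
  have "continuous_on {0..T} n"
    unfolding continuous_on_iff
  proof (intro ballI allI impI)
    fix t \<epsilon> :: real assume t: "t \<in> {0..T}" and \<epsilon>: "0 < \<epsilon>"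
    obtain d where d: "d > 0" "\<forall>(k::nat) a b. (\<forall>i<k. 0 \<le> a i \<and> a i \<le> b i \<and> b i \<le> T) \<and>
       disjoint_family_on (\<lambda>i. {a i<..<b i}) {..<k} \<and> (\<Sum>i<k. b i - a i) < d
       \<longrightarrow> (\<Sum>i<k. L2_norm {0..L} (\<lambda>s. x (b i) s - x (a i) s)) < \<epsilon>" using ac'[OF \<epsilon>] by blast
    \<comment> \<open>Absolute continuity for a family consisting of one interval is
      continuity.\<close>
    have small: "L2_norm {0..L} (\<lambda>s. x b s - x a s) < \<epsilon>" if "0 \<le> a" "a \<le> b" "b \<le> T" "b - a < d" for a b
      using d(2)[rule_format, of 1 "\<lambda>_. a" "\<lambda>_. b"] that by (simp add: disjoint_family_on_def)
    show "\<exists>d>0. \<forall>x'\<in>{0..T}. dist x' t < d \<longrightarrow> dist (n x') (n t) < \<epsilon>"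
    proof (intro exI[of _ d] conjI d(1) ballI impI)
      fix t' assume t': "t' \<in> {0..T}" "dist t' t < d"
      show "dist (n t') (n t) < \<epsilon>"
      proof (cases "t \<le> t'")
        case True
        then show ?thesis using small[of t t'] ndiff[of t t'] t t' by (simp add: dist_real_def)
      next
        case False
        then show ?thesis using small[of t' t] ndiff[of t' t] t t' by (simp add: dist_real_def)
      qed
    qed
  qed
  then have "bounded (n ` {0..T})" by (intro compact_imp_bounded compact_continuous_image) auto
  then obtain K where "\<forall>y\<in>n ` {0..T}. norm y \<le> K" unfolding bounded_iff by blast
  then have K: "\<And>t. t \<in> {0..T} \<Longrightarrow> \<bar>n t\<bar> \<le> K" by auto
  have K0: "0 \<le> K" using K[of 0] T by simp
  have step: "\<bar>B (x b) (x b) - B (x a) (x a)\<bar> \<le> (2 * C * K) * L2_norm {0..L} (\<lambda>s. x b s - x a s)"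
    if ab: "a \<in> {0..T}" "b \<in> {0..T}" for a b
  proof -
    have xa: "x a \<in> L2 {0..L}" and xb: "x b \<in> L2 {0..L}" using x ab by auto
    note dL = L2_diff[OF xb xa]
    have "B (x b) (x b) - B (x a) (x a) = B (\<lambda>s. x b s - x a s) (x b) + B (\<lambda>s. x b s - x a s) (x a)"
      using B_sym[OF xa xb] by (simp add: B_diff_left xa xb)
    moreover have "\<bar>B (\<lambda>s. x b s - x a s) (x c)\<bar> \<le> (C * K) * L2_norm {0..L} (\<lambda>s. x b s - x a s)" if c: "c \<in> {0..T}" for c
    proof -
      have "\<bar>B (\<lambda>s. x b s - x a s) (x c)\<bar> \<le> C * L2_norm {0..L} (\<lambda>s. x b s - x a s) * n c"
        using C(2)[OF dL, of "x c"] x c by (simp add: n_def)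
      also have "\<dots> \<le> C * L2_norm {0..L} (\<lambda>s. x b s - x a s) * K"
        using K[OF c] C(1) by (intro mult_left_mono mult_nonneg_nonneg) auto
      finally show ?thesis by (simp add: mult_ac)
    qed
    from this[OF ab(1)] this[OF ab(2)] calculation show ?thesis by linarith
  qed
  \<comment> \<open>The \<open>+ 1\<close> keeps the denominator positive when \<open>C\<close> or
    \<open>K\<close> is 0, and makes the final inequality strict.\<close>
  define e' where "e' = e / (2 * C * K + 1)"
  have CK: "0 < 2 * C * K + 1" using C(1) K0 by (simp add: add_nonneg_pos)
  have e': "0 < e'" using e CK by (simp add: e'_def)
  obtain d where d: "d > 0" "\<And>(k::nat) a b. (\<forall>i<k. 0 \<le> a i \<and> a i \<le> b i \<and> b i \<le> T) \<and>
       disjoint_family_on (\<lambda>i. {a i<..<b i}) {..<k} \<and> (\<Sum>i<k. b i - a i) < d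
       \<Longrightarrow> (\<Sum>i<k. L2_norm {0..L} (\<lambda>s. x (b i) s - x (a i) s)) < e'" using ac'[OF e'] by blast
  show ?thesis
  proof (intro exI[of _ d] conjI d(1) allI impI)
    fix k :: nat and l u :: "nat \<Rightarrow> real"
    assume h: "(\<forall>i<k. 0 \<le> l i \<and> l i \<le> u i \<and> u i \<le> T)
            \<and> disjoint_family_on (\<lambda>i. {l i<..<u i}) {..<k} \<and> (\<Sum>i<k. u i - l i) < d"
    have lu: "l i \<in> {0..T}" "u i \<in> {0..T}" if "i < k" for i
      using conjunct1[OF h, rule_format, OF that] by auto
    have "(\<Sum>i<k. \<bar>B (x (u i)) (x (u i)) - B (x (l i)) (x (l i))\<bar>)
      \<le> (\<Sum>i<k. (2 * C * K) * L2_norm {0..L} (\<lambda>s. x (u i) s - x (l i) s))"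
      by (intro sum_mono step lu) auto
    also have "\<dots> = (2 * C * K) * (\<Sum>i<k. L2_norm {0..L} (\<lambda>s. x (u i) s - x (l i) s))" by (simp add: sum_distrib_left)
    also have "\<dots> \<le> (2 * C * K) * e'" using d(2)[OF h] C(1) K0 by (intro mult_left_mono) auto
    also have "\<dots> < (2 * C * K + 1) * e'" using e' by (simp add: distrib_right)
    also have "\<dots> = e" using CK by (simp add: e'_def)
    finally show "(\<Sum>i<k. \<bar>B (x (u i)) (x (u i)) - B (x (l i)) (x (l i))\<bar>) < e" .
  qed
qed

text \<open>Stated for an arbitrary integrable supply rate \<open>h\<close>, so that it serves both
  the gain and the passivity claim. The inequality is first obtained on each \<open>{0..T}\<close>
  with T > 0, then carried to the half-line by dominated convergence.\<close>

lemma dissipation_integral: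
  fixes h :: "real \<Rightarrow> real"
  assumes x: "\<And>\<tau>. 0 \<le> \<tau> \<Longrightarrow> x \<tau> \<in> L2 {0..L}" and ac: "locally_abs_continuous L x"
    and x0: "AE s in lebesgue_on {0..L}. x 0 s = 0"
    and pos: "\<And>f. f \<in> L2 {0..L} \<Longrightarrow> 0 \<le> B f f"
    and h: "integrable (lebesgue_on {0..}) h"
    and der: "AE t in lebesgue_on {0..}. \<exists>v. has_L2_deriv L x v t \<and> 2 * B v (x t) \<le> h t"
  shows "0 \<le> (LINT t|lebesgue_on {0..}. h t)"
proof -
  have int: "0 \<le> integ 0 T h" if T: "0 < T" for T
  proof -
    have hT: "integrable (lebesgue_on {0..T}) h"
    proof -
      have "integrable lebesgue (\<lambda>t. indicator {0..} t *\<^sub>R h t)"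
        using h by (simp add: integrable_restrict_space)
      then have "integrable lebesgue (\<lambda>t. indicator {0..T} t *\<^sub>R (indicator {0..} t *\<^sub>R h t))"
        by (rule integrable_mult_indicator[rotated]) simp
      moreover have "(\<lambda>t. indicat_real {0..T} t *\<^sub>R (indicat_real {0..} t *\<^sub>R h t)) = (\<lambda>t. indicator {0..T} t *\<^sub>R h t)"
        by (auto simp: indicator_def fun_eq_iff)
      ultimately show ?thesis by (subst integrable_restrict_space) auto
    qed
    have "B (x T) (x T) - B (x 0) (x 0) \<le> integ 0 T h"
    proof (rule abs_continuous_le_integral[OF less_imp_le[OF T] B_abs_continuous[OF x ac T] _ hT])
      have "AE t in lebesgue. t \<in> {0..} \<longrightarrow> (\<exists>v. has_L2_deriv L x v t \<and> 2 * B v (x t) \<le> h t)"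
        using der by (simp add: AE_restrict_space_iff)
      \<comment> \<open>The energy is differentiated from both sides, which
        \<open>B_has_derivative\<close> allows only for \<open>0 < t\<close>.\<close>
      moreover have "AE t in lebesgue. t \<noteq> (0::real)" by (rule AE_completion[OF AE_lborel_singleton])
      ultimately have "AE t in lebesgue. t \<in> {0..T} \<longrightarrow>
          (\<exists>d. ((\<lambda>\<tau>. B (x \<tau>) (x \<tau>)) has_vector_derivative d) (at t) \<and> d \<le> h t)"
      proof eventually_elim
        case (elim t)
        show ?case
        proof
          assume t: "t \<in> {0..T}"
          then obtain v where v: "has_L2_deriv L x v t" "2 * B v (x t) \<le> h t" using elim by auto
          have "0 < t" using t elim by auto
          from B_has_derivative[OF x this v(1)] v(2)
          show "\<exists>d. ((\<lambda>\<tau>. B (x \<tau>) (x \<tau>)) has_vector_derivative d) (at t) \<and> d \<le> h t" by blast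
        qed
      qed
      then show "AE t in lebesgue_on {0..T}. \<exists>d. ((\<lambda>\<tau>. B (x \<tau>) (x \<tau>)) has_vector_derivative d) (at t) \<and> d \<le> h t"
        by (simp add: AE_restrict_space_iff)
    qed auto
    moreover have "B (x 0) (x 0) = 0"
    proof -
      have "integ 0 L (\<lambda>s. x 0 s \<bullet> g s) = 0" for g
        by (rule integral_eq_zero_AE) (use x0 in \<open>auto elim!: eventually_mono\<close>)
      then show ?thesis by (simp add: B_def kform_def)
    qed
    ultimately show ?thesis using pos[of "x T"] x T by simp
  qed
  have lim: "(\<lambda>n. LINT t|lebesgue_on {0..}. indicator {0..real n} t *\<^sub>R h t) \<longlonglongrightarrow> (LINT t|lebesgue_on {0..}. h t)"
  proof (rule integral_dominated_convergence[where w="\<lambda>t. \<bar>h t\<bar>"])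
    show "AE t in lebesgue_on {0..}. (\<lambda>n. indicator {0..real n} t *\<^sub>R h t) \<longlonglongrightarrow> h t"
    proof (rule AE_I2)
      fix t assume t: "t \<in> space (lebesgue_on {0::real..})"
      obtain m where m: "t \<le> real m" using real_arch_simple by blast
      show "(\<lambda>n. indicator {0..real n} t *\<^sub>R h t) \<longlonglongrightarrow> h t"
      proof (rule tendsto_eventually, rule eventually_sequentiallyI[of m])
        show "indicator {0..real n} t *\<^sub>R h t = h t" if "m \<le> n" for n
          using t m that by (auto simp: indicator_def)
      qed
    qed
    show "(\<lambda>t. indicator {0..real n} t *\<^sub>R h t) \<in> borel_measurable (lebesgue_on {0..})" for n
      using h by (intro borel_measurable_scaleR borel_measurable_indicator) (auto simp: sets_restrict_space_iff)
  qed (use h in \<open>auto simp: indicator_def\<close>)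
  have "0 \<le> (LINT t|lebesgue_on {0..}. indicator {0..real n} t *\<^sub>R h t)" for n
  \<comment> \<open>The inequality on \<open>{0..T}\<close> was proved for positive
    \<open>T\<close>; for \<open>n = 0\<close> the integration set is a single point.\<close>
  proof (cases "n = 0")
    case True
    have "AE t in lebesgue_on {0..}. t \<noteq> (0::real)"
      by (rule AE_lborel_imp_lebesgue_on[OF AE_lborel_singleton]) simp
    then have "AE t in lebesgue_on {0..}. indicator {0..real n} t *\<^sub>R h t = 0"
      by eventually_elim (use True in auto)
    then show ?thesis by (simp add: integral_eq_zero_AE)
  next
    case False
    have "(LINT t|lebesgue_on {0..}. indicator {0..real n} t *\<^sub>R h t)
        = (LINT t|lebesgue. indicator {0..} t *\<^sub>R (indicator {0..real n} t *\<^sub>R h t))"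
      by (simp add: integral_restrict_space)
    also have "\<dots> = (LINT t|lebesgue. indicator {0..real n} t *\<^sub>R h t)"
      by (intro Bochner_Integration.integral_cong refl) (auto simp: indicator_def)
    also have "\<dots> = integ 0 (real n) h" by (simp add: integral_restrict_space)
    finally show ?thesis using int[of "real n"] False by simp
  qed
  then show ?thesis using LIMSEQ_le_const[OF lim] by blast
qed

end

section \<open>The output and the derivative of the energy in terms of \<open>u\<close> and
  \<open>w\<close>\<close>

context pi_operator begin

lemma state_kernel_bdd:
  assumes G: "bdd_kernel L G"
  shows "bdd_kernel L (\<lambda>s \<theta>. transpose (G \<theta> s) ** U \<theta> + integ 0 L (\<lambda>\<eta>. transpose (G \<eta> s) ** W \<eta> \<theta>))"
  by (intro bdd_meas_add bdd_meas_mult bdd_meas_linear[OF bounded_linear_transpose bdd_meas_swap[OF G]]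
      bdd_meas_compose[OF U measurable_snd]
      bdd_meas_kernel_prod[OF bounded_bilinear_matrix_matrix_mult
        bdd_meas_linear[OF bounded_linear_transpose bdd_meas_swap[OF G]] W])

lemma Phi_bdd:
  assumes G: "bdd_kernel L G" and D: "bdd_kernel L D"
  shows "bdd_kernel L (\<lambda>s \<theta>. Phi (\<lambda>\<eta>. transpose (G \<eta> s)) (\<lambda>\<zeta>. D \<zeta> \<theta>))"
proof -
  have GT: "bdd_kernel L (\<lambda>s \<theta>. transpose (G \<theta> s))"
    by (rule bdd_meas_linear[OF bounded_linear_transpose bdd_meas_swap[OF G]])
  have "bdd_kernel L (\<lambda>s \<theta>. integ 0 L (\<lambda>\<zeta>. (transpose (G \<zeta> s) ** U \<zeta> + integ 0 L (\<lambda>\<eta>. transpose (G \<eta> s) ** W \<eta> \<zeta>)) ** D \<zeta> \<theta>))"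
    by (rule bdd_meas_kernel_prod[OF bounded_bilinear_matrix_matrix_mult state_kernel_bdd[OF G] D])
  then show ?thesis
    by (rule bdd_meas_cong[THEN iffD1, rotated])
      (auto simp: space_pair_measure Phi_alt[OF bdd_meas_section1[OF GT] bdd_meas_section2[OF D]])
qed

end

lemma bdd_meas_Bc: "bdd_meas (lebesgue_on {a..b::real}) (Bc S)"
proof -
  have "Bc S \<eta> = - (matrix_inv (B2 S) ** Bbc S) ** vstack4 0 (scalar_mat (len S - \<eta>)) 0 (mat 1)" for \<eta>
    by (simp add: Bc_def matrix_mult_uminus_left)
  then have "Bc S = (\<lambda>\<eta>. - (matrix_inv (B2 S) ** Bbc S) ** vstack4 0 (scalar_mat (len S - \<eta>)) 0 (mat 1))" by (rule ext)
  then show ?thesis by (simp only: bdd_meas_mult bdd_meas_const bdd_meas_vstack4)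
qed

lemma bdd_kernel_fst: "bdd_meas (lebesgue_on {0..L::real}) f \<Longrightarrow> bdd_kernel L (\<lambda>s \<theta>. f s)"
  by (rule bdd_meas_compose[OF _ measurable_fst])

lemma bdd_kernel_snd: "bdd_meas (lebesgue_on {0..L::real}) f \<Longrightarrow> bdd_kernel L (\<lambda>s \<theta>. f \<theta>)"
  by (rule bdd_meas_compose[OF _ measurable_snd])

text \<open>\<open>C3\<close> collects what the boundary term and the two distributed terms of the
  output become once the state is represented by \<open>u\<close>; \<open>kernel_mult\<close> moves
  \<open>Ca\<close> and \<open>Cb\<close> inside the integrals over the Green kernels.\<close>

lemma output_representation:
  fixes S :: "('n::finite, 'm::finite, 'q::finite) pde_system"
  assumes adm: "admissible_data S" and f: "f \<in> X_space S"
  defines "u \<equiv> weak_deriv (len S) (weak_deriv (len S) f)"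
  shows "bdd_meas (lebesgue_on {0..len S}) (C3 S)"
    and "C1 S *v boundary_values (len S) f
       + integ 0 (len S) (\<lambda>s. Ca S s *v f s + Cb S s *v weak_deriv (len S) f s) = integ 0 (len S) (\<lambda>\<theta>. C3 S \<theta> *v u \<theta>)"
proof -
  define L where "L = len S"
  define f1 where "f1 = weak_deriv (len S) f"
  let ?M = "lebesgue_on {0..L}"
  interpret finite_measure ?M by (rule finite_measure_Icc)
  have L: "0 < L" and Ca: "bdd_meas ?M (Ca S)" and Cb: "bdd_meas ?M (Cb S)"
    using adm by (auto simp: admissible_data_def L_def intro: bdd_meas_continuous_on)
  note rep = X_space_representation[OF adm f, folded f1_def, folded L_def]
  have u: "u \<in> L2 {0..L}" using rep(2) by (simp add: u_def f1_def L_def)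
  have ui: "integrable ?M u" by (rule L2_integrable[OF u])
  define V where "V \<eta> = bnd_mat L ** Bc S \<eta> + vstack4 0 (scalar_mat (L - \<eta>)) 0 (mat 1)" for \<eta>
  have V: "bdd_meas ?M V"
    unfolding V_def by (intro bdd_meas_add bdd_meas_mult bdd_meas_const bdd_meas_Bc bdd_meas_vstack4)
  have G: "bdd_kernel L (Gker S)" "bdd_kernel L (Gker' S)" using bdd_kernel_Gker[OF L] bdd_kernel_Gker'[OF L] by blast+
  have CG: "bdd_kernel L (\<lambda>s \<theta>. Ca S s ** Gker S s \<theta>)" "bdd_kernel L (\<lambda>s \<theta>. Cb S s ** Gker' S s \<theta>)"
    by (intro bdd_meas_mult bdd_kernel_fst Ca Cb G)+
  have I: "bdd_meas ?M (\<lambda>\<theta>. integ 0 L (\<lambda>s. Ca S s ** Gker S s \<theta>))" "bdd_meas ?M (\<lambda>\<theta>. integ 0 L (\<lambda>s. Cb S s ** Gker' S s \<theta>))"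
    by (rule bdd_meas_integral[OF bdd_meas_swap[OF CG(1)]], rule bdd_meas_integral[OF bdd_meas_swap[OF CG(2)]])
  have C3: "C3 S \<theta> = C1 S ** V \<theta> + (integ 0 L (\<lambda>s. Ca S s ** Gker S s \<theta>) + integ 0 L (\<lambda>s. Cb S s ** Gker' S s \<theta>))"
    if "\<theta> \<in> space ?M" for \<theta>
    using bdd_meas_integrable[OF bdd_meas_section2[OF CG(1) that]] bdd_meas_integrable[OF bdd_meas_section2[OF CG(2) that]]
    by (simp add: C3_def V_def L_def[symmetric])
  have "bdd_meas ?M (\<lambda>\<theta>. C1 S ** V \<theta> + (integ 0 L (\<lambda>s. Ca S s ** Gker S s \<theta>) + integ 0 L (\<lambda>s. Cb S s ** Gker' S s \<theta>)))"
    by (intro bdd_meas_add bdd_meas_mult bdd_meas_const V I)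
  then have "bdd_meas ?M (C3 S)" by (rule bdd_meas_cong[THEN iffD1, rotated]) (simp add: C3)
  then show "bdd_meas (lebesgue_on {0..len S}) (C3 S)" by (simp add: L_def)
  have mv: "integrable ?M (\<lambda>\<theta>. A \<theta> *v u \<theta>)" if "bdd_meas ?M A" for A :: "real \<Rightarrow> real^'n^'k::finite"
    by (rule bdd_meas_integrable_mult[OF bounded_bilinear_matrix_vector_mult that ui])
  have fL2: "f \<in> L2 {0..L}" using f by (simp add: X_space_def L_def)
  have fi: "integrable ?M (\<lambda>s. Ca S s *v f s)" "integrable ?M (\<lambda>s. Cb S s *v f1 s)"
    using bdd_meas_integrable_mult[OF bounded_bilinear_matrix_vector_mult Ca L2_integrable[OF fL2]]
      bdd_meas_integrable_mult[OF bounded_bilinear_matrix_vector_mult Cb L2_integrable] rep(1) by auto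
  have uu: "weak_deriv L f1 = u" by (simp add: u_def f1_def L_def)
  have "C1 S *v boundary_values L f = integ 0 L (\<lambda>\<theta>. C1 S *v (V \<theta> *v u \<theta>))"
    unfolding rep(5)[unfolded uu] V_def[symmetric]
    by (rule integral_bounded_linear[OF matrix_vector_mul_bounded_linear mv[OF V], symmetric])
  then have 1: "C1 S *v boundary_values L f = integ 0 L (\<lambda>\<theta>. (C1 S ** V \<theta>) *v u \<theta>)"
    by (simp add: matrix_vector_mul_assoc)
  have "integ 0 L (\<lambda>s. Ca S s *v f s) = integ 0 L (\<lambda>s. Ca S s *v integ 0 L (\<lambda>\<eta>. Gker S s \<eta> *v u \<eta>))"
    by (rule integral_cong_AE_lebesgue_on) (use rep(3) in \<open>auto simp: uu elim!: eventually_mono\<close>)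
  also have "\<dots> = integ 0 L (\<lambda>\<theta>. integ 0 L (\<lambda>s. Ca S s ** Gker S s \<theta>) *v u \<theta>)"
    by (rule kernel_mult[OF Ca G(1) ui])
  finally have 2: "integ 0 L (\<lambda>s. Ca S s *v f s) = integ 0 L (\<lambda>\<theta>. integ 0 L (\<lambda>s. Ca S s ** Gker S s \<theta>) *v u \<theta>)" .
  have "integ 0 L (\<lambda>s. Cb S s *v f1 s) = integ 0 L (\<lambda>s. Cb S s *v integ 0 L (\<lambda>\<eta>. Gker' S s \<eta> *v u \<eta>))"
    by (rule integral_cong_AE_lebesgue_on) (use rep(4) in \<open>auto simp: uu elim!: eventually_mono\<close>)
  also have "\<dots> = integ 0 L (\<lambda>\<theta>. integ 0 L (\<lambda>s. Cb S s ** Gker' S s \<theta>) *v u \<theta>)"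
    by (rule kernel_mult[OF Cb G(2) ui])
  finally have 3: "integ 0 L (\<lambda>s. Cb S s *v f1 s) = integ 0 L (\<lambda>\<theta>. integ 0 L (\<lambda>s. Cb S s ** Gker' S s \<theta>) *v u \<theta>)" .
  have "integ 0 L (\<lambda>\<theta>. C3 S \<theta> *v u \<theta>) = integ 0 L (\<lambda>\<theta>. (C1 S ** V \<theta>) *v u \<theta>
     + (integ 0 L (\<lambda>s. Ca S s ** Gker S s \<theta>) *v u \<theta> + integ 0 L (\<lambda>s. Cb S s ** Gker' S s \<theta>) *v u \<theta>))"
    by (intro Bochner_Integration.integral_cong refl) (simp add: C3 matrix_vector_mult_add_rdistrib)
  also have "\<dots> = C1 S *v boundary_values L f + integ 0 L (\<lambda>s. Ca S s *v f s + Cb S s *v f1 s)"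
    using mv[OF bdd_meas_mult[OF bdd_meas_const[of _ "C1 S"] V]] mv[OF I(1)] mv[OF I(2)] fi by (simp add: 1 2 3)
  finally show "C1 S *v boundary_values (len S) f
       + integ 0 (len S) (\<lambda>s. Ca S s *v f s + Cb S s *v weak_deriv (len S) f s) = integ 0 (len S) (\<lambda>\<theta>. C3 S \<theta> *v u \<theta>)"
    by (simp add: L_def f1_def)
qed

definition glue :: "'n mker \<Rightarrow> 'n mker \<Rightarrow> 'n mker"
  where "glue N1 N2 s \<theta> = (if \<theta> \<le> s then N1 s \<theta> else N2 s \<theta>)"

text \<open>By symmetry of the form the representable factor \<open>f\<close> is put on the left and
  the PDE is inserted on the right. The term with \<open>A0\<close> pairs state with state and leads
  to \<open>map_L3\<close>, the one with \<open>A1\<close> pairs state with derivative and leads to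
  \<open>map_L2\<close>, the one with \<open>A2\<close> pairs state with \<open>u\<close> and leads
  to \<open>map_L1\<close>, and the input term leads to \<open>Vker\<close>.\<close>

proposition energy_derivative:
  fixes S :: "('n::finite, 'm::finite, 'q::finite) pde_system"
  assumes adm: "admissible_data S" and L: "len S = L" and f: "f \<in> X_space S"
    and Q: "quadratic_form L M (glue N1 N2)" and N: "bdd_kernel L N1" "bdd_kernel L N2"
    and v: "v \<in> L2 {0..L}"
      "AE s in lebesgue_on {0..L}. v s = A0 S s *v f s + A1 S s *v weak_deriv L f s
         + A2 S s *v weak_deriv L (weak_deriv L f) s + B1 S s *v w"
    and H: "H_pair S M N1 N2 = (H1, H2)"
  defines "u \<equiv> weak_deriv L (weak_deriv L f)"
  shows "\<exists>K. bdd_kernel L K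
      \<and> (\<forall>s\<in>{0..L}. \<forall>\<theta>\<in>{0..L}. s \<noteq> \<theta> \<longrightarrow> K s \<theta> =
          (if \<theta> \<le> s then H1 s \<theta> + transpose (H2 \<theta> s) else transpose (H1 \<theta> s + transpose (H2 s \<theta>))))
      \<and> 2 * quadratic_form.B L M (glue N1 N2) v f =
          2 * (w \<bullet> integ 0 L (\<lambda>s. integ 0 L (\<lambda>\<theta>. transpose (Vker S M N1 N2 s \<theta>)) *v u s)) + kform L K u u"
    and "bdd_meas (lebesgue_on {0..L}) (\<lambda>s. integ 0 L (\<lambda>\<theta>. transpose (Vker S M N1 N2 s \<theta>)))"
proof -
  let ?M = "lebesgue_on {0..L}"
  interpret Q: quadratic_form L M "glue N1 N2" by fact
  interpret finite_measure ?M by (rule finite_measure_Icc)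
  define f1 where "f1 = weak_deriv L f"
  have A: "bdd_meas ?M (A0 S)" "bdd_meas ?M (A1 S)" "bdd_meas ?M (A2 S)" "bdd_meas ?M (B1 S)"
    using adm L by (auto simp: admissible_data_def intro: bdd_meas_continuous_on)
  note rep = X_space_representation[OF adm f, unfolded L, folded f1_def, folded u_def[folded f1_def]]
  have fL2: "f \<in> L2 {0..L}" using f L by (simp add: X_space_def)
  have ui: "integrable ?M u" and fi: "integrable ?M f" and f1i: "integrable ?M f1"
    using rep fL2 by (auto intro: L2_integrable)
  have G: "bdd_kernel L (Gker S)" "bdd_kernel L (Gker' S)"
    using bdd_kernel_Gker[OF Q.L] bdd_kernel_Gker'[OF Q.L] by blast+
  have wL2: "(\<lambda>s. B1 S s *v w) \<in> L2 {0..L}"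
    by (rule bdd_meas_L2, rule bdd_meas_bilinear[OF bounded_bilinear_matrix_vector_mult A(4) bdd_meas_const])
  have AL2: "(\<lambda>s. A0 S s *v f s) \<in> L2 {0..L}" "(\<lambda>s. A1 S s *v f1 s) \<in> L2 {0..L}" "(\<lambda>s. A2 S s *v u s) \<in> L2 {0..L}"
    by (rule L2_bdd_mult[OF A(1) fL2], rule L2_bdd_mult[OF A(2) rep(1)], rule L2_bdd_mult[OF A(3) rep(2)])
  have pi: "pi_operator L (\<lambda>s. M s ** A s) (\<lambda>s \<theta>. N1 s \<theta> ** A \<theta>) (\<lambda>s \<theta>. N2 s \<theta> ** A \<theta>)" if "bdd_meas ?M A" for A
    by unfold_locales (intro Q.L bdd_meas_mult Q.M that bdd_kernel_snd N)+
  \<comment> \<open>The coefficient matrix is absorbed into the operator: the multiplier becomes M A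
    and the kernels become N A, which are the arguments that \<open>H_pair\<close> passes to the
    maps.\<close>
  have form: "Q.B f (\<lambda>s. A s *v z s) = integ 0 L (\<lambda>s. f s \<bullet> ((M s ** A s) *v z s
      + integ 0 L (\<lambda>\<theta>. pi_operator.W (\<lambda>s \<theta>. N1 s \<theta> ** A \<theta>) (\<lambda>s \<theta>. N2 s \<theta> ** A \<theta>) s \<theta> *v z \<theta>)))"
    if A: "bdd_meas ?M A" and z: "z \<in> L2 {0..L}" for A z
  proof -
    note zA = L2_bdd_mult[OF A z]
    have W: "pi_operator.W (\<lambda>s \<theta>. N1 s \<theta> ** A \<theta>) (\<lambda>s \<theta>. N2 s \<theta> ** A \<theta>) s \<theta> = glue N1 N2 s \<theta> ** A \<theta>" for s \<theta>
      by (simp add: pi_operator.W_def[OF pi[OF A]] glue_def)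
    show ?thesis
      unfolding Q.B_def kform_def W using Q.Mf_integrable[OF fL2 zA] Q.Nf_integrable[OF fL2 zA]
      by (simp add: inner_add_right matrix_vector_mul_assoc)
  qed
  define V where "V s \<theta> = Vker S M N1 N2 s \<theta>" for s \<theta>
  have pi0: "pi_operator L M N1 N2" by unfold_locales (intro Q.L Q.M N)+
  interpret P: pi_operator L M N1 N2 by (rule pi0)
  define K where "K s \<theta> = transpose (Gker S \<theta> s) ** M \<theta> + integ 0 L (\<lambda>\<eta>. transpose (Gker S \<eta> s) ** P.W \<eta> \<theta>)" for s \<theta>
  have KB: "bdd_kernel L (\<lambda>s \<theta>. K s \<theta> ** B1 S \<theta>)"
    unfolding K_def by (intro bdd_meas_mult bdd_kernel_snd A P.state_kernel_bdd G)
  have VK: "V s \<theta> = K s \<theta> ** B1 S \<theta>" if "s \<in> {0..L}" "\<theta> \<in> {0..L}" for s \<theta>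
    using P.W_col[OF bdd_meas_linear[OF bounded_linear_transpose bdd_meas_section2[OF G(1), of s]], of \<theta>] that L
    by (simp add: V_def Vker_def K_def add.assoc)
  have V: "bdd_kernel L V"
    using KB by (rule bdd_meas_cong[THEN iffD1, rotated]) (auto simp: space_pair_measure VK)
  have VT: "bdd_kernel L (\<lambda>s \<theta>. transpose (V s \<theta>))" by (rule bdd_meas_linear[OF bounded_linear_transpose V])
  show VTb: "bdd_meas ?M (\<lambda>s. integ 0 L (\<lambda>\<theta>. transpose (Vker S M N1 N2 s \<theta>)))"
    using bdd_meas_integral[OF VT] by (simp add: V_def)
  \<comment> \<open>As \<open>w\<close> is constant in space, it can be taken out of both integrals.
    This leaves the transposed integral of \<open>Vker\<close> that occurs in the \<open>Q\<close>
    of \<open>map_L4\<close> and \<open>map_L5\<close>.\<close>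
  have B1w: "Q.B f (\<lambda>s. B1 S s *v w) = w \<bullet> integ 0 L (\<lambda>s. integ 0 L (\<lambda>\<theta>. transpose (Vker S M N1 N2 s \<theta>)) *v u s)"
  proof -
    have "Q.B f (\<lambda>s. B1 S s *v w) = integ 0 L (\<lambda>s. f s \<bullet> (M s *v (B1 S s *v w) + integ 0 L (\<lambda>\<theta>. P.W s \<theta> *v (B1 S \<theta> *v w))))"
      unfolding Q.B_def kform_def P.W_def glue_def[symmetric]
      using Q.Mf_integrable[OF fL2 wL2] Q.Nf_integrable[OF fL2 wL2] by (simp add: inner_add_right)
    also have "\<dots> = kform L K u (\<lambda>s. B1 S s *v w)"
      unfolding K_def by (rule P.form_state[OF G(1) ui L2_integrable[OF wL2] rep(3)])
    also have "\<dots> = integ 0 L (\<lambda>s. w \<bullet> (integ 0 L (\<lambda>\<theta>. transpose (V s \<theta>)) *v u s))"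
      unfolding kform_def
    proof (rule Bochner_Integration.integral_cong[OF refl])
      fix s assume s: "s \<in> space ?M"
      have Vi: "integrable ?M (V s)" by (rule bdd_meas_integrable[OF bdd_meas_section1[OF V s]])
      have "integ 0 L (\<lambda>\<theta>. K s \<theta> *v (B1 S \<theta> *v w)) = integ 0 L (\<lambda>\<theta>. V s \<theta> *v w)"
        using s by (intro Bochner_Integration.integral_cong refl) (simp add: VK matrix_vector_mul_assoc)
      also have "\<dots> = integ 0 L (V s) *v w"
        by (rule integral_bounded_linear[OF bounded_bilinear.bounded_linear_left[OF bounded_bilinear_matrix_vector_mult] Vi])
      finally have "u s \<bullet> integ 0 L (\<lambda>\<theta>. K s \<theta> *v (B1 S \<theta> *v w)) = w \<bullet> (transpose (integ 0 L (V s)) *v u s)"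
        by (simp add: dot_matrix_vector_mult[of "u s"] inner_commute)
      also have "transpose (integ 0 L (V s)) = integ 0 L (\<lambda>\<theta>. transpose (V s \<theta>))"
        by (rule integral_bounded_linear[OF bounded_linear_transpose Vi, symmetric])
      finally show "u s \<bullet> integ 0 L (\<lambda>\<theta>. K s \<theta> *v (B1 S \<theta> *v w)) = w \<bullet> (integ 0 L (\<lambda>\<theta>. transpose (V s \<theta>)) *v u s)" .
    qed
    also have "\<dots> = w \<bullet> integ 0 L (\<lambda>s. integ 0 L (\<lambda>\<theta>. transpose (V s \<theta>)) *v u s)"
      using bdd_meas_integrable_mult[OF bounded_bilinear_matrix_vector_mult VTb ui]
      by (intro integral_inner_right) (simp add: V_def)
    finally show ?thesis by (simp add: V_def)
  qed
  interpret P0: pi_operator L "\<lambda>s. M s ** A0 S s" "\<lambda>s \<theta>. N1 s \<theta> ** A0 S \<theta>" "\<lambda>s \<theta>. N2 s \<theta> ** A0 S \<theta>" by (rule pi[OF A(1)])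
  interpret P1: pi_operator L "\<lambda>s. M s ** A1 S s" "\<lambda>s \<theta>. N1 s \<theta> ** A1 S \<theta>" "\<lambda>s \<theta>. N2 s \<theta> ** A1 S \<theta>" by (rule pi[OF A(2)])
  interpret P2: pi_operator L "\<lambda>s. M s ** A2 S s" "\<lambda>s \<theta>. N1 s \<theta> ** A2 S \<theta>" "\<lambda>s \<theta>. N2 s \<theta> ** A2 S \<theta>" by (rule pi[OF A(3)])
  define K0 where "K0 s \<theta> = P0.Phi (\<lambda>\<eta>. transpose (Gker S \<eta> s)) (\<lambda>\<zeta>. Gker S \<zeta> \<theta>)" for s \<theta>
  define K1 where "K1 s \<theta> = P1.Phi (\<lambda>\<eta>. transpose (Gker S \<eta> s)) (\<lambda>\<zeta>. Gker' S \<zeta> \<theta>)" for s \<theta>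
  define K2 where "K2 s \<theta> = transpose (Gker S \<theta> s) ** (M \<theta> ** A2 S \<theta>) + integ 0 L (\<lambda>\<eta>. transpose (Gker S \<eta> s) ** P2.W \<eta> \<theta>)" for s \<theta>
  have Kb: "bdd_kernel L K0" "bdd_kernel L K1" "bdd_kernel L K2"
    unfolding K0_def K1_def K2_def by (rule P0.Phi_bdd[OF G(1) G(1)], rule P1.Phi_bdd[OF G(1) G(2)], rule P2.state_kernel_bdd[OF G(1)])
  have B0: "Q.B f (\<lambda>s. A0 S s *v f s) = kform L K0 u u"
    unfolding form[OF A(1) fL2] K0_def by (rule P0.form_state_state[OF G(1) G(1) ui fi rep(3) rep(3)])
  have B1: "Q.B f (\<lambda>s. A1 S s *v f1 s) = kform L K1 u u"
    unfolding form[OF A(2) rep(1)] K1_def by (rule P1.form_state_state[OF G(1) G(2) ui f1i rep(3) rep(4)])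
  have B2: "Q.B f (\<lambda>s. A2 S s *v u s) = kform L K2 u u"
    unfolding form[OF A(3) rep(2)] K2_def by (rule P2.form_state[OF G(1) ui ui rep(3)])
  have "Q.B v f = Q.B f v" by (rule Q.B_sym[OF v(1) fL2])
  also have "\<dots> = Q.B f (\<lambda>s. (A0 S s *v f s + A1 S s *v f1 s + A2 S s *v u s) + B1 S s *v w)"
  proof -
    have ae: "AE s in ?M. v s = (A0 S s *v f s + A1 S s *v f1 s + A2 S s *v u s) + B1 S s *v w"
      using v(2) by (simp add: f1_def u_def)
    have "integ 0 L (\<lambda>\<theta>. J \<theta> *v v \<theta>) = integ 0 L (\<lambda>\<theta>. J \<theta> *v ((A0 S \<theta> *v f \<theta> + A1 S \<theta> *v f1 \<theta> + A2 S \<theta> *v u \<theta>) + B1 S \<theta> *v w))" for J :: "real \<Rightarrow> real^'n^'n"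
      by (rule integral_cong_AE_lebesgue_on) (use ae in \<open>auto elim!: eventually_mono\<close>)
    moreover have "integ 0 L (\<lambda>\<theta>. f \<theta> \<bullet> (M \<theta> *v v \<theta>)) = integ 0 L (\<lambda>\<theta>. f \<theta> \<bullet> (M \<theta> *v ((A0 S \<theta> *v f \<theta> + A1 S \<theta> *v f1 \<theta> + A2 S \<theta> *v u \<theta>) + B1 S \<theta> *v w)))"
      by (rule integral_cong_AE_lebesgue_on) (use ae in \<open>auto elim!: eventually_mono\<close>)
    ultimately show ?thesis unfolding Q.B_def kform_def by (simp only:)
  qed
  also have "\<dots> = kform L K0 u u + kform L K1 u u + kform L K2 u u
      + w \<bullet> integ 0 L (\<lambda>s. integ 0 L (\<lambda>\<theta>. transpose (Vker S M N1 N2 s \<theta>)) *v u s)"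
    using fL2 AL2 wL2 by (simp only: Q.B_add_right L2_add B0 B1 B2 B1w)
  finally have E: "Q.B v f = kform L K0 u u + kform L K1 u u + kform L K2 u u
      + w \<bullet> integ 0 L (\<lambda>s. integ 0 L (\<lambda>\<theta>. transpose (Vker S M N1 N2 s \<theta>)) *v u s)" .
  define KK where "KK s \<theta> = K0 s \<theta> + K1 s \<theta> + K2 s \<theta>" for s \<theta>
  have KKb: "bdd_kernel L KK" unfolding KK_def by (intro bdd_meas_add Kb)
  have KKT: "bdd_kernel L (\<lambda>s \<theta>. transpose (KK \<theta> s))"
    by (rule bdd_meas_linear[OF bounded_linear_transpose bdd_meas_swap[OF KKb]])
  have KKk: "kform L KK u u = kform L K0 u u + kform L K1 u u + kform L K2 u u"
    unfolding KK_def kform_add[OF bdd_meas_add[OF Kb(1) Kb(2)] Kb(3) ui ui] kform_add[OF Kb(1) Kb(2) ui ui] ..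
  have Hs: "KK s \<theta> = (if \<theta> \<le> s then H1 s \<theta> else H2 s \<theta>)" if st: "s \<in> {0..L}" "\<theta> \<in> {0..L}" "s \<noteq> \<theta>" for s \<theta>
  proof -
    have "H1 = fst (H_pair S M N1 N2)" "H2 = snd (H_pair S M N1 N2)" using H by simp_all
    then show ?thesis
      unfolding KK_def K0_def K1_def K2_def P0.map_L3_eq[OF L st] P1.map_L2_eq[OF L st] P2.map_L1_eq[OF L st]
      by (simp add: H_pair_def Let_def case_prod_beta)
  qed
  \<comment> \<open>The factor 2 of the energy derivative is used to symmetrise: twice the form of
    \<open>KK\<close> at (u, u) is the form of \<open>KK\<close> plus its transpose. Below the
    diagonal \<open>KK\<close> is \<open>H1\<close>, above it \<open>H2\<close>, whence the
    combination of \<open>H1\<close> with the transposed \<open>H2\<close>.\<close>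
  define K where "K s \<theta> = KK s \<theta> + transpose (KK \<theta> s)" for s \<theta>
  have "bdd_kernel L K" unfolding K_def by (rule bdd_meas_add[OF KKb KKT])
  moreover have "\<forall>s\<in>{0..L}. \<forall>\<theta>\<in>{0..L}. s \<noteq> \<theta> \<longrightarrow> K s \<theta> =
          (if \<theta> \<le> s then H1 s \<theta> + transpose (H2 \<theta> s) else transpose (H1 \<theta> s + transpose (H2 s \<theta>)))"
    by (auto simp: K_def Hs transpose_add)
  moreover have "kform L K u u = 2 * kform L KK u u"
    unfolding K_def using kform_add[OF KKb KKT ui ui] kform_transpose[OF KKb ui ui] by simp
  then have "2 * Q.B v f =
      2 * (w \<bullet> integ 0 L (\<lambda>s. integ 0 L (\<lambda>\<theta>. transpose (Vker S M N1 N2 s \<theta>)) *v u s)) + kform L K u u"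
    using E KKk by simp
  ultimately show "\<exists>K. bdd_kernel L K
      \<and> (\<forall>s\<in>{0..L}. \<forall>\<theta>\<in>{0..L}. s \<noteq> \<theta> \<longrightarrow> K s \<theta> =
          (if \<theta> \<le> s then H1 s \<theta> + transpose (H2 \<theta> s) else transpose (H1 \<theta> s + transpose (H2 s \<theta>))))
      \<and> 2 * Q.B v f =
          2 * (w \<bullet> integ 0 L (\<lambda>s. integ 0 L (\<lambda>\<theta>. transpose (Vker S M N1 N2 s \<theta>)) *v u s)) + kform L K u u"
    by (intro exI[of _ K] conjI)
qed

section \<open>The energy form of continuous data in \<open>Phi2\<close>\<close>

lemma continuous_kernel_bdd:
  fixes K :: "real \<Rightarrow> real \<Rightarrow> 'a::euclidean_space"
  assumes "continuous_on UNIV (\<lambda>(s, \<theta>). K s \<theta>)"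
  shows "bdd_kernel L K"
proof -
  let ?M = "lebesgue_on {0..L}" and ?K = "\<lambda>p. K (fst p) (snd p)"
  have c: "continuous_on UNIV ?K" using assms by (simp add: case_prod_beta')
  have idm: "(\<lambda>x. x) \<in> measurable ?M borel" by (rule ident_measurable_lebesgue_on)
  have "(\<lambda>p. (fst p, snd p)) \<in> measurable (?M \<Otimes>\<^sub>M ?M) (borel \<Otimes>\<^sub>M borel)"
    by (intro measurable_Pair measurable_compose[OF measurable_fst idm] measurable_compose[OF measurable_snd idm])
  then have "(\<lambda>p. (fst p, snd p)) \<in> borel_measurable (?M \<Otimes>\<^sub>M ?M)" by (simp add: borel_prod)
  from measurable_compose[OF this borel_measurable_continuous_onI[OF c]]
  have "?K \<in> borel_measurable (?M \<Otimes>\<^sub>M ?M)" by simp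
  moreover have "bounded (?K ` ({0..L} \<times> {0..L}))"
    by (intro compact_imp_bounded compact_continuous_image continuous_on_subset[OF c] compact_Times) auto
  then obtain B where "\<forall>y\<in>?K ` ({0..L} \<times> {0..L}). norm y \<le> B" unfolding bounded_iff by blast
  ultimately show ?thesis
    unfolding bdd_meas_def by (intro conjI exI[of _ B]) (auto simp: space_pair_measure)
qed

lemma Phi2_symmetric:
  assumes "(M, N1, N2) \<in> Phi2 L"
  shows "s \<in> {0..L} \<Longrightarrow> transpose (M s) = M s"
    and "s \<in> {0..L} \<Longrightarrow> \<theta> \<in> {0..L} \<Longrightarrow> s \<le> \<theta> \<Longrightarrow> N2 s \<theta> = transpose (N1 \<theta> s)"
proof -
  obtain d1 d2 :: nat and Z1 and T :: "nat + nat + nat \<Rightarrow> nat + nat + nat \<Rightarrow> real" where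
    T: "psd_on ({..<d1} <+> double d2) T"
    and M: "\<forall>s\<in>{0..L}. M s = congr_prod d1 d1 (Z1 s) (\<lambda>i j. T (b1 i) (b1 j)) (Z1 s)"
    and N2: "\<forall>s\<in>{0..L}. \<forall>\<theta>\<in>{0..L}. s \<le> \<theta> \<longrightarrow> N2 s \<theta> = transpose (N1 \<theta> s)"
    using assms unfolding Phi2_def mem_Collect_eq prod.case by (elim exE conjE) (rule that; assumption)
  have sym: "T (b1 i) (b1 j) = T (b1 j) (b1 i)" if "i < d1" "j < d1" for i j
    using T InlI[of i "{..<d1}" "double d2"] InlI[of j "{..<d1}" "double d2"] that unfolding psd_on_def by blast
  show "transpose (M s) = M s" if "s \<in> {0..L}"
    using that M by (simp add: transpose_congr_prod) (auto simp: congr_prod_outer sym intro!: sum.cong)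
  show "s \<in> {0..L} \<Longrightarrow> \<theta> \<in> {0..L} \<Longrightarrow> s \<le> \<theta> \<Longrightarrow> N2 s \<theta> = transpose (N1 \<theta> s)"
    using N2 by blast
qed

lemma Phi2_quadratic_form:
  fixes M :: "real \<Rightarrow> real^'n::finite^'n"
  assumes L: "0 < L" and e: "0 < \<epsilon>" and M: "bdd_meas (lebesgue_on {0..L}) M"
    and N: "bdd_kernel L N1" "bdd_kernel L N2" and Phi2: "(\<lambda>s. M s - \<epsilon> *\<^sub>R mat 1, N1, N2) \<in> Phi2 L"
  shows "quadratic_form L M (glue N1 N2)"
    and "f \<in> L2 {0..L} \<Longrightarrow> 0 \<le> quadratic_form.B L M (glue N1 N2) f f"
proof -
  note sym = Phi2_symmetric[OF Phi2]
  have G: "bdd_kernel L (glue N1 N2)"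
    unfolding glue_def by (intro bdd_meas_If N pred_le_lebesgue_on)
  show Q: "quadratic_form L M (glue N1 N2)"
  proof
    show "transpose (M s) = M s" if "s \<in> {0..L}" for s
    proof -
      have "transpose (M s) = transpose ((M s - \<epsilon> *\<^sub>R mat 1) + scalar_mat \<epsilon>)" by simp
      also have "\<dots> = M s" unfolding transpose_add sym(1)[OF that] transpose_scalar_mat by simp
      finally show ?thesis .
    qed
    have sp: "AE s in lebesgue_on {0..L}. s \<in> {0..L}" using AE_space[of "lebesgue_on {0..L}"] by simp
    show "AE s in lebesgue_on {0..L}. AE \<theta> in lebesgue_on {0..L}. transpose (glue N1 N2 \<theta> s) = glue N1 N2 s \<theta>"
      using sp
    proof eventually_elim
      case (elim s)
      note s = elim
      show ?case using sp AE_neq_lebesgue_on[of s L]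
      proof eventually_elim
        case (elim \<theta>)
        then show ?case using sym(2)[of s \<theta>] sym(2)[of \<theta> s] s by (auto simp: glue_def)
      qed
    qed
  qed (use L M G in auto)
  interpret Q: quadratic_form L M "glue N1 N2" by (rule Q)
  show "0 \<le> Q.B f f" if f: "f \<in> L2 {0..L}"
  proof -
    \<comment> \<open>Positivity is known for the multiplier reduced by \<epsilon> times the
      identity; adding back \<epsilon> times the squared norm of \<open>f\<close> keeps it.\<close>
    have "0 \<le> integ 0 L (\<lambda>s. f s \<bullet> ((M s - \<epsilon> *\<^sub>R mat 1) *v f s)) + kform L (glue N1 N2) f f"
      using Phi2_nonneg[OF Phi2 f] unfolding glue_def[abs_def] .
    also have "integ 0 L (\<lambda>s. f s \<bullet> ((M s - \<epsilon> *\<^sub>R mat 1) *v f s)) = integ 0 L (\<lambda>s. f s \<bullet> (M s *v f s) - \<epsilon> * (f s \<bullet> f s))"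
      by (simp add: matrix_vector_mult_diff_rdistrib scalar_mat_mult_vec inner_diff_right)
    also have "\<dots> = integ 0 L (\<lambda>s. f s \<bullet> (M s *v f s)) - \<epsilon> * integ 0 L (\<lambda>s. f s \<bullet> f s)"
      using Q.Mf_integrable[OF f f] L2_integrable_inner[OF f f] by simp
    finally have "\<epsilon> * integ 0 L (\<lambda>s. f s \<bullet> f s) \<le> Q.B f f" by (simp add: Q.B_def)
    moreover have "0 \<le> \<epsilon> * integ 0 L (\<lambda>s. f s \<bullet> f s)"
      using e by (intro mult_nonneg_nonneg Bochner_Integration.integral_nonneg) auto
    ultimately show ?thesis by linarith
  qed
qed

section \<open>The two dissipation inequalities\<close>

lemma inner_transpose_mult_vec: "x \<bullet> (transpose A *v y) = (A *v x) \<bullet> (y :: real^'m::finite)" for x :: "real^'n::finite"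
  by (simp only: dot_matrix_vector_mult transpose_transpose)

text \<open>With the output kernel \<open>C3\<close> this is the contribution of the squared output
  that is quadratic in \<open>u\<close>.\<close>

lemma kform_gram:
  fixes C :: "real \<Rightarrow> real^'n::finite^'q::finite"
  assumes C: "bdd_meas (lebesgue_on {0..L}) C" and u: "integrable (lebesgue_on {0..L}) u"
  shows "bdd_kernel L (\<lambda>s \<theta>. transpose (C s) ** C \<theta>)"
    and "kform L (\<lambda>s \<theta>. transpose (C s) ** C \<theta>) u u = integ 0 L (\<lambda>s. C s *v u s) \<bullet> integ 0 L (\<lambda>s. C s *v u s)"
proof -
  show "bdd_kernel L (\<lambda>s \<theta>. transpose (C s) ** C \<theta>)"
    by (intro bdd_meas_mult bdd_kernel_fst bdd_kernel_snd bdd_meas_linear[OF bounded_linear_transpose] C)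
  define c where "c = integ 0 L (\<lambda>s. C s *v u s)"
  have i: "integrable (lebesgue_on {0..L}) (\<lambda>s. C s *v u s)"
    by (rule bdd_meas_integrable_mult[OF bounded_bilinear_matrix_vector_mult C u])
  have "integ 0 L (\<lambda>\<theta>. (transpose (C s) ** C \<theta>) *v u \<theta>) = transpose (C s) *v c" for s
    unfolding c_def matrix_vector_mul_assoc[symmetric]
    by (rule integral_bounded_linear[OF matrix_vector_mul_bounded_linear i])
  then have "kform L (\<lambda>s \<theta>. transpose (C s) ** C \<theta>) u u = integ 0 L (\<lambda>s. (C s *v u s) \<bullet> c)"
    by (simp only: kform_def inner_transpose_mult_vec)
  also have "\<dots> = c \<bullet> c" using i by (simp add: c_def)
  finally show "kform L (\<lambda>s \<theta>. transpose (C s) ** C \<theta>) u u = integ 0 L (\<lambda>s. C s *v u s) \<bullet> integ 0 L (\<lambda>s. C s *v u s)"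
    by (simp add: c_def)
qed

lemma Phi1_nonpos:
  fixes P :: "real^'m::finite^'m" and Q :: "real \<Rightarrow> real^'n::finite^'m"
  assumes "(- P, \<lambda>\<theta>. - Q \<theta>, \<lambda>s \<theta>. - R1 s \<theta>, \<lambda>s \<theta>. - R2 s \<theta>) \<in> Phi1 L"
    and "0 < L" "integrable (lebesgue_on {0..L}) u"
  shows "L * (w \<bullet> (P *v w)) + 2 * (w \<bullet> integ 0 L (\<lambda>\<theta>. Q \<theta> *v u \<theta>))
     + kform L (\<lambda>s \<theta>. if \<theta> \<le> s then R1 s \<theta> else R2 s \<theta>) u u \<le> 0"
proof -
  have neg: "(- A) *v x = - (A *v x)" for A :: "real^'n^'k::finite" and x
    by (rule bounded_bilinear.minus_left[OF bounded_bilinear_matrix_vector_mult])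
  have neg': "(- A) *v x = - (A *v x)" for A :: "real^'m^'m" and x
    by (rule bounded_bilinear.minus_left[OF bounded_bilinear_matrix_vector_mult])
  have "(\<lambda>s \<theta>. if \<theta> \<le> s then - R1 s \<theta> else - R2 s \<theta>) = (\<lambda>s \<theta>. (- 1) *\<^sub>R (if \<theta> \<le> s then R1 s \<theta> else R2 s \<theta>))"
    by (auto simp: fun_eq_iff)
  then show ?thesis
    using Phi1_nonneg[OF assms, of w] by (simp only: kform_scaleR) (simp add: neg neg')
qed

text \<open>The diagonal meets each section in one point. On it the two triangular formulas for a
  kernel need not agree.\<close>

lemma kform_cong_offdiag:
  assumes "\<And>s \<theta>. s \<in> {0..L} \<Longrightarrow> \<theta> \<in> {0..L} \<Longrightarrow> s \<noteq> \<theta> \<Longrightarrow> K s \<theta> = K' s \<theta>"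
  shows "kform L K f g = kform L K' f g"
proof (rule kform_cong_AE)
  have sp: "AE s in lebesgue_on {0..L}. s \<in> {0..L}" using AE_space[of "lebesgue_on {0..L}"] by simp
  show "AE s in lebesgue_on {0..L}. AE \<theta> in lebesgue_on {0..L}. K s \<theta> = K' s \<theta>"
    using sp
  proof eventually_elim
    case (elim s)
    note s = elim
    show ?case using sp AE_neq_lebesgue_on[of s L] by eventually_elim (use assms[OF s] in auto)
  qed
qed

lemma energy_and_output:
  fixes S :: "('n::finite, 'm::finite, 'q::finite) pde_system"
  assumes adm: "admissible_data S" and L: "len S = L" and f: "f \<in> X_space S"
    and Qf: "quadratic_form L M (glue N1 N2)" and N: "bdd_kernel L N1" "bdd_kernel L N2"
    and v: "v \<in> L2 {0..L}"
      "AE s in lebesgue_on {0..L}. v s = A0 S s *v f s + A1 S s *v weak_deriv L f s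
         + A2 S s *v weak_deriv L (weak_deriv L f) s + B1 S s *v w"
    and y: "y = C1 S *v boundary_values L f
            + integ 0 L (\<lambda>s. Ca S s *v f s + Cb S s *v weak_deriv L f s) + D1 S *v w"
    and H: "H_pair S M N1 N2 = (H1, H2)"
  defines "V \<equiv> \<lambda>s. integ 0 L (\<lambda>\<theta>. transpose (Vker S M N1 N2 s \<theta>))"
  obtains u K where "integrable (lebesgue_on {0..L}) u" "bdd_meas (lebesgue_on {0..L}) (C3 S)"
    "integrable (lebesgue_on {0..L}) (\<lambda>s. C3 S s *v u s)" "integrable (lebesgue_on {0..L}) (\<lambda>s. V s *v u s)"
    "y = integ 0 L (\<lambda>s. C3 S s *v u s) + D1 S *v w" "bdd_kernel L K"
    "\<forall>s\<in>{0..L}. \<forall>\<theta>\<in>{0..L}. s \<noteq> \<theta> \<longrightarrow> K s \<theta> =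
          (if \<theta> \<le> s then H1 s \<theta> + transpose (H2 \<theta> s) else transpose (H1 \<theta> s + transpose (H2 s \<theta>)))"
    "2 * quadratic_form.B L M (glue N1 N2) v f = 2 * (w \<bullet> integ 0 L (\<lambda>s. V s *v u s)) + kform L K u u"
proof -
  define u where "u = weak_deriv L (weak_deriv L f)"
  have ui: "integrable (lebesgue_on {0..L}) u"
    using X_space_representation(2)[OF adm f] L by (auto simp: u_def intro: L2_integrable)
  note energy = energy_derivative[OF adm L f Qf N v H, folded u_def]
  obtain K where K: "bdd_kernel L K"
    "\<forall>s\<in>{0..L}. \<forall>\<theta>\<in>{0..L}. s \<noteq> \<theta> \<longrightarrow> K s \<theta> =
          (if \<theta> \<le> s then H1 s \<theta> + transpose (H2 \<theta> s) else transpose (H1 \<theta> s + transpose (H2 s \<theta>)))"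
    "2 * quadratic_form.B L M (glue N1 N2) v f = 2 * (w \<bullet> integ 0 L (\<lambda>s. V s *v u s)) + kform L K u u"
    using energy(1) unfolding V_def by blast
  have C3: "bdd_meas (lebesgue_on {0..L}) (C3 S)" "y = integ 0 L (\<lambda>s. C3 S s *v u s) + D1 S *v w"
    using output_representation[OF adm f] L by (simp_all add: y u_def)
  have V: "bdd_meas (lebesgue_on {0..L}) V" using energy(2) by (simp add: V_def)
  show ?thesis
    by (rule that[OF ui C3(1) _ _ C3(2) K])
      (rule bdd_meas_integrable_mult[OF bounded_bilinear_matrix_vector_mult _ ui], fact)+
qed

text \<open>The output is c + D1 w, with \<open>c\<close> the integral of \<open>C3\<close> against
  \<open>u\<close>. Expanding its square accounts for all terms that \<open>map_L4\<close> adds to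
  the energy part: D1^T D1 in \<open>P\<close>, D1^T C3 in \<open>Q\<close> and C3^T C3 in
  \<open>R1\<close>.\<close>

lemma gain_dissipation:
  fixes S :: "('n::finite, 'm::finite, 'q::finite) pde_system"
  assumes adm: "admissible_data S" and L: "len S = L" and f: "f \<in> X_space S"
    and Qf: "quadratic_form L M (glue N1 N2)" and N: "bdd_kernel L N1" "bdd_kernel L N2"
    and v: "v \<in> L2 {0..L}"
      "AE s in lebesgue_on {0..L}. v s = A0 S s *v f s + A1 S s *v weak_deriv L f s
         + A2 S s *v weak_deriv L (weak_deriv L f) s + B1 S s *v w"
    and y: "y = C1 S *v boundary_values L f
            + integ 0 L (\<lambda>s. Ca S s *v f s + Cb S s *v weak_deriv L f s) + D1 S *v w"
    and map: "(P, Q, R1, R2) = map_L4 \<gamma> S M N1 N2"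
    and Phi1: "(- P, \<lambda>\<theta>. - Q \<theta>, \<lambda>s \<theta>. - R1 s \<theta>, \<lambda>s \<theta>. - R2 s \<theta>) \<in> Phi1 L"
  shows "2 * quadratic_form.B L M (glue N1 N2) v f \<le> \<gamma>\<^sup>2 * (w \<bullet> w) - y \<bullet> y"
proof -
  let ?M = "lebesgue_on {0..L}"
  have L0: "0 < L" using adm L by (simp add: admissible_data_def)
  obtain H1 H2 where H: "H_pair S M N1 N2 = (H1, H2)" by fastforce
  define V where "V s = integ 0 L (\<lambda>\<theta>. transpose (Vker S M N1 N2 s \<theta>))" for s
  obtain u K where ui: "integrable ?M u" and C3b: "bdd_meas ?M (C3 S)"
    and Cu: "integrable ?M (\<lambda>s. C3 S s *v u s)" and Vu: "integrable ?M (\<lambda>s. V s *v u s)"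
    and y_eq: "y = integ 0 L (\<lambda>s. C3 S s *v u s) + D1 S *v w"
    and K: "bdd_kernel L K"
      "\<forall>s\<in>{0..L}. \<forall>\<theta>\<in>{0..L}. s \<noteq> \<theta> \<longrightarrow> K s \<theta> =
          (if \<theta> \<le> s then H1 s \<theta> + transpose (H2 \<theta> s) else transpose (H1 \<theta> s + transpose (H2 s \<theta>)))"
      "2 * quadratic_form.B L M (glue N1 N2) v f = 2 * (w \<bullet> integ 0 L (\<lambda>s. V s *v u s)) + kform L K u u"
    unfolding V_def by (rule energy_and_output[OF adm L f Qf N v y H])
  define c where "c = integ 0 L (\<lambda>s. C3 S s *v u s)"
  have yc: "y = c + D1 S *v w" using y_eq by (simp add: c_def)
  have P: "P = (1 / L) *\<^sub>R (transpose (D1 S) ** D1 S - scalar_mat (\<gamma>\<^sup>2))"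
    and Q: "Q = (\<lambda>s. transpose (D1 S) ** C3 S s + V s)"
    and R1: "R1 = (\<lambda>s \<theta>. H1 s \<theta> + transpose (H2 \<theta> s) + transpose (C3 S s) ** C3 S \<theta>)"
    and R2: "R2 = (\<lambda>s \<theta>. transpose (R1 \<theta> s))"
    using map by (simp_all add: map_L4_def H L V_def)
  \<comment> \<open>The length \<open>L\<close> in front of the \<open>w\<close> block cancels the
    factor 1/L in \<open>P\<close>.\<close>
  have Pw: "L * (w \<bullet> (P *v w)) = (D1 S *v w) \<bullet> (D1 S *v w) - \<gamma>\<^sup>2 * (w \<bullet> w)"
    using L0 by (simp add: P scaleR_matrix_vector_assoc[symmetric] matrix_vector_mult_diff_rdistrib
        scalar_mat_mult_vec inner_diff_right matrix_vector_mul_assoc[symmetric] inner_transpose_mult_vec del: transpose_matrix_vector)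
  have "integ 0 L (\<lambda>s. Q s *v u s) = integ 0 L (\<lambda>s. transpose (D1 S) *v (C3 S s *v u s) + V s *v u s)"
    by (simp add: Q matrix_vector_mult_add_rdistrib matrix_vector_mul_assoc)
  also have "\<dots> = transpose (D1 S) *v c + integ 0 L (\<lambda>s. V s *v u s)"
    using Vu integrable_bounded_linear[OF matrix_vector_mul_bounded_linear Cu, of "transpose (D1 S)"]
      integral_bounded_linear[OF matrix_vector_mul_bounded_linear Cu, of "transpose (D1 S)"]
    by (simp add: c_def)
  finally have Qu: "w \<bullet> integ 0 L (\<lambda>s. Q s *v u s) = (D1 S *v w) \<bullet> c + w \<bullet> integ 0 L (\<lambda>s. V s *v u s)"
    by (simp add: inner_add_right inner_transpose_mult_vec del: transpose_matrix_vector)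
  \<comment> \<open>The Gram kernel is reproduced when it is transposed and its arguments are
    swapped, so it enters both triangles in the same form although \<open>R2\<close> is defined by
    transposing \<open>R1\<close>.\<close>
  have "kform L (\<lambda>s \<theta>. if \<theta> \<le> s then R1 s \<theta> else R2 s \<theta>) u u = kform L (\<lambda>s \<theta>. K s \<theta> + transpose (C3 S s) ** C3 S \<theta>) u u"
    by (rule kform_cong_offdiag) (auto simp: K(2) R1 R2 transpose_add matrix_transpose_mul)
  also have "\<dots> = kform L K u u + c \<bullet> c"
    using kform_add[OF K(1) kform_gram(1)[OF C3b ui] ui ui] kform_gram(2)[OF C3b ui] by (simp add: c_def)
  finally have Ru: "kform L (\<lambda>s \<theta>. if \<theta> \<le> s then R1 s \<theta> else R2 s \<theta>) u u = kform L K u u + c \<bullet> c" .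
  have "y \<bullet> y = c \<bullet> c + 2 * ((D1 S *v w) \<bullet> c) + (D1 S *v w) \<bullet> (D1 S *v w)"
    by (simp add: yc inner_add_left inner_add_right inner_commute)
  then show ?thesis
    using Phi1_nonpos[OF Phi1 L0 ui, of w] unfolding Pw Qu Ru K(3) by (simp add: algebra_simps)
qed

text \<open>With y = c + D1 w, the term -2 y^T w equals -2 w^T c - w^T (D1 + D1^T) w. This accounts
  for -C3 in \<open>Q\<close> and for \<open>P\<close> in \<open>map_L5\<close>; there is no term
  quadratic in \<open>c\<close>, hence no Gram kernel in \<open>R1\<close>.\<close>

lemma passivity_dissipation:
  fixes S :: "('n::finite, 'm::finite, 'm) pde_system"
  assumes adm: "admissible_data S" and L: "len S = L" and f: "f \<in> X_space S"
    and Qf: "quadratic_form L M (glue N1 N2)" and N: "bdd_kernel L N1" "bdd_kernel L N2"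
    and v: "v \<in> L2 {0..L}"
      "AE s in lebesgue_on {0..L}. v s = A0 S s *v f s + A1 S s *v weak_deriv L f s
         + A2 S s *v weak_deriv L (weak_deriv L f) s + B1 S s *v w"
    and y: "y = C1 S *v boundary_values L f
            + integ 0 L (\<lambda>s. Ca S s *v f s + Cb S s *v weak_deriv L f s) + D1 S *v w"
    and map: "(P, Q, R1, R2) = map_L5 S M N1 N2"
    and Phi1: "(- P, \<lambda>\<theta>. - Q \<theta>, \<lambda>s \<theta>. - R1 s \<theta>, \<lambda>s \<theta>. - R2 s \<theta>) \<in> Phi1 L"
  shows "2 * quadratic_form.B L M (glue N1 N2) v f \<le> 2 * (y \<bullet> w)"
proof -
  let ?M = "lebesgue_on {0..L}"
  have L0: "0 < L" using adm L by (simp add: admissible_data_def)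
  obtain H1 H2 where H: "H_pair S M N1 N2 = (H1, H2)" by fastforce
  define V where "V s = integ 0 L (\<lambda>\<theta>. transpose (Vker S M N1 N2 s \<theta>))" for s
  obtain u K where ui: "integrable ?M u" and C3b: "bdd_meas ?M (C3 S)"
    and Cu: "integrable ?M (\<lambda>s. C3 S s *v u s)" and Vu: "integrable ?M (\<lambda>s. V s *v u s)"
    and y_eq: "y = integ 0 L (\<lambda>s. C3 S s *v u s) + D1 S *v w"
    and K: "bdd_kernel L K"
      "\<forall>s\<in>{0..L}. \<forall>\<theta>\<in>{0..L}. s \<noteq> \<theta> \<longrightarrow> K s \<theta> =
          (if \<theta> \<le> s then H1 s \<theta> + transpose (H2 \<theta> s) else transpose (H1 \<theta> s + transpose (H2 s \<theta>)))"
      "2 * quadratic_form.B L M (glue N1 N2) v f = 2 * (w \<bullet> integ 0 L (\<lambda>s. V s *v u s)) + kform L K u u"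
    unfolding V_def by (rule energy_and_output[OF adm L f Qf N v y H])
  define c where "c = integ 0 L (\<lambda>s. C3 S s *v u s)"
  have yc: "y = c + D1 S *v w" using y_eq by (simp add: c_def)
  have P: "P = - (1 / L) *\<^sub>R (D1 S + transpose (D1 S))"
    and Q: "Q = (\<lambda>s. - C3 S s + V s)"
    and R1: "R1 = (\<lambda>s \<theta>. H1 s \<theta> + transpose (H2 \<theta> s))"
    and R2: "R2 = (\<lambda>s \<theta>. transpose (R1 \<theta> s))"
    using map by (simp_all add: map_L5_def H L V_def)
  have "w \<bullet> (transpose (D1 S) *v w) = w \<bullet> (D1 S *v w)"
    by (simp only: inner_transpose_mult_vec inner_commute)
  then have Pw: "L * (w \<bullet> (P *v w)) = - 2 * (w \<bullet> (D1 S *v w))"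
    using L0 by (simp add: P scaleR_matrix_vector_assoc[symmetric] matrix_vector_mult_add_rdistrib inner_add_right
        del: scaleR_minus_left)
  have "integ 0 L (\<lambda>s. Q s *v u s) = - c + integ 0 L (\<lambda>s. V s *v u s)"
    using Vu Cu by (simp add: Q c_def matrix_vector_mult_diff_rdistrib)
  then have Qu: "w \<bullet> integ 0 L (\<lambda>s. Q s *v u s) = - (w \<bullet> c) + w \<bullet> integ 0 L (\<lambda>s. V s *v u s)"
    by (simp add: inner_diff_right)
  have Ru: "kform L (\<lambda>s \<theta>. if \<theta> \<le> s then R1 s \<theta> else R2 s \<theta>) u u = kform L K u u"
    by (rule kform_cong_offdiag) (auto simp: K(2) R1 R2)
  have "y \<bullet> w = w \<bullet> c + w \<bullet> (D1 S *v w)"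
    by (simp only: yc inner_commute[of _ w] inner_add_right)
  then show ?thesis
    using Phi1_nonpos[OF Phi1 L0 ui, of w] unfolding Pw Qu Ru K(3) by (simp add: algebra_simps)
qed

theorem theorem8:
  fixes L \<epsilon> \<gamma> :: real
    and M :: "real \<Rightarrow> real^'n::finite^'n" and N1 N2 :: "real \<Rightarrow> real \<Rightarrow> real^'n^'n"
  assumes "0 < L" and "0 < \<epsilon>" and "0 < \<gamma>"
    and "polynomial_function M"
    and "polynomial_function (\<lambda>(s, \<theta>). N1 s \<theta>)"
    and "polynomial_function (\<lambda>(s, \<theta>). N2 s \<theta>)"
    and "(\<lambda>s. M s - \<epsilon> *\<^sub>R mat 1, N1, N2) \<in> Phi2 L"
  shows
    "(\<forall>(S :: ('n, 'm::finite, 'q::finite) pde_system) x y w P Q R1 R2.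
        len S = L \<and> admissible_data S \<and> is_solution S x y w \<and> y \<in> L2 {0..} \<and> w \<in> L2 {0..}
        \<and> (P, Q, R1, R2) = map_L4 \<gamma> S M N1 N2
        \<and> (- P, \<lambda>\<theta>. - Q \<theta>, \<lambda>s \<theta>. - R1 s \<theta>, \<lambda>s \<theta>. - R2 s \<theta>) \<in> Phi1 L
        \<longrightarrow> L2_norm {0..} y \<le> \<gamma> * L2_norm {0..} w)
     \<and>
     (\<forall>(S :: ('n, 'm, 'm) pde_system) x y w P Q R1 R2.
        len S = L \<and> admissible_data S \<and> is_solution S x y w \<and> y \<in> L2 {0..} \<and> w \<in> L2 {0..}
        \<and> (P, Q, R1, R2) = map_L5 S M N1 N2
        \<and> (- P, \<lambda>\<theta>. - Q \<theta>, \<lambda>s \<theta>. - R1 s \<theta>, \<lambda>s \<theta>. - R2 s \<theta>) \<in> Phi1 L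
        \<longrightarrow> 0 \<le> L2_inner {0..} y w)"
proof -
  have M: "bdd_meas (lebesgue_on {0..L}) M"
    by (rule bdd_meas_continuous_on) (rule continuous_on_polymonial_function[OF assms(4)])
  have N: "bdd_kernel L N1" "bdd_kernel L N2"
    by (rule continuous_kernel_bdd[OF continuous_on_polymonial_function[OF assms(5)]],
        rule continuous_kernel_bdd[OF continuous_on_polymonial_function[OF assms(6)]])
  note Qf = Phi2_quadratic_form[OF assms(1,2) M N assms(7)]
  interpret Q: quadratic_form L M "glue N1 N2" by (rule Qf(1))
  show ?thesis
  proof (intro conjI allI impI; elim conjE)
    fix S :: "('n, 'm, 'q) pde_system" and x y w P Q R1 R2
    assume S: "len S = L" "admissible_data S" "is_solution S x y w" "y \<in> L2 {0..}" "w \<in> L2 {0..}"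
      and map: "(P, Q, R1, R2) = map_L4 \<gamma> S M N1 N2"
      and Phi1: "(- P, \<lambda>\<theta>. - Q \<theta>, \<lambda>s \<theta>. - R1 s \<theta>, \<lambda>s \<theta>. - R2 s \<theta>) \<in> Phi1 L"
    note sol = S(3)[unfolded is_solution_def S(1)]
    have yw: "integrable (lebesgue_on {0..}) (\<lambda>t. y t \<bullet> y t)" "integrable (lebesgue_on {0..}) (\<lambda>t. w t \<bullet> w t)"
      using S(4,5) by (auto intro: L2_integrable_inner)
    \<comment> \<open>The supply rate of the gain claim; after integration over time it compares the
      squares of the two norms.\<close>
    have "0 \<le> (LINT t|lebesgue_on {0..}. \<gamma>\<^sup>2 * (w t \<bullet> w t) - y t \<bullet> y t)"
    proof (rule Q.dissipation_integral[of x])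
      show "AE t in lebesgue_on {0..}. \<exists>v. has_L2_deriv L x v t \<and> 2 * Q.B v (x t) \<le> \<gamma>\<^sup>2 * (w t \<bullet> w t) - y t \<bullet> y t"
        using conjunct2[OF conjunct2[OF conjunct2[OF sol]]]
      proof eventually_elim
        case (elim t)
        then obtain v where v: "has_L2_deriv L x v t"
          "AE s in lebesgue_on {0..L}. v s = A0 S s *v x t s + A1 S s *v weak_deriv L (x t) s
             + A2 S s *v weak_deriv L (weak_deriv L (x t)) s + B1 S s *v w t" by blast
        have vL: "v \<in> L2 {0..L}" using v(1) by (simp add: has_L2_deriv_def)
        have "2 * Q.B v (x t) \<le> \<gamma>\<^sup>2 * (w t \<bullet> w t) - y t \<bullet> y t"
          using elim by (intro gain_dissipation[OF S(2,1) _ Qf(1) N vL v(2) _ map Phi1]) auto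
        with v(1) show ?case by blast
      qed
    qed (use sol yw Qf(2) in auto)
    then have "(L2_norm {0..} y)\<^sup>2 \<le> (\<gamma> * L2_norm {0..} w)\<^sup>2"
      using yw by (simp add: L2_norm_square power_mult_distrib)
    then show "L2_norm {0..} y \<le> \<gamma> * L2_norm {0..} w"
      by (rule power2_le_imp_le) (use assms(3) in simp)
  next
    fix S :: "('n, 'm, 'm) pde_system" and x y w P Q R1 R2
    assume S: "len S = L" "admissible_data S" "is_solution S x y w" "y \<in> L2 {0..}" "w \<in> L2 {0..}"
      and map: "(P, Q, R1, R2) = map_L5 S M N1 N2"
      and Phi1: "(- P, \<lambda>\<theta>. - Q \<theta>, \<lambda>s \<theta>. - R1 s \<theta>, \<lambda>s \<theta>. - R2 s \<theta>) \<in> Phi1 L"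
    note sol = S(3)[unfolded is_solution_def S(1)]
    have yw: "integrable (lebesgue_on {0..}) (\<lambda>t. y t \<bullet> w t)"
      using S(4,5) by (rule L2_integrable_inner)
    have "0 \<le> (LINT t|lebesgue_on {0..}. 2 * (y t \<bullet> w t))"
    proof (rule Q.dissipation_integral[of x])
      show "AE t in lebesgue_on {0..}. \<exists>v. has_L2_deriv L x v t \<and> 2 * Q.B v (x t) \<le> 2 * (y t \<bullet> w t)"
        using conjunct2[OF conjunct2[OF conjunct2[OF sol]]]
      proof eventually_elim
        case (elim t)
        then obtain v where v: "has_L2_deriv L x v t"
          "AE s in lebesgue_on {0..L}. v s = A0 S s *v x t s + A1 S s *v weak_deriv L (x t) s
             + A2 S s *v weak_deriv L (weak_deriv L (x t)) s + B1 S s *v w t" by blast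
        have vL: "v \<in> L2 {0..L}" using v(1) by (simp add: has_L2_deriv_def)
        have "2 * Q.B v (x t) \<le> 2 * (y t \<bullet> w t)"
          using elim by (intro passivity_dissipation[OF S(2,1) _ Qf(1) N vL v(2) _ map Phi1]) auto
        with v(1) show ?case by blast
      qed
    qed (use sol yw Qf(2) in auto)
    then show "0 \<le> L2_inner {0..} y w" by (simp add: L2_inner_def)
  qed
qed

end
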